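(* Let $\rho:\mathbb{R}^d\to(0,\infty)$ be a critical radius function and let $L$ be a non-negative self-adjoint operator on $L^2(\mathbb{R}^d)$ such that the kernels $p_t(x,y)$ of the semigroup $e^{-tL}$ satisfy: for every $N>0$ there are constants $c,C>0$ such that $$|p_t(x,y)|\le \frac{C}{t^{d/2}}e^{-\frac{|x-y|^2}{ct}}\Big(1+\frac{\sqrt t}{\rho(x)}+\frac{\sqrt t}{\rho(y)}\Big)^{-N}\qquad\text{for all }x,y\in\mathbb{R}^d,\ t>0.$$ Let $\theta\ge 0$, $0<\alpha<d$, $1<p<d/\alpha$ and $1/q=1/p-\alpha/d$. Let $K$ satisfy $$\Big(\frac1K+\frac{q}{Kp'}\Big)\Big[\Big(1-\frac{\alpha}{d}\Big)\frac{p'}{q}+\frac1{q'}\Big]=\frac12 .$$ If $W\in\mathcal{A}_{p,q}^{\rho,\theta/(3K)}$, then $$\|L^{-\alpha/2}\|_{L^p(W^{p/q})\to L^q(W)}\lesssim [W]_{\mathcal{A}_{p,q}^{\rho,\theta/(3K)}}^{\frac{p'}{q}(1-\frac{\alpha}{d})+\frac1{q'}} .$$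
   Context: Critical radius function: $\rho:\mathbb{R}^d\to(0,\infty)$ for which there are constants $C_0,N_0>0$ with $C_0^{-1}\rho(x)(1+\frac{|x-y|}{\rho(x)})^{-N_0}\le\rho(y)\le C_0\rho(x)(1+\frac{|x-y|}{\rho(x)})^{\frac{N_0}{N_0+1}}$ for all $x,y\in\mathbb{R}^d$. For a cube $Q\subset\mathbb{R}^d$ with center $x_Q$ and side-length $l_Q$, $\psi_\theta(Q):=(1+l_Q/\rho(x_Q))^\theta$. A matrix weight $W:\mathbb{R}^d\to\mathbb{C}^{n\times n}$ is a self-adjoint matrix function with locally integrable entries which is positive definite almost everywhere; $W^r$ ($r\in\mathbb{R}$) is defined by the spectral calculus. $|\cdot|_{op}$ is the operator norm on $\mathbb{C}^{n\times n}$ for the Euclidean norm. For $\theta\ge0$ and $1<p\le q<\infty$, $W\in\mathcal{A}_{p,q}^{\rho,\theta}$ means $$[W]_{\mathcal{A}_{p,q}^{\rho,\theta}}:=\sup_Q\frac{1}{\psi_\theta(Q)|Q|}\int_Q\Big(\frac{1}{\psi_\theta(Q)|Q|}\int_Q|W(x)^{1/q}W(y)^{-1/q}|_{op}^{p'}dy\Big)^{q/p'}dx<\infty,$$ the supremum over all cubes $Q$. $L^r(W)$ is the space of measurable $\vec f:\mathbb{R}^d\to\mathbb{C}^n$ with $\|\vec f\|_{L^r(W)}:=(\int|W(x)^{1/r}\vec f(x)|^rdx)^{1/r}<\infty$; in particular $\|\vec f\|_{L^p(W^{p/q})}=(\int|W(x)^{1/q}\vec f(x)|^pdx)^{1/p}$.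 $L^{-\alpha/2}f(x):=\int_0^\infty e^{-tL}f(x)\,t^{\frac{\alpha}{2}-1}dt$, acting componentwise on $\mathbb{C}^n$-valued functions (where $e^{-tL}f(x)=\int p_t(x,y)f(y)dy$). $A\lesssim B$ means $A\le CB$ with $C$ independent of $W$ and of the functions involved (it may depend on $d,n,p,q,\alpha,\theta,\rho,L$). $r'=r/(r-1)$. *)

theory Defs
  imports "HOL-Analysis.Analysis"
begin

section \<open>Critical radius functions and cubes\<close>

definition critical_radius_function :: "(real ^ 'd \<Rightarrow> real) \<Rightarrow> bool" where
  "critical_radius_function \<rho> \<longleftrightarrow>
     (\<forall>x. 0 < \<rho> x) \<and>
     (\<exists>C0>0. \<exists>N0>0. \<forall>x y.
        \<rho> x / C0 * (1 + norm (x - y) / \<rho> x) powr (- N0) \<le> \<rho> y \<and>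
        \<rho> y \<le> C0 * \<rho> x * (1 + norm (x - y) / \<rho> x) powr (N0 / (N0 + 1)))"

definition cube :: "real ^ 'd \<Rightarrow> real \<Rightarrow> (real ^ 'd) set" where
  "cube c l = {y. \<forall>i. \<bar>y $ i - c $ i\<bar> \<le> l / 2}"

definition psi :: "(real ^ 'd \<Rightarrow> real) \<Rightarrow> real \<Rightarrow> real ^ 'd \<Rightarrow> real \<Rightarrow> real" where
  "psi \<rho> \<theta> c l = (1 + l / \<rho> c) powr \<theta>"

definition conj_exp :: "real \<Rightarrow> real" where
  "conj_exp r = r / (r - 1)"

text \<open>Only used with exponents \<open>r > 0\<close>, whence \<open>top\<close> to the power \<open>r\<close> is \<open>top\<close>.\<close>
definition epowr :: "ennreal \<Rightarrow> real \<Rightarrow> ennreal" where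
  "epowr a r = (if a = top then top else ennreal (enn2real a powr r))"


section \<open>Spectral calculus of self-adjoint complex matrices\<close>

definition ctranspose :: "complex ^ 'n ^ 'n \<Rightarrow> complex ^ 'n ^ 'n" where
  "ctranspose A = (\<chi> i j. cnj (A $ j $ i))"

definition self_adjoint_matrix :: "complex ^ 'n ^ 'n \<Rightarrow> bool" where
  "self_adjoint_matrix A \<longleftrightarrow> ctranspose A = A"

definition pos_def_matrix :: "complex ^ 'n ^ 'n \<Rightarrow> bool" where
  "pos_def_matrix A \<longleftrightarrow>
     self_adjoint_matrix A \<and> (\<forall>v. v \<noteq> 0 \<longrightarrow> 0 < Re (\<Sum>i\<in>UNIV. (A *v v) $ i * cnj (v $ i)))"

definition unitary_matrix :: "complex ^ 'n ^ 'n \<Rightarrow> bool" where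
  "unitary_matrix U \<longleftrightarrow> ctranspose U ** U = mat 1 \<and> U ** ctranspose U = mat 1"

definition diag_matrix :: "('n \<Rightarrow> real) \<Rightarrow> complex ^ 'n ^ 'n" where
  "diag_matrix l = (\<chi> i j. if i = j then of_real (l i) else 0)"

text \<open>By the spectral theorem a self-adjoint matrix has a unitary diagonalization; by
  \<open>spectral_calculus_unique\<close> below the result does not depend on which one is chosen.\<close>
definition spectral_calculus :: "(real \<Rightarrow> real) \<Rightarrow> complex ^ 'n ^ 'n \<Rightarrow> complex ^ 'n ^ 'n" where
  "spectral_calculus h A =
     (THE B. \<exists>U l. unitary_matrix U \<and> A = U ** diag_matrix l ** ctranspose U \<and>
                   B = U ** diag_matrix (h \<circ> l) ** ctranspose U)"

definition matrix_powr :: "complex ^ 'n ^ 'n \<Rightarrow> real \<Rightarrow> complex ^ 'n ^ 'n" where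
  "matrix_powr A r = spectral_calculus (\<lambda>s. s powr r) A"

lemma diag_matrix_mult_left: "(diag_matrix l ** M) $ i $ j = of_real (l i) * M $ i $ j"
  by (simp add: diag_matrix_def matrix_matrix_mult_def if_distrib[of "\<lambda>z. z * _"]
      cong: if_cong)

lemma diag_matrix_mult_right: "(M ** diag_matrix l) $ i $ j = M $ i $ j * of_real (l j)"
  by (simp add: diag_matrix_def matrix_matrix_mult_def if_distrib[of "\<lambda>z. _ * z"]
      cong: if_cong)

lemma spectral_calculus_unique:
  fixes U V :: "complex ^ 'n ^ 'n"
  assumes U: "unitary_matrix U" and V: "unitary_matrix V"
    and eq: "U ** diag_matrix l ** ctranspose U = V ** diag_matrix m ** ctranspose V"
  shows "U ** diag_matrix (h \<circ> l) ** ctranspose U = V ** diag_matrix (h \<circ> m) ** ctranspose V"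
proof -
  define M where "M = ctranspose V ** U"
  have "M ** diag_matrix l = ctranspose V ** (U ** diag_matrix l ** ctranspose U) ** U"
    using U by (simp add: M_def unitary_matrix_def matrix_mul_assoc[symmetric])
  also have "\<dots> = diag_matrix m ** M"
    using V by (simp add: eq M_def unitary_matrix_def matrix_mul_assoc)
  finally have "M $ i $ j * of_real (l j) = of_real (m i) * M $ i $ j" for i j
    by (metis diag_matrix_mult_left diag_matrix_mult_right)
  then have "M $ i $ j = 0 \<or> l j = m i" for i j
    by (metis mult.commute mult_cancel_left of_real_eq_iff)
  then have "M $ i $ j * of_real (h (l j)) = of_real (h (m i)) * M $ i $ j" for i j
    by (metis mult.commute mult_zero_left)
  then have M: "M ** diag_matrix (h \<circ> l) = diag_matrix (h \<circ> m) ** M"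
    by (simp add: vec_eq_iff diag_matrix_mult_left diag_matrix_mult_right)
  have "U ** diag_matrix (h \<circ> l) ** ctranspose U
      = V ** (M ** diag_matrix (h \<circ> l)) ** ctranspose U"
    using V by (simp add: M_def unitary_matrix_def matrix_mul_assoc)
  also have "\<dots> = V ** diag_matrix (h \<circ> m) ** ctranspose V"
    unfolding M using U by (simp add: M_def unitary_matrix_def matrix_mul_assoc[symmetric])
  finally show ?thesis .
qed


section \<open>Matrix weights\<close>

definition matrix_weight :: "(real ^ 'd \<Rightarrow> complex ^ 'n ^ 'n) \<Rightarrow> bool" where
  "matrix_weight W \<longleftrightarrow>
     (\<forall>x. self_adjoint_matrix (W x)) \<and>
     (\<forall>i j. \<forall>S. compact S \<longrightarrow> set_integrable lebesgue S (\<lambda>x. W x $ i $ j)) \<and>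
     (AE x in lebesgue. pos_def_matrix (W x))"

definition Apq_const ::
    "(real ^ 'd \<Rightarrow> real) \<Rightarrow> real \<Rightarrow> real \<Rightarrow> real \<Rightarrow> (real ^ 'd \<Rightarrow> complex ^ 'n ^ 'n) \<Rightarrow> ennreal"
  where
  "Apq_const \<rho> \<theta> p q W =
     (SUP (c, l) \<in> UNIV \<times> {0<..}.
        ennreal (1 / (psi \<rho> \<theta> c l * measure lebesgue (cube c l))) *
        (\<integral>\<^sup>+ x \<in> cube c l.
           epowr
             (ennreal (1 / (psi \<rho> \<theta> c l * measure lebesgue (cube c l))) *
              (\<integral>\<^sup>+ y \<in> cube c l.
                 ennreal (onorm (\<lambda>v. (matrix_powr (W x) (1 / q) ** matrix_powr (W y) (- 1 / q)) *v v)
                            powr conj_exp p) \<partial>lebesgue))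
             (q / conj_exp p) \<partial>lebesgue))"

definition Apq_class ::
    "(real ^ 'd \<Rightarrow> real) \<Rightarrow> real \<Rightarrow> real \<Rightarrow> real \<Rightarrow> (real ^ 'd \<Rightarrow> complex ^ 'n ^ 'n) set" where
  "Apq_class \<rho> \<theta> p q = {W. matrix_weight W \<and> Apq_const \<rho> \<theta> p q W < top}"

definition weighted_norm ::
    "real \<Rightarrow> (real ^ 'd \<Rightarrow> complex ^ 'n ^ 'n) \<Rightarrow> (real ^ 'd \<Rightarrow> complex ^ 'n) \<Rightarrow> ennreal" where
  "weighted_norm r W f =
     epowr (\<integral>\<^sup>+ x. ennreal (norm (matrix_powr (W x) (1 / r) *v f x) powr r) \<partial>lebesgue) (1 / r)"

definition weighted_Lp ::
    "real \<Rightarrow> (real ^ 'd \<Rightarrow> complex ^ 'n ^ 'n) \<Rightarrow> (real ^ 'd \<Rightarrow> complex ^ 'n) set" where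
  "weighted_Lp r W = {f. f \<in> borel_measurable lebesgue \<and> weighted_norm r W f < top}"

text \<open>The norm of \<open>T\<close> as an operator from \<open>L\<^sup>p(V)\<close> to \<open>L\<^sup>q(W)\<close>.\<close>
definition weighted_op_norm ::
    "real \<Rightarrow> (real ^ 'd \<Rightarrow> complex ^ 'n ^ 'n) \<Rightarrow> real \<Rightarrow> (real ^ 'd \<Rightarrow> complex ^ 'n ^ 'n) \<Rightarrow>
     ((real ^ 'd \<Rightarrow> complex ^ 'n) \<Rightarrow> (real ^ 'd \<Rightarrow> complex ^ 'n)) \<Rightarrow> ennreal" where
  "weighted_op_norm p V q W T =
     (SUP f \<in> {f \<in> weighted_Lp p V. weighted_norm p V f \<le> 1}. weighted_norm q W (T f))"


section \<open>Unbounded operators on the Hilbert space of square-integrable functions\<close>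

text \<open>Elements of \<open>L\<^sup>2\<close> are represented by square-integrable functions, and identities between
  them are stated almost everywhere.\<close>

definition L2 :: "(real ^ 'd \<Rightarrow> complex) set" where
  "L2 = {f. f \<in> borel_measurable lebesgue \<and> integrable lebesgue (\<lambda>x. (norm (f x))\<^sup>2)}"

definition l2_inner :: "(real ^ 'd \<Rightarrow> complex) \<Rightarrow> (real ^ 'd \<Rightarrow> complex) \<Rightarrow> complex" where
  "l2_inner f g = (\<integral>x. f x * cnj (g x) \<partial>lebesgue)"

definition l2_norm :: "(real ^ 'd \<Rightarrow> complex) \<Rightarrow> real" where
  "l2_norm f = sqrt (\<integral>x. (norm (f x))\<^sup>2 \<partial>lebesgue)"

definition l2_eq :: "(real ^ 'd \<Rightarrow> complex) \<Rightarrow> (real ^ 'd \<Rightarrow> complex) \<Rightarrow> bool" where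
  "l2_eq f g \<longleftrightarrow> (AE x in lebesgue. f x = g x)"

text \<open>A linear operator \<open>A\<close> on \<open>L\<^sup>2\<close> with domain \<open>D\<close>; the clause on \<open>l2_eq f g\<close> makes \<open>D\<close> and \<open>A\<close>
  compatible with almost-everywhere equality.\<close>
definition l2_operator ::
    "(real ^ 'd \<Rightarrow> complex) set \<Rightarrow> ((real ^ 'd \<Rightarrow> complex) \<Rightarrow> (real ^ 'd \<Rightarrow> complex)) \<Rightarrow> bool" where
  "l2_operator D A \<longleftrightarrow>
     D \<subseteq> L2 \<and> (\<forall>f\<in>D. A f \<in> L2) \<and>
     (\<forall>f\<in>D. \<forall>g\<in>L2. l2_eq f g \<longrightarrow> g \<in> D \<and> l2_eq (A f) (A g)) \<and>
     (\<forall>f\<in>D. \<forall>g\<in>D. (\<lambda>x. f x + g x) \<in> D \<and> l2_eq (A (\<lambda>x. f x + g x)) (\<lambda>x. A f x + A g x)) \<and>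
     (\<forall>f\<in>D. \<forall>c. (\<lambda>x. c * f x) \<in> D \<and> l2_eq (A (\<lambda>x. c * f x)) (\<lambda>x. c * A f x))"

text \<open>The third conjunct says that the adjoint of \<open>A\<close> has the same graph as \<open>A\<close>.\<close>
definition nonneg_self_adjoint ::
    "(real ^ 'd \<Rightarrow> complex) set \<Rightarrow> ((real ^ 'd \<Rightarrow> complex) \<Rightarrow> (real ^ 'd \<Rightarrow> complex)) \<Rightarrow> bool" where
  "nonneg_self_adjoint D A \<longleftrightarrow>
     l2_operator D A \<and>
     (\<forall>f\<in>L2. \<forall>\<epsilon>>0. \<exists>g\<in>D. l2_norm (\<lambda>x. f x - g x) < \<epsilon>) \<and>
     (\<forall>f\<in>L2. \<forall>h\<in>L2.
        (\<forall>g\<in>D. l2_inner (A g) f = l2_inner g h) \<longleftrightarrow> f \<in> D \<and> l2_eq (A f) h) \<and>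
     (\<forall>f\<in>D. 0 \<le> Re (l2_inner (A f) f))"

text \<open>\<open>T t\<close> is \<open>e\<^bsup>-tA\<^esup>\<close>: the strongly continuous semigroup of bounded operators whose
  infinitesimal generator is \<open>-A\<close>, including equality of the domains.\<close>
definition semigroup_generated_by ::
    "(real \<Rightarrow> (real ^ 'd \<Rightarrow> complex) \<Rightarrow> (real ^ 'd \<Rightarrow> complex)) \<Rightarrow>
     (real ^ 'd \<Rightarrow> complex) set \<Rightarrow> ((real ^ 'd \<Rightarrow> complex) \<Rightarrow> (real ^ 'd \<Rightarrow> complex)) \<Rightarrow> bool" where
  "semigroup_generated_by T D A \<longleftrightarrow>
     (\<forall>t\<ge>0. l2_operator L2 (T t) \<and> (\<exists>M. \<forall>f\<in>L2. l2_norm (T t f) \<le> M * l2_norm f)) \<and>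
     (\<forall>f\<in>L2. l2_eq (T 0 f) f) \<and>
     (\<forall>s\<ge>0. \<forall>t\<ge>0. \<forall>f\<in>L2. l2_eq (T (s + t) f) (T s (T t f))) \<and>
     (\<forall>f\<in>L2. ((\<lambda>t. l2_norm (\<lambda>x. T t f x - f x)) \<longlongrightarrow> 0) (at_right 0)) \<and>
     (\<forall>f\<in>L2. \<forall>h\<in>L2.
        f \<in> D \<and> l2_eq (A f) h \<longleftrightarrow>
        ((\<lambda>t. l2_norm (\<lambda>x. (f x - T t f x) / of_real t - h x)) \<longlongrightarrow> 0) (at_right 0))"

text \<open>Joint measurability is part of the notion: without it integrals such as
  \<open>frac_integral\<close> below have no meaning pointwise in \<open>x\<close>.\<close>
definition semigroup_kernel ::
    "(real \<Rightarrow> (real ^ 'd \<Rightarrow> complex) \<Rightarrow> (real ^ 'd \<Rightarrow> complex)) \<Rightarrow>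
     (real \<Rightarrow> real ^ 'd \<Rightarrow> real ^ 'd \<Rightarrow> complex) \<Rightarrow> bool" where
  "semigroup_kernel T k \<longleftrightarrow>
     (\<lambda>(t, x, y). k t x y) \<in> borel_measurable (lebesgue_on ({0<..} \<times> UNIV)) \<and>
     (\<forall>t>0. \<forall>f\<in>L2. AE x in lebesgue.
        integrable lebesgue (\<lambda>y. k t x y * f y) \<and> T t f x = (\<integral>y. k t x y * f y \<partial>lebesgue))"

definition kernel_upper_bound ::
    "(real ^ 'd \<Rightarrow> real) \<Rightarrow> (real \<Rightarrow> real ^ 'd \<Rightarrow> real ^ 'd \<Rightarrow> complex) \<Rightarrow> bool" where
  "kernel_upper_bound \<rho> k \<longleftrightarrow>
     (\<forall>N>0. \<exists>c>0. \<exists>C>0. \<forall>x y. \<forall>t>0.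
        norm (k t x y) \<le>
          C / t powr (real CARD('d) / 2) * exp (- (norm (x - y))\<^sup>2 / (c * t)) *
          (1 + sqrt t / \<rho> x + sqrt t / \<rho> y) powr (- N))"


section \<open>The fractional integral \<open>L\<^bsup>-\<alpha>/2\<^esup>\<close>\<close>

definition kernel_apply ::
    "(real \<Rightarrow> real ^ 'd \<Rightarrow> real ^ 'd \<Rightarrow> complex) \<Rightarrow> real \<Rightarrow>
     (real ^ 'd \<Rightarrow> complex) \<Rightarrow> real ^ 'd \<Rightarrow> complex" where
  "kernel_apply k t f x = (\<integral>y. k t x y * f y \<partial>lebesgue)"

definition frac_integral ::
    "(real \<Rightarrow> real ^ 'd \<Rightarrow> real ^ 'd \<Rightarrow> complex) \<Rightarrow> real \<Rightarrow>
     (real ^ 'd \<Rightarrow> complex) \<Rightarrow> real ^ 'd \<Rightarrow> complex" where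
  "frac_integral k \<alpha> f x =
     (LINT t:{0<..}|lebesgue. kernel_apply k t f x * of_real (t powr (\<alpha> / 2 - 1)))"

text \<open>The Bochner integral is \<open>0\<close> when its integrand is not integrable; this predicate says that
  all integrals in \<open>frac_integral k \<alpha> f x\<close> converge absolutely.\<close>
definition frac_integral_defined ::
    "(real \<Rightarrow> real ^ 'd \<Rightarrow> real ^ 'd \<Rightarrow> complex) \<Rightarrow> real \<Rightarrow>
     (real ^ 'd \<Rightarrow> complex) \<Rightarrow> real ^ 'd \<Rightarrow> bool" where
  "frac_integral_defined k \<alpha> f x \<longleftrightarrow>
     (AE t in lebesgue. 0 < t \<longrightarrow> integrable lebesgue (\<lambda>y. k t x y * f y)) \<and>
     set_integrable lebesgue {0<..} (\<lambda>t. kernel_apply k t f x * of_real (t powr (\<alpha> / 2 - 1)))"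

definition vec_frac_integral ::
    "(real \<Rightarrow> real ^ 'd \<Rightarrow> real ^ 'd \<Rightarrow> complex) \<Rightarrow> real \<Rightarrow>
     (real ^ 'd \<Rightarrow> complex ^ 'n) \<Rightarrow> real ^ 'd \<Rightarrow> complex ^ 'n" where
  "vec_frac_integral k \<alpha> f x = (\<chi> i. frac_integral k \<alpha> (\<lambda>y. f y $ i) x)"

end

theory Submission
  imports Defs
begin

text \<open>
  The operator norms \<open>F x y\<close> of \<open>W x powr (1/q) ** W y powr (-1/q)\<close> form a submultiplicative kernel.
  A critical radius function changes by at most a power of \<open>m = 1 + 2 powr k / \<rho>\<close> over cubes of side
  \<open>2 powr k\<close>, so the mixed averages of \<open>F\<close> over dyadic cubes and their triples are bounded by
  \<open>B m powr \<tau>\<close>, where \<open>B\<close> is a multiple of the characteristic of the weight.  The heat kernel bound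
  dominates the kernel of \<open>L powr (-\<alpha>/2)\<close> by the sum over \<open>k\<close> of
  \<open>2 powr (k (\<alpha> - d)) m powr (-N)\<close> on the pairs of points in neighbouring cubes of side \<open>2 powr k\<close>,
  with \<open>N\<close> at our disposal.  It remains to bound the forms
  \<open>\<Sum>k. 2 powr (k \<alpha>) \<integral> avg (h (avg (F g)))\<close> for \<open>g\<close> in the unit ball of \<open>L\<^sup>p\<close> and \<open>h\<close> in that of
  \<open>L\<^sup>s\<close>, \<open>1/q + 1/s = 1\<close>.

  Where \<open>m\<close> is bounded, submultiplicativity forces the rows of \<open>F\<close> and their averages to be large on a
  substantial part of each cube.  Hence they satisfy reverse Hoelder inequalities, with gains of the
  order \<open>B powr (-P/q)\<close> and \<open>1/B\<close>, where \<open>P\<close> is conjugate to \<open>p\<close>.  Hoelder's inequality on each cube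
  then leaves averages of \<open>g\<close> and \<open>h\<close> with exponents slightly below \<open>p\<close> and \<open>s\<close>; Hedberg's
  optimisation sums them over the scales, and the maximal function theorem at the exponents left
  over costs \<open>B powr (P/q\<^sup>2)\<close> and \<open>B powr (1/s)\<close>.  Together with the factor \<open>B powr (1/q)\<close> from the
  averages of \<open>F\<close> this is \<open>B powr (1 + P/q\<^sup>2)\<close>, the claimed power.  Where \<open>m\<close> is large, the factor
  \<open>m powr (-N)\<close> compensates for the growth of the averages and makes the sum over \<open>k\<close> converge.
\<close>

section \<open>Powers of extended non-negative reals\<close>

text \<open>The matrices enter only through \<open>F\<close>: the weighted size of the fractional
  integral at \<open>x\<close> is at most a dimensional constant times the integral of the scalar
  kernel against \<open>F x y\<close> and the weighted size of \<open>f\<close> at \<open>y\<close>.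
  With the exponents \<open>p\<close> and \<open>s\<close> themselves the maximal function would
  have to be bounded on \<open>L^1\<close>, which fails; so the room won by the reverse Hoelder
  inequalities is the whole source of the powers of \<open>B\<close> beyond \<open>1/q\<close>. The
  bookkeeping closes because \<open>1/q + 1/s = 1\<close>, while
  \<open>1 - \<alpha>/d = 1/P + 1/q\<close> turns the exponent of the statement into
  \<open>1 + P/q^2\<close>. A lower bound \<open>B \<ge> 1\<close> is needed, hence a lower bound
  for the characteristic that does not depend on the weight; it comes from
  \<open>F x x \<ge> 1\<close>. All estimates are carried out in \<open>ennreal\<close> for Borel
  functions and \<open>lborel\<close>, so that Tonelli applies freely and absolute convergence of
  the fractional integral is a consequence of the estimate; the weight, the kernel and
  \<open>f\<close> are first replaced by Borel versions that agree with them almost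
  everywhere.\<close>

notation epowr (infixr "\<up>" 85)

lemma epowr_ennreal: "0 \<le> x \<Longrightarrow> ennreal x \<up> r = ennreal (x powr r)"
  by (simp add: epowr_def)

text \<open>Since \<open>0 powr r = 0\<close> and \<open>top\<close> is kept by convention, both end
  points are fixed by every exponent, zero and negative ones included. This is why the laws for sums
  and products of exponents and for inverses carry no side conditions.\<close>

lemma epowr_simps [simp]: "0 \<up> r = 0" "1 \<up> r = 1" "top \<up> r = top"
  by (simp_all add: epowr_def)

lemma epowr_1 [simp]: "a \<up> 1 = a"
  by (cases a) (simp_all add: epowr_def)

lemma epowr_eq_0_iff [simp]: "a \<up> r = 0 \<longleftrightarrow> a = 0"
  by (cases a) (auto simp: epowr_ennreal ennreal_eq_0_iff)

lemma epowr_eq_top_iff [simp]: "a \<up> r = top \<longleftrightarrow> a = top"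
  by (cases a) (auto simp: epowr_ennreal)

lemma epowr_less_top_iff [simp]: "a \<up> r < top \<longleftrightarrow> a < top"
  by (metis epowr_eq_top_iff less_top)

lemma epowr_add: "a \<up> (r + s) = a \<up> r * a \<up> s"
  by (cases a) (auto simp: epowr_ennreal powr_add ennreal_mult)

lemma epowr_epowr: "(a \<up> r) \<up> s = a \<up> (r * s)"
  by (cases a) (auto simp: epowr_ennreal powr_powr)

lemma epowr_mult: "0 < r \<Longrightarrow> (a * b) \<up> r = a \<up> r * b \<up> r"
  by (cases a; cases b)
    (auto simp: epowr_ennreal powr_mult ennreal_mult[symmetric] ennreal_mult_top ennreal_top_mult
      simp del: ennreal_mult)

lemma epowr_inverse: "inverse a \<up> r = inverse (a \<up> r)"
proof (cases a)
  case (real x)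
  then show ?thesis
    by (cases "x = 0") (simp_all add: epowr_ennreal inverse_ennreal inverse_powr)
qed simp

lemma epowr_divide: "0 < r \<Longrightarrow> (a / b) \<up> r = a \<up> r / b \<up> r"
  by (simp add: divide_ennreal_def epowr_mult epowr_inverse)

lemma epowr_mono: "0 \<le> r \<Longrightarrow> a \<le> b \<Longrightarrow> a \<up> r \<le> b \<up> r"
  by (cases a; cases b) (auto simp: epowr_ennreal powr_mono2 ennreal_leI top_unique)

lemma epowr_le_iff: "0 < r \<Longrightarrow> a \<up> r \<le> b \<longleftrightarrow> a \<le> b \<up> (1 / r)"
  using epowr_mono[of "1 / r" "a \<up> r" b] epowr_mono[of r a "b \<up> (1 / r)"]
  by (auto simp: epowr_epowr)

lemma epowr_mono_iff: "0 < r \<Longrightarrow> a \<up> r \<le> b \<up> r \<longleftrightarrow> a \<le> b"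
  by (simp add: epowr_le_iff epowr_epowr)

lemma epowr_SUP: "0 < r \<Longrightarrow> (SUP i\<in>I. f i) \<up> r = (SUP i\<in>I. f i \<up> r)"
proof (rule antisym)
  assume r: "0 < r"
  show "(SUP i\<in>I. f i) \<up> r \<le> (SUP i\<in>I. f i \<up> r)"
    unfolding epowr_le_iff[OF r] using r
    by (intro SUP_least) (metis SUP_upper epowr_le_iff)
  show "(SUP i\<in>I. f i \<up> r) \<le> (SUP i\<in>I. f i) \<up> r"
    using r by (intro SUP_least epowr_mono SUP_upper) auto
qed

lemma borel_measurable_epowr [measurable]:
  "f \<in> borel_measurable M \<Longrightarrow> (\<lambda>x. f x \<up> r) \<in> borel_measurable M"
  unfolding epowr_def by (intro measurable_If) auto

lemma ennreal_Youngs: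
  fixes x y :: ennreal and p q :: real
  assumes "1 < p" "1 < q" "1 / p + 1 / q = 1"
  shows "x * y \<le> ennreal (1 / p) * x \<up> p + ennreal (1 / q) * y \<up> q"
proof (cases "x = top \<or> y = top")
  case True
  then show ?thesis
    using assms by (auto simp: ennreal_mult_top)
next
  case False
  then obtain a b where ab: "x = ennreal a" "y = ennreal b" "0 \<le> a" "0 \<le> b"
    by (metis ennreal_cases)
  have "a * b \<le> a powr p / p + b powr q / q"
    using Youngs_inequality[of p q a b] assms ab by simp
  then show ?thesis
    using ab assms
    by (simp add: epowr_ennreal ennreal_mult[symmetric] ennreal_plus[symmetric] ennreal_leI
        del: ennreal_plus)
qed

text \<open>Young's inequality applied to \<open>f / a\<close> and \<open>g / b\<close>, where
  \<open>a\<close> and \<open>b\<close> are the two norms. The norms \<open>0\<close> and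
  \<open>top\<close> are treated separately, because there the normalisation would divide by zero or
  infinity.\<close>

lemma nn_integral_Holder:
  fixes f g :: "'a \<Rightarrow> ennreal" and p q :: real
  assumes [measurable]: "f \<in> borel_measurable M" "g \<in> borel_measurable M"
    and pq: "1 < p" "1 < q" "1 / p + 1 / q = 1"
  shows "(\<integral>\<^sup>+x. f x * g x \<partial>M) \<le> (\<integral>\<^sup>+x. f x \<up> p \<partial>M) \<up> (1 / p) * (\<integral>\<^sup>+x. g x \<up> q \<partial>M) \<up> (1 / q)"
proof -
  define A where "A = (\<integral>\<^sup>+x. f x \<up> p \<partial>M)"
  define B where "B = (\<integral>\<^sup>+x. g x \<up> q \<partial>M)"
  consider "A = 0" | "B = 0" | "A \<noteq> 0" "B \<noteq> 0" "A = top \<or> B = top"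
    | "A \<noteq> 0" "B \<noteq> 0" "A \<noteq> top" "B \<noteq> top" by blast
  then show ?thesis
  proof cases
    case 1
    then have "AE x in M. f x = 0"
      unfolding A_def by (simp add: nn_integral_0_iff_AE)
    then have "(\<integral>\<^sup>+x. f x * g x \<partial>M) = 0"
      by (subst nn_integral_0_iff_AE) auto
    then show ?thesis by simp
  next
    case 2
    then have "AE x in M. g x = 0"
      unfolding B_def by (simp add: nn_integral_0_iff_AE)
    then have "(\<integral>\<^sup>+x. f x * g x \<partial>M) = 0"
      by (subst nn_integral_0_iff_AE) auto
    then show ?thesis by simp
  next
    case 3
    then have "A \<up> (1 / p) * B \<up> (1 / q) = top"
      by (auto simp: ennreal_mult_eq_top_iff)
    then show ?thesis
      unfolding A_def B_def by simp
  next
    case 4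
    define a b where "a = A \<up> (1 / p)" and "b = B \<up> (1 / q)"
    have ab: "a \<noteq> 0" "b \<noteq> 0" "a \<noteq> top" "b \<noteq> top"
      using 4 by (auto simp: a_def b_def)
    have ap: "a \<up> p = A" "b \<up> q = B"
      using pq by (auto simp: a_def b_def epowr_epowr)
    have one: "c / c = 1" if "c \<noteq> 0" "c \<noteq> top" for c :: ennreal
      using that by (simp add: less_top)
    have "(\<integral>\<^sup>+x. (f x / a) * (g x / b) \<partial>M)
        \<le> (\<integral>\<^sup>+x. ennreal (1 / p) * (f x / a) \<up> p + ennreal (1 / q) * (g x / b) \<up> q \<partial>M)"
      by (intro nn_integral_mono ennreal_Youngs pq)
    also have "\<dots> = ennreal (1 / p) * ((\<integral>\<^sup>+x. f x \<up> p \<partial>M) / a \<up> p)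
        + ennreal (1 / q) * ((\<integral>\<^sup>+x. g x \<up> q \<partial>M) / b \<up> q)"
      using pq by (simp add: nn_integral_add nn_integral_cmult nn_integral_divide epowr_divide)
    also have "\<dots> = ennreal (1 / p) + ennreal (1 / q)"
      unfolding ap A_def[symmetric] B_def[symmetric] using one[of A] one[of B] 4 by simp
    also have "\<dots> = 1"
      using pq by (simp add: ennreal_plus[symmetric] del: ennreal_plus)
    finally have *: "(\<integral>\<^sup>+x. (f x / a) * (g x / b) \<partial>M) \<le> 1" .
    have "(\<integral>\<^sup>+x. f x * g x \<partial>M) = (\<integral>\<^sup>+x. (a * b) * ((f x / a) * (g x / b)) \<partial>M)"
    proof (intro nn_integral_cong)
      fix x
      have "(a * b) * ((f x / a) * (g x / b)) = (a / a) * (b / b) * (f x * g x)"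
        by (simp add: divide_ennreal_def algebra_simps)
      also have "\<dots> = f x * g x"
        using ab one[of a] one[of b] by simp
      finally show "f x * g x = (a * b) * ((f x / a) * (g x / b))" by simp
    qed
    also have "\<dots> = (a * b) * (\<integral>\<^sup>+x. (f x / a) * (g x / b) \<partial>M)"
      by (rule nn_integral_cmult) measurable
    also have "\<dots> \<le> (a * b) * 1"
      by (intro mult_left_mono *) auto
    finally show ?thesis
      by (simp add: a_def b_def A_def B_def)
  qed
qed

text \<open>Tested against \<open>h = min u n powr (q - 1)\<close> on a set of finite measure, the hypothesis gives the bound
  for the truncated function, whose norm is finite.\<close>
lemma nn_integral_dual_bound:
  fixes u :: "'a \<Rightarrow> ennreal" and p q :: real
  assumes [measurable]: "u \<in> borel_measurable M" and sf: "sigma_finite_measure M"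
    and pq: "1 < p" "1 < q" "1 / p + 1 / q = 1"
    and bound: "\<And>h :: 'a \<Rightarrow> ennreal. h \<in> borel_measurable M \<Longrightarrow> (\<integral>\<^sup>+x. h x \<up> p \<partial>M) \<le> 1 \<Longrightarrow>
      (\<integral>\<^sup>+x. h x * u x \<partial>M) \<le> C"
  shows "(\<integral>\<^sup>+x. u x \<up> q \<partial>M) \<up> (1 / q) \<le> C"
proof -
  interpret sigma_finite_measure M by fact
  obtain A :: "nat \<Rightarrow> 'a set" where A: "range A \<subseteq> sets M" "(\<Union>i. A i) = space M"
      "\<And>i. emeasure M (A i) \<noteq> \<infinity>" "incseq A"
    using sigma_finite_incseq by blast
  then have [measurable]: "A n \<in> sets M" for n by auto
  define v where "v n x = min (u x) (of_nat n) * indicator (A n) x" for n x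
  have [measurable]: "v n \<in> borel_measurable M" for n
    unfolding v_def by measurable
  have q1: "(q - 1) * p = q" "1 - 1 / p = 1 / q"
    using pq by (auto simp: field_simps)
  have trunc: "(\<integral>\<^sup>+x. v n x \<up> q \<partial>M) \<up> (1 / q) \<le> C" for n
  proof (cases "(\<integral>\<^sup>+x. v n x \<up> q \<partial>M) = 0")
    case True
    then show ?thesis by simp
  next
    case False
    define I where "I = (\<integral>\<^sup>+x. v n x \<up> q \<partial>M)"
    have "v n x \<up> q \<le> of_nat n \<up> q * indicator (A n) x" for x
      using pq epowr_mono[of q "min (u x) (of_nat n)" "of_nat n"]
      by (simp add: v_def split: split_indicator)
    then have "I \<le> (\<integral>\<^sup>+x. of_nat n \<up> q * indicator (A n) x \<partial>M)"
      unfolding I_def by (intro nn_integral_mono)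
    also have "\<dots> = of_nat n \<up> q * emeasure M (A n)"
      by (subst nn_integral_cmult_indicator) auto
    also have "\<dots> < top"
      using A(3)[of n] by (simp add: ennreal_mult_eq_top_iff less_top[symmetric])
    finally have fin: "I < top" .
    have I0: "I \<noteq> 0" using False I_def by simp
    define h where "h x = v n x \<up> (q - 1) / I \<up> (1 / p)" for x
    have "(\<integral>\<^sup>+x. h x \<up> p \<partial>M) = (\<integral>\<^sup>+x. v n x \<up> q / I \<partial>M)"
      unfolding h_def using pq by (simp add: epowr_divide epowr_epowr q1)
    also have "\<dots> = I / I"
      by (simp add: nn_integral_divide I_def)
    also have "\<dots> = 1"
      using I0 fin by simp
    finally have "(\<integral>\<^sup>+x. h x * u x \<partial>M) \<le> C"
      by (intro bound) (auto simp: h_def)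
    have "I / I \<up> (1 / p) = (\<integral>\<^sup>+x. v n x \<up> q / I \<up> (1 / p) \<partial>M)"
      by (simp add: nn_integral_divide I_def)
    also have "\<dots> = (\<integral>\<^sup>+x. h x * v n x \<partial>M)"
      using epowr_add[of _ "q - 1" 1] by (simp add: h_def divide_ennreal_def algebra_simps)
    also have "\<dots> \<le> (\<integral>\<^sup>+x. h x * u x \<partial>M)"
      by (intro nn_integral_mono mult_left_mono) (auto simp: v_def split: split_indicator)
    also have "\<dots> \<le> C" by fact
    also have "I / I \<up> (1 / p) = I \<up> (1 / q)"
    proof -
      have "I = I \<up> (1 / q) * I \<up> (1 / p)"
        using pq epowr_add[of I "1 / q" "1 / p"] by (simp add: add.commute)
      then have "I / I \<up> (1 / p) = I \<up> (1 / q) * (I \<up> (1 / p) / I \<up> (1 / p))"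
        by (metis ennreal_times_divide)
      also have "I \<up> (1 / p) / I \<up> (1 / p) = 1"
        using I0 fin by simp
      finally show ?thesis by simp
    qed
    finally show ?thesis unfolding I_def .
  qed
  have inc: "incseq (\<lambda>n x. v n x \<up> q)"
  proof (intro incseq_SucI le_funI epowr_mono)
    fix n x
    show "v n x \<le> v (Suc n) x"
    proof (cases "x \<in> A n")
      case True
      have le: "(of_nat n :: ennreal) \<le> of_nat (Suc n)"
        by (rule of_nat_mono) simp
      have "x \<in> A (Suc n)"
        using True incseqD[OF A(4), of n "Suc n"] by auto
      then show ?thesis
        using True min.mono[OF order_refl le, of "u x"] by (simp add: v_def del: of_nat_Suc)
    qed (simp add: v_def)
  qed (use pq in simp)
  have sup: "(SUP n. v n x) = u x" if "x \<in> space M" for x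
  proof (rule antisym)
    show "(SUP n. v n x) \<le> u x"
      by (intro SUP_least) (auto simp: v_def split: split_indicator)
    show "u x \<le> (SUP n. v n x)"
      unfolding le_SUP_iff
    proof safe
      fix y assume y: "y < u x"
      then obtain n where n: "y < of_nat n"
        using ennreal_Ex_less_of_nat[of y] by (metis less_top order_less_le_trans top_greatest not_le)
      have "\<exists>m. x \<in> A m" using that unfolding A(2)[symmetric] by simp
      then obtain m where m: "x \<in> A m" ..
      have "x \<in> A (max n m)" using incseqD[OF A(4), of m "max n m"] m by auto
      moreover have "y < of_nat (max n m)"
        using n by (rule order_less_le_trans) (simp add: del: of_nat_max)
      ultimately have "y < v (max n m) x"
        using y by (simp add: v_def)
      then show "\<exists>i\<in>UNIV. y < v i x" by blast
    qed
  qed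
  have "(\<integral>\<^sup>+x. u x \<up> q \<partial>M) = (\<integral>\<^sup>+x. (SUP n. v n x \<up> q) \<partial>M)"
    using pq by (intro nn_integral_cong) (simp add: epowr_SUP[symmetric] sup)
  also have "\<dots> = (SUP n. \<integral>\<^sup>+x. v n x \<up> q \<partial>M)"
    by (rule nn_integral_monotone_convergence_SUP[OF inc]) measurable
  finally have "(\<integral>\<^sup>+x. u x \<up> q \<partial>M) \<up> (1 / q) = (SUP n. (\<integral>\<^sup>+x. v n x \<up> q \<partial>M) \<up> (1 / q))"
    using pq by (simp add: epowr_SUP)
  also have "\<dots> \<le> C"
    by (intro SUP_least trunc)
  finally show ?thesis .
qed

section \<open>Dyadic cubes\<close>

text \<open>Half-open dyadic cubes: the cells of one level partition the space, so lying in the same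
  cell is an equivalence relation and boundaries never have to be discussed.\<close>

definition cell :: "int \<Rightarrow> real ^ 'd \<Rightarrow> (real ^ 'd) set" where
  "cell k x = {y. \<forall>i. \<lfloor>y $ i / 2 powr real_of_int k\<rfloor> = \<lfloor>x $ i / 2 powr real_of_int k\<rfloor>}"

text \<open>The cell of \<open>x\<close> with all its neighbours of the same level. Two close points
  may lie in different cells of every level, but points at distance at most \<open>2 powr k\<close>
  always lie in each other's \<open>tri k\<close>; this is what makes a single dyadic grid
  suffice.\<close>

definition tri :: "int \<Rightarrow> real ^ 'd \<Rightarrow> (real ^ 'd) set" where
  "tri k x = {y. \<forall>i. \<bar>\<lfloor>y $ i / 2 powr real_of_int k\<rfloor> - \<lfloor>x $ i / 2 powr real_of_int k\<rfloor>\<bar> \<le> 1}"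

abbreviation volume :: "'d itself \<Rightarrow> int \<Rightarrow> real" where
  "volume t k \<equiv> 2 powr (real_of_int k * real CARD('d))"

lemma borel_measurable_vec_nth [measurable]:
  "(\<lambda>x :: 'a :: euclidean_space ^ 'd. x $ i) \<in> borel_measurable borel"
  by (intro borel_measurable_continuous_onI continuous_intros)

lemma pred_cell [measurable]: "Measurable.pred (borel \<Otimes>\<^sub>M borel) (\<lambda>(x, y). y \<in> cell k x)"
  unfolding cell_def by simp

lemma pred_tri [measurable]: "Measurable.pred (borel \<Otimes>\<^sub>M borel) (\<lambda>(x, y). y \<in> tri k x)"
proof -
  have "\<bar>m - n\<bar> \<le> 1 \<longleftrightarrow> real_of_int m - real_of_int n \<le> 1 \<and> real_of_int n - real_of_int m \<le> 1" for m n
    by linarith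
  then show ?thesis
    unfolding tri_def by simp
qed

lemma measurable_in_cell [measurable (raw)]:
  assumes [measurable]: "f \<in> measurable M borel" "g \<in> measurable M borel"
  shows "Measurable.pred M (\<lambda>x. f x \<in> cell k (g x))"
proof -
  have "(\<lambda>x. (g x, f x)) \<in> measurable M (borel \<Otimes>\<^sub>M borel)" by measurable
  from measurable_compose[OF this pred_cell] show ?thesis by simp
qed

lemma measurable_in_tri [measurable (raw)]:
  assumes [measurable]: "f \<in> measurable M borel" "g \<in> measurable M borel"
  shows "Measurable.pred M (\<lambda>x. f x \<in> tri k (g x))"
proof -
  have "(\<lambda>x. (g x, f x)) \<in> measurable M (borel \<Otimes>\<^sub>M borel)" by measurable
  from measurable_compose[OF this pred_tri] show ?thesis by simp
qed

lemma sets_cell [measurable, simp]: "cell k x \<in> sets borel"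
  using measurable_in_cell[of "\<lambda>x. x" borel "\<lambda>_. x" k] by (simp add: pred_def)

lemma sets_tri [measurable, simp]: "tri k x \<in> sets borel"
  using measurable_in_tri[of "\<lambda>x. x" borel "\<lambda>_. x" k] by (simp add: pred_def)

text \<open>The set is squeezed between \<open>box a b\<close> and \<open>cbox a b\<close>, which
  have the same measure.\<close>

lemma emeasure_half_open_cube:
  fixes a :: "real ^ 'd"
  assumes s: "0 \<le> s"
  shows "emeasure lborel {y. \<forall>i. a $ i \<le> y $ i \<and> y $ i < a $ i + s} = ennreal (s ^ CARD('d))"
proof (rule antisym)
  define b where "b = a + (\<chi> i. s)"
  have bas: "(b - a) \<bullet> e = s \<and> a \<bullet> e \<le> b \<bullet> e" if "e \<in> Basis" for e
    using that s by (auto simp: Basis_vec_def b_def inner_axis inner_add_left)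
  have "{y. \<forall>i. a $ i \<le> y $ i \<and> y $ i < a $ i + s} \<in> sets borel" (is "?S \<in> _")
    by measurable
  moreover have "?S \<subseteq> cbox a b" "box a b \<subseteq> ?S"
    by (auto simp: b_def mem_box_cart) (meson less_imp_le)+
  ultimately have "emeasure lborel ?S \<le> emeasure lborel (cbox a b)"
      "emeasure lborel (box a b) \<le> emeasure lborel ?S"
    by (intro emeasure_mono; simp)+
  moreover have "(\<Prod>e\<in>Basis. (b - a) \<bullet> e) = s ^ CARD('d)"
    using bas by (simp add: DIM_cart)
  ultimately show "emeasure lborel ?S \<le> ennreal (s ^ CARD('d))"
    and "ennreal (s ^ CARD('d)) \<le> emeasure lborel ?S"
    using bas by simp_all
qed

lemma cell_eq: "cell k x = {y. \<forall>i. of_int \<lfloor>x $ i / 2 powr k\<rfloor> * 2 powr k \<le> y $ i \<and>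
    y $ i < of_int \<lfloor>x $ i / 2 powr k\<rfloor> * 2 powr k + 2 powr k}"
  by (auto simp: cell_def floor_eq_iff field_simps)

lemma abs_floor_diff_le_1_iff:
  fixes s a :: real and m :: int
  assumes "0 < s"
  shows "\<bar>\<lfloor>a / s\<rfloor> - m\<bar> \<le> 1 \<longleftrightarrow> (of_int m - 1) * s \<le> a \<and> a < (of_int m - 1) * s + 3 * s"
proof -
  have "\<bar>\<lfloor>a / s\<rfloor> - m\<bar> \<le> 1 \<longleftrightarrow> m - 1 \<le> \<lfloor>a / s\<rfloor> \<and> \<lfloor>a / s\<rfloor> < m + 2" by auto
  also have "\<dots> \<longleftrightarrow> of_int (m - 1) \<le> a / s \<and> a / s < of_int (m + 2)"
    by (simp only: le_floor_iff floor_less_iff)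
  also have "\<dots> \<longleftrightarrow> (of_int m - 1) * s \<le> a \<and> a < (of_int m - 1) * s + 3 * s"
    using assms by (auto simp: field_simps)
  finally show ?thesis .
qed

lemma tri_eq: "tri k x = {y. \<forall>i. (of_int \<lfloor>x $ i / 2 powr k\<rfloor> - 1) * 2 powr k \<le> y $ i \<and>
    y $ i < (of_int \<lfloor>x $ i / 2 powr k\<rfloor> - 1) * 2 powr k + 3 * 2 powr k}"
  by (simp add: tri_def abs_floor_diff_le_1_iff)

lemma emeasure_cell [simp]:
  "emeasure lborel (cell k (x :: real ^ 'd)) = ennreal (volume TYPE('d) k)"
  using emeasure_half_open_cube[of "2 powr k" "\<chi> i. of_int \<lfloor>x $ i / 2 powr k\<rfloor> * 2 powr k"]
  by (simp add: cell_eq powr_powr[symmetric] powr_realpow)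

lemma emeasure_tri [simp]:
  "emeasure lborel (tri k (x :: real ^ 'd)) = ennreal (3 ^ CARD('d) * volume TYPE('d) k)"
  using emeasure_half_open_cube[of "3 * 2 powr k" "\<chi> i. (of_int \<lfloor>x $ i / 2 powr k\<rfloor> - 1) * 2 powr k"]
  by (simp add: tri_eq powr_powr[symmetric] powr_realpow power_mult_distrib)

lemma cell_self [simp]: "x \<in> cell k x" and tri_self [simp]: "x \<in> tri k x"
  by (simp_all add: cell_def tri_def)

lemma cell_subset_tri: "cell k x \<subseteq> tri k x"
  by (auto simp: cell_def tri_def)

lemma cell_cong: "y \<in> cell k x \<Longrightarrow> cell k y = cell k x"
  and tri_cong: "y \<in> cell k x \<Longrightarrow> tri k y = tri k x"
  by (simp_all add: cell_def tri_def)

lemma cell_sym: "y \<in> cell k x \<longleftrightarrow> x \<in> cell k y"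
  and tri_sym: "y \<in> tri k x \<longleftrightarrow> x \<in> tri k y"
  unfolding cell_def tri_def mem_Collect_eq by (metis, metis abs_minus_commute)

lemma indicator_cell_sym: "indicator (cell k x) y = (indicator (cell k y) x :: ennreal)"
  using cell_sym[of y k x] by (simp add: indicator_def)

lemma indicator_tri_sym: "indicator (tri k x) y = (indicator (tri k y) x :: ennreal)"
  using tri_sym[of y k x] by (simp add: indicator_def)

text \<open>Passing to a coarser level divides the integer coordinates of a cell by a power of two
  and rounds down. Nesting of cells and of their neighbourhoods becomes arithmetic of
  \<open>div\<close>.\<close>

lemma floor_coarser:
  assumes "k \<le> j"
  shows "\<lfloor>a / 2 powr real_of_int j\<rfloor> = \<lfloor>a / 2 powr real_of_int k\<rfloor> div 2 ^ nat (j - k)"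
proof -
  have "2 powr real_of_int j = 2 powr real_of_int k * 2 powr real_of_int (j - k)"
    by (simp add: powr_add[symmetric])
  also have "2 powr real_of_int (j - k) = real_of_int (2 ^ nat (j - k))"
    using assms powr_realpow[of 2 "nat (j - k)"] by simp
  finally have "a / 2 powr real_of_int j = a / 2 powr real_of_int k / real_of_int (2 ^ nat (j - k))"
    by (metis divide_divide_eq_left)
  then have "\<lfloor>a / 2 powr real_of_int j\<rfloor> = \<lfloor>a / 2 powr real_of_int k / real_of_int (2 ^ nat (j - k))\<rfloor>"
    by (rule arg_cong)
  also have "\<dots> = \<lfloor>a / 2 powr real_of_int k\<rfloor> div 2 ^ nat (j - k)"
    by (rule floor_divide_real_eq_div) simp
  finally show ?thesis .
qed

lemma cell_coarser: "k \<le> j \<Longrightarrow> y \<in> cell k x \<Longrightarrow> y \<in> cell j x"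
  by (simp add: cell_def floor_coarser)

lemma cell_subset: "k \<le> j \<Longrightarrow> y \<in> cell j x \<Longrightarrow> cell k y \<subseteq> cell j x"
  using cell_coarser cell_cong by blast

text \<open>Neighbours stay neighbours or coincide on a coarser grid: from
  \<open>a \<le> b + 1\<close> and \<open>1 \<le> n\<close> follows
  \<open>a div n \<le> (b + n) div n = b div n + 1\<close>.\<close>

lemma tri_coarser:
  assumes "k \<le> j" "y \<in> tri k x"
  shows "y \<in> tri j x"
proof -
  have div_le: "a div n \<le> b div n + 1" if "a \<le> b + 1" "0 < n" for a b n :: int
  proof -
    have "a div n \<le> (b + n) div n"
      using that by (intro zdiv_mono1) auto
    then show ?thesis using that by simp
  qed
  have *: "\<bar>a div n - b div n\<bar> \<le> 1" if "\<bar>a - b\<bar> \<le> 1" "0 < n" for a b n :: int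
    using div_le[of a b n] div_le[of b a n] that by linarith
  show ?thesis
    using assms unfolding tri_def by (auto simp: floor_coarser intro!: *)
qed

lemma cell_subset_tri': "k \<le> j \<Longrightarrow> y \<in> tri j x \<Longrightarrow> cell k y \<subseteq> tri j x"
  using cell_subset[of k j y y] by (auto simp: cell_def tri_def)

lemma tri_norm:
  fixes x y :: "real ^ 'd"
  assumes "y \<in> tri k x"
  shows "norm (x - y) \<le> 3 * real CARD('d) * 2 powr k"
proof -
  have "norm (x - y) \<le> (\<Sum>i\<in>UNIV. \<bar>(x - y) $ i\<bar>)"
    by (rule norm_le_l1_cart)
  also have "\<dots> \<le> (\<Sum>i\<in>(UNIV :: 'd set). 3 * 2 powr k)"
  proof (rule sum_mono)
    fix i
    have "y \<in> tri k x" "x \<in> tri k x" using assms by simp_all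
    then have "\<forall>i. (of_int \<lfloor>x $ i / 2 powr k\<rfloor> - 1) * 2 powr k \<le> z $ i \<and>
        z $ i < (of_int \<lfloor>x $ i / 2 powr k\<rfloor> - 1) * 2 powr k + 3 * 2 powr k" if "z = x \<or> z = y" for z
      using that unfolding tri_eq by blast
    from this[of x] this[of y] show "\<bar>(x - y) $ i\<bar> \<le> 3 * 2 powr k"
      unfolding vector_minus_component by (smt (verit))
  qed
  finally show ?thesis by (simp add: algebra_simps)
qed

lemma norm_tri:
  fixes x y :: "real ^ 'd"
  assumes "norm (x - y) \<le> 2 powr k"
  shows "y \<in> tri k x"
  unfolding tri_def
proof safe
  fix i
  define s where "s = 2 powr real_of_int k"
  have s: "0 < s" by (simp add: s_def)
  have "\<bar>x $ i - y $ i\<bar> \<le> s"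
    using component_le_norm_cart[of "x - y" i] assms by (simp add: s_def)
  then have "x $ i / s \<le> y $ i / s + 1" "y $ i / s \<le> x $ i / s + 1"
    using s by (auto simp: field_simps)
  then have "\<lfloor>x $ i / s\<rfloor> \<le> \<lfloor>y $ i / s\<rfloor> + 1" "\<lfloor>y $ i / s\<rfloor> \<le> \<lfloor>x $ i / s\<rfloor> + 1"
    by linarith+
  then show "\<bar>\<lfloor>y $ i / 2 powr real_of_int k\<rfloor> - \<lfloor>x $ i / 2 powr real_of_int k\<rfloor>\<bar> \<le> 1"
    unfolding s_def by linarith
qed

section \<open>Averaging over the cells of one level\<close>

lemma nn_integral_pair_swap:
  fixes f :: "real ^ 'd \<Rightarrow> real ^ 'd \<Rightarrow> ennreal"
  assumes "(\<lambda>(x, y). f x y) \<in> borel_measurable (borel \<Otimes>\<^sub>M borel)"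
  shows "(\<integral>\<^sup>+x. \<integral>\<^sup>+y. f x y \<partial>lborel \<partial>lborel) = (\<integral>\<^sup>+y. \<integral>\<^sup>+x. f x y \<partial>lborel \<partial>lborel)"
  using assms by (intro lborel_pair.Fubini'[symmetric]) simp

text \<open>Tonelli and the symmetry of \<open>y \<in> cell k x\<close> in \<open>x\<close> and
  \<open>y\<close>: each \<open>y\<close> is counted with the measure of its own cell. Integrating
  over \<open>x\<close> in this way replaces summation over the cells of a level.\<close>

lemma nn_integral_cell_average:
  fixes f :: "real ^ 'd \<Rightarrow> ennreal"
  assumes [measurable]: "f \<in> borel_measurable borel"
  shows "(\<integral>\<^sup>+x. (\<integral>\<^sup>+y. f y * indicator (cell k x) y \<partial>lborel) \<partial>lborel)
    = ennreal (volume TYPE('d) k) * (\<integral>\<^sup>+x. f x \<partial>lborel)"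
proof -
  have "(\<integral>\<^sup>+x. (\<integral>\<^sup>+y. f y * indicator (cell k x) y \<partial>lborel) \<partial>lborel)
      = (\<integral>\<^sup>+y. (\<integral>\<^sup>+x. f y * indicator (cell k x) y \<partial>lborel) \<partial>lborel)"
    by (rule nn_integral_pair_swap) (simp add: split_beta' indicator_def)
  also have "\<dots> = (\<integral>\<^sup>+y. (\<integral>\<^sup>+x. f y * indicator (cell k y) x \<partial>lborel) \<partial>lborel)"
    by (intro nn_integral_cong) (simp only: indicator_cell_sym)
  finally show ?thesis
    by (simp add: nn_integral_cmult nn_integral_multc mult.commute)
qed

lemma nn_integral_tri_average:
  fixes f w :: "real ^ 'd \<Rightarrow> ennreal"
  assumes [measurable]: "f \<in> borel_measurable borel" "w \<in> borel_measurable borel"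
  shows "(\<integral>\<^sup>+x. (\<integral>\<^sup>+y. f y * w y * indicator (tri k x) y \<partial>lborel) \<partial>lborel)
    = ennreal (3 ^ CARD('d) * volume TYPE('d) k) * (\<integral>\<^sup>+x. f x * w x \<partial>lborel)"
proof -
  have "(\<integral>\<^sup>+x. (\<integral>\<^sup>+y. f y * w y * indicator (tri k x) y \<partial>lborel) \<partial>lborel)
      = (\<integral>\<^sup>+y. (\<integral>\<^sup>+x. f y * w y * indicator (tri k x) y \<partial>lborel) \<partial>lborel)"
    by (rule nn_integral_pair_swap) (simp add: split_beta' indicator_def)
  also have "\<dots> = (\<integral>\<^sup>+y. (\<integral>\<^sup>+x. f y * w y * indicator (tri k y) x \<partial>lborel) \<partial>lborel)"
    by (intro nn_integral_cong) (simp only: indicator_tri_sym)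
  finally show ?thesis
    by (simp add: nn_integral_cmult nn_integral_multc mult.commute)
qed

lemma countable_cells: "countable {cell k x | k (x :: real ^ 'd). True}"
proof (rule countable_subset)
  show "{cell k x | k (x :: real ^ 'd). True} \<subseteq>
      range (\<lambda>(k, c :: int ^ 'd). {y. \<forall>i. \<lfloor>y $ i / 2 powr real_of_int k\<rfloor> = c $ i})"
  proof safe
    fix k :: int and x :: "real ^ 'd"
    show "cell k x \<in> range (\<lambda>(k, c :: int ^ 'd). {y. \<forall>i. \<lfloor>y $ i / 2 powr real_of_int k\<rfloor> = c $ i})"
      by (rule image_eqI[of _ _ "(k, \<chi> i. \<lfloor>x $ i / 2 powr real_of_int k\<rfloor>)"]) (auto simp: cell_def)
  qed
qed auto

lemma cell_level_unique:
  assumes "cell k (x :: real ^ 'd) \<subseteq> cell j y" 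
  shows "k \<le> j"
proof -
  have "emeasure lborel (cell k x) \<le> emeasure lborel (cell j y)"
    using assms by (intro emeasure_mono) auto
  then show ?thesis by (simp add: ennreal_le_iff)
qed

section \<open>Maximal cells in families of bounded size\<close>

definition maximal_sets :: "'a set set \<Rightarrow> 'a set set" where
  "maximal_sets \<C> = {C \<in> \<C>. \<forall>C'\<in>\<C>. C \<subseteq> C' \<longrightarrow> C' = C}"

text \<open>The common bound \<open>K\<close> on the levels is what guarantees that every member
  lies in a maximal one; without it increasing chains of cells could be infinite.\<close>

definition cell_family :: "int \<Rightarrow> (real ^ 'd) set set \<Rightarrow> bool" where
  "cell_family K \<C> \<longleftrightarrow> (\<forall>C\<in>\<C>. \<exists>k x. k \<le> K \<and> C = cell k x)"

lemma cell_familyE: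
  assumes "cell_family K \<C>" "C \<in> \<C>"
  obtains k x where "k \<le> K" "C = cell k x"
  using assms unfolding cell_family_def by blast

text \<open>Every member that contains \<open>cell k x\<close> is of the form
  \<open>cell i x\<close> with \<open>k \<le> i \<le> K\<close>, so there are finitely many
  candidates and the largest level among them is maximal in the whole family.\<close>

lemma maximal_sets_above:
  assumes fam: "cell_family K \<C>" and C: "C \<in> \<C>"
  obtains k x j where "C = cell k x" "cell j x \<in> maximal_sets \<C>" "k \<le> j"
proof -
  obtain k x where kx: "k \<le> K" "C = cell k x"
    using cell_familyE[OF fam C] by blast
  define J where "J = {j. k \<le> j \<and> j \<le> K \<and> cell j x \<in> \<C>}"
  have J: "finite J" "k \<in> J"
    using kx C by (auto simp: J_def intro: finite_subset[of _ "{k..K}"])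
  define j where "j = Max J"
  have jJ: "j \<in> J" unfolding j_def using J by (intro Max_in) auto
  have "C' = cell j x" if C'in: "C' \<in> \<C>" and sub: "cell j x \<subseteq> C'" for C'
  proof -
    obtain i y where iy: "i \<le> K" "C' = cell i y"
      using cell_familyE[OF fam C'in] by blast
    have x: "x \<in> cell i y" using sub iy(2) cell_self[of x j] by (metis subsetD)
    then have C': "C' = cell i x" using cell_cong[OF x] iy by simp
    have "j \<le> i" using cell_level_unique[of j x i x] sub C' by simp
    then have "i \<in> J" using jJ iy C'in C' by (auto simp: J_def)
    then have "i \<le> j" unfolding j_def using J by simp
    then show ?thesis using \<open>j \<le> i\<close> C' by simp
  qed
  then have "cell j x \<in> maximal_sets \<C>"
    using jJ by (auto simp: maximal_sets_def J_def)
  then show thesis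
    using kx jJ by (intro that[of k x j]) (simp_all add: J_def)
qed

lemma Union_maximal_sets: "cell_family K \<C> \<Longrightarrow> \<Union>(maximal_sets \<C>) = \<Union>\<C>"
proof (intro equalityI subsetI)
  fix y assume fam: "cell_family K \<C>" and "y \<in> \<Union>\<C>"
  then obtain C where C: "C \<in> \<C>" "y \<in> C" by blast
  obtain k x j where *: "C = cell k x" "cell j x \<in> maximal_sets \<C>" "k \<le> j"
    using maximal_sets_above[OF fam C(1)] by metis
  then show "y \<in> \<Union>(maximal_sets \<C>)"
    using C cell_coarser[of k j y x] by (intro UnionI[of "cell j x"]) auto
next
  fix y assume "y \<in> \<Union>(maximal_sets \<C>)"
  then obtain C where "C \<in> maximal_sets \<C>" "y \<in> C" by blast
  then have "C \<in> \<C>" by (simp add: maximal_sets_def)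
  with \<open>y \<in> C\<close> show "y \<in> \<Union>\<C>" by blast
qed

text \<open>Two cells with a common point are nested, so distinct maximal ones cannot meet.\<close>

lemma maximal_sets_disjoint:
  assumes fam: "cell_family K \<C>"
  shows "disjoint_family_on (\<lambda>C. C) (maximal_sets \<C>)"
  unfolding disjoint_family_on_def
proof (intro ballI impI)
  fix A B assume AB: "A \<in> maximal_sets \<C>" "B \<in> maximal_sets \<C>" "A \<noteq> B"
  then have "A \<in> \<C>" "B \<in> \<C>" by (simp_all add: maximal_sets_def)
  then obtain k x j y where *: "A = cell k x" "B = cell j y"
    using cell_familyE[OF fam] by metis
  show "A \<inter> B = {}"
  proof (rule ccontr)
    assume "A \<inter> B \<noteq> {}"
    then obtain z where z: "z \<in> A" "z \<in> B" by blast
    then have eq: "A = cell k z" "B = cell j z" using * cell_cong[of z k x] cell_cong[of z j y] by simp_all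
    have "A \<subseteq> B \<or> B \<subseteq> A"
      unfolding eq using cell_subset[of k j z z] cell_subset[of j k z z] by (cases "k \<le> j") auto
    then show False
      using AB unfolding maximal_sets_def by auto
  qed
qed

lemma cell_family_countable: "cell_family K \<C> \<Longrightarrow> countable \<C>"
  by (rule countable_subset[OF _ countable_cells]) (blast elim: cell_familyE)

lemma sets_Union_cells: "cell_family K \<C> \<Longrightarrow> \<Union>\<C> \<in> sets borel"
  using cell_family_countable by (intro sets.countable_Union) (auto simp: cell_family_def)

lemma maximal_sets_family: "cell_family K \<C> \<Longrightarrow> cell_family K (maximal_sets \<C>)"
  by (auto simp: maximal_sets_def cell_family_def)

lemma emeasure_maximal_sets:
  assumes fam: "cell_family K \<C>" and [simp]: "sets \<mu> = sets borel"
  shows "emeasure \<mu> (\<Union>\<C>) = (\<integral>\<^sup>+C. emeasure \<mu> C \<partial>count_space (maximal_sets \<C>))"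
proof -
  have "emeasure \<mu> (\<Union>((\<lambda>C. C) ` maximal_sets \<C>)) = (\<integral>\<^sup>+C. emeasure \<mu> C \<partial>count_space (maximal_sets \<C>))"
    using maximal_sets_family[OF fam] cell_family_countable[OF maximal_sets_family[OF fam]]
    by (intro emeasure_UN_countable maximal_sets_disjoint[OF fam]) (auto simp: cell_family_def)
  then show ?thesis
    using Union_maximal_sets[OF fam] by simp
qed

text \<open>This is how covering arguments are run below: an inequality between integrals over a
  union of cells is read as one between two measures with densities, and then it need only be
  checked on single maximal cells.\<close>

lemma emeasure_cells_mono:
  assumes "cell_family K \<C>" "sets \<mu> = sets borel" "sets \<nu> = sets borel"
    and "\<And>C. C \<in> maximal_sets \<C> \<Longrightarrow> emeasure \<mu> C \<le> emeasure \<nu> C"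
  shows "emeasure \<mu> (\<Union>\<C>) \<le> emeasure \<nu> (\<Union>\<C>)"
  unfolding emeasure_maximal_sets[OF assms(1,2)] emeasure_maximal_sets[OF assms(1,3)]
  by (intro nn_integral_mono assms(4)) simp

section \<open>Averages, stopping cubes and the reverse Hoelder inequality\<close>

definition eavg :: "'a :: euclidean_space set \<Rightarrow> ('a \<Rightarrow> ennreal) \<Rightarrow> ennreal" where
  "eavg S f = (\<integral>\<^sup>+x\<in>S. f x \<partial>lborel) / emeasure lborel S"

lemma eavg_mono: "(\<And>x. x \<in> S \<Longrightarrow> f x \<le> g x) \<Longrightarrow> eavg S f \<le> eavg S g"
  unfolding eavg_def
  by (intro divide_right_mono_ennreal nn_integral_mono) (auto split: split_indicator)

lemma nn_integral_eq_eavg: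
  assumes "emeasure lborel S \<noteq> 0" "emeasure lborel S < top"
  shows "(\<integral>\<^sup>+x\<in>S. f x \<partial>lborel) = eavg S f * emeasure lborel S"
  unfolding eavg_def using assms
  by (metis ennreal_divide_times ennreal_divide_self mult.commute mult_1)

lemma le_eavg_iff:
  assumes "emeasure lborel S \<noteq> 0" "emeasure lborel S < top"
  shows "c \<le> eavg S f \<longleftrightarrow> c * emeasure lborel S \<le> (\<integral>\<^sup>+x\<in>S. f x \<partial>lborel)"
  unfolding eavg_def using divide_less_ennreal[OF assms] by (metis not_le)

lemma eavg_le_iff:
  assumes "emeasure lborel S \<noteq> 0" "emeasure lborel S < top"
  shows "eavg S f \<le> c \<longleftrightarrow> (\<integral>\<^sup>+x\<in>S. f x \<partial>lborel) \<le> c * emeasure lborel S"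
  unfolding nn_integral_eq_eavg[OF assms] using assms
  by (simp add: mult.commute[of _ "emeasure lborel S"] ennreal_mult_le_mult_iff less_top)

lemma emeasure_cubes_bounds:
  "emeasure lborel (cell k x) \<noteq> 0" "emeasure lborel (cell k x) < top"
  "emeasure lborel (tri k x) \<noteq> 0" "emeasure lborel (tri k x) < top"
proof -
  have "0 < 3 ^ CARD('a) * volume TYPE('a) k" by simp
  then show "emeasure lborel (cell k x) \<noteq> 0" "emeasure lborel (cell k x) < top"
      "emeasure lborel (tri k x) \<noteq> 0" "emeasure lborel (tri k x) < top"
    by (simp_all add: ennreal_eq_0_iff not_le del: zero_less_mult_iff)
qed

lemmas eavg_cube_simps =
  nn_integral_eq_eavg[OF emeasure_cubes_bounds(3,4)]
  le_eavg_iff[OF emeasure_cubes_bounds(1,2)]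
  eavg_le_iff[OF emeasure_cubes_bounds(3,4)]

text \<open>By outer regularity \<open>T\<close> lies in an open set \<open>U\<close> of almost the
  same measure. The cells of level at most \<open>K\<close> through points of \<open>T\<close> that
  stay inside \<open>U\<close> cover \<open>T\<close>; on the maximal ones the hypothesis applies,
  and they are disjoint, so the bound adds up to \<open>l\<close> times the measure of
  \<open>U\<close>.\<close>

lemma nn_integral_dyadic_level_set:
  fixes w :: "real ^ 'd \<Rightarrow> ennreal" and l :: real
  assumes [measurable]: "w \<in> borel_measurable borel" and l: "0 \<le> l"
    and T [measurable]: "T \<in> sets borel" and fin: "emeasure lborel T < top"
    and le: "\<And>x k. x \<in> T \<Longrightarrow> k \<le> K \<Longrightarrow> (\<integral>\<^sup>+y\<in>cell k x. w y \<partial>lborel) \<le> ennreal l * ennreal (volume TYPE('d) k)"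
  shows "(\<integral>\<^sup>+y\<in>T. w y \<partial>lborel) \<le> ennreal l * emeasure lborel T"
proof (rule ennreal_le_epsilon)
  fix e :: real assume e: "0 < e"
  \<comment> \<open>Dividing by \<open>l + 1\<close> rather than by \<open>l\<close> also covers
    \<open>l = 0\<close>.\<close>
  define e' where "e' = e / (l + 1)"
  have e': "0 < e'" using e l by (simp add: e'_def)
  obtain U where U: "open U" "T \<subseteq> U" "emeasure lborel (U - T) < e'"
    using outer_regular_lborel[OF T e'] by blast
  have [measurable]: "U \<in> sets borel" using U by auto
  define \<C> where "\<C> = {C. \<exists>k x. C = cell k x \<and> k \<le> K \<and> x \<in> T \<and> C \<subseteq> U}"
  have fam: "cell_family K \<C>"
    unfolding cell_family_def \<C>_def by blast
  note [measurable] = sets_Union_cells[OF fam]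
  have cover: "T \<subseteq> \<Union>\<C>"
  proof
    fix x assume x: "x \<in> T"
    then obtain r where r: "0 < r" "ball x r \<subseteq> U"
      using U openE by (metis subsetD)
    obtain n :: nat where n: "(1 / 2) ^ n < r / (3 * real CARD('d))"
      using r real_arch_pow_inv[of "r / (3 * real CARD('d))" "1 / 2"] by auto
    \<comment> \<open>Fine enough for the cell to fit into the ball around \<open>x\<close>, and at
      most \<open>K\<close> so that the hypothesis applies to it.\<close>
    define k where "k = min K (- int n)"
    have "2 powr real_of_int k \<le> 2 powr - real n"
      by (intro powr_mono) (auto simp: k_def)
    also have "\<dots> = (1 / 2) ^ n"
      by (simp add: powr_minus powr_realpow power_one_over inverse_eq_divide)
    also note n
    finally have k: "3 * real CARD('d) * 2 powr k < r"
      by (simp add: field_simps)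
    have "cell k x \<subseteq> ball x r"
      using tri_norm[of _ k x] k cell_subset_tri[of k x] by (fastforce simp: dist_norm)
    then have "k \<le> K" "cell k x \<subseteq> U" using r by (auto simp: k_def)
    then have "cell k x \<in> \<C>"
      using x unfolding \<C>_def by blast
    then show "x \<in> \<Union>\<C>" using cell_self by blast
  qed
  have sub: "\<Union>\<C> \<subseteq> U" by (auto simp: \<C>_def)
  have "emeasure (density lborel w) C \<le> emeasure (density lborel (\<lambda>_. ennreal l)) C"
    if "C \<in> maximal_sets \<C>" for C
  proof -
    have "C \<in> \<C>" using that by (simp add: maximal_sets_def)
    then obtain k x where "C = cell k x" "k \<le> K" "x \<in> T" by (auto simp: \<C>_def)
    then show ?thesis
      using le[of x k] by (simp add: emeasure_density nn_integral_cmult_indicator)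
  qed
  then have "emeasure (density lborel w) (\<Union>\<C>) \<le> emeasure (density lborel (\<lambda>_. ennreal l)) (\<Union>\<C>)"
    by (intro emeasure_cells_mono[OF fam]) auto
  then have "(\<integral>\<^sup>+y\<in>\<Union>\<C>. w y \<partial>lborel) \<le> ennreal l * emeasure lborel (\<Union>\<C>)"
    by (simp add: emeasure_density nn_integral_cmult_indicator)
  moreover have "(\<integral>\<^sup>+y\<in>T. w y \<partial>lborel) \<le> (\<integral>\<^sup>+y\<in>\<Union>\<C>. w y \<partial>lborel)"
    using cover by (intro nn_integral_mono) (auto split: split_indicator)
  ultimately have "(\<integral>\<^sup>+y\<in>T. w y \<partial>lborel) \<le> ennreal l * emeasure lborel (\<Union>\<C>)"
    by (rule order_trans[rotated])
  also have "\<dots> \<le> ennreal l * emeasure lborel U"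
    using sub by (intro mult_left_mono emeasure_mono) auto
  also have "emeasure lborel U = emeasure lborel T + emeasure lborel (U - T)"
    using U(2) by (subst plus_emeasure) (auto simp: Un_absorb1)
  also have "ennreal l * \<dots> \<le> ennreal l * (emeasure lborel T + ennreal e')"
    using U(3) by (intro mult_left_mono add_left_mono) auto
  also have "\<dots> = ennreal l * emeasure lborel T + ennreal (l * e')"
    using l e' by (simp add: distrib_left ennreal_mult)
  also have "l * e' \<le> e" using e l by (simp add: e'_def field_simps)
  finally show "(\<integral>\<^sup>+y\<in>T. w y \<partial>lborel) \<le> ennreal l * emeasure lborel T + ennreal e"
    by (meson add_left_mono ennreal_leI order_trans \<open>l * e' \<le> e\<close>)
qed

text \<open>One half of the dyadic Lebesgue differentiation theorem. On the exceptional set, cut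
  down to finite measure, the integral of \<open>w\<close> is at most \<open>l\<close> times the
  measure although \<open>w\<close> exceeds \<open>l\<close> there pointwise; so the integral of
  \<open>w - l\<close> vanishes and the set is null.\<close>

lemma AE_le_of_cells_le:
  fixes w :: "real ^ 'd \<Rightarrow> ennreal" and l :: real
  assumes [measurable]: "w \<in> borel_measurable borel" and l: "0 \<le> l"
  shows "AE x in lborel. (\<forall>k\<le>K. (\<integral>\<^sup>+y\<in>cell k x. w y \<partial>lborel) \<le> ennreal l * ennreal (volume TYPE('d) k))
    \<longrightarrow> w x \<le> ennreal l"
proof -
  define \<B> where "\<B> = {C. \<exists>k x :: real ^ 'd. C = cell k x \<and> k \<le> K \<and>
    ennreal l * ennreal (volume TYPE('d) k) < (\<integral>\<^sup>+y\<in>C. w y \<partial>lborel)}"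
  have fam: "cell_family K \<B>"
    unfolding cell_family_def \<B>_def by blast
  note [measurable] = sets_Union_cells[OF fam]
  \<comment> \<open>Removing the countable union of the cells with too large an average keeps the
    exceptional set Borel; the ball makes its measure finite, which the subtraction of
    \<open>l\<close> requires.\<close>
  define T where "T n = {x. x \<notin> \<Union>\<B> \<and> ennreal l < w x \<and> x \<in> ball 0 (real n)}" for n :: nat
  have [measurable]: "T n \<in> sets borel" for n
  proof -
    have "T n = ({x. ennreal l < w x} \<inter> ball 0 (real n)) - \<Union>\<B>"
      by (auto simp: T_def)
    moreover have "{x. ennreal l < w x} \<in> sets borel" by measurable
    ultimately show ?thesis
      using sets_Union_cells[OF fam] by auto
  qed
  have "AE x in lborel. x \<notin> T n" for n
  proof -
    have fin: "emeasure lborel (T n) < top"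
    proof (rule order_le_less_trans)
      show "emeasure lborel (T n) \<le> emeasure lborel (ball (0 :: real ^ 'd) (real n))"
        by (intro emeasure_mono) (simp_all add: T_def subset_eq)
      show "emeasure lborel (ball (0 :: real ^ 'd) (real n)) < top"
        using emeasure_lborel_ball_finite by simp
    qed
    have "(\<integral>\<^sup>+y\<in>T n. w y \<partial>lborel) \<le> ennreal l * emeasure lborel (T n)"
    proof (intro nn_integral_dyadic_level_set l fin)
      fix x k assume "x \<in> T n" "k \<le> K"
      then have "cell k x \<notin> \<B>" using cell_self[of x k] by (auto simp: T_def)
      then show "(\<integral>\<^sup>+y\<in>cell k x. w y \<partial>lborel) \<le> ennreal l * ennreal (volume TYPE('d) k)"
        using \<open>k \<le> K\<close> unfolding \<B>_def mem_Collect_eq not_less[symmetric] by blast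
    qed auto
    moreover have "(\<integral>\<^sup>+y\<in>T n. w y \<partial>lborel)
        = (\<integral>\<^sup>+y. (w y - ennreal l) * indicator (T n) y + ennreal l * indicator (T n) y \<partial>lborel)"
    proof (rule nn_integral_cong)
      fix y
      have "w y = (w y - ennreal l) + ennreal l" if "y \<in> T n"
        using that by (simp add: T_def less_imp_le diff_add_cancel_ennreal)
      then show "w y * indicator (T n) y = (w y - ennreal l) * indicator (T n) y + ennreal l * indicator (T n) y"
        by (simp split: split_indicator)
    qed
    moreover have "\<dots> = (\<integral>\<^sup>+y\<in>T n. (w y - ennreal l) \<partial>lborel) + ennreal l * emeasure lborel (T n)"
      by (simp add: nn_integral_add nn_integral_cmult_indicator)
    moreover have "ennreal l * emeasure lborel (T n) \<noteq> top"
      using fin by (simp add: ennreal_mult_eq_top_iff less_top)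
    ultimately have "ennreal l * emeasure lborel (T n) + (\<integral>\<^sup>+y\<in>T n. (w y - ennreal l) \<partial>lborel)
        \<le> ennreal l * emeasure lborel (T n) + 0" "ennreal l * emeasure lborel (T n) \<noteq> top"
      by (simp_all add: add.commute)
    then have "(\<integral>\<^sup>+y\<in>T n. (w y - ennreal l) \<partial>lborel) = 0"
      unfolding ennreal_add_left_cancel_le by simp
    then have "AE y in lborel. (w y - ennreal l) * indicator (T n) y = 0"
      by (subst (asm) nn_integral_0_iff_AE) auto
    then show ?thesis
      by eventually_elim (auto simp: T_def diff_eq_0_iff_ennreal split: split_indicator)
  qed
  then have "AE x in lborel. \<forall>n. x \<notin> T n"
    by (simp add: AE_all_countable)
  then show ?thesis
  proof eventually_elim
    case (elim x)
    show ?case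
    proof (intro impI, rule ccontr)
      assume *: "\<forall>k\<le>K. (\<integral>\<^sup>+y\<in>cell k x. w y \<partial>lborel) \<le> ennreal l * ennreal (volume TYPE('d) k)"
        and "\<not> w x \<le> ennreal l"
      have "x \<notin> \<Union>\<B>"
      proof
        assume "x \<in> \<Union>\<B>"
        then obtain k y where "k \<le> K" "x \<in> cell k y"
          "ennreal l * ennreal (volume TYPE('d) k) < (\<integral>\<^sup>+y\<in>cell k y. w y \<partial>lborel)"
          by (auto simp: \<B>_def)
        then show False using * cell_cong[of x k y] by (metis not_le)
      qed
      moreover obtain n :: nat where "norm x < real n" using reals_Archimedean2 by blast
      ultimately show False
        using elim \<open>\<not> w x \<le> ennreal l\<close> by (auto simp: T_def)
    qed
  qed
qed

lemma volume_Suc: "volume TYPE('d :: finite) (k + 1) = 2 ^ CARD('d) * volume TYPE('d) k"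
  by (simp add: powr_add[symmetric] powr_realpow[symmetric] algebra_simps)

text \<open>The stopping cubes are the maximal cells on which the average of \<open>w\<close> exceeds \<open>l\<close>; outside of
  them \<open>w \<le> l\<close>, and the average over each of them is at most \<open>3\<^sup>d l\<close> because its parent
  (or \<open>tri k z\<close> itself) was not selected.\<close>
lemma stopping_estimate:
  fixes w :: "real ^ 'd \<Rightarrow> ennreal" and l \<beta> :: real
  assumes [measurable]: "w \<in> borel_measurable borel" and l: "0 < l" and \<beta>: "0 < \<beta>"
    and avg: "eavg (tri k z) w \<le> ennreal l"
    and weak: "\<And>x j. x \<in> tri k z \<Longrightarrow> j \<le> k \<Longrightarrow>
      emeasure lborel (cell j x) \<le> 2 * emeasure lborel {y \<in> cell j x. ennreal \<beta> * eavg (cell j x) w < w y}"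
  shows "(\<integral>\<^sup>+x\<in>tri k z. w x * indicator {x. ennreal l < w x} x \<partial>lborel)
    \<le> ennreal (2 * 3 ^ CARD('d) * l) * (\<integral>\<^sup>+x\<in>tri k z. indicator {x. ennreal (\<beta> * l) < w x} x \<partial>lborel)"
proof -
  define Q where "Q = tri k z"
  have [measurable]: "Q \<in> sets borel" by (simp add: Q_def)
  define \<C> where "\<C> = {C. \<exists>j x. C = cell j x \<and> j \<le> k \<and> x \<in> Q \<and>
    ennreal l * ennreal (volume TYPE('d) j) < (\<integral>\<^sup>+y\<in>C. w y \<partial>lborel)}"
  have fam: "cell_family k \<C>"
    unfolding cell_family_def \<C>_def by blast
  note [measurable] = sets_Union_cells[OF fam]
  have sub: "\<Union>\<C> \<subseteq> Q"
    using cell_subset_tri' by (fastforce simp: \<C>_def Q_def)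
  \<comment> \<open>With \<open>h\<close> as a density the claim becomes a comparison of the
    measures with densities \<open>w\<close> and \<open>h\<close> on the individual stopping
    cells.\<close>
  define h where "h x = ennreal (2 * 3 ^ CARD('d) * l) * indicator {x. ennreal (\<beta> * l) < w x} x" for x
  have [measurable]: "h \<in> borel_measurable borel" unfolding h_def by measurable
  have "(\<integral>\<^sup>+x\<in>Q. w x * indicator {x. ennreal l < w x} x \<partial>lborel) \<le> (\<integral>\<^sup>+x\<in>\<Union>\<C>. w x \<partial>lborel)"
  proof (rule nn_integral_mono_AE)
    show "AE x in lborel. w x * indicator {x. ennreal l < w x} x * indicator Q x \<le> w x * indicator (\<Union>\<C>) x"
      using AE_le_of_cells_le[OF assms(1) less_imp_le[OF l], of k]
    proof eventually_elim
      case (elim x)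
      have "w x \<le> ennreal l" if "x \<in> Q" "x \<notin> \<Union>\<C>"
      proof (rule elim[rule_format])
        fix j assume "j \<le> k"
        moreover have "cell j x \<notin> \<C>"
          using that cell_self[of x j] by blast
        ultimately show "(\<integral>\<^sup>+y\<in>cell j x. w y \<partial>lborel) \<le> ennreal l * ennreal (volume TYPE('d) j)"
          using that(1) unfolding \<C>_def mem_Collect_eq not_less[symmetric] by blast
      qed
      then show ?case by (auto split: split_indicator)
    qed
  qed
  also have "\<dots> = emeasure (density lborel w) (\<Union>\<C>)"
    by (simp add: emeasure_density)
  also have "\<dots> \<le> emeasure (density lborel h) (\<Union>\<C>)"
  proof (rule emeasure_cells_mono[OF fam])
    fix C assume C: "C \<in> maximal_sets \<C>"
    then have "C \<in> \<C>" by (simp add: maximal_sets_def)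
    then obtain j x where jx: "C = cell j x" "j \<le> k" "x \<in> Q"
      and big: "ennreal l * ennreal (volume TYPE('d) j) < (\<integral>\<^sup>+y\<in>cell j x. w y \<partial>lborel)"
      by (auto simp: \<C>_def)
    have "(\<integral>\<^sup>+y\<in>C. w y \<partial>lborel) \<le> ennreal l * ennreal (3 ^ CARD('d) * volume TYPE('d) j)"
    proof (cases "j = k")
      case True
      have "(\<integral>\<^sup>+y\<in>C. w y \<partial>lborel) \<le> (\<integral>\<^sup>+y\<in>Q. w y \<partial>lborel)"
        using jx cell_subset_tri'[of j k x z] by (intro nn_integral_mono) (auto simp: Q_def split: split_indicator)
      also have "\<dots> \<le> ennreal l * emeasure lborel Q"
        using avg unfolding Q_def eavg_cube_simps .
      finally show ?thesis using True by (simp add: Q_def)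
    next
      case False
      have "(\<integral>\<^sup>+y\<in>cell (j + 1) x. w y \<partial>lborel) \<le> ennreal l * ennreal (volume TYPE('d) (j + 1))"
      proof (rule ccontr)
        assume "\<not> ?thesis"
        then have "cell (j + 1) x \<in> \<C>"
          using jx False unfolding \<C>_def by (auto simp: not_le intro!: exI[of _ "j + 1"] exI[of _ x])
        moreover have "C \<subseteq> cell (j + 1) x"
          using jx cell_subset[of j "j + 1" x x] by simp
        ultimately have "cell (j + 1) x = cell j x"
          using C jx unfolding maximal_sets_def by auto
        then show False using cell_level_unique[of "j + 1" x j x] by simp
      qed
      moreover have "(\<integral>\<^sup>+y\<in>C. w y \<partial>lborel) \<le> (\<integral>\<^sup>+y\<in>cell (j + 1) x. w y \<partial>lborel)"
        using jx cell_subset[of j "j + 1" x x] by (intro nn_integral_mono) (auto split: split_indicator)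
      moreover have "volume TYPE('d) (j + 1) \<le> 3 ^ CARD('d) * volume TYPE('d) j"
        unfolding volume_Suc by (intro mult_right_mono power_mono) auto
      ultimately show ?thesis
        by (meson ennreal_leI mult_left_mono order_trans zero_le)
    qed
    also have "\<dots> = ennreal (3 ^ CARD('d) * l) * emeasure lborel (cell j x)"
      using l by (simp add: ennreal_mult[symmetric] algebra_simps)
    also have "\<dots> \<le> ennreal (3 ^ CARD('d) * l) * (2 * emeasure lborel {y \<in> cell j x. ennreal \<beta> * eavg (cell j x) w < w y})"
      using weak[of x j] jx by (intro mult_left_mono) (auto simp: Q_def)
    also have "\<dots> \<le> ennreal (3 ^ CARD('d) * l) * (2 * emeasure lborel {y \<in> cell j x. ennreal (\<beta> * l) < w y})"
    proof (intro mult_left_mono emeasure_mono)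
      have "ennreal l \<le> eavg (cell j x) w"
        using big unfolding eavg_cube_simps(2) by simp
      then have "ennreal (\<beta> * l) \<le> ennreal \<beta> * eavg (cell j x) w"
        using \<beta> l by (simp add: ennreal_mult mult_left_mono)
      then show "{y \<in> cell j x. ennreal \<beta> * eavg (cell j x) w < w y} \<subseteq> {y \<in> cell j x. ennreal (\<beta> * l) < w y}"
        by auto
    qed auto
    also have "\<dots> = ennreal (2 * 3 ^ CARD('d) * l) * emeasure lborel {y \<in> cell j x. ennreal (\<beta> * l) < w y}"
      using l by (simp add: ennreal_mult algebra_simps)
    also have "\<dots> = (\<integral>\<^sup>+y. ennreal (2 * 3 ^ CARD('d) * l) * indicator {y \<in> cell j x. ennreal (\<beta> * l) < w y} y \<partial>lborel)"
      by (rule nn_integral_cmult_indicator[symmetric]) simp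
    also have "\<dots> = emeasure (density lborel h) C"
      by (subst emeasure_density) (auto simp: h_def jx intro!: nn_integral_cong split: split_indicator)
    finally show "emeasure (density lborel w) C \<le> emeasure (density lborel h) C"
      by (simp add: emeasure_density jx)
  qed auto
  also have "\<dots> \<le> (\<integral>\<^sup>+x\<in>Q. h x \<partial>lborel)"
  proof -
    have "indicator (\<Union>\<C>) x \<le> (indicator Q x :: ennreal)" for x
      using subsetD[OF sub, of x] by (simp add: indicator_def)
    then show ?thesis
      by (simp add: emeasure_density) (intro nn_integral_mono mult_left_mono, auto)
  qed
  also have "\<dots> = ennreal (2 * 3 ^ CARD('d) * l) * (\<integral>\<^sup>+x\<in>Q. indicator {x. ennreal (\<beta> * l) < w x} x \<partial>lborel)"
    unfolding h_def by (simp add: mult.assoc nn_integral_cmult)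
  finally show ?thesis unfolding Q_def .
qed

section \<open>The layer-cake formula for powers\<close>

definition power_density :: "real \<Rightarrow> real \<Rightarrow> ennreal" where
  "power_density r t = ennreal (r * t powr (r - 1)) * indicator {0<..} t"

lemma borel_measurable_power_density [measurable]: "power_density r \<in> borel_measurable borel"
  unfolding power_density_def by measurable

lemma nn_integral_power_density_real:
  assumes r: "0 < r" and a: "0 \<le> a"
  shows "(\<integral>\<^sup>+t. power_density r t * indicator {t. t < a} t \<partial>lborel) = ennreal (a powr r)"
proof -
  have "((\<lambda>t. r * t powr (r - 1)) has_integral r * (a powr r / r)) {0..a}"
    using has_integral_powr_from_0[of "r - 1" a] r a by (intro has_integral_mult_right) simp
  then have "(\<integral>\<^sup>+t. ennreal (indicator {0..a} t * (r * t powr (r - 1))) \<partial>lborel) = ennreal (r * (a powr r / r))"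
    using r by (intro nn_integral_has_integral_lebesgue) auto
  moreover have "(\<integral>\<^sup>+t. power_density r t * indicator {t. t < a} t \<partial>lborel)
      = (\<integral>\<^sup>+t. ennreal (indicator {0..a} t * (r * t powr (r - 1))) \<partial>lborel)"
  proof (rule nn_integral_cong_AE)
    have "AE t in lborel. t \<noteq> 0" "AE t in lborel. t \<noteq> a"
      by (rule AE_lborel_singleton)+
    then show "AE t in lborel. power_density r t * indicator {t. t < a} t
        = ennreal (indicator {0..a} t * (r * t powr (r - 1)))"
      by eventually_elim (auto simp: power_density_def split: split_indicator)
  qed
  ultimately show ?thesis using r by simp
qed

lemma nn_integral_power_density:
  assumes r: "0 < r"
  shows "(\<integral>\<^sup>+t. power_density r t * indicator {t. ennreal t < a} t \<partial>lborel) = a \<up> r"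
proof (cases a)
  case (real x)
  have "power_density r t * indicator {t. ennreal t < a} t = power_density r t * indicator {t. t < x} t" for t
    using real by (auto simp: power_density_def ennreal_less_iff split: split_indicator)
  then show ?thesis
    using nn_integral_power_density_real[OF r, of x] real by (simp add: epowr_ennreal)
next
  case top
  have "ennreal b \<le> (\<integral>\<^sup>+t. power_density r t * indicator {t. ennreal t < a} t \<partial>lborel)" if "0 < b" for b
  proof -
    have "ennreal b = (\<integral>\<^sup>+t. power_density r t * indicator {t. t < b powr (1 / r)} t \<partial>lborel)"
      using that r by (subst nn_integral_power_density_real) (auto simp: powr_powr)
    also have "\<dots> \<le> (\<integral>\<^sup>+t. power_density r t * indicator {t. ennreal t < a} t \<partial>lborel)"
      using top by (intro nn_integral_mono) (auto split: split_indicator)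
    finally show ?thesis .
  qed
  note ge = this
  have "(\<integral>\<^sup>+t. power_density r t * indicator {t. ennreal t < a} t \<partial>lborel) = top"
  proof (rule ccontr)
    assume "\<not> ?thesis"
    then obtain x where "(\<integral>\<^sup>+t. power_density r t * indicator {t. ennreal t < a} t \<partial>lborel) = ennreal x" "0 \<le> x"
      by (metis ennreal_cases)
    then show False using ge[of "x + 1"] by simp
  qed
  then show ?thesis using top by simp
qed

text \<open>The factor \<open>h\<close> and the function \<open>g\<close> whose levels are cut are
  kept apart because the applications split a power as \<open>w\<close> times a small power of its
  truncation, or as \<open>f\<close> times \<open>(2 * f) \<up> (r - 1)\<close>.\<close>

lemma layer_cake:
  fixes g h :: "'a :: euclidean_space \<Rightarrow> ennreal"
  assumes [measurable]: "g \<in> borel_measurable borel" "h \<in> borel_measurable borel" and r: "0 < r"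
  shows "(\<integral>\<^sup>+x. h x * g x \<up> r \<partial>lborel)
    = (\<integral>\<^sup>+t. power_density r t * (\<integral>\<^sup>+x. h x * indicator {x. ennreal t < g x} x \<partial>lborel) \<partial>lborel)"
proof -
  have "(\<integral>\<^sup>+x. h x * g x \<up> r \<partial>lborel)
      = (\<integral>\<^sup>+x. h x * (\<integral>\<^sup>+t. power_density r t * indicator {t. ennreal t < g x} t \<partial>lborel) \<partial>lborel)"
    by (simp add: nn_integral_power_density[OF r])
  also have "\<dots> = (\<integral>\<^sup>+x. (\<integral>\<^sup>+t. h x * (power_density r t * indicator {x. ennreal t < g x} x) \<partial>lborel) \<partial>lborel)"
    by (subst nn_integral_cmult[symmetric]) (auto intro!: nn_integral_cong split: split_indicator)
  also have "\<dots> = (\<integral>\<^sup>+t. (\<integral>\<^sup>+x. h x * (power_density r t * indicator {x. ennreal t < g x} x) \<partial>lborel) \<partial>lborel)"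
    by (rule lborel_pair.Fubini') (simp add: indicator_def)
  also have "\<dots> = (\<integral>\<^sup>+t. power_density r t * (\<integral>\<^sup>+x. h x * indicator {x. ennreal t < g x} x \<partial>lborel) \<partial>lborel)"
    by (subst nn_integral_cmult[symmetric]) (auto intro!: nn_integral_cong simp: mult.left_commute)
  finally show ?thesis .
qed

text \<open>This is the absorption factor of the reverse Hoelder argument. It equals
  \<open>\<beta> / 4\<close> times \<open>1 / \<beta>\<close> times
  \<open>(1 / \<beta>) powr \<delta>\<close>, where \<open>\<delta> = \<beta> / (8 * D)\<close>; by
  \<open>ln u \<le> u - 1\<close> the exponent \<delta> is so small that the last factor is at most
  \<open>2\<close>. The linear dependence of \<delta> on \<beta> decides how the characteristic
  enters in the end.\<close>

lemma reverse_Holder_exponent_bound: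
  fixes \<beta> D :: real
  assumes "0 < \<beta>" "\<beta> \<le> 1" "1 \<le> D"
  shows "\<beta> / (8 * D) * (2 * D) * (1 / \<beta>) powr (1 + \<beta> / (8 * D)) \<le> 1 / 2"
proof -
  define \<delta> where "\<delta> = \<beta> / (8 * D)"
  have \<delta>: "0 \<le> \<delta>" "\<delta> \<le> \<beta> / 8" using assms by (auto simp: \<delta>_def field_simps)
  have "\<delta> * ln (1 / \<beta>) \<le> \<beta> / 8 * (1 / \<beta>)"
    using assms \<delta> ln_le_minus_one[of "1 / \<beta>"] by (intro mult_mono) auto
  also have "\<dots> \<le> ln 2"
    using assms ln2_ge_two_thirds by simp
  finally have "(1 / \<beta>) powr \<delta> \<le> 2"
    using assms by (simp add: powr_def ln_div exp_le_cancel_iff[symmetric, of _ "ln 2"] del: exp_le_cancel_iff)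
  then have "\<beta> / 4 * ((1 / \<beta>) powr 1 * (1 / \<beta>) powr \<delta>) \<le> 1 / 2"
    using assms by simp
  moreover have "\<beta> / (8 * D) * (2 * D) = \<beta> / 4"
    using assms by simp
  ultimately show ?thesis unfolding \<delta>_def powr_add by simp
qed

lemma ennreal_mult_le_trans:
  fixes a b c x y :: ennreal
  assumes "a \<le> c * x" "b * x \<le> y"
  shows "b * a \<le> c * y"
proof -
  have "b * a \<le> b * (c * x)" by (intro mult_left_mono assms) simp
  also have "\<dots> = c * (b * x)" by (simp add: mult_ac)
  also have "\<dots> \<le> c * y" by (intro mult_left_mono assms) simp
  finally show ?thesis .
qed

text \<open>The layers \<open>t < eavg Q w\<close> are trivial, the others are controlled by the stopping estimate;
  the choice of the exponent makes the resulting term absorbable, which requires truncating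
  \<open>w\<close> first.\<close>
theorem reverse_Holder:
  fixes w :: "real ^ 'd \<Rightarrow> ennreal" and \<beta> :: real
  assumes [measurable]: "w \<in> borel_measurable borel" and \<beta>: "0 < \<beta>" "\<beta> \<le> 1"
    and fin: "eavg (tri k z) w < top"
    and weak: "\<And>x j. x \<in> tri k z \<Longrightarrow> j \<le> k \<Longrightarrow>
      emeasure lborel (cell j x) \<le> 2 * emeasure lborel {y \<in> cell j x. ennreal \<beta> * eavg (cell j x) w < w y}"
  defines "\<delta> \<equiv> \<beta> / (8 * 3 ^ CARD('d))"
  shows "eavg (tri k z) (\<lambda>x. w x \<up> (1 + \<delta>)) \<le> 2 * eavg (tri k z) w \<up> (1 + \<delta>)"
proof -
  define Q where "Q = tri k z"
  have [measurable]: "Q \<in> sets borel" by (simp add: Q_def)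
  define B where "B = (2 * 3 ^ CARD('d) :: real)"
  have B: "0 < B" by (simp add: B_def)
  have \<delta>: "0 < \<delta>" using \<beta> by (simp add: \<delta>_def)
  obtain l where l: "eavg Q w = ennreal l" "0 \<le> l"
    using fin unfolding Q_def by (cases "eavg (tri k z) w") auto
  define W where "W = (\<integral>\<^sup>+x\<in>Q. w x \<partial>lborel)"
  have W: "W = ennreal l * emeasure lborel Q"
    unfolding W_def Q_def eavg_cube_simps using l by (simp add: Q_def)
  have Wfin: "W < top"
    unfolding W Q_def using emeasure_cubes_bounds(4)[of k z] by (simp add: ennreal_mult_less_top del: emeasure_tri)
  define v where "v N x = min (w x) (of_nat N)" for N :: nat and x
  have [measurable]: "v N \<in> borel_measurable borel" for N unfolding v_def by measurable
  have layer: "indicator {t. t < real N} t * (\<integral>\<^sup>+x\<in>Q. w x * indicator {x. ennreal t < w x} x \<partial>lborel)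
      \<le> W * indicator {t. ennreal t < ennreal l} t
        + ennreal (B * t) * (\<integral>\<^sup>+x\<in>Q. indicator {x. ennreal t < v N x / ennreal \<beta>} x \<partial>lborel)"
    if t: "0 < t" for t N
  proof (cases "t < l")
    case True
    have "(\<integral>\<^sup>+x\<in>Q. w x * indicator {x. ennreal t < w x} x \<partial>lborel) \<le> W"
      unfolding W_def by (intro nn_integral_mono) (auto split: split_indicator)
    then show ?thesis using True t by (auto simp: ennreal_less_iff split: split_indicator intro: order_trans)
  next
    case False
    have "(\<integral>\<^sup>+x\<in>Q. w x * indicator {x. ennreal t < w x} x \<partial>lborel)
        \<le> ennreal (B * t) * (\<integral>\<^sup>+x\<in>Q. indicator {x. ennreal (\<beta> * t) < w x} x \<partial>lborel)"
      unfolding B_def Q_def using \<beta> t False l weak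
      by (intro stopping_estimate) (auto simp: Q_def[symmetric] ennreal_leI)
    moreover have "indicator {t. t < real N} t * (\<integral>\<^sup>+x\<in>Q. indicator {x. ennreal (\<beta> * t) < w x} x \<partial>lborel)
        \<le> (\<integral>\<^sup>+x\<in>Q. indicator {x. ennreal t < v N x / ennreal \<beta>} x \<partial>lborel)"
    proof (cases "t < real N")
      case tN: True
      have "ennreal t < v N x / ennreal \<beta>" if "ennreal (\<beta> * t) < w x" for x
      proof -
        \<comment> \<open>Since \<open>\<beta> \<le> 1\<close>, the height
          \<open>\<beta> * t\<close> is still below the truncation level, so \<open>w\<close> and
          \<open>v N\<close> exceed it at the same points.\<close>
        have "\<beta> * t < real N"
          using \<beta> t tN mult_right_mono[of \<beta> 1 t] by linarith
        then have "ennreal (\<beta> * t) < v N x"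
          using that t \<beta> by (simp add: v_def ennreal_of_nat_eq_real_of_nat ennreal_less_iff)
        then have "ennreal (\<beta> * t) * ennreal (inverse \<beta>) < v N x * ennreal (inverse \<beta>)"
          by (rule ennreal_mult_strict_right_mono) (use \<beta> in auto)
        moreover have "ennreal (\<beta> * t) * ennreal (inverse \<beta>) = ennreal t"
          using \<beta> t by (simp add: ennreal_mult[symmetric] field_simps del: ennreal_mult)
        ultimately show ?thesis
          using \<beta> t by (simp add: divide_ennreal_def inverse_ennreal)
      qed
      then show ?thesis
        by (auto intro!: nn_integral_mono simp: tN split: split_indicator)
    qed simp
    ultimately have "indicator {t. t < real N} t * (\<integral>\<^sup>+x\<in>Q. w x * indicator {x. ennreal t < w x} x \<partial>lborel)
      \<le> ennreal (B * t) * (\<integral>\<^sup>+x\<in>Q. indicator {x. ennreal t < v N x / ennreal \<beta>} x \<partial>lborel)"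
      by (rule ennreal_mult_le_trans)
    then show ?thesis
      by (rule order_trans) simp
  qed
  have trunc: "(\<integral>\<^sup>+x. (w x * indicator Q x) * v N x \<up> \<delta> \<partial>lborel) \<le> 2 * (ennreal (l powr \<delta>) * W)" for N
  proof -
    define G where "G = (\<integral>\<^sup>+x. (w x * indicator Q x) * v N x \<up> \<delta> \<partial>lborel)"
    have ind: "indicator {x. ennreal t < v N x} x
        = (indicator {t. t < real N} t * indicator {x. ennreal t < w x} x :: ennreal)" if "0 < t" for t x
      using that by (auto simp: v_def ennreal_of_nat_eq_real_of_nat ennreal_less_iff split: split_indicator)
    have "G = (\<integral>\<^sup>+t. power_density \<delta> t * (\<integral>\<^sup>+x. (w x * indicator Q x) * indicator {x. ennreal t < v N x} x \<partial>lborel) \<partial>lborel)"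
      unfolding G_def using \<delta> by (intro layer_cake) auto
    also have "\<dots> = (\<integral>\<^sup>+t. power_density \<delta> t * (indicator {t. t < real N} t *
        (\<integral>\<^sup>+x\<in>Q. w x * indicator {x. ennreal t < w x} x \<partial>lborel)) \<partial>lborel)"
    proof (intro nn_integral_cong)
      fix t :: real
      show "power_density \<delta> t * (\<integral>\<^sup>+x. (w x * indicator Q x) * indicator {x. ennreal t < v N x} x \<partial>lborel)
        = power_density \<delta> t * (indicator {t. t < real N} t * (\<integral>\<^sup>+x\<in>Q. w x * indicator {x. ennreal t < w x} x \<partial>lborel))"
      proof (cases "0 < t")
        case True
        then show ?thesis
          by (simp add: ind[OF True] nn_integral_cmult[symmetric] mult_ac)
      qed (simp add: power_density_def)
    qed
    also have "\<dots> \<le> (\<integral>\<^sup>+t. power_density \<delta> t * (W * indicator {t. ennreal t < ennreal l} t)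
        + ennreal (\<delta> * B) * (power_density (1 + \<delta>) t *
          (\<integral>\<^sup>+x. indicator Q x * indicator {x. ennreal t < v N x / ennreal \<beta>} x \<partial>lborel)) \<partial>lborel)"
    proof (intro nn_integral_mono)
      fix t :: real
      show "power_density \<delta> t * (indicator {t. t < real N} t * (\<integral>\<^sup>+x\<in>Q. w x * indicator {x. ennreal t < w x} x \<partial>lborel))
        \<le> power_density \<delta> t * (W * indicator {t. ennreal t < ennreal l} t)
        + ennreal (\<delta> * B) * (power_density (1 + \<delta>) t *
          (\<integral>\<^sup>+x. indicator Q x * indicator {x. ennreal t < v N x / ennreal \<beta>} x \<partial>lborel))"
      proof (cases "0 < t")
        case True
        let ?X = "\<integral>\<^sup>+x\<in>Q. indicator {x. ennreal t < v N x / ennreal \<beta>} x \<partial>lborel"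
        \<comment> \<open>The factor \<open>t\<close> supplied by the stopping estimate raises the
          density of exponent \<delta> to that of exponent \<open>1 + \<delta>\<close>, leaving the
          small number \<delta> in front; this smallness makes the absorption possible.\<close>
        have "\<delta> * t powr (\<delta> - 1) * (B * t) \<le> \<delta> * B * ((1 + \<delta>) * t powr \<delta>)"
        proof -
          have "t powr (\<delta> - 1) * t = t powr \<delta>"
            using True powr_add[of t "\<delta> - 1" 1] by simp
          then have "\<delta> * t powr (\<delta> - 1) * (B * t) = \<delta> * B * (1 * t powr \<delta>)"
            by (simp add: algebra_simps)
          also have "\<dots> \<le> \<delta> * B * ((1 + \<delta>) * t powr \<delta>)"
            using \<delta> B by (intro mult_left_mono mult_right_mono) auto
          finally show ?thesis .
        qed
        then have "power_density \<delta> t * ennreal (B * t) \<le> ennreal (\<delta> * B) * power_density (1 + \<delta>) t"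
          using True \<delta> B by (simp add: power_density_def ennreal_mult[symmetric] ennreal_leI)
        then have "power_density \<delta> t * (ennreal (B * t) * ?X) \<le> ennreal (\<delta> * B) * (power_density (1 + \<delta>) t * ?X)"
          unfolding mult.assoc[symmetric] by (rule mult_right_mono) simp
        moreover have "?X = (\<integral>\<^sup>+x. indicator Q x * indicator {x. ennreal t < v N x / ennreal \<beta>} x \<partial>lborel)"
          by (simp add: mult.commute)
        ultimately show ?thesis
          using mult_left_mono[OF layer[OF True, of N], of "power_density \<delta> t"]
          by (auto simp: distrib_left intro: order_trans add_left_mono)
      qed (simp add: power_density_def)
    qed
    also have "\<dots> = W * (\<integral>\<^sup>+t. power_density \<delta> t * indicator {t. ennreal t < ennreal l} t \<partial>lborel)
        + ennreal (\<delta> * B) * (\<integral>\<^sup>+t. power_density (1 + \<delta>) t *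
          (\<integral>\<^sup>+x. indicator Q x * indicator {x. ennreal t < v N x / ennreal \<beta>} x \<partial>lborel) \<partial>lborel)"
    proof (subst nn_integral_add)
      have "(\<lambda>(t, x). indicator Q x * indicator {x. ennreal t < v N x / ennreal \<beta>} x :: ennreal)
          \<in> borel_measurable (lborel \<Otimes>\<^sub>M lborel)"
        by (simp add: indicator_def)
      then have [measurable]: "(\<lambda>t. \<integral>\<^sup>+x. indicator Q x * indicator {x. ennreal t < v N x / ennreal \<beta>} x \<partial>lborel)
          \<in> borel_measurable lborel"
        by (rule lborel.borel_measurable_nn_integral)
      show "(\<lambda>t. ennreal (\<delta> * B) * (power_density (1 + \<delta>) t *
          (\<integral>\<^sup>+x. indicator Q x * indicator {x. ennreal t < v N x / ennreal \<beta>} x \<partial>lborel))) \<in> borel_measurable lborel"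
        by measurable
      show "(\<integral>\<^sup>+t. power_density \<delta> t * (W * indicator {t. ennreal t < ennreal l} t) \<partial>lborel)
        + (\<integral>\<^sup>+t. ennreal (\<delta> * B) * (power_density (1 + \<delta>) t *
          (\<integral>\<^sup>+x. indicator Q x * indicator {x. ennreal t < v N x / ennreal \<beta>} x \<partial>lborel)) \<partial>lborel)
        = W * (\<integral>\<^sup>+t. power_density \<delta> t * indicator {t. ennreal t < ennreal l} t \<partial>lborel)
        + ennreal (\<delta> * B) * (\<integral>\<^sup>+t. power_density (1 + \<delta>) t *
          (\<integral>\<^sup>+x. indicator Q x * indicator {x. ennreal t < v N x / ennreal \<beta>} x \<partial>lborel) \<partial>lborel)"
        by (simp add: nn_integral_cmult[symmetric] mult.left_commute)
    qed simp
    also have "\<dots> = W * ennreal l \<up> \<delta> + ennreal (\<delta> * B) * (\<integral>\<^sup>+x. indicator Q x * (v N x / ennreal \<beta>) \<up> (1 + \<delta>) \<partial>lborel)"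
      using \<delta> by (subst layer_cake) (auto simp: nn_integral_power_density)
    also have "\<dots> \<le> W * ennreal l \<up> \<delta> + ennreal (1 / 2) * G"
    proof (intro add_left_mono)
      have "(\<integral>\<^sup>+x. indicator Q x * (v N x / ennreal \<beta>) \<up> (1 + \<delta>) \<partial>lborel)
          = (\<integral>\<^sup>+x. ennreal ((1 / \<beta>) powr (1 + \<delta>)) * (indicator Q x * v N x \<up> (1 + \<delta>)) \<partial>lborel)"
      proof (intro nn_integral_cong)
        fix x
        have "v N x / ennreal \<beta> = ennreal (1 / \<beta>) * v N x"
          using \<beta> by (simp add: divide_ennreal_def inverse_ennreal inverse_eq_divide mult.commute)
        then show "indicator Q x * (v N x / ennreal \<beta>) \<up> (1 + \<delta>)
            = ennreal ((1 / \<beta>) powr (1 + \<delta>)) * (indicator Q x * v N x \<up> (1 + \<delta>))"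
          using \<beta> \<delta> by (simp add: epowr_mult epowr_ennreal mult_ac)
      qed
      also have "\<dots> = ennreal ((1 / \<beta>) powr (1 + \<delta>)) * (\<integral>\<^sup>+x. indicator Q x * v N x \<up> (1 + \<delta>) \<partial>lborel)"
        by (rule nn_integral_cmult) simp
      also have "(\<integral>\<^sup>+x. indicator Q x * v N x \<up> (1 + \<delta>) \<partial>lborel) \<le> G"
        unfolding G_def epowr_add
        by (intro nn_integral_mono) (auto simp: v_def split: split_indicator intro!: mult_right_mono)
      finally have "ennreal (\<delta> * B) * (\<integral>\<^sup>+x. indicator Q x * (v N x / ennreal \<beta>) \<up> (1 + \<delta>) \<partial>lborel)
          \<le> ennreal (\<delta> * B) * (ennreal ((1 / \<beta>) powr (1 + \<delta>)) * G)"
        by (simp add: mult_left_mono)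
      also have "\<dots> = ennreal (\<delta> * B * (1 / \<beta>) powr (1 + \<delta>)) * G"
        using \<delta> B \<beta> by (simp add: ennreal_mult mult.assoc)
      also have "\<dots> \<le> ennreal (1 / 2) * G"
        using reverse_Holder_exponent_bound[of \<beta> "3 ^ CARD('d)"] \<beta>
        by (intro mult_right_mono ennreal_leI) (auto simp: \<delta>_def B_def)
      finally show "ennreal (\<delta> * B) * (\<integral>\<^sup>+x. indicator Q x * (v N x / ennreal \<beta>) \<up> (1 + \<delta>) \<partial>lborel)
          \<le> ennreal (1 / 2) * G" .
    qed
    finally have *: "G \<le> W * ennreal l \<up> \<delta> + ennreal (1 / 2) * G" .
    \<comment> \<open>Truncation bounds \<open>G\<close> by a finite number depending on
      \<open>N\<close>. Only this allows half of \<open>G\<close> to be subtracted from both sides;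
      the resulting bound no longer depends on \<open>N\<close>.\<close>
    have "G \<le> (\<integral>\<^sup>+x. (of_nat N) \<up> \<delta> * (w x * indicator Q x) \<partial>lborel)"
      unfolding G_def using \<delta>
      by (intro nn_integral_mono) (simp add: mult.commute[of _ "_ \<up> \<delta>"], intro mult_right_mono epowr_mono, auto simp: v_def)
    also have "\<dots> = of_nat N \<up> \<delta> * W"
      unfolding W_def by (rule nn_integral_cmult) simp
    also have "\<dots> < top"
      using Wfin of_nat_less_top[of N] by (simp add: ennreal_mult_less_top)
    finally have "G < top" .
    then obtain g where g: "G = ennreal g" "0 \<le> g" by (cases G) auto
    have "W * ennreal l \<up> \<delta> < top"
      using Wfin by (simp add: ennreal_mult_less_top)
    then obtain u where u: "W * ennreal l \<up> \<delta> = ennreal u" "0 \<le> u"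
      by (cases "W * ennreal l \<up> \<delta>") auto
    have "ennreal (1 / 2 * g) = ennreal (1 / 2) * ennreal g"
      using g by (intro ennreal_mult) auto
    moreover have "ennreal (u + 1 / 2 * g) = ennreal u + ennreal (1 / 2 * g)"
      using g u by (intro ennreal_plus) auto
    ultimately have "ennreal g \<le> ennreal (u + 1 / 2 * g)"
      using *[unfolded g(1) u(1)] by (simp only:)
    then have "g \<le> u + 1 / 2 * g"
      using g u by (subst (asm) ennreal_le_iff) auto
    then have "ennreal g \<le> ennreal (2 * u)"
      by (intro ennreal_leI) simp
    also have "\<dots> = 2 * (W * ennreal l \<up> \<delta>)"
      using u by (simp add: ennreal_mult)
    finally show ?thesis
      unfolding G_def[symmetric] g(1)[symmetric] using l by (simp add: epowr_ennreal mult.commute)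
  qed
  have "(\<integral>\<^sup>+x\<in>Q. w x \<up> (1 + \<delta>) \<partial>lborel) = (\<integral>\<^sup>+x. (SUP N. (w x * indicator Q x) * v N x \<up> \<delta>) \<partial>lborel)"
  proof (intro nn_integral_cong)
    fix x
    have sup: "(SUP N. v N x) = w x"
    proof (rule antisym)
      show "w x \<le> (SUP N. v N x)"
        unfolding le_SUP_iff
      proof safe
        fix y assume y: "y < w x"
        then obtain n where "y < of_nat n"
          using ennreal_Ex_less_of_nat[of y] by (metis order_less_le_trans top_greatest)
        then have "y < v n x" using y by (simp add: v_def)
        then show "\<exists>i\<in>UNIV. y < v i x" by blast
      qed
    qed (auto simp: v_def intro: SUP_least)
    have "w x \<up> (1 + \<delta>) = w x * (SUP N. v N x \<up> \<delta>)"
      using \<delta> by (simp add: epowr_add epowr_SUP[symmetric] sup)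
    then show "w x \<up> (1 + \<delta>) * indicator Q x = (SUP N. (w x * indicator Q x) * v N x \<up> \<delta>)"
      by (simp add: SUP_mult_left_ennreal split: split_indicator)
  qed
  also have "\<dots> = (SUP N. \<integral>\<^sup>+x. (w x * indicator Q x) * v N x \<up> \<delta> \<partial>lborel)"
  proof (rule nn_integral_monotone_convergence_SUP)
    show "incseq (\<lambda>N x. (w x * indicator Q x) * v N x \<up> \<delta>)"
    proof (intro incseq_SucI le_funI mult_left_mono epowr_mono)
      fix N x
      have "(of_nat N :: ennreal) \<le> of_nat (Suc N)" by (rule of_nat_mono) simp
      then show "v N x \<le> v (Suc N) x"
        unfolding v_def by (rule min.mono[OF order_refl])
    qed (use \<delta> in auto)
  qed measurable
  also have "\<dots> \<le> 2 * (ennreal (l powr \<delta>) * W)"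
    by (intro SUP_least trunc)
  also have "\<dots> = 2 * ennreal l \<up> (1 + \<delta>) * emeasure lborel Q"
    using l by (simp add: W epowr_add epowr_ennreal mult_ac)
  finally show ?thesis
    using l unfolding Q_def eavg_cube_simps by simp
qed

section \<open>The dyadic maximal function\<close>

text \<open>The supremum runs over the neighbourhoods \<open>tri k x\<close> instead of the cells,
  since the localised forms below live on these sets.\<close>

definition maximal_fun :: "(real ^ 'd \<Rightarrow> ennreal) \<Rightarrow> real ^ 'd \<Rightarrow> ennreal" where
  "maximal_fun f x = (SUP k. eavg (tri k x) f)"

lemma eavg_tri_le_maximal_fun: "eavg (tri k x) f \<le> maximal_fun f x"
  unfolding maximal_fun_def by (rule SUP_upper) simp

lemma borel_measurable_eavg_tri [measurable]:
  fixes f :: "real ^ 'd \<Rightarrow> ennreal"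
  assumes [measurable]: "f \<in> borel_measurable borel"
  shows "(\<lambda>x. eavg (tri k x) f) \<in> borel_measurable borel"
proof -
  have "(\<lambda>(x, y). f y * indicator (tri k x) y) \<in> borel_measurable (lborel \<Otimes>\<^sub>M lborel)"
    by (simp add: indicator_def)
  then have "(\<lambda>x. \<integral>\<^sup>+y\<in>tri k x. f y \<partial>lborel) \<in> borel_measurable lborel"
    by (rule lborel.borel_measurable_nn_integral)
  then show ?thesis
    unfolding eavg_def emeasure_tri by simp
qed

lemma borel_measurable_maximal_fun [measurable]:
  "f \<in> borel_measurable borel \<Longrightarrow> maximal_fun f \<in> borel_measurable borel"
  unfolding maximal_fun_def[abs_def] by measurable

text \<open>Pigeonhole: \<open>tri k x\<close> is a disjoint union of cells of level
  \<open>k\<close>, and if all of them had average at most \<open>l\<close>, so would their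
  union.\<close>

lemma exists_large_cell_in_tri:
  fixes f :: "real ^ 'd \<Rightarrow> ennreal"
  assumes [measurable]: "f \<in> borel_measurable borel" and large: "ennreal l < eavg (tri k x) f"
  obtains y where "y \<in> tri k x" "ennreal l * ennreal (volume TYPE('d) k) < (\<integral>\<^sup>+z\<in>cell k y. f z \<partial>lborel)"
proof (rule ccontr)
  assume *: "\<not> thesis"
  define \<C> where "\<C> = cell k ` tri k x"
  have fam: "cell_family k \<C>" by (auto simp: cell_family_def \<C>_def)
  have un: "\<Union>\<C> = tri k x"
    using cell_subset_tri'[of k k _ x] cell_self by (force simp: \<C>_def)
  have "emeasure (density lborel f) (\<Union>\<C>) \<le> emeasure (density lborel (\<lambda>_. ennreal l)) (\<Union>\<C>)"
  proof (rule emeasure_cells_mono[OF fam])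
    fix C assume "C \<in> maximal_sets \<C>"
    then have "C \<in> \<C>" by (simp add: maximal_sets_def)
    then obtain y where y: "y \<in> tri k x" "C = cell k y" by (auto simp: \<C>_def)
    then have "(\<integral>\<^sup>+z\<in>cell k y. f z \<partial>lborel) \<le> ennreal l * ennreal (volume TYPE('d) k)"
      using * that not_less by blast
    then show "emeasure (density lborel f) C \<le> emeasure (density lborel (\<lambda>_. ennreal l)) C"
      using y by (simp add: emeasure_density nn_integral_cmult_indicator)
  qed auto
  then have "(\<integral>\<^sup>+z\<in>tri k x. f z \<partial>lborel) \<le> ennreal l * emeasure lborel (tri k x)"
    unfolding un by (simp add: emeasure_density nn_integral_cmult_indicator)
  then have "eavg (tri k x) f \<le> ennreal l"
    unfolding eavg_cube_simps .
  then show False using large by simp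
qed

text \<open>The level set is covered by the triples of the maximal cells on which the average
  exceeds \<open>l\<close>. These cells are disjoint, each has measure below \<open>1 / l\<close>
  times its integral, and tripling costs \<open>3 ^ CARD('d)\<close>.\<close>

lemma maximal_fun_weak_type:
  fixes f :: "real ^ 'd \<Rightarrow> ennreal"
  assumes [measurable]: "f \<in> borel_measurable borel" and l: "0 < l"
  shows "ennreal l * emeasure lborel {x. ennreal l < maximal_fun f x} \<le> ennreal (3 ^ CARD('d)) * (\<integral>\<^sup>+x. f x \<partial>lborel)"
proof (cases "(\<integral>\<^sup>+x. f x \<partial>lborel) = top")
  case True
  then show ?thesis by (simp add: ennreal_mult_top)
next
  case False
  then obtain I where I: "(\<integral>\<^sup>+x. f x \<partial>lborel) = ennreal I" "0 \<le> I"
    by (metis ennreal_cases)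
  \<comment> \<open>A cell with average above \<open>l\<close> has volume below
    \<open>I / l\<close>, and for a positive level the volume is at least the level; so finite mass
    bounds the levels, as maximal cells require.\<close>
  define K where "K = max 0 \<lceil>I / l\<rceil>"
  define \<C> where "\<C> = {C. \<exists>k y. C = cell k y \<and>
    ennreal l * ennreal (volume TYPE('d) k) < (\<integral>\<^sup>+z\<in>C. f z \<partial>lborel)}"
  have level: "k \<le> K" if "ennreal l * ennreal (volume TYPE('d) k) < (\<integral>\<^sup>+z\<in>cell k y. f z \<partial>lborel)" for k y
  proof (cases "k \<le> 0")
    case False
    have "(\<integral>\<^sup>+z\<in>cell k y. f z \<partial>lborel) \<le> ennreal I"
      unfolding I(1)[symmetric] by (intro nn_integral_mono) (auto split: split_indicator)
    with that have "ennreal (l * volume TYPE('d) k) < ennreal I"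
      using l by (simp add: ennreal_mult[symmetric])
    then have "l * volume TYPE('d) k < I" using l by (simp add: ennreal_less_iff)
    then have *: "volume TYPE('d) k < I / l" using l by (simp add: field_simps)
    have card: "1 \<le> real CARD('d)" by (simp add: Suc_leI)
    have "real_of_int k \<le> 2 ^ nat k"
      using False of_nat_less_two_power[of "nat k"] by (simp add: less_imp_le)
    also have "\<dots> = 2 powr real_of_int k"
      using False by (simp add: powr_realpow[symmetric])
    also have "\<dots> \<le> volume TYPE('d) k"
      using False card mult_left_mono[of 1 "real CARD('d)" "real_of_int k"] by (intro powr_mono) auto
    finally show ?thesis using * unfolding K_def by linarith
  qed (simp add: K_def)
  have fam: "cell_family K \<C>"
    using level unfolding cell_family_def \<C>_def by blast
  note cnt = cell_family_countable[OF maximal_sets_family[OF fam]]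
  \<comment> \<open>The triple of a cell given merely as a set. It is well defined because the set
    determines its level, through its volume, and all its points have the same
    neighbourhood.\<close>
  define T where "T C = {x. \<exists>k y. C = cell k y \<and> x \<in> tri k y}" for C :: "(real ^ 'd) set"
  have level_eq: "k = j" if "cell k x = cell j y" for k j and x y :: "real ^ 'd"
    using cell_level_unique[of k x j y] cell_level_unique[of j y k x] that by simp
  have T: "T (cell k y) = tri k y" for k and y :: "real ^ 'd"
  proof
    show "T (cell k y) \<subseteq> tri k y"
    proof
      fix x assume "x \<in> T (cell k y)"
      then obtain j z where jz: "cell k y = cell j z" "x \<in> tri j z" by (auto simp: T_def)
      then have "j = k" using level_eq by metis
      moreover have "z \<in> cell k y" using jz cell_self[of z j] by simp
      ultimately show "x \<in> tri k y" using jz tri_cong by blast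
    qed
  qed (auto simp: T_def)
  have Tm: "T C \<in> sets borel \<and> emeasure lborel (T C) = ennreal (3 ^ CARD('d)) * emeasure lborel C"
    if "C \<in> maximal_sets \<C>" for C
  proof -
    have "C \<in> \<C>" using that by (simp add: maximal_sets_def)
    then obtain k y where "C = cell k y" by (auto simp: \<C>_def)
    then show ?thesis by (simp add: T ennreal_mult)
  qed
  have sub: "{x. ennreal l < maximal_fun f x} \<subseteq> (\<Union>C\<in>maximal_sets \<C>. T C)"
  proof
    fix x assume "x \<in> {x. ennreal l < maximal_fun f x}"
    then obtain k where "ennreal l < eavg (tri k x) f"
      by (auto simp: maximal_fun_def less_SUP_iff)
    then obtain y where y: "y \<in> tri k x" "ennreal l * ennreal (volume TYPE('d) k) < (\<integral>\<^sup>+z\<in>cell k y. f z \<partial>lborel)"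
      using exists_large_cell_in_tri[OF assms(1)] by metis
    then have "cell k y \<in> \<C>" unfolding \<C>_def by blast
    then obtain i z j where ij: "cell k y = cell i z" "cell j z \<in> maximal_sets \<C>" "i \<le> j"
      using maximal_sets_above[OF fam] by metis
    then have "i = k" using level_eq by metis
    have "y \<in> cell k z" using ij cell_self[of y k] \<open>i = k\<close> by simp
    then have "x \<in> tri k z" using y tri_sym tri_cong by blast
    then have "x \<in> T (cell j z)" using ij \<open>i = k\<close> by (simp add: T tri_coarser[of k j])
    then show "x \<in> (\<Union>C\<in>maximal_sets \<C>. T C)" using ij by blast
  qed
  have "emeasure lborel {x. ennreal l < maximal_fun f x}
      = (\<integral>\<^sup>+x. indicator {x. ennreal l < maximal_fun f x} x \<partial>lborel)"
    by simp
  also have "\<dots> \<le> (\<integral>\<^sup>+x. (\<integral>\<^sup>+C. indicator (T C) x \<partial>count_space (maximal_sets \<C>)) \<partial>lborel)"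
  proof (intro nn_integral_mono)
    fix x
    show "indicator {x. ennreal l < maximal_fun f x} x
        \<le> (\<integral>\<^sup>+C. indicator (T C) x \<partial>count_space (maximal_sets \<C>))"
    proof (cases "x \<in> {x. ennreal l < maximal_fun f x}")
      case True
      then obtain C where "C \<in> maximal_sets \<C>" "x \<in> T C" using sub by blast
      then show ?thesis
        using nn_integral_ge_point[of C "maximal_sets \<C>" "\<lambda>C. indicator (T C) x"] True by simp
    qed simp
  qed
  also have "\<dots> = (\<integral>\<^sup>+C. (\<integral>\<^sup>+x. indicator (T C) x \<partial>lborel) \<partial>count_space (maximal_sets \<C>))"
    using Tm by (intro nn_integral_count_space_nn_integral cnt borel_measurable_indicator) auto
  also have "\<dots> = (\<integral>\<^sup>+C. ennreal (3 ^ CARD('d)) * emeasure lborel C \<partial>count_space (maximal_sets \<C>))"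
    using Tm by (intro nn_integral_cong) simp
  finally have "ennreal l * emeasure lborel {x. ennreal l < maximal_fun f x}
      \<le> ennreal l * (\<integral>\<^sup>+C. ennreal (3 ^ CARD('d)) * emeasure lborel C \<partial>count_space (maximal_sets \<C>))"
    by (rule mult_left_mono) simp
  also have "\<dots> = ennreal (3 ^ CARD('d)) * (\<integral>\<^sup>+C. ennreal l * emeasure lborel C \<partial>count_space (maximal_sets \<C>))"
    by (subst (1 2) nn_integral_cmult) (simp_all add: mult_ac)
  also have "\<dots> \<le> ennreal (3 ^ CARD('d)) * (\<integral>\<^sup>+C. emeasure (density lborel f) C \<partial>count_space (maximal_sets \<C>))"
  proof (intro mult_left_mono nn_integral_mono)
    fix C assume "C \<in> space (count_space (maximal_sets \<C>))"
    then have "C \<in> \<C>" by (simp add: maximal_sets_def)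
    then obtain k y where "C = cell k y" "ennreal l * ennreal (volume TYPE('d) k) < (\<integral>\<^sup>+z\<in>C. f z \<partial>lborel)"
      by (auto simp: \<C>_def)
    then show "ennreal l * emeasure lborel C \<le> emeasure (density lborel f) C"
      by (simp add: emeasure_density)
  qed simp
  also have "(\<integral>\<^sup>+C. emeasure (density lborel f) C \<partial>count_space (maximal_sets \<C>)) = emeasure (density lborel f) (\<Union>\<C>)"
    by (rule emeasure_maximal_sets[OF fam, symmetric]) simp
  also have "\<dots> \<le> (\<integral>\<^sup>+x. f x \<partial>lborel)"
    using sets_Union_cells[OF fam] by (simp add: emeasure_density) (intro nn_integral_mono, auto split: split_indicator)
  finally show ?thesis by (simp add: mult_left_mono)
qed

text \<open>Marcinkiewicz interpolation between the weak type inequality and the trivial bound for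
  bounded functions. The factor \<open>1 / (r - 1)\<close> is kept explicit, since later
  \<open>r - 1\<close> is proportional to a negative power of the characteristic.\<close>

lemma maximal_fun_strong_type:
  fixes f :: "real ^ 'd \<Rightarrow> ennreal"
  assumes [measurable]: "f \<in> borel_measurable borel" and r: "1 < r"
  shows "(\<integral>\<^sup>+x. maximal_fun f x \<up> r \<partial>lborel)
    \<le> ennreal (3 ^ CARD('d) * 2 powr r * r / (r - 1)) * (\<integral>\<^sup>+x. f x \<up> r \<partial>lborel)"
proof -
  have weak: "ennreal t * emeasure lborel {x. ennreal t < maximal_fun f x}
      \<le> ennreal (2 * 3 ^ CARD('d)) * (\<integral>\<^sup>+x. f x * indicator {x. ennreal t < 2 * f x} x \<partial>lborel)" if t: "0 < t" for t
  proof -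
    \<comment> \<open>The rest \<open>f - g\<close> is at most \<open>t / 2\<close> and contributes
      no more than that to any average, so the maximal function of \<open>g\<close> exceeds
      \<open>t / 2\<close> wherever that of \<open>f\<close> exceeds \<open>t\<close>.\<close>
    define g where "g x = f x * indicator {x. ennreal t < 2 * f x} x" for x
    have [measurable]: "g \<in> borel_measurable borel" unfolding g_def by measurable
    have f_le: "f x \<le> g x + ennreal (t / 2)" for x
    proof (cases "ennreal t < 2 * f x")
      case False
      then have "2 * f x \<le> 2 * ennreal (t / 2)"
        using t by (simp add: ennreal_mult[symmetric] not_less del: ennreal_mult flip: ennreal_numeral)
      then show ?thesis
        by (subst (asm) ennreal_mult_le_mult_iff) (auto simp: add_increasing)
    qed (simp add: g_def)
    have "eavg (tri k x) f \<le> eavg (tri k x) g + ennreal (t / 2)" for k x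
    proof -
      have "(\<integral>\<^sup>+y\<in>tri k x. f y \<partial>lborel) \<le> (\<integral>\<^sup>+y. g y * indicator (tri k x) y + ennreal (t / 2) * indicator (tri k x) y \<partial>lborel)"
        using f_le by (intro nn_integral_mono) (auto split: split_indicator)
      also have "\<dots> = (\<integral>\<^sup>+y\<in>tri k x. g y \<partial>lborel) + ennreal (t / 2) * emeasure lborel (tri k x)"
        by (subst nn_integral_add) (auto simp: nn_integral_cmult_indicator simp del: emeasure_tri)
      also have "\<dots> = (eavg (tri k x) g + ennreal (t / 2)) * emeasure lborel (tri k x)"
        unfolding eavg_cube_simps by (simp add: distrib_right)
      finally show ?thesis unfolding eavg_cube_simps .
    qed
    then have le: "maximal_fun f x \<le> maximal_fun g x + ennreal (t / 2)" for x
      unfolding maximal_fun_def[of f]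
      by (intro SUP_least) (meson add_right_mono eavg_tri_le_maximal_fun order_trans)
    have "{x. ennreal t < maximal_fun f x} \<subseteq> {x. ennreal (t / 2) < maximal_fun g x}"
    proof safe
      fix x assume "ennreal t < maximal_fun f x"
      then have "ennreal (t / 2 + t / 2) < maximal_fun g x + ennreal (t / 2)"
        using le[of x] by simp
      then show "ennreal (t / 2) < maximal_fun g x"
        using t by (subst (asm) ennreal_plus) (auto simp: not_le[symmetric] add_right_mono)
    qed
    then have "ennreal (t / 2) * emeasure lborel {x. ennreal t < maximal_fun f x}
        \<le> ennreal (t / 2) * emeasure lborel {x. ennreal (t / 2) < maximal_fun g x}"
      by (intro mult_left_mono emeasure_mono) auto
    also have "\<dots> \<le> ennreal (3 ^ CARD('d)) * (\<integral>\<^sup>+x. g x \<partial>lborel)"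
      using t by (intro maximal_fun_weak_type) auto
    finally have "2 * (ennreal (t / 2) * emeasure lborel {x. ennreal t < maximal_fun f x})
        \<le> 2 * (ennreal (3 ^ CARD('d)) * (\<integral>\<^sup>+x. g x \<partial>lborel))"
      by (rule mult_left_mono) simp
    moreover have "2 * ennreal (t / 2) = ennreal t"
      using t by (simp add: ennreal_mult[symmetric] del: ennreal_mult flip: ennreal_numeral)
    moreover have "2 * ennreal (3 ^ CARD('d)) = ennreal (2 * 3 ^ CARD('d))"
      by (simp add: ennreal_mult)
    ultimately show ?thesis unfolding g_def by (simp add: mult.assoc[symmetric] del: ennreal_mult)
  qed
  \<comment> \<open>Dividing by \<open>t\<close> lowers the exponent by one; renormalising the
    density produces the factor \<open>r / (r - 1)\<close>.\<close>
  have dens: "power_density r t / ennreal t = ennreal (r / (r - 1)) * power_density (r - 1) t" if "0 < t" for t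
  proof -
    have "t powr (r - 2) = t powr (r - 1) / t"
      using that powr_diff[of t "r - 1" 1] by simp
    then show ?thesis
      using that r by (simp add: power_density_def divide_ennreal ennreal_mult[symmetric])
  qed
  have "(\<integral>\<^sup>+x. maximal_fun f x \<up> r \<partial>lborel)
      = (\<integral>\<^sup>+t. power_density r t * emeasure lborel {x. ennreal t < maximal_fun f x} \<partial>lborel)"
    using layer_cake[of "maximal_fun f" "\<lambda>_. 1" r] r by simp
  also have "\<dots> \<le> (\<integral>\<^sup>+t. ennreal (r / (r - 1) * (2 * 3 ^ CARD('d))) * (power_density (r - 1) t *
      (\<integral>\<^sup>+x. f x * indicator {x. ennreal t < 2 * f x} x \<partial>lborel)) \<partial>lborel)"
  proof (intro nn_integral_mono)
    fix t :: real
    let ?X = "\<integral>\<^sup>+x. f x * indicator {x. ennreal t < 2 * f x} x \<partial>lborel"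
    show "power_density r t * emeasure lborel {x. ennreal t < maximal_fun f x}
      \<le> ennreal (r / (r - 1) * (2 * 3 ^ CARD('d))) * (power_density (r - 1) t * ?X)"
    proof (cases "0 < t")
      case True
      have "power_density r t * emeasure lborel {x. ennreal t < maximal_fun f x}
          = power_density r t / ennreal t * (ennreal t * emeasure lborel {x. ennreal t < maximal_fun f x})"
        using True by (simp add: ennreal_divide_times mult.assoc[symmetric] mult_divide_eq_ennreal ennreal_eq_0_iff
            ennreal_times_divide[symmetric])
      also have "\<dots> \<le> power_density r t / ennreal t * (ennreal (2 * 3 ^ CARD('d)) * ?X)"
        by (intro mult_left_mono weak True) simp
      also have "\<dots> = ennreal (r / (r - 1) * (2 * 3 ^ CARD('d))) * (power_density (r - 1) t * ?X)"
      proof -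
        have "ennreal (r / (r - 1) * (2 * 3 ^ CARD('d))) = ennreal (r / (r - 1)) * ennreal (2 * 3 ^ CARD('d))"
          using r by (intro ennreal_mult) auto
        then show ?thesis
          unfolding dens[OF True] by (simp only: mult_ac)
      qed
      finally show ?thesis .
    qed (simp add: power_density_def)
  qed
  also have "\<dots> = ennreal (r / (r - 1) * (2 * 3 ^ CARD('d))) * (\<integral>\<^sup>+t. power_density (r - 1) t *
      (\<integral>\<^sup>+x. f x * indicator {x. ennreal t < 2 * f x} x \<partial>lborel) \<partial>lborel)"
  proof (rule nn_integral_cmult)
    have "(\<lambda>(t, x). f x * indicator {x. ennreal t < 2 * f x} x) \<in> borel_measurable (lborel \<Otimes>\<^sub>M lborel)"
      by (simp add: indicator_def)
    then have [measurable]: "(\<lambda>t. \<integral>\<^sup>+x. f x * indicator {x. ennreal t < 2 * f x} x \<partial>lborel) \<in> borel_measurable lborel"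
      by (rule lborel.borel_measurable_nn_integral)
    show "(\<lambda>t. power_density (r - 1) t * (\<integral>\<^sup>+x. f x * indicator {x. ennreal t < 2 * f x} x \<partial>lborel)) \<in> borel_measurable lborel"
      by measurable
  qed
  also have "\<dots> = ennreal (r / (r - 1) * (2 * 3 ^ CARD('d))) * (\<integral>\<^sup>+x. f x * (2 * f x) \<up> (r - 1) \<partial>lborel)"
    using r by (subst layer_cake) auto
  also have "(\<integral>\<^sup>+x. f x * (2 * f x) \<up> (r - 1) \<partial>lborel) = (\<integral>\<^sup>+x. ennreal (2 powr (r - 1)) * f x \<up> r \<partial>lborel)"
  proof (intro nn_integral_cong)
    fix x
    show "f x * (2 * f x) \<up> (r - 1) = ennreal (2 powr (r - 1)) * f x \<up> r"
      using r epowr_add[of "f x" 1 "r - 1"] epowr_ennreal[of 2 "r - 1"] by (simp add: epowr_mult mult_ac)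
  qed
  also have "\<dots> = ennreal (2 powr (r - 1)) * (\<integral>\<^sup>+x. f x \<up> r \<partial>lborel)"
    by (rule nn_integral_cmult) simp
  also have "ennreal (r / (r - 1) * (2 * 3 ^ CARD('d))) * (ennreal (2 powr (r - 1)) * (\<integral>\<^sup>+x. f x \<up> r \<partial>lborel))
      = ennreal (3 ^ CARD('d) * 2 powr r * r / (r - 1)) * (\<integral>\<^sup>+x. f x \<up> r \<partial>lborel)"
  proof -
    have "r / (r - 1) * (2 * 3 ^ CARD('d)) * 2 powr (r - 1) = 3 ^ CARD('d) * 2 powr r * r / (r - 1)"
    proof -
      have *: "2 powr r = 2 * 2 powr (r - 1)"
        using powr_add[of 2 1 "r - 1"] by simp
      show ?thesis unfolding * by (simp add: mult_ac)
    qed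
    moreover have "ennreal (r / (r - 1) * (2 * 3 ^ CARD('d)) * 2 powr (r - 1))
        = ennreal (r / (r - 1) * (2 * 3 ^ CARD('d))) * ennreal (2 powr (r - 1))"
      using r by (intro ennreal_mult) auto
    ultimately show ?thesis
      by (simp only: mult.assoc)
  qed
  finally show ?thesis .
qed

section \<open>Submultiplicative kernels satisfying an averaged condition\<close>

lemma eavg_Holder:
  fixes f g :: "'a :: euclidean_space \<Rightarrow> ennreal"
  assumes [measurable]: "f \<in> borel_measurable borel" "g \<in> borel_measurable borel" "S \<in> sets borel"
    and S: "emeasure lborel S \<noteq> 0" "emeasure lborel S < top"
    and pq: "1 < p" "1 < q" "1 / p + 1 / q = 1"
  shows "eavg S (\<lambda>x. f x * g x) \<le> eavg S (\<lambda>x. f x \<up> p) \<up> (1 / p) * eavg S (\<lambda>x. g x \<up> q) \<up> (1 / q)"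
proof -
  have "(\<integral>\<^sup>+x\<in>S. f x * g x \<partial>lborel) = (\<integral>\<^sup>+x. (f x * indicator S x) * (g x * indicator S x) \<partial>lborel)"
    by (intro nn_integral_cong) (auto split: split_indicator)
  also have "\<dots> \<le> (\<integral>\<^sup>+x. (f x * indicator S x) \<up> p \<partial>lborel) \<up> (1 / p)
      * (\<integral>\<^sup>+x. (g x * indicator S x) \<up> q \<partial>lborel) \<up> (1 / q)"
    using pq by (intro nn_integral_Holder) auto
  also have "(\<integral>\<^sup>+x. (f x * indicator S x) \<up> p \<partial>lborel) = (\<integral>\<^sup>+x\<in>S. f x \<up> p \<partial>lborel)"
    by (intro nn_integral_cong) (auto split: split_indicator)
  also have "(\<integral>\<^sup>+x. (g x * indicator S x) \<up> q \<partial>lborel) = (\<integral>\<^sup>+x\<in>S. g x \<up> q \<partial>lborel)"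
    by (intro nn_integral_cong) (auto split: split_indicator)
  also have "(\<integral>\<^sup>+x\<in>S. f x \<up> p \<partial>lborel) \<up> (1 / p) * (\<integral>\<^sup>+x\<in>S. g x \<up> q \<partial>lborel) \<up> (1 / q)
      = eavg S (\<lambda>x. f x \<up> p) \<up> (1 / p) * eavg S (\<lambda>x. g x \<up> q) \<up> (1 / q)
        * (emeasure lborel S \<up> (1 / p) * emeasure lborel S \<up> (1 / q))"
    unfolding nn_integral_eq_eavg[OF S] using pq by (simp add: epowr_mult mult_ac)
  also have "emeasure lborel S \<up> (1 / p) * emeasure lborel S \<up> (1 / q) = emeasure lborel S"
    unfolding epowr_add[symmetric] pq by simp
  finally show ?thesis
    unfolding eavg_le_iff[OF S] .
qed

lemma eavg_cmult:
  fixes f :: "'a :: euclidean_space \<Rightarrow> ennreal"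
  assumes [measurable]: "f \<in> borel_measurable borel" "S \<in> sets borel"
  shows "eavg S (\<lambda>x. c * f x) = c * eavg S f"
  unfolding eavg_def by (simp add: mult.assoc nn_integral_cmult ennreal_times_divide)

lemma eavg_subset_finite:
  assumes "eavg S f < top" "T \<subseteq> S" "emeasure lborel S \<noteq> 0" "emeasure lborel S < top"
    "emeasure lborel T \<noteq> 0" "emeasure lborel T < top"
  shows "eavg T f < top"
proof -
  have "(\<integral>\<^sup>+x\<in>T. f x \<partial>lborel) \<le> (\<integral>\<^sup>+x\<in>S. f x \<partial>lborel)"
    using assms(2) by (intro nn_integral_mono) (auto split: split_indicator)
  also have "\<dots> < top"
    using assms by (simp add: nn_integral_eq_eavg ennreal_mult_less_top)
  finally show ?thesis
    using assms(5) unfolding eavg_def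
    by (metis ennreal_divide_eq_top_iff less_top)
qed

lemma emeasure_le_twice_complement:
  assumes [measurable]: "E \<in> sets M" "G \<in> sets M" and S: "S = E \<union> G" "emeasure M S < top"
    and half: "emeasure M E \<le> ennreal (1 / 2) * emeasure M S"
  shows "emeasure M S \<le> 2 * emeasure M G"
proof -
  have "emeasure M S \<le> emeasure M E + emeasure M G"
    unfolding S by (rule emeasure_subadditive) auto
  also have "\<dots> \<le> ennreal (1 / 2) * emeasure M S + emeasure M G"
    using half by (rule add_right_mono)
  finally have le: "emeasure M S \<le> ennreal (1 / 2) * emeasure M S + emeasure M G" .
  obtain s where s: "emeasure M S = ennreal s" "0 \<le> s" using S(2) by (cases "emeasure M S") auto
  have "emeasure M G \<le> emeasure M S" unfolding S by (intro emeasure_mono) auto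
  then obtain g where g: "emeasure M G = ennreal g" "0 \<le> g"
    using S(2) by (cases "emeasure M G") (auto simp: top_unique)
  have "ennreal (1 / 2) * ennreal s + ennreal g = ennreal (1 / 2 * s + g)"
    using s g ennreal_mult[of "1 / 2" s] ennreal_plus[of "1 / 2 * s" g] by (simp only: zero_le_mult_iff) simp
  then have "ennreal s \<le> ennreal (1 / 2 * s + g)"
    using le unfolding s(1) g(1) by (simp only:)
  then have "s \<le> 1 / 2 * s + g"
    using s g by (subst (asm) ennreal_le_iff) auto
  then have "ennreal s \<le> ennreal (2 * g)" by (intro ennreal_leI) simp
  then show ?thesis using g s by (simp add: ennreal_mult)
qed

text \<open>An abstraction of the operator norms of
  \<open>W x powr (1/q) ** W y powr (-1/q)\<close>. The middle factors of a product of two such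
  matrices cancel, hence the submultiplicativity; it replaces every further use of the matrix
  structure in the scalar estimates.\<close>

locale submultiplicative_kernel =
  fixes F :: "real ^ 'd \<Rightarrow> real ^ 'd \<Rightarrow> ennreal" and P q :: real
  assumes F_measurable [measurable]: "(\<lambda>(x, y). F x y) \<in> borel_measurable (borel \<Otimes>\<^sub>M borel)"
    and F_submult: "F x z \<le> F x y * F y z"
    and F_pos: "F x y \<noteq> 0" and F_finite: "F x y \<noteq> top"
    and P: "1 < P" and q: "1 < q"
begin

text \<open>The expression under the supremum in the characteristic, formed for an arbitrary set
  \<open>S\<close> and without the factors \<open>psi\<close>.\<close>

definition A_const :: "(real ^ 'd) set \<Rightarrow> ennreal" where
  "A_const S = eavg S (\<lambda>x. eavg S (\<lambda>y. F x y \<up> P) \<up> (q / P))"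

lemma F_measurable' [measurable (raw)]:
  assumes [measurable]: "f \<in> measurable M borel" "g \<in> measurable M borel"
  shows "(\<lambda>x. F (f x) (g x)) \<in> borel_measurable M"
proof -
  have "(\<lambda>x. (f x, g x)) \<in> measurable M (borel \<Otimes>\<^sub>M borel)" by measurable
  from measurable_compose[OF this F_measurable] show ?thesis by simp
qed

lemma eavg_F_measurable [measurable]:
  assumes [measurable]: "S \<in> sets borel"
  shows "(\<lambda>x. eavg S (\<lambda>y. F x y \<up> r)) \<in> borel_measurable borel"
proof -
  have "(\<lambda>(x, y). F x y \<up> r * indicator S y) \<in> borel_measurable (lborel \<Otimes>\<^sub>M lborel)"
    by measurable
  then have "(\<lambda>x. \<integral>\<^sup>+y\<in>S. F x y \<up> r \<partial>lborel) \<in> borel_measurable lborel"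
    by (rule lborel.borel_measurable_nn_integral)
  then show ?thesis
    unfolding eavg_def by simp
qed

lemma eavg_F_mult_measurable [measurable]:
  assumes [measurable]: "S \<in> sets borel" "g \<in> borel_measurable borel"
  shows "(\<lambda>x. eavg S (\<lambda>y. F x y * g y)) \<in> borel_measurable borel"
proof -
  have "(\<lambda>(x, y). F x y * g y * indicator S y) \<in> borel_measurable (lborel \<Otimes>\<^sub>M lborel)"
    by measurable
  then have "(\<lambda>x. \<integral>\<^sup>+y\<in>S. F x y * g y \<partial>lborel) \<in> borel_measurable lborel"
    by (rule lborel.borel_measurable_nn_integral)
  then show ?thesis
    unfolding eavg_def by simp
qed

text \<open>Averaging \<open>G z \<le> G y * F y z\<close> over \<open>z\<close> bounds the mean of
  \<open>G \<up> P\<close> by \<open>G y \<up> P * A y\<close>. So where \<open>G \<up> P\<close> is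
  below \<beta> times its mean, \<open>A y\<close> is at least \<open>1 / \<beta>\<close>;
  Chebyshev's inequality for \<open>A \<up> (q / P)\<close>, whose mean is \<open>A_const S\<close>,
  shows that this happens on at most half of \<open>S\<close>.\<close>

lemma large_values_row:
  fixes G :: "real ^ 'd \<Rightarrow> ennreal"
  assumes [measurable]: "G \<in> borel_measurable borel" "S \<in> sets borel"
    and S: "emeasure lborel S \<noteq> 0" "emeasure lborel S < top"
    and G: "\<And>y z. G z \<le> G y * F y z" "\<And>y. G y \<noteq> 0" "\<And>y. G y \<noteq> top"
    and \<beta>: "0 < \<beta>" "ennreal \<beta> \<up> (q / P) * A_const S \<le> ennreal (1 / 2)"
  shows "emeasure lborel S \<le> 2 * emeasure lborel {y \<in> S. ennreal \<beta> * eavg S (\<lambda>z. G z \<up> P) < G y \<up> P}"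
proof -
  define m where "m = eavg S (\<lambda>z. G z \<up> P)"
  define A where "A y = eavg S (\<lambda>z. F y z \<up> P)" for y
  have [measurable]: "A \<in> borel_measurable borel" unfolding A_def by measurable
  define E where "E = {y \<in> S. G y \<up> P \<le> ennreal \<beta> * m}"
  have [measurable]: "E \<in> sets borel" unfolding E_def by measurable
  have qP: "0 < q / P" using P q by simp
  have m_le: "m \<le> G y \<up> P * A y" for y
  proof -
    have "m \<le> eavg S (\<lambda>z. G y \<up> P * F y z \<up> P)"
      unfolding m_def using P G(1)[of _ y]
      by (intro eavg_mono) (simp add: epowr_mult[symmetric] epowr_mono)
    also have "\<dots> = G y \<up> P * A y"
      unfolding A_def by (rule eavg_cmult) auto
    finally show ?thesis .
  qed
  have one_le: "1 \<le> ennreal \<beta> \<up> (q / P) * A y \<up> (q / P)" if y: "y \<in> E" for y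
  proof -
    have Gy: "G y \<up> P \<noteq> 0" "G y \<up> P \<noteq> top" using G by auto
    have "1 \<le> ennreal \<beta> * A y"
    proof (cases "m = top")
      case True
      then have "A y = top" using m_le[of y] Gy by (auto simp: top_unique ennreal_mult_eq_top_iff)
      then show ?thesis using \<beta>(1) by (simp add: ennreal_mult_top)
    next
      case False
      have "G y \<up> P \<le> ennreal \<beta> * m" using y by (simp add: E_def)
      also have "\<dots> \<le> ennreal \<beta> * (G y \<up> P * A y)" by (intro mult_left_mono m_le) simp
      finally have "G y \<up> P * 1 \<le> G y \<up> P * (ennreal \<beta> * A y)" by (simp add: mult_ac)
      then show ?thesis using Gy by (subst (asm) ennreal_mult_le_mult_iff) auto
    qed
    then have "1 \<up> (q / P) \<le> (ennreal \<beta> * A y) \<up> (q / P)"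
      using qP by (intro epowr_mono) auto
    then show ?thesis using qP by (simp add: epowr_mult)
  qed
  have "emeasure lborel E = (\<integral>\<^sup>+y. indicator E y \<partial>lborel)"
    by simp
  also have "\<dots> \<le> (\<integral>\<^sup>+y. ennreal \<beta> \<up> (q / P) * (A y \<up> (q / P) * indicator S y) \<partial>lborel)"
    using one_le by (intro nn_integral_mono) (auto simp: E_def mult.assoc[symmetric] split: split_indicator)
  also have "\<dots> = ennreal \<beta> \<up> (q / P) * (\<integral>\<^sup>+y\<in>S. A y \<up> (q / P) \<partial>lborel)"
    by (rule nn_integral_cmult) measurable
  also have "(\<integral>\<^sup>+y\<in>S. A y \<up> (q / P) \<partial>lborel) = A_const S * emeasure lborel S"
    unfolding nn_integral_eq_eavg[OF S] A_const_def A_def ..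
  also have "ennreal \<beta> \<up> (q / P) * (A_const S * emeasure lborel S)
      = ennreal \<beta> \<up> (q / P) * A_const S * emeasure lborel S"
    by (simp add: mult.assoc)
  also have "\<dots> \<le> ennreal (1 / 2) * emeasure lborel S"
    by (intro mult_right_mono \<beta>) simp
  finally show ?thesis
    unfolding m_def[symmetric]
    by (intro emeasure_le_twice_complement[of E]) (auto simp: E_def S)
qed

text \<open>Let \<open>e\<close> be the proportion of \<open>S\<close> on which
  \<open>H \<up> q\<close> is below \<beta> times its mean \<open>m\<close>. Integrating
  \<open>H z \<up> P \<le> F z x \<up> P * H x \<up> P\<close> over such \<open>x\<close>, raising
  to the power \<open>q / P\<close> and averaging over \<open>z\<close> gives
  \<open>e \<up> (q / P) * m \<le> \<beta> * A_const S * m\<close>. Finiteness of \<open>m\<close>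
  permits cancelling it.\<close>

lemma large_values_column:
  fixes H :: "real ^ 'd \<Rightarrow> ennreal"
  assumes [measurable]: "H \<in> borel_measurable borel" "S \<in> sets borel"
    and S: "emeasure lborel S \<noteq> 0" "emeasure lborel S < top"
    and H: "\<And>x z. H z \<le> F z x * H x" "\<And>x. H x \<noteq> 0" and fin: "eavg S (\<lambda>x. H x \<up> q) < top"
    and \<beta>: "0 < \<beta>" "ennreal \<beta> * A_const S \<le> ennreal (1 / 2) \<up> (q / P)"
  shows "emeasure lborel S \<le> 2 * emeasure lborel {x \<in> S. ennreal \<beta> * eavg S (\<lambda>x. H x \<up> q) < H x \<up> q}"
proof -
  define m where "m = eavg S (\<lambda>x. H x \<up> q)"
  define A where "A z = eavg S (\<lambda>x. F z x \<up> P)" for z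
  have [measurable]: "A \<in> borel_measurable borel" unfolding A_def by measurable
  define E where "E = {x \<in> S. H x \<up> q \<le> ennreal \<beta> * m}"
  have [measurable]: "E \<in> sets borel" unfolding E_def by measurable
  have qP: "0 < q / P" and Pq: "0 < P / q" and P0: "0 < P" using P q by auto
  have "emeasure lborel E \<le> ennreal (1 / 2) * emeasure lborel S"
  proof (cases "m = 0")
    case True
    then have "E = {}" using H(2) by (auto simp: E_def)
    then show ?thesis by simp
  next
    case False
    define e where "e = emeasure lborel E / emeasure lborel S"
    have "e * H z \<up> P \<le> (ennreal \<beta> * m) \<up> (P / q) * A z" for z
    proof -
      have "emeasure lborel E * H z \<up> P = (\<integral>\<^sup>+x. H z \<up> P * indicator E x \<partial>lborel)"
        by (subst nn_integral_cmult_indicator) (simp_all add: mult.commute)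
      also have "\<dots> \<le> (\<integral>\<^sup>+x. (ennreal \<beta> * m) \<up> (P / q) * (F z x \<up> P * indicator S x) \<partial>lborel)"
      proof (intro nn_integral_mono)
        fix x
        show "H z \<up> P * indicator E x \<le> (ennreal \<beta> * m) \<up> (P / q) * (F z x \<up> P * indicator S x)"
        proof (cases "x \<in> E")
          case True
          have "H z \<up> P \<le> F z x \<up> P * (H x \<up> q) \<up> (P / q)"
            using epowr_mono[OF _ H(1)[of z x], of P] P q by (simp add: epowr_mult epowr_epowr)
          also have "\<dots> \<le> F z x \<up> P * (ennreal \<beta> * m) \<up> (P / q)"
            using True Pq by (intro mult_left_mono epowr_mono) (auto simp: E_def)
          finally show ?thesis using True by (simp add: E_def mult.commute)
        qed simp
      qed
      also have "\<dots> = (ennreal \<beta> * m) \<up> (P / q) * (\<integral>\<^sup>+x\<in>S. F z x \<up> P \<partial>lborel)"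
        by (rule nn_integral_cmult) measurable
      also have "\<dots> = (ennreal \<beta> * m) \<up> (P / q) * A z * emeasure lborel S"
        unfolding nn_integral_eq_eavg[OF S] A_def by (simp only: mult.assoc)
      finally have "emeasure lborel E * H z \<up> P / emeasure lborel S
          \<le> (ennreal \<beta> * m) \<up> (P / q) * A z * emeasure lborel S / emeasure lborel S"
        by (rule divide_right_mono_ennreal)
      also have "\<dots> = (ennreal \<beta> * m) \<up> (P / q) * A z"
        by (rule mult_divide_eq_ennreal) (use S in auto)
      finally show ?thesis
        by (simp add: e_def divide_ennreal_def mult_ac)
    qed
    then have "(e * H z \<up> P) \<up> (q / P) \<le> ((ennreal \<beta> * m) \<up> (P / q) * A z) \<up> (q / P)" for z
      using qP by (intro epowr_mono) auto
    then have le: "e \<up> (q / P) * H z \<up> q \<le> (ennreal \<beta> * m) * A z \<up> (q / P)" for z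
      using qP P q by (simp add: epowr_mult epowr_epowr)
    have "e \<up> (q / P) * m = eavg S (\<lambda>z. e \<up> (q / P) * H z \<up> q)"
      unfolding m_def by (rule eavg_cmult[symmetric]) auto
    also have "\<dots> \<le> eavg S (\<lambda>z. (ennreal \<beta> * m) * A z \<up> (q / P))"
      by (intro eavg_mono le)
    also have "\<dots> = m * (ennreal \<beta> * A_const S)"
      by (subst eavg_cmult) (auto simp: A_const_def A_def mult_ac)
    also have "\<dots> \<le> m * ennreal (1 / 2) \<up> (q / P)"
      by (intro mult_left_mono \<beta>) simp
    finally have "m * e \<up> (q / P) \<le> m * ennreal (1 / 2) \<up> (q / P)" by (simp add: mult.commute)
    then have "e \<up> (q / P) \<le> ennreal (1 / 2) \<up> (q / P)"
      using False fin unfolding m_def[symmetric] by (subst (asm) ennreal_mult_le_mult_iff) auto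
    then have "e \<le> ennreal (1 / 2)" using qP by (simp add: epowr_mono_iff)
    then have "e * emeasure lborel S \<le> ennreal (1 / 2) * emeasure lborel S"
      by (rule mult_right_mono) simp
    moreover have "e * emeasure lborel S = emeasure lborel E"
      using S unfolding e_def by (metis ennreal_divide_times ennreal_divide_self mult.right_neutral)
    ultimately show ?thesis by simp
  qed
  then show ?thesis
    unfolding m_def[symmetric]
    by (intro emeasure_le_twice_complement[of E]) (auto simp: E_def S)
qed

text \<open>Hoelder's inequality in \<open>y\<close> for each fixed \<open>x\<close>, then in
  \<open>x\<close>. It is used with enlarged exponents for \<open>F\<close> at small scales and with
  \<open>P\<close> and \<open>q\<close> themselves at large ones.\<close>

lemma eavg_mixed_Holder:
  fixes g h :: "real ^ 'd \<Rightarrow> ennreal"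
  assumes [measurable]: "g \<in> borel_measurable borel" "h \<in> borel_measurable borel" "S \<in> sets borel"
    and S: "emeasure lborel S \<noteq> 0" "emeasure lborel S < top"
    and r: "1 < r" "1 < a" "1 / r + 1 / a = 1" and s: "1 < s" "1 < b" "1 / s + 1 / b = 1"
  shows "eavg S (\<lambda>x. h x * eavg S (\<lambda>y. F x y * g y))
    \<le> eavg S (\<lambda>x. eavg S (\<lambda>y. F x y \<up> r) \<up> (s / r)) \<up> (1 / s)
      * (eavg S (\<lambda>x. h x \<up> b) \<up> (1 / b) * eavg S (\<lambda>y. g y \<up> a) \<up> (1 / a))"
proof -
  define c where "c = eavg S (\<lambda>y. g y \<up> a) \<up> (1 / a)"
  define X where "X x = eavg S (\<lambda>y. F x y \<up> r) \<up> (1 / r)" for x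
  have [measurable]: "X \<in> borel_measurable borel" unfolding X_def by measurable
  have "eavg S (\<lambda>x. h x * eavg S (\<lambda>y. F x y * g y)) \<le> eavg S (\<lambda>x. c * (X x * h x))"
  proof (intro eavg_mono)
    fix x
    have "eavg S (\<lambda>y. F x y * g y) \<le> X x * c"
      unfolding X_def c_def using r S by (intro eavg_Holder) auto
    then have "h x * eavg S (\<lambda>y. F x y * g y) \<le> h x * (X x * c)"
      by (rule mult_left_mono) simp
    then show "h x * eavg S (\<lambda>y. F x y * g y) \<le> c * (X x * h x)"
      by (simp add: mult_ac)
  qed
  also have "\<dots> = c * eavg S (\<lambda>x. X x * h x)"
    by (rule eavg_cmult) auto
  also have "\<dots> \<le> c * (eavg S (\<lambda>x. X x \<up> s) \<up> (1 / s) * eavg S (\<lambda>x. h x \<up> b) \<up> (1 / b))"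
    using s S by (intro mult_left_mono eavg_Holder) auto
  finally show ?thesis
    unfolding c_def X_def epowr_epowr by (simp add: mult_ac)
qed

text \<open>Both the row functions \<open>\<lambda>y. F x y powr P\<close> and their averages \<open>H powr q\<close> satisfy a reverse
  Hoelder inequality with quantified exponents, by submultiplicativity of \<open>F\<close>.\<close>
lemma bump_estimate:
  fixes g h :: "real ^ 'd \<Rightarrow> ennreal" and c :: real
  assumes [measurable]: "g \<in> borel_measurable borel" "h \<in> borel_measurable borel" and c: "1 \<le> c"
    and A_tri: "A_const (tri k z) \<le> ennreal c"
    and A_cell: "\<And>x j. x \<in> tri k z \<Longrightarrow> j \<le> k \<Longrightarrow> A_const (cell j x) \<le> ennreal c"
  defines "\<delta>1 \<equiv> (1 / (2 * c)) powr (P / q) / (8 * 3 ^ CARD('d))"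
    and "\<delta>2 \<equiv> (1 / 2) powr (q / P) / c / (8 * 3 ^ CARD('d))"
  assumes a: "1 < a" "1 / (P * (1 + \<delta>1)) + 1 / a = 1" and b: "1 < b" "1 / (q * (1 + \<delta>2)) + 1 / b = 1"
  shows "eavg (tri k z) (\<lambda>x. h x * eavg (tri k z) (\<lambda>y. F x y * g y))
    \<le> 4 * ennreal (c powr (1 / q)) * (eavg (tri k z) (\<lambda>x. h x \<up> b) \<up> (1 / b) * eavg (tri k z) (\<lambda>y. g y \<up> a) \<up> (1 / a))"
proof -
  define Q where "Q = tri k z"
  have [measurable]: "Q \<in> sets borel" by (simp add: Q_def)
  have Q: "emeasure lborel Q \<noteq> 0" "emeasure lborel Q < top"
    unfolding Q_def by (rule emeasure_cubes_bounds)+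
  \<comment> \<open>Both thresholds are the largest allowed by the two large-value lemmas:
    \<open>\<beta>1 \<up> (q / P) * c = 1 / 2\<close> and
    \<open>\<beta>2 * c = (1 / 2) \<up> (q / P)\<close>. Hence \<beta>1 is of the order
    \<open>c powr (- P / q)\<close> and \<beta>2 of the order \<open>1 / c\<close>.\<close>
  define \<beta>1 where "\<beta>1 = (1 / (2 * c)) powr (P / q)"
  define \<beta>2 where "\<beta>2 = (1 / 2) powr (q / P) / c"
  have \<beta>1: "0 < \<beta>1" "\<beta>1 \<le> 1" and \<beta>2: "0 < \<beta>2" "\<beta>2 \<le> 1"
  proof -
    show "0 < \<beta>1" "0 < \<beta>2" using c by (auto simp: \<beta>1_def \<beta>2_def)
    show "\<beta>1 \<le> 1" unfolding \<beta>1_def using c P q by (intro powr_le1) auto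
    have "(1 / 2) powr (q / P) \<le> 1" using P q by (intro powr_le1) auto
    then show "\<beta>2 \<le> 1" unfolding \<beta>2_def using c by (simp add: divide_le_eq)
  qed
  have eqs: "\<delta>1 = \<beta>1 / (8 * 3 ^ CARD('d))" "\<delta>2 = \<beta>2 / (8 * 3 ^ CARD('d))"
    by (simp_all only: \<delta>1_def \<delta>2_def \<beta>1_def \<beta>2_def)
  have \<delta>1: "\<delta>1 = \<beta>1 / (8 * 3 ^ CARD('d))" "0 < \<delta>1" and \<delta>2: "\<delta>2 = \<beta>2 / (8 * 3 ^ CARD('d))" "0 < \<delta>2"
    using \<beta>1 \<beta>2 unfolding eqs by auto
  have c1: "ennreal \<beta>1 \<up> (q / P) * ennreal c = ennreal (1 / 2)"
    using c P q by (simp add: \<beta>1_def epowr_ennreal powr_powr ennreal_mult[symmetric])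
  have c2: "ennreal \<beta>2 * ennreal c = ennreal (1 / 2) \<up> (q / P)"
  proof -
    have "ennreal (1 / 2) \<up> (q / P) = ennreal ((1 / 2) powr (q / P))"
      by (rule epowr_ennreal) simp
    also have "(1 / 2) powr (q / P) = \<beta>2 * c"
      using c by (simp add: \<beta>2_def)
    also have "ennreal (\<beta>2 * c) = ennreal \<beta>2 * ennreal c"
      using \<beta>2 c by (intro ennreal_mult) auto
    finally show ?thesis by simp
  qed
  have row: "eavg Q (\<lambda>y. F x y \<up> (P * (1 + \<delta>1))) \<le> 2 * eavg Q (\<lambda>y. F x y \<up> P) \<up> (1 + \<delta>1)" for x
  proof (cases "eavg Q (\<lambda>y. F x y \<up> P) = top")
    case True
    then show ?thesis by (simp add: ennreal_mult_top)
  next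
    case False
    have "eavg Q (\<lambda>y. (F x y \<up> P) \<up> (1 + \<delta>1)) \<le> 2 * eavg Q (\<lambda>y. F x y \<up> P) \<up> (1 + \<delta>1)"
      unfolding \<delta>1(1) Q_def
    proof (rule reverse_Holder)
      fix y j assume "y \<in> tri k z" "j \<le> k"
      then have "ennreal \<beta>1 \<up> (q / P) * A_const (cell j y) \<le> ennreal (1 / 2)"
        unfolding c1[symmetric] by (intro mult_left_mono A_cell) auto
      then show "emeasure lborel (cell j y) \<le> 2 * emeasure lborel
          {t \<in> cell j y. ennreal \<beta>1 * eavg (cell j y) (\<lambda>y. F x y \<up> P) < F x t \<up> P}"
        using \<beta>1 F_submult F_pos F_finite by (intro large_values_row emeasure_cubes_bounds) auto
    qed (use \<beta>1 False in \<open>auto simp: Q_def less_top\<close>)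
    then show ?thesis by (simp only: epowr_epowr)
  qed
  \<comment> \<open>\<open>H\<close> inherits \<open>H w \<le> F w x * H x\<close> from the
    submultiplicativity of \<open>F\<close>, which is the hypothesis of the column estimate, and the
    mean of \<open>H \<up> q\<close> over \<open>Q\<close> is exactly
    \<open>A_const Q\<close>.\<close>
  define H where "H x = eavg Q (\<lambda>y. F x y \<up> P) \<up> (1 / P)" for x
  have [measurable]: "H \<in> borel_measurable borel" unfolding H_def by measurable
  have Hq: "H x \<up> q = eavg Q (\<lambda>y. F x y \<up> P) \<up> (q / P)" for x
    by (simp add: H_def epowr_epowr)
  have H_le: "H w \<le> F w x * H x" for w x
  proof -
    have "eavg Q (\<lambda>y. F w y \<up> P) \<le> eavg Q (\<lambda>y. F w x \<up> P * F x y \<up> P)"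
      using P F_submult[of w _ x] by (intro eavg_mono) (simp add: epowr_mult[symmetric] epowr_mono)
    also have "\<dots> = F w x \<up> P * eavg Q (\<lambda>y. F x y \<up> P)"
      by (rule eavg_cmult) auto
    finally have "eavg Q (\<lambda>y. F w y \<up> P) \<up> (1 / P) \<le> (F w x \<up> P * eavg Q (\<lambda>y. F x y \<up> P)) \<up> (1 / P)"
      using P by (intro epowr_mono) auto
    then show ?thesis
      using P by (simp add: H_def epowr_mult epowr_epowr)
  qed
  have H_pos: "H x \<noteq> 0" for x
  proof
    assume "H x = 0"
    then have "(\<integral>\<^sup>+y\<in>Q. F x y \<up> P \<partial>lborel) = 0"
      using Q by (auto simp: H_def eavg_def)
    then have "AE y in lborel. F x y \<up> P * indicator Q y = 0"
      by (subst (asm) nn_integral_0_iff_AE) auto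
    then have "AE y in lborel. y \<notin> Q"
      by eventually_elim (auto simp: F_pos split: split_indicator)
    then have "Q \<in> null_sets lborel"
      by (subst (asm) AE_iff_null_sets[symmetric]) auto
    then show False using Q by auto
  qed
  have HQ: "eavg Q (\<lambda>x. H x \<up> q) \<le> ennreal c"
    using A_tri unfolding A_const_def Q_def[symmetric] Hq .
  then have Hfin: "eavg Q (\<lambda>x. H x \<up> q) < top"
    using ennreal_less_top order_le_less_trans by blast
  have "eavg Q (\<lambda>x. (H x \<up> q) \<up> (1 + \<delta>2)) \<le> 2 * eavg Q (\<lambda>x. H x \<up> q) \<up> (1 + \<delta>2)"
    unfolding \<delta>2(1) Q_def
  proof (rule reverse_Holder)
    fix y j assume yj: "y \<in> tri k z" "j \<le> k"
    then have "ennreal \<beta>2 * A_const (cell j y) \<le> ennreal (1 / 2) \<up> (q / P)"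
      unfolding c2[symmetric] by (intro mult_left_mono A_cell) auto
    moreover have "eavg (cell j y) (\<lambda>x. H x \<up> q) < top"
      using yj cell_subset_tri'[of j k y z]
      by (intro eavg_subset_finite[OF Hfin] Q emeasure_cubes_bounds) (simp add: Q_def)
    ultimately show "emeasure lborel (cell j y) \<le> 2 * emeasure lborel
        {t \<in> cell j y. ennreal \<beta>2 * eavg (cell j y) (\<lambda>x. H x \<up> q) < H t \<up> q}"
      using \<beta>2 H_le H_pos by (intro large_values_column emeasure_cubes_bounds) auto
  qed (use \<beta>2 Hfin in \<open>auto simp: Q_def\<close>)
  also have "\<dots> \<le> 2 * ennreal c \<up> (1 + \<delta>2)"
    using HQ \<delta>2 by (intro mult_left_mono epowr_mono) auto
  finally have col: "eavg Q (\<lambda>x. H x \<up> (q * (1 + \<delta>2))) \<le> 2 * ennreal c \<up> (1 + \<delta>2)"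
    unfolding epowr_epowr .
  define r where "r = P * (1 + \<delta>1)"
  define s where "s = q * (1 + \<delta>2)"
  have r: "1 < r" and s: "1 < s"
    unfolding r_def s_def using P q \<delta>1 \<delta>2 by (smt (verit) mult_less_cancel_left2 mult_le_cancel_left1)+
  have "eavg Q (\<lambda>x. eavg Q (\<lambda>y. F x y \<up> r) \<up> (s / r)) \<le> eavg Q (\<lambda>x. 2 \<up> (s / r) * H x \<up> s)"
  proof (intro eavg_mono)
    fix x
    have "eavg Q (\<lambda>y. F x y \<up> r) \<up> (s / r) \<le> (2 * H x \<up> r) \<up> (s / r)"
      using row[of x] r s P unfolding r_def H_def epowr_epowr by (intro epowr_mono) auto
    also have "\<dots> = 2 \<up> (s / r) * H x \<up> s"
      using r s by (simp add: epowr_mult epowr_epowr)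
    finally show "eavg Q (\<lambda>y. F x y \<up> r) \<up> (s / r) \<le> 2 \<up> (s / r) * H x \<up> s" .
  qed
  also have "\<dots> = 2 \<up> (s / r) * eavg Q (\<lambda>x. H x \<up> s)"
    by (rule eavg_cmult) auto
  also have "\<dots> \<le> 2 \<up> (s / r) * (2 * ennreal c \<up> (1 + \<delta>2))"
    using col unfolding s_def by (rule mult_left_mono) simp
  finally have "eavg Q (\<lambda>x. eavg Q (\<lambda>y. F x y \<up> r) \<up> (s / r)) \<up> (1 / s)
      \<le> (2 \<up> (s / r) * (2 * ennreal c \<up> (1 + \<delta>2))) \<up> (1 / s)"
    using s by (intro epowr_mono) auto
  \<comment> \<open>As \<open>s = q * (1 + \<delta>2)\<close>, the power
    \<open>(1 + \<delta>2) / s\<close> collapses to \<open>1 / q\<close>: raising the exponents does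
    not change the power of \<open>c\<close>.\<close>
  also have "\<dots> = 2 \<up> (1 / r) * (2 \<up> (1 / s) * ennreal c \<up> (1 / q))"
    using s q \<delta>2 by (simp add: epowr_mult epowr_epowr s_def)
  also have "\<dots> \<le> 2 * (2 * ennreal c \<up> (1 / q))"
  proof -
    have "(2 :: ennreal) \<up> t \<le> 2" if "t \<le> 1" for t
      using that epowr_ennreal[of 2 t] powr_mono[of t 1 2] ennreal_leI[of "2 powr t" 2] by simp
    then show ?thesis using r s by (intro mult_mono) auto
  qed
  also have "\<dots> = 4 * ennreal (c powr (1 / q))"
    using c by (simp add: epowr_ennreal mult.assoc[symmetric])
  finally have le: "eavg Q (\<lambda>x. eavg Q (\<lambda>y. F x y \<up> r) \<up> (s / r)) \<up> (1 / s) \<le> 4 * ennreal (c powr (1 / q))" .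
  have "eavg Q (\<lambda>x. h x * eavg Q (\<lambda>y. F x y * g y))
    \<le> eavg Q (\<lambda>x. eavg Q (\<lambda>y. F x y \<up> r) \<up> (s / r)) \<up> (1 / s)
      * (eavg Q (\<lambda>x. h x \<up> b) \<up> (1 / b) * eavg Q (\<lambda>y. g y \<up> a) \<up> (1 / a))"
    using r s a b Q unfolding r_def s_def by (intro eavg_mixed_Holder) auto
  also have "\<dots> \<le> 4 * ennreal (c powr (1 / q)) * (eavg Q (\<lambda>x. h x \<up> b) \<up> (1 / b) * eavg Q (\<lambda>y. g y \<up> a) \<up> (1 / a))"
    by (intro mult_right_mono le) simp
  finally show ?thesis unfolding Q_def .
qed

end

section \<open>Sums over dyadic scales\<close>

text \<open>A two-sided geometric series, because the summands in Hedberg's optimisation decay in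
  both directions from the crossing level.\<close>

definition geometric_const :: "real \<Rightarrow> ennreal" where
  "geometric_const \<gamma> = (\<integral>\<^sup>+i. ennreal (2 powr (- \<gamma> * \<bar>real_of_int i\<bar>)) \<partial>count_space UNIV)"

lemma geometric_const_finite:
  assumes "0 < \<gamma>"
  shows "geometric_const \<gamma> < top"
proof -
  define r where "r = 2 powr - \<gamma>"
  have r: "0 < r" "r < 1" using assms by (auto simp: r_def powr_less_one)
  have rn: "2 powr (- \<gamma> * real n) = r ^ n" for n
    unfolding r_def using powr_powr[of 2 "- \<gamma>" "real n"] powr_realpow[of "2 powr - \<gamma>" n] by simp
  have "geometric_const \<gamma> \<le> (\<integral>\<^sup>+i. (\<integral>\<^sup>+n. ennreal (r ^ n) * (indicator {int n} i + indicator {- int n} i)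
      \<partial>count_space (UNIV :: nat set)) \<partial>count_space (UNIV :: int set))"
    unfolding geometric_const_def
  proof (intro nn_integral_mono)
    fix i :: int
    have "ennreal (2 powr (- \<gamma> * \<bar>real_of_int i\<bar>)) = ennreal (r ^ nat \<bar>i\<bar>)"
      using rn[of "nat \<bar>i\<bar>"] by simp
    also have "\<dots> \<le> ennreal (r ^ nat \<bar>i\<bar>) * (indicator {int (nat \<bar>i\<bar>)} i + indicator {- int (nat \<bar>i\<bar>)} i)"
    proof -
      have "(1 :: ennreal) \<le> indicator {int (nat \<bar>i\<bar>)} i + indicator {- int (nat \<bar>i\<bar>)} i"
        by (cases "0 \<le> i") (auto simp: indicator_def)
      from mult_left_mono[OF this, of "ennreal (r ^ nat \<bar>i\<bar>)"] show ?thesis by simp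
    qed
    also have "\<dots> \<le> (\<integral>\<^sup>+n. ennreal (r ^ n) * (indicator {int n} i + indicator {- int n} i)
      \<partial>count_space (UNIV :: nat set))"
      by (rule nn_integral_ge_point) simp
    finally show "ennreal (2 powr (- \<gamma> * \<bar>real_of_int i\<bar>)) \<le> (\<integral>\<^sup>+n. ennreal (r ^ n) *
      (indicator {int n} i + indicator {- int n} i) \<partial>count_space (UNIV :: nat set))" .
  qed
  also have "\<dots> = (\<integral>\<^sup>+n. (\<integral>\<^sup>+i. ennreal (r ^ n) * (indicator {int n} i + indicator {- int n} i)
      \<partial>count_space (UNIV :: int set)) \<partial>count_space (UNIV :: nat set))"
    by (rule nn_integral_count_space_nn_integral) auto
  also have "\<dots> = (\<integral>\<^sup>+n. ennreal (2 * r ^ n) \<partial>count_space (UNIV :: nat set))"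
    using r by (intro nn_integral_cong) (simp add: nn_integral_cmult nn_integral_add ennreal_mult mult.commute)
  also have "\<dots> = (\<Sum>n. ennreal (2 * r ^ n))"
    by (rule nn_integral_count_space_nat)
  also have "\<dots> = ennreal (\<Sum>n. 2 * r ^ n)"
    using r by (intro suminf_ennreal2 summable_mult summable_geometric) auto
  finally show ?thesis by (simp add: order_le_less_trans)
qed

lemma nn_integral_count_space_shift:
  fixes f :: "int \<Rightarrow> ennreal"
  shows "(\<integral>\<^sup>+k. f (k - j) \<partial>count_space UNIV) = (\<integral>\<^sup>+k. f k \<partial>count_space UNIV)"
proof (rule nn_integral_bij_count_space)
  show "bij_betw (\<lambda>k. k - j) UNIV UNIV"
    by (rule bij_betw_byWitness[of _ "\<lambda>k. k + j"]) auto
qed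

text \<open>Hedberg's optimisation: the two bounds for \<open>V k\<close> cross near \<open>2 powr (- k * e) = U\<close>.\<close>
lemma Hedberg_sum:
  fixes U :: ennreal and V :: "int \<Rightarrow> ennreal" and \<alpha> e :: real
  assumes \<alpha>: "0 < \<alpha>" "\<alpha> < e" and V: "\<And>k. V k \<le> U" "\<And>k. V k \<le> ennreal (2 powr (- real_of_int k * e))"
  shows "(\<integral>\<^sup>+k. ennreal (2 powr (real_of_int k * \<alpha>)) * V k \<partial>count_space UNIV)
    \<le> (geometric_const (min \<alpha> (e - \<alpha>)) * ennreal (2 powr (e - \<alpha>))) * U \<up> ((e - \<alpha>) / e)"
proof (cases "U = 0 \<or> U = top")
  case True
  have "(1 :: ennreal) \<le> geometric_const \<gamma>" for \<gamma>
    unfolding geometric_const_def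
    by (rule order_trans[OF _ nn_integral_ge_point[of 0]]) auto
  then have "geometric_const \<gamma> \<noteq> 0" for \<gamma> by (metis not_one_le_zero)
  then show ?thesis
    using True V(1) by (auto simp: ennreal_mult_top)
next
  case False
  then obtain u where u: "U = ennreal u" "0 < u"
    by (metis ennreal_cases ennreal_0 order_le_less)
  define \<gamma> where "\<gamma> = min \<alpha> (e - \<alpha>)"
  define j where "j = \<lfloor>- log 2 u / e\<rfloor>"
  have e: "0 < e" using \<alpha> by simp
  have "real_of_int j \<le> - log 2 u / e" "- log 2 u / e < real_of_int j + 1"
    by (simp_all add: j_def)
  then have j: "log 2 u \<le> - real_of_int j * e" "- (real_of_int j + 1) * e < log 2 u"
    using e by (auto simp: field_simps)
  have u_le: "u \<le> 2 powr (- real_of_int j * e)"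
    using powr_mono[OF j(1), of 2] u by simp
  have le_u: "2 powr (- real_of_int j * e) \<le> 2 powr e * u"
  proof -
    have "2 powr (- (real_of_int j + 1) * e) \<le> u"
      using powr_mono[OF less_imp_le[OF j(2)], of 2] u by simp
    then have "2 powr e * 2 powr (- (real_of_int j + 1) * e) \<le> 2 powr e * u" by simp
    then show ?thesis by (simp add: powr_add[symmetric] algebra_simps)
  qed
  \<comment> \<open>Up to level \<open>j\<close> the bound \<open>U\<close> is used and the summands
    grow at rate \<alpha>; beyond \<open>j\<close> the second bound makes them decay at rate
    \<open>e - \<alpha>\<close>. The exponent \<gamma> is the smaller of the two rates.\<close>
  have summand: "ennreal (2 powr (real_of_int k * \<alpha>)) * V k
      \<le> ennreal (2 powr (real_of_int j * (\<alpha> - e))) * ennreal (2 powr (- \<gamma> * \<bar>real_of_int (k - j)\<bar>))" for k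
  proof -
    have "V k \<le> ennreal (2 powr (- real_of_int (max j k) * e))"
    proof (cases "k \<le> j")
      case True
      have "V k \<le> ennreal u" using V(1) u by simp
      also have "\<dots> \<le> ennreal (2 powr (- real_of_int j * e))" by (intro ennreal_leI u_le)
      finally show ?thesis using True by (simp add: max_absorb1)
    qed (use V(2)[of k] in \<open>simp add: max_absorb2\<close>)
    then have "ennreal (2 powr (real_of_int k * \<alpha>)) * V k
        \<le> ennreal (2 powr (real_of_int k * \<alpha>)) * ennreal (2 powr (- real_of_int (max j k) * e))"
      by (rule mult_left_mono) simp
    also have "\<dots> = ennreal (2 powr (real_of_int k * \<alpha> - real_of_int (max j k) * e))"
      by (simp add: ennreal_mult[symmetric] powr_add[symmetric])
    also have "\<dots> \<le> ennreal (2 powr (real_of_int j * (\<alpha> - e) - \<gamma> * \<bar>real_of_int (k - j)\<bar>))"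
    proof (intro ennreal_leI powr_mono)
      show "real_of_int k * \<alpha> - real_of_int (max j k) * e \<le> real_of_int j * (\<alpha> - e) - \<gamma> * \<bar>real_of_int (k - j)\<bar>"
      proof (cases "k \<le> j")
        case True
        have "\<gamma> * (real_of_int j - real_of_int k) \<le> \<alpha> * (real_of_int j - real_of_int k)"
          using True by (intro mult_right_mono) (auto simp: \<gamma>_def)
        then show ?thesis using True by (simp add: max_absorb1 algebra_simps)
      next
        case False
        have "\<gamma> * (real_of_int k - real_of_int j) \<le> (e - \<alpha>) * (real_of_int k - real_of_int j)"
          using False by (intro mult_right_mono) (auto simp: \<gamma>_def)
        then show ?thesis using False by (simp add: max_absorb2 algebra_simps)
      qed
    qed simp
    also have "\<dots> = ennreal (2 powr (real_of_int j * (\<alpha> - e))) * ennreal (2 powr (- \<gamma> * \<bar>real_of_int (k - j)\<bar>))"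
      by (simp add: ennreal_mult[symmetric] powr_add[symmetric])
    finally show ?thesis .
  qed
  have "(\<integral>\<^sup>+k. ennreal (2 powr (real_of_int k * \<alpha>)) * V k \<partial>count_space UNIV)
      \<le> (\<integral>\<^sup>+k. ennreal (2 powr (real_of_int j * (\<alpha> - e))) * ennreal (2 powr (- \<gamma> * \<bar>real_of_int (k - j)\<bar>)) \<partial>count_space UNIV)"
    by (intro nn_integral_mono summand)
  also have "\<dots> = ennreal (2 powr (real_of_int j * (\<alpha> - e))) * geometric_const \<gamma>"
    unfolding geometric_const_def
    by (subst nn_integral_cmult) (simp_all add: nn_integral_count_space_shift[of "\<lambda>i. ennreal (2 powr (- \<gamma> * \<bar>real_of_int i\<bar>))" j, simplified])
  also have "\<dots> \<le> ennreal (2 powr (e - \<alpha>) * u powr ((e - \<alpha>) / e)) * geometric_const \<gamma>"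
  proof (intro mult_right_mono ennreal_leI)
    have "2 powr (real_of_int j * (\<alpha> - e)) = (2 powr (- real_of_int j * e)) powr ((e - \<alpha>) / e)"
    proof -
      have "real_of_int j * (\<alpha> - e) = - real_of_int j * e * ((e - \<alpha>) / e)"
        using e by (simp add: field_simps)
      then show ?thesis by (simp only: powr_powr)
    qed
    also have "\<dots> \<le> (2 powr e * u) powr ((e - \<alpha>) / e)"
      using le_u \<alpha> by (intro powr_mono2) auto
    also have "\<dots> = 2 powr (e - \<alpha>) * u powr ((e - \<alpha>) / e)"
      using e u by (simp add: powr_mult powr_powr)
    finally show "2 powr (real_of_int j * (\<alpha> - e)) \<le> 2 powr (e - \<alpha>) * u powr ((e - \<alpha>) / e)" .
  qed simp
  also have "\<dots> = (geometric_const \<gamma> * ennreal (2 powr (e - \<alpha>))) * U \<up> ((e - \<alpha>) / e)"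
    using u by (simp add: epowr_ennreal ennreal_mult mult_ac)
  finally show ?thesis unfolding \<gamma>_def .
qed

text \<open>Only the scales with \<open>2 powr k \<ge> R\<close> contribute, and from the first of
  them onwards the summands are dominated by a geometric series of ratio one half, so the bound does
  not depend on \<open>R\<close>.\<close>

lemma large_scales_sum:
  fixes R :: real
  assumes R: "0 < R"
  shows "(\<integral>\<^sup>+k. ennreal (if 2 \<le> 1 + 2 powr real_of_int k / R then 1 / (1 + 2 powr real_of_int k / R) else 0)
    \<partial>count_space UNIV) \<le> geometric_const 1"
proof -
  define j where "j = \<lceil>log 2 R\<rceil>"
  have Rj: "R \<le> 2 powr real_of_int j"
    using R powr_mono[of "log 2 R" "real_of_int j" 2] by (simp add: j_def)
  have "(\<integral>\<^sup>+k. ennreal (if 2 \<le> 1 + 2 powr real_of_int k / R then 1 / (1 + 2 powr real_of_int k / R) else 0)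
    \<partial>count_space UNIV) \<le> (\<integral>\<^sup>+k. ennreal (2 powr (- 1 * \<bar>real_of_int (k - j)\<bar>)) \<partial>count_space UNIV)"
  proof (intro nn_integral_mono ennreal_leI)
    fix k :: int
    show "(if 2 \<le> 1 + 2 powr real_of_int k / R then 1 / (1 + 2 powr real_of_int k / R) else 0)
      \<le> 2 powr (- 1 * \<bar>real_of_int (k - j)\<bar>)"
    proof (cases "2 \<le> 1 + 2 powr real_of_int k / R")
      case True
      then have "R \<le> 2 powr real_of_int k" using R by (simp add: field_simps)
      then have "log 2 R \<le> real_of_int k" using R by (simp add: log_le_iff)
      then have jk: "j \<le> k" unfolding j_def by (simp add: ceiling_le_iff)
      have "1 / (1 + 2 powr real_of_int k / R) \<le> 1 / (2 powr real_of_int k / R)"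
        using R by (intro frac_le) auto
      also have "\<dots> \<le> 2 powr real_of_int j / 2 powr real_of_int k"
        using Rj by (simp add: divide_right_mono)
      also have "\<dots> = 2 powr (- 1 * \<bar>real_of_int (k - j)\<bar>)"
        using jk by (simp add: powr_diff[symmetric])
      finally show ?thesis using True by simp
    qed simp
  qed
  also have "\<dots> = geometric_const 1"
    unfolding geometric_const_def
    by (rule nn_integral_count_space_shift[of "\<lambda>i. ennreal (2 powr (- 1 * \<bar>real_of_int i\<bar>))" j])
  finally show ?thesis .
qed

lemma epowr_mult_le_add:
  assumes "0 < s" "0 < t" "s + t = 1"
  shows "X \<up> s * Y \<up> t \<le> X + Y"
proof -
  have "X \<up> s * Y \<up> t \<le> max X Y \<up> s * max X Y \<up> t"
    using assms by (intro mult_mono epowr_mono) auto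
  also have "\<dots> = max X Y"
    unfolding epowr_add[symmetric] assms by simp
  also have "\<dots> \<le> X + Y"
    by (simp add: max_def)
  finally show ?thesis .
qed

lemma eavg_epowr_mono:
  fixes g :: "'a :: euclidean_space \<Rightarrow> ennreal"
  assumes [measurable]: "g \<in> borel_measurable borel" "S \<in> sets borel"
    and S: "emeasure lborel S \<noteq> 0" "emeasure lborel S < top" and ap: "1 < a" "a < p"
  shows "eavg S (\<lambda>x. g x \<up> a) \<up> (1 / a) \<le> eavg S (\<lambda>x. g x \<up> p) \<up> (1 / p)"
proof -
  have "eavg S (\<lambda>x. g x \<up> a * 1) \<le> eavg S (\<lambda>x. (g x \<up> a) \<up> (p / a)) \<up> (1 / (p / a))
      * eavg S (\<lambda>x. 1 \<up> (p / (p - a))) \<up> (1 / (p / (p - a)))"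
    using ap S by (intro eavg_Holder) (auto simp: field_simps)
  also have "eavg S (\<lambda>x. 1 \<up> (p / (p - a))) = 1"
    using S by (simp add: eavg_def)
  finally have "eavg S (\<lambda>x. g x \<up> a) \<le> eavg S (\<lambda>x. g x \<up> p) \<up> (a / p)"
    using ap by (simp add: epowr_epowr)
  then have "eavg S (\<lambda>x. g x \<up> a) \<up> (1 / a) \<le> (eavg S (\<lambda>x. g x \<up> p) \<up> (a / p)) \<up> (1 / a)"
    using ap by (intro epowr_mono) auto
  then show ?thesis using ap by (simp add: epowr_epowr)
qed

text \<open>The exponent conjugate to \<open>r' (1 + \<delta>)\<close>, where \<open>r'\<close> is conjugate to \<open>r\<close>, is slightly smaller
  than \<open>r\<close>; the maximal function then costs a factor \<open>1 / \<delta>\<close>.\<close>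
lemma maximal_fun_bump_exponent:
  fixes f :: "real ^ 'd \<Rightarrow> ennreal"
  assumes [measurable]: "f \<in> borel_measurable borel" and r: "1 < r" "1 / r + 1 / r' = 1" "1 < r'"
    and \<delta>: "0 < \<delta>" "\<delta> \<le> 1" and f: "(\<integral>\<^sup>+x. f x \<up> r \<partial>lborel) \<le> 1"
  obtains a where "1 < a" "a < r" "1 / (r' * (1 + \<delta>)) + 1 / a = 1"
    "(\<integral>\<^sup>+x. maximal_fun (\<lambda>y. f y \<up> a) x \<up> (r / a) \<partial>lborel)
      \<le> ennreal (3 ^ CARD('d) * 2 powr r * r * 2 / ((r - 1) * \<delta>))"
proof -
  have r': "r' = r / (r - 1)" using r by (simp add: field_simps)
  define t where "t = 1 - (r - 1) / (r * (1 + \<delta>))"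
  define a where "a = 1 / t"
  \<comment> \<open>Here \<open>r * t = r / a\<close> is the exponent at which the maximal function
    is applied; its distance from \<open>1\<close>, namely
    \<open>(r - 1) * \<delta> / (1 + \<delta>)\<close>, enters the strong type constant
    inversely.\<close>
  have rt: "r * t = 1 + (r - 1) * (\<delta> / (1 + \<delta>))"
  proof -
    have "r * t = r - (r - 1) / (1 + \<delta>)"
    proof -
      have "r * ((r - 1) / (r * (1 + \<delta>))) = (r - 1) / (1 + \<delta>)"
        using r by (metis mult_divide_mult_cancel_left times_divide_eq_right less_numeral_extra(3) zero_less_one order.strict_trans)
      then show ?thesis unfolding t_def right_diff_distrib by simp
    qed
    also have "(r - 1) / (1 + \<delta>) = (r - 1) * (1 - \<delta> / (1 + \<delta>))"
      using \<delta> by (simp add: field_simps)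
    finally show ?thesis by (simp add: algebra_simps)
  qed
  have pos: "0 < (r - 1) * (\<delta> / (1 + \<delta>))" using r \<delta> by simp
  have t0: "0 < t"
  proof -
    have "0 < r * t" using rt pos by simp
    then show ?thesis using r by (simp add: zero_less_mult_iff)
  qed
  have t1: "t < 1" using r \<delta> unfolding t_def by simp
  have a1: "1 < a" using t0 t1 by (simp add: a_def)
  have ra: "r / a = r * t" by (simp add: a_def)
  have "1 < r * t" using rt pos by simp
  then have ar: "a < r" using t0 by (simp add: a_def field_simps)
  have conj: "1 / (r' * (1 + \<delta>)) + 1 / a = 1"
    using r \<delta> unfolding a_def t_def r' by (simp add: field_simps)
  have low: "(r - 1) * \<delta> / 2 \<le> r / a - 1"
  proof -
    have "\<delta> / 2 \<le> \<delta> / (1 + \<delta>)" using \<delta> by (intro divide_left_mono) auto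
    then have "(r - 1) * (\<delta> / 2) \<le> (r - 1) * (\<delta> / (1 + \<delta>))" using r by (intro mult_left_mono) auto
    then show ?thesis unfolding ra rt by simp
  qed
  have "(\<integral>\<^sup>+x. maximal_fun (\<lambda>y. f y \<up> a) x \<up> (r / a) \<partial>lborel)
      \<le> ennreal (3 ^ CARD('d) * 2 powr (r / a) * (r / a) / (r / a - 1)) * (\<integral>\<^sup>+x. (f x \<up> a) \<up> (r / a) \<partial>lborel)"
    using ar a1 by (intro maximal_fun_strong_type) auto
  also have "\<dots> \<le> ennreal (3 ^ CARD('d) * 2 powr (r / a) * (r / a) / (r / a - 1)) * 1"
    using f a1 by (intro mult_left_mono) (auto simp: epowr_epowr)
  also have "\<dots> \<le> ennreal (3 ^ CARD('d) * 2 powr r * r * 2 / ((r - 1) * \<delta>))"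
  proof -
    have "3 ^ CARD('d) * 2 powr (r / a) * (r / a) / (r / a - 1) \<le> 3 ^ CARD('d) * 2 powr r * r / ((r - 1) * \<delta> / 2)"
      using a1 r \<delta> low by (intro frac_le mult_mono powr_mono) (auto simp: divide_le_eq)
    then show ?thesis by (simp add: ennreal_leI mult_ac)
  qed
  finally show thesis using that a1 ar conj by blast
qed

text \<open>The factor \<open>4\<close> stems from the enlarged exponents on a single cube, the next
  factor from Hedberg's sum. The last two stem from the maximal theorem for \<open>h\<close> and for
  \<open>g\<close>, with the powers of \<open>c\<close> contained in \<open>1 / \<delta>2\<close>
  and \<open>1 / \<delta>1\<close> split off.\<close>

definition small_scales_const :: "nat \<Rightarrow> real \<Rightarrow> real \<Rightarrow> real \<Rightarrow> real \<Rightarrow> real \<Rightarrow> ennreal" where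
  "small_scales_const d \<alpha> p P q s =
     4 * (geometric_const (min \<alpha> (real d / p - \<alpha>)) * ennreal (2 powr (real d / p - \<alpha>)))
     * (ennreal ((3 ^ d * 2 powr s * s * 2 / (s - 1) * (8 * 3 ^ d * 2 powr (q / P))) powr (1 / s))
        * ennreal ((3 ^ d * 2 powr p * p * 2 / (p - 1) * (8 * 3 ^ d * 2 powr (P / q))) powr (1 / q)))"

section \<open>Bilinear forms at small and at large scales\<close>

context submultiplicative_kernel
begin

definition tri_form :: "(real ^ 'd \<Rightarrow> ennreal) \<Rightarrow> (real ^ 'd \<Rightarrow> ennreal) \<Rightarrow> int \<Rightarrow> real ^ 'd \<Rightarrow> ennreal" where
  "tri_form g h k x = eavg (tri k x) (\<lambda>z. h z * eavg (tri k x) (\<lambda>y. F z y * g y))"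

lemma tri_form_measurable [measurable]:
  assumes [measurable]: "g \<in> borel_measurable borel" "h \<in> borel_measurable borel"
  shows "tri_form g h k \<in> borel_measurable borel"
proof -
  have "(\<lambda>((x, z), y). F z y * g y * indicator (tri k x) y)
      \<in> borel_measurable ((lborel \<Otimes>\<^sub>M lborel) \<Otimes>\<^sub>M lborel)"
    by (simp add: indicator_def split_beta')
  then have "(\<lambda>(x, z). \<integral>\<^sup>+y\<in>tri k x. F z y * g y \<partial>lborel) \<in> borel_measurable (lborel \<Otimes>\<^sub>M lborel)"
    using lborel.borel_measurable_nn_integral[of "\<lambda>xz y. F (snd xz) y * g y * indicator (tri k (fst xz)) y"
        "lborel \<Otimes>\<^sub>M lborel"] by (simp add: split_beta')
  then have [measurable]: "(\<lambda>(x, z). eavg (tri k x) (\<lambda>y. F z y * g y)) \<in> borel_measurable (lborel \<Otimes>\<^sub>M lborel)"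
    unfolding eavg_def emeasure_tri split_beta' by measurable
  have "(\<lambda>(x, z). h z * eavg (tri k x) (\<lambda>y. F z y * g y) * indicator (tri k x) z)
      \<in> borel_measurable (lborel \<Otimes>\<^sub>M lborel)"
    by (simp add: indicator_def split_beta')
  then have "(\<lambda>x. \<integral>\<^sup>+z\<in>tri k x. h z * eavg (tri k x) (\<lambda>y. F z y * g y) \<partial>lborel) \<in> borel_measurable lborel"
    by (rule lborel.borel_measurable_nn_integral)
  then show ?thesis
    unfolding tri_form_def[abs_def] eavg_def[of _ "\<lambda>z. h z * _ z"] emeasure_tri by simp
qed

text \<open>On each good cube the form is at most \<open>c powr (1 / q)\<close> times an average of
  \<open>h\<close> and one of \<open>g\<close>, with exponents \<open>b < s\<close> and
  \<open>a < p\<close>. The first is replaced by a maximal function and leaves the sum over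
  \<open>k\<close>; the second is summed by Hedberg's lemma, whose decaying bound comes from the
  unit norm of \<open>g\<close>. Hoelder's inequality with exponents \<open>s\<close> and
  \<open>q\<close> and the maximal theorem then contribute \<open>c powr (1 / s)\<close> and
  \<open>c powr (P / (q * q))\<close>.\<close>

lemma small_scales:
  fixes g h :: "real ^ 'd \<Rightarrow> ennreal" and good :: "int \<Rightarrow> (real ^ 'd) set" and c p s \<alpha> :: real
  assumes [measurable]: "g \<in> borel_measurable borel" "h \<in> borel_measurable borel" and c: "1 \<le> c"
    and p: "1 < p" "1 / p + 1 / P = 1" and s: "1 < s" "1 / q + 1 / s = 1"
    and \<alpha>: "0 < \<alpha>" "1 / q = 1 / p - \<alpha> / real CARD('d)"
    and g: "(\<integral>\<^sup>+x. g x \<up> p \<partial>lborel) \<le> 1" and h: "(\<integral>\<^sup>+x. h x \<up> s \<partial>lborel) \<le> 1"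
    and A_tri: "\<And>k x. x \<in> good k \<Longrightarrow> A_const (tri k x) \<le> ennreal c"
    and A_cell: "\<And>k x y j. x \<in> good k \<Longrightarrow> y \<in> tri k x \<Longrightarrow> j \<le> k \<Longrightarrow> A_const (cell j y) \<le> ennreal c"
  shows "(\<integral>\<^sup>+x. (\<integral>\<^sup>+k. ennreal (2 powr (real_of_int k * \<alpha>)) * (tri_form g h k x * indicator (good k) x)
      \<partial>count_space UNIV) \<partial>lborel)
    \<le> small_scales_const CARD('d) \<alpha> p P q s * ennreal (c powr (1 + P / (q * q)))"
proof -
  define \<delta>1 where "\<delta>1 = (1 / (2 * c)) powr (P / q) / (8 * 3 ^ CARD('d))"
  define \<delta>2 where "\<delta>2 = (1 / 2) powr (q / P) / c / (8 * 3 ^ CARD('d))"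
  have D1: "1 \<le> 8 * (3 :: real) ^ CARD('d)" using one_le_power[of "3 :: real" "CARD('d)"] by linarith
  have \<delta>1: "0 < \<delta>1" "\<delta>1 \<le> 1"
  proof -
    have "(1 / (2 * c)) powr (P / q) \<le> 1" using c P q by (intro powr_le1) auto
    then show "\<delta>1 \<le> 1" using D1 by (simp add: \<delta>1_def divide_le_eq)
    show "0 < \<delta>1" using c by (simp add: \<delta>1_def)
  qed
  have \<delta>2: "0 < \<delta>2" "\<delta>2 \<le> 1"
  proof -
    have "(1 / 2) powr (q / P) \<le> 1" using P q by (intro powr_le1) auto
    also have "1 \<le> c * (8 * 3 ^ CARD('d))" using c D1 mult_mono[of 1 c 1 "8 * 3 ^ CARD('d)"] by simp
    finally show "\<delta>2 \<le> 1" using c by (simp add: \<delta>2_def divide_le_eq)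
    show "0 < \<delta>2" using c by (simp add: \<delta>2_def)
  qed
  obtain a where a: "1 < a" "a < p" "1 / (P * (1 + \<delta>1)) + 1 / a = 1"
    "(\<integral>\<^sup>+x. maximal_fun (\<lambda>y. g y \<up> a) x \<up> (p / a) \<partial>lborel)
      \<le> ennreal (3 ^ CARD('d) * 2 powr p * p * 2 / ((p - 1) * \<delta>1))"
    using maximal_fun_bump_exponent[OF _ p P \<delta>1 g] by auto
  have s': "1 / s + 1 / q = 1" using s by simp
  obtain b where b: "1 < b" "b < s" "1 / (q * (1 + \<delta>2)) + 1 / b = 1"
    "(\<integral>\<^sup>+x. maximal_fun (\<lambda>y. h y \<up> b) x \<up> (s / b) \<partial>lborel)
      \<le> ennreal (3 ^ CARD('d) * 2 powr s * s * 2 / ((s - 1) * \<delta>2))"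
    using maximal_fun_bump_exponent[OF _ s(1) s' q \<delta>2 h] by auto
  define M1 where "M1 = 3 ^ CARD('d) * 2 powr p * p * 2 / ((p - 1) * \<delta>1)"
  define M2 where "M2 = 3 ^ CARD('d) * 2 powr s * s * 2 / ((s - 1) * \<delta>2)"
  define e where "e = real CARD('d) / p"
  have d0: "0 < real CARD('d)" by simp
  \<comment> \<open>The scaling relation between \<open>p\<close> and \<open>q\<close> in the form
    needed here: Hedberg's lemma produces the power \<open>(e - \<alpha>) / e = p / q\<close> of the
    maximal function to the power \<open>1 / a\<close>, and its \<open>q\<close>-th power is then
    integrated with exponent \<open>p / a\<close>.\<close>
  have pq: "(e - \<alpha>) / e = p / q"
  proof -
    have "(e - \<alpha>) / e = p * (1 / p - \<alpha> / real CARD('d))"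
      using p d0 by (simp add: e_def field_simps)
    then show ?thesis unfolding \<alpha>(2)[symmetric] by simp
  qed
  have e: "\<alpha> < e" "0 < e"
  proof -
    show "0 < e" using p by (simp add: e_def)
    moreover have "0 < (e - \<alpha>) / e" unfolding pq using p q by simp
    ultimately show "\<alpha> < e" by (simp add: zero_less_divide_iff)
  qed
  define CH where "CH = geometric_const (min \<alpha> (e - \<alpha>)) * ennreal (2 powr (e - \<alpha>))"
  define MG where "MG x = maximal_fun (\<lambda>y. g y \<up> a) x" for x
  define MH where "MH x = maximal_fun (\<lambda>y. h y \<up> b) x" for x
  have [measurable]: "MG \<in> borel_measurable borel" "MH \<in> borel_measurable borel"
    unfolding MG_def MH_def by measurable
  have pointwise: "(\<integral>\<^sup>+k. ennreal (2 powr (real_of_int k * \<alpha>)) * (tri_form g h k x * indicator (good k) x) \<partial>count_space UNIV)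
      \<le> (4 * ennreal (c powr (1 / q)) * CH) * (MH x \<up> (1 / b) * MG x \<up> (p / (a * q)))" for x
  proof -
    define V where "V k = eavg (tri k x) (\<lambda>y. g y \<up> a) \<up> (1 / a)" for k
    have "ennreal (2 powr (real_of_int k * \<alpha>)) * (tri_form g h k x * indicator (good k) x)
        \<le> (4 * ennreal (c powr (1 / q)) * MH x \<up> (1 / b)) * (ennreal (2 powr (real_of_int k * \<alpha>)) * V k)" for k
    proof (cases "x \<in> good k")
      case True
      have "tri_form g h k x \<le> 4 * ennreal (c powr (1 / q)) * (eavg (tri k x) (\<lambda>x. h x \<up> b) \<up> (1 / b) * V k)"
        unfolding tri_form_def V_def using A_tri[OF True] A_cell[OF True] a b c
        by (intro bump_estimate) (auto simp: \<delta>1_def \<delta>2_def)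
      also have "\<dots> \<le> 4 * ennreal (c powr (1 / q)) * (MH x \<up> (1 / b) * V k)"
        using b unfolding MH_def
        by (intro mult_left_mono mult_right_mono epowr_mono eavg_tri_le_maximal_fun) auto
      finally have "ennreal (2 powr (real_of_int k * \<alpha>)) * tri_form g h k x
          \<le> ennreal (2 powr (real_of_int k * \<alpha>)) * (4 * ennreal (c powr (1 / q)) * (MH x \<up> (1 / b) * V k))"
        by (rule mult_left_mono) simp
      then show ?thesis using True by (simp add: mult_ac)
    qed simp
    then have "(\<integral>\<^sup>+k. ennreal (2 powr (real_of_int k * \<alpha>)) * (tri_form g h k x * indicator (good k) x) \<partial>count_space UNIV)
        \<le> (\<integral>\<^sup>+k. (4 * ennreal (c powr (1 / q)) * MH x \<up> (1 / b)) * (ennreal (2 powr (real_of_int k * \<alpha>)) * V k) \<partial>count_space UNIV)"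
      by (intro nn_integral_mono)
    also have "\<dots> = (4 * ennreal (c powr (1 / q)) * MH x \<up> (1 / b)) *
        (\<integral>\<^sup>+k. ennreal (2 powr (real_of_int k * \<alpha>)) * V k \<partial>count_space UNIV)"
      by (rule nn_integral_cmult) simp
    also have "(\<integral>\<^sup>+k. ennreal (2 powr (real_of_int k * \<alpha>)) * V k \<partial>count_space UNIV)
        \<le> CH * (MG x \<up> (1 / a)) \<up> ((e - \<alpha>) / e)"
      unfolding CH_def
    proof (rule Hedberg_sum[OF \<alpha>(1) e(1)])
      fix k
      show "V k \<le> MG x \<up> (1 / a)"
        using a unfolding V_def MG_def by (intro epowr_mono eavg_tri_le_maximal_fun) auto
      have "V k \<le> eavg (tri k x) (\<lambda>y. g y \<up> p) \<up> (1 / p)"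
        unfolding V_def using a emeasure_cubes_bounds by (intro eavg_epowr_mono) auto
      also have "\<dots> \<le> ennreal (2 powr (- real_of_int k * real CARD('d))) \<up> (1 / p)"
      proof (intro epowr_mono)
        have "(\<integral>\<^sup>+y\<in>tri k x. g y \<up> p \<partial>lborel) \<le> (\<integral>\<^sup>+y. g y \<up> p \<partial>lborel)"
          by (intro nn_integral_mono) (auto split: split_indicator)
        also have "\<dots> \<le> ennreal (2 powr (- real_of_int k * real CARD('d)) * (3 ^ CARD('d) * volume TYPE('d) k))"
        proof -
          have "2 powr (- real_of_int k * real CARD('d)) * (3 ^ CARD('d) * volume TYPE('d) k) = (3 :: real) ^ CARD('d)"
            by (simp add: powr_minus)
          moreover have "(1 :: real) \<le> 3 ^ CARD('d)" by (rule one_le_power) simp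
          ultimately have "ennreal 1 \<le> ennreal (2 powr (- real_of_int k * real CARD('d)) * (3 ^ CARD('d) * volume TYPE('d) k))"
            by (intro ennreal_leI) linarith
          moreover have "(\<integral>\<^sup>+y. g y \<up> p \<partial>lborel) \<le> ennreal 1" using g by simp
          ultimately show ?thesis by (rule order_trans[rotated])
        qed
        finally show "eavg (tri k x) (\<lambda>y. g y \<up> p) \<le> ennreal (2 powr (- real_of_int k * real CARD('d)))"
          unfolding eavg_cube_simps emeasure_tri by (simp add: ennreal_mult[symmetric])
      qed (use p in simp)
      also have "\<dots> = ennreal (2 powr (- real_of_int k * e))"
        by (simp add: epowr_ennreal powr_powr e_def)
      finally show "V k \<le> ennreal (2 powr (- real_of_int k * e))" .
    qed
    finally show ?thesis
      by (simp add: pq epowr_epowr mult_ac mult_left_mono mult_right_mono)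
  qed
  have "(\<integral>\<^sup>+x. (\<integral>\<^sup>+k. ennreal (2 powr (real_of_int k * \<alpha>)) * (tri_form g h k x * indicator (good k) x)
      \<partial>count_space UNIV) \<partial>lborel)
    \<le> (\<integral>\<^sup>+x. (4 * ennreal (c powr (1 / q)) * CH) * (MH x \<up> (1 / b) * MG x \<up> (p / (a * q))) \<partial>lborel)"
    by (intro nn_integral_mono pointwise)
  also have "\<dots> = (4 * ennreal (c powr (1 / q)) * CH) * (\<integral>\<^sup>+x. MH x \<up> (1 / b) * MG x \<up> (p / (a * q)) \<partial>lborel)"
    by (rule nn_integral_cmult) measurable
  also have "(\<integral>\<^sup>+x. MH x \<up> (1 / b) * MG x \<up> (p / (a * q)) \<partial>lborel)
      \<le> (\<integral>\<^sup>+x. (MH x \<up> (1 / b)) \<up> s \<partial>lborel) \<up> (1 / s) * (\<integral>\<^sup>+x. (MG x \<up> (p / (a * q))) \<up> q \<partial>lborel) \<up> (1 / q)"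
    using s s' q by (intro nn_integral_Holder) auto
  also have "\<dots> \<le> ennreal M2 \<up> (1 / s) * ennreal M1 \<up> (1 / q)"
  proof (intro mult_mono epowr_mono)
    show "(\<integral>\<^sup>+x. (MH x \<up> (1 / b)) \<up> s \<partial>lborel) \<le> ennreal M2"
      using b(4) unfolding MH_def M2_def epowr_epowr by simp
    have "p / (a * q) * q = p / a" using q by simp
    then show "(\<integral>\<^sup>+x. (MG x \<up> (p / (a * q))) \<up> q \<partial>lborel) \<le> ennreal M1"
      using a(4) unfolding MG_def M1_def epowr_epowr by simp
  qed (use s q in auto)
  finally have *: "(\<integral>\<^sup>+x. (\<integral>\<^sup>+k. ennreal (2 powr (real_of_int k * \<alpha>)) * (tri_form g h k x * indicator (good k) x)
      \<partial>count_space UNIV) \<partial>lborel)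
    \<le> (4 * ennreal (c powr (1 / q)) * CH) * (ennreal M2 \<up> (1 / s) * ennreal M1 \<up> (1 / q))"
    by (simp add: mult_left_mono)
  define N1 where "N1 = 3 ^ CARD('d) * 2 powr p * p * 2 / (p - 1) * (8 * 3 ^ CARD('d) * 2 powr (P / q))"
  define N2 where "N2 = 3 ^ CARD('d) * 2 powr s * s * 2 / (s - 1) * (8 * 3 ^ CARD('d) * 2 powr (q / P))"
  have N: "0 \<le> N1" "0 \<le> N2" using p s by (auto simp: N1_def N2_def)
  have "1 / \<delta>1 = 8 * 3 ^ CARD('d) * 2 powr (P / q) * c powr (P / q)"
    using c by (simp add: \<delta>1_def powr_divide powr_mult)
  then have \<delta>1_inv: "1 / \<delta>1 = 8 * 3 ^ CARD('d) * 2 powr (P / q) * c powr (P / q)" .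
  have "M1 = 3 ^ CARD('d) * 2 powr p * p * 2 / (p - 1) * (1 / \<delta>1)"
    by (simp add: M1_def)
  then have M1: "M1 = N1 * c powr (P / q)"
    unfolding \<delta>1_inv N1_def by (simp only: mult_ac)
  have "1 / \<delta>2 = 8 * 3 ^ CARD('d) * 2 powr (q / P) * c"
    using c by (simp add: \<delta>2_def powr_divide)
  then have \<delta>2_inv: "1 / \<delta>2 = 8 * 3 ^ CARD('d) * 2 powr (q / P) * c" .
  have "M2 = 3 ^ CARD('d) * 2 powr s * s * 2 / (s - 1) * (1 / \<delta>2)"
    by (simp add: M2_def)
  then have M2: "M2 = N2 * c"
    unfolding \<delta>2_inv N2_def by (simp only: mult_ac)
  have "ennreal M2 \<up> (1 / s) = ennreal (N2 powr (1 / s)) * ennreal (c powr (1 / s))"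
  proof -
    have "ennreal M2 \<up> (1 / s) = ennreal ((N2 * c) powr (1 / s))"
      unfolding M2 by (rule epowr_ennreal) (use N c in simp)
    then show ?thesis using N c by (simp add: powr_mult ennreal_mult)
  qed
  moreover have "ennreal M1 \<up> (1 / q) = ennreal (N1 powr (1 / q)) * ennreal (c powr (P / (q * q)))"
  proof -
    have "ennreal M1 \<up> (1 / q) = ennreal ((N1 * c powr (P / q)) powr (1 / q))"
      unfolding M1 by (rule epowr_ennreal) (use N c in simp)
    then show ?thesis using N c by (simp add: powr_mult powr_powr ennreal_mult)
  qed
  moreover have "ennreal (c powr (1 + P / (q * q)))
      = ennreal (c powr (1 / q)) * (ennreal (c powr (1 / s)) * ennreal (c powr (P / (q * q))))"
  proof -
    have "1 + P / (q * q) = 1 / q + (1 / s + P / (q * q))" using s by simp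
    then have "c powr (1 + P / (q * q)) = c powr (1 / q) * (c powr (1 / s) * c powr (P / (q * q)))"
      by (simp only: powr_add)
    then show ?thesis by (simp add: ennreal_mult)
  qed
  ultimately show ?thesis
    using * unfolding small_scales_const_def CH_def e_def N1_def N2_def by (simp only: mult_ac)
qed

text \<open>At large scales no bump is needed, as the powers of \<open>m = 1 + 2 powr k / \<rho>\<close> pay for the growth of
  the constants and for the summation over the scales.\<close>
lemma large_scales:
  fixes g h \<rho>' :: "real ^ 'd \<Rightarrow> ennreal" and \<rho> :: "real ^ 'd \<Rightarrow> real" and B p s \<alpha> C1 \<kappa> \<tau> :: real
  assumes [measurable]: "g \<in> borel_measurable borel" "h \<in> borel_measurable borel" "\<rho> \<in> borel_measurable borel"
    and p: "1 < p" "1 / p + 1 / P = 1" and s: "1 < s" "1 / q + 1 / s = 1"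
    and \<alpha>: "0 < \<alpha>" "1 / q = 1 / p - \<alpha> / real CARD('d)"
    and g: "(\<integral>\<^sup>+x. g x \<up> p \<partial>lborel) \<le> 1" and h: "(\<integral>\<^sup>+x. h x \<up> s \<partial>lborel) \<le> 1"
    and \<rho>: "\<And>x. 0 < \<rho> x"
  defines "m \<equiv> \<lambda>k x. 1 + 2 powr real_of_int k / \<rho> x"
  assumes comparable: "\<And>k x y. y \<in> tri k x \<Longrightarrow> m k y \<le> C1 * m k x powr \<kappa>"
    and C1: "1 \<le> C1" and \<kappa>: "1 \<le> \<kappa>" and B: "0 \<le> B"
    and A_tri: "\<And>k x. A_const (tri k x) \<le> ennreal (B * m k x powr \<tau>)"
  shows "(\<integral>\<^sup>+x. (\<integral>\<^sup>+k. ennreal (2 powr (real_of_int k * \<alpha>)) * (ennreal (m k x powr - (\<kappa> + \<tau> / q)) *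
      (tri_form g h k x * indicator {x. C1 * 2 powr \<kappa> \<le> m k x} x)) \<partial>count_space UNIV) \<partial>lborel)
    \<le> ennreal (B powr (1 / q)) * (ennreal (3 ^ CARD('d) * C1) * (geometric_const 1 * 2))"
proof -
  define w where "w k y = ennreal (if 2 \<le> m k y then 1 / m k y else 0)" for k y
  have [measurable]: "m k \<in> borel_measurable borel" for k unfolding m_def by measurable
  have [measurable]: "w k \<in> borel_measurable borel" for k unfolding w_def by measurable
  define f where "f y = h y \<up> s + g y \<up> p" for y
  have [measurable]: "f \<in> borel_measurable borel" unfolding f_def by measurable
  have m1: "1 \<le> m k x" for k x using \<rho>[of x] by (simp add: m_def)
  have d0: "0 < real CARD('d)" by simp
  have pointwise: "ennreal (2 powr (real_of_int k * \<alpha>)) * (ennreal (m k x powr - (\<kappa> + \<tau> / q)) *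
      (tri_form g h k x * indicator {x. C1 * 2 powr \<kappa> \<le> m k x} x))
    \<le> ennreal (B powr (1 / q) * C1 * 2 powr (- real_of_int k * real CARD('d))) * (\<integral>\<^sup>+y. f y * w k y * indicator (tri k x) y \<partial>lborel)"
    for k x
  proof (cases "C1 * 2 powr \<kappa> \<le> m k x")
    case big: True
    define Q where "Q = tri k x"
    have [measurable]: "Q \<in> sets borel" by (simp add: Q_def)
    define W where "W = 2 powr (- real_of_int k * real CARD('d))"
    define X where "X = (\<integral>\<^sup>+y\<in>Q. h y \<up> s \<partial>lborel)"
    define Y where "Y = (\<integral>\<^sup>+y\<in>Q. g y \<up> p \<partial>lborel)"
    have avg: "eavg Q u \<le> ennreal W * (\<integral>\<^sup>+y\<in>Q. u y \<partial>lborel)" for u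
    proof -
      have "1 * (\<integral>\<^sup>+y\<in>Q. u y \<partial>lborel) \<le> ennreal (W * (3 ^ CARD('d) * volume TYPE('d) k)) * (\<integral>\<^sup>+y\<in>Q. u y \<partial>lborel)"
      proof (intro mult_right_mono)
        have "W * (3 ^ CARD('d) * volume TYPE('d) k) = 3 ^ CARD('d)"
          by (simp add: W_def powr_minus)
        moreover have "(1 :: real) \<le> 3 ^ CARD('d)" by (rule one_le_power) simp
        ultimately have "ennreal 1 \<le> ennreal (W * (3 ^ CARD('d) * volume TYPE('d) k))"
          by (intro ennreal_leI) linarith
        then show "1 \<le> ennreal (W * (3 ^ CARD('d) * volume TYPE('d) k))" by (simp only: ennreal_1)
      qed simp
      then show ?thesis
        unfolding Q_def eavg_cube_simps emeasure_tri by (simp add: ennreal_mult W_def mult_ac)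
    qed
    have Y1: "Y \<le> 1"
    proof -
      have "Y \<le> (\<integral>\<^sup>+y. g y \<up> p \<partial>lborel)"
        unfolding Y_def by (intro nn_integral_mono) (auto split: split_indicator)
      then show ?thesis using g by simp
    qed
    have "tri_form g h k x \<le> A_const Q \<up> (1 / q) * (eavg Q (\<lambda>x. h x \<up> s) \<up> (1 / s) * eavg Q (\<lambda>y. g y \<up> p) \<up> (1 / p))"
      unfolding tri_form_def A_const_def Q_def using p s P q
      by (intro eavg_mixed_Holder emeasure_cubes_bounds) (auto simp: add.commute)
    also have "\<dots> \<le> ennreal (B * m k x powr \<tau>) \<up> (1 / q) * ((ennreal W * X) \<up> (1 / s) * (ennreal W * Y) \<up> (1 / p))"
      unfolding X_def Y_def using p s q A_tri[of k x]
      by (intro mult_mono epowr_mono avg) (auto simp: Q_def)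
    also have "(ennreal W * X) \<up> (1 / s) * (ennreal W * Y) \<up> (1 / p)
        = ennreal W \<up> (1 / s + 1 / p) * (X \<up> (1 / s) * Y \<up> (1 / p))"
      using p s by (simp add: epowr_mult epowr_add mult_ac)
    \<comment> \<open>As \<open>1 / p = 1 / q + \<alpha> / d\<close> and \<open>Y \<le> 1\<close>,
      the surplus power may be dropped. The remaining exponents \<open>1 / s\<close> and
      \<open>1 / q\<close> add up to one, so the product is at most \<open>X + Y\<close> and becomes
      additive in the cubes.\<close>
    also have "Y \<up> (1 / p) = Y \<up> (1 / q) * Y \<up> (\<alpha> / real CARD('d))"
      using \<alpha> by (simp add: epowr_add[symmetric])
    also have "ennreal (B * m k x powr \<tau>) \<up> (1 / q) = ennreal (B powr (1 / q) * m k x powr (\<tau> / q))"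
      using B m1[of k x] by (simp add: epowr_ennreal powr_mult powr_powr)
    \<comment> \<open>By \<open>1 / s + 1 / p = 1 + \<alpha> / d\<close> the normalising factors
      contain an additional \<open>2 powr (- k * \<alpha>)\<close>, which cancels the weight of
      scale \<open>k\<close> in the sum.\<close>
    also have "ennreal W \<up> (1 / s + 1 / p) = ennreal (2 powr (- real_of_int k * (real CARD('d) + \<alpha>)))"
    proof -
      have "1 / s + 1 / p = 1 + \<alpha> / real CARD('d)" using s \<alpha> by simp
      then have "- real_of_int k * real CARD('d) * (1 / s + 1 / p) = - real_of_int k * (real CARD('d) + \<alpha>)"
        using d0 by (simp add: field_simps)
      then show ?thesis by (simp only: W_def epowr_ennreal powr_powr powr_ge_zero)
    qed
    also have "X \<up> (1 / s) * (Y \<up> (1 / q) * Y \<up> (\<alpha> / real CARD('d))) \<le> X + Y"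
    proof -
      have "Y \<up> (\<alpha> / real CARD('d)) \<le> 1"
        using epowr_mono[OF _ Y1, of "\<alpha> / real CARD('d)"] \<alpha> by simp
      then have "X \<up> (1 / s) * (Y \<up> (1 / q) * Y \<up> (\<alpha> / real CARD('d))) \<le> X \<up> (1 / s) * (Y \<up> (1 / q) * 1)"
        by (intro mult_left_mono) auto
      also have "\<dots> \<le> X + Y"
        using epowr_mult_le_add[of "1 / s" "1 / q" X Y] s q by simp
      finally show ?thesis .
    qed
    finally have "tri_form g h k x \<le> ennreal (B powr (1 / q) * m k x powr (\<tau> / q)) *
        (ennreal (2 powr (- real_of_int k * (real CARD('d) + \<alpha>))) * (X + Y))"
      by (simp add: mult_left_mono)
    then have "ennreal (2 powr (real_of_int k * \<alpha>)) * (ennreal (m k x powr - (\<kappa> + \<tau> / q)) * tri_form g h k x)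
      \<le> ennreal (2 powr (real_of_int k * \<alpha>)) * (ennreal (m k x powr - (\<kappa> + \<tau> / q)) *
        (ennreal (B powr (1 / q) * m k x powr (\<tau> / q)) * (ennreal (2 powr (- real_of_int k * (real CARD('d) + \<alpha>))) * (X + Y))))"
      by (intro mult_left_mono) auto
    also have "\<dots> = ennreal (B powr (1 / q) * (m k x powr - \<kappa>) * W) * (X + Y)"
    proof -
      have "2 powr (real_of_int k * \<alpha>) * 2 powr (- real_of_int k * (real CARD('d) + \<alpha>)) = W"
        unfolding W_def powr_add[symmetric] by (simp add: algebra_simps)
      moreover have "m k x powr - (\<kappa> + \<tau> / q) * m k x powr (\<tau> / q) = m k x powr - \<kappa>"
        unfolding powr_add[symmetric] by simp
      ultimately have "2 powr (real_of_int k * \<alpha>) * (m k x powr - (\<kappa> + \<tau> / q) *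
          (B powr (1 / q) * m k x powr (\<tau> / q) * 2 powr (- real_of_int k * (real CARD('d) + \<alpha>))))
          = B powr (1 / q) * (m k x powr - \<kappa>) * W" (is "?l = _")
      proof -
        have "?l = B powr (1 / q) * (m k x powr - (\<kappa> + \<tau> / q) * m k x powr (\<tau> / q)) *
            (2 powr (real_of_int k * \<alpha>) * 2 powr (- real_of_int k * (real CARD('d) + \<alpha>)))"
          by (simp only: mult_ac)
        also have "\<dots> = B powr (1 / q) * (m k x powr - \<kappa>) * W"
          by (simp only: \<open>2 powr (real_of_int k * \<alpha>) * 2 powr (- real_of_int k * (real CARD('d) + \<alpha>)) = W\<close>
              \<open>m k x powr - (\<kappa> + \<tau> / q) * m k x powr (\<tau> / q) = m k x powr - \<kappa>\<close>)
        finally show ?thesis .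
      qed
      moreover have "ennreal (2 powr (real_of_int k * \<alpha>)) * (ennreal (m k x powr - (\<kappa> + \<tau> / q)) *
        (ennreal (B powr (1 / q) * m k x powr (\<tau> / q)) * (ennreal (2 powr (- real_of_int k * (real CARD('d) + \<alpha>))) * (X + Y))))
        = ennreal ?l * (X + Y)"
        by (simp add: ennreal_mult mult.assoc)
      ultimately show ?thesis by (simp only:)
    qed
    also have "\<dots> = ennreal (B powr (1 / q) * W) * (\<integral>\<^sup>+y. ennreal (m k x powr - \<kappa>) * (f y * indicator Q y) \<partial>lborel)"
    proof -
      have "X + Y = (\<integral>\<^sup>+y. f y * indicator Q y \<partial>lborel)"
        unfolding X_def Y_def f_def by (simp add: distrib_right nn_integral_add)
      then show ?thesis
        by (subst nn_integral_cmult) (auto simp: ennreal_mult mult_ac W_def)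
    qed
    also have "\<dots> \<le> ennreal (B powr (1 / q) * W) * (\<integral>\<^sup>+y. ennreal C1 * (f y * w k y * indicator Q y) \<partial>lborel)"
    proof (intro mult_left_mono nn_integral_mono)
      fix y
      show "ennreal (m k x powr - \<kappa>) * (f y * indicator Q y) \<le> ennreal C1 * (f y * w k y * indicator Q y)"
      proof (cases "y \<in> Q")
        case True
        \<comment> \<open>Comparability is used in both directions: it moves the decay from
          \<open>x\<close> to \<open>y\<close> as
          \<open>m k x powr - \<kappa> \<le> C1 / m k y\<close>, and the threshold
          \<open>C1 * 2 powr \<kappa>\<close> for \<open>m k x\<close> forces
          \<open>m k y \<ge> 2\<close>. Both together allow the summation over \<open>k\<close> for
          fixed \<open>y\<close>.\<close>
        have yx: "m k y \<le> C1 * m k x powr \<kappa>" using comparable True by (simp add: Q_def)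
        have "x \<in> tri k y" using True tri_sym unfolding Q_def by blast
        then have "C1 * 2 powr \<kappa> \<le> C1 * m k y powr \<kappa>" using comparable[of x k y] big by linarith
        then have "2 powr \<kappa> \<le> m k y powr \<kappa>" using C1 by simp
        then have two: "2 \<le> m k y" using \<kappa> m1[of k y] powr_less_mono2[of \<kappa> "m k y" 2] by linarith
        have "m k x powr - \<kappa> = 1 / (m k x powr \<kappa>)" by (simp add: powr_minus_divide)
        also have "\<dots> \<le> C1 * (1 / m k y)"
          using yx C1 two m1[of k x] by (simp add: field_simps)
        finally have "ennreal (m k x powr - \<kappa>) \<le> ennreal C1 * w k y"
          using two C1 by (simp add: w_def ennreal_mult[symmetric] ennreal_leI)
        from mult_right_mono[OF this, of "f y"] show ?thesis using True by (simp add: mult_ac)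
      qed simp
    qed simp
    also have "\<dots> = ennreal (B powr (1 / q) * C1 * W) * (\<integral>\<^sup>+y. f y * w k y * indicator Q y \<partial>lborel)"
      using C1 by (subst nn_integral_cmult) (auto simp: ennreal_mult mult_ac W_def)
    finally show ?thesis using big unfolding Q_def W_def by simp
  qed simp
  have "(\<integral>\<^sup>+x. (\<integral>\<^sup>+k. ennreal (2 powr (real_of_int k * \<alpha>)) * (ennreal (m k x powr - (\<kappa> + \<tau> / q)) *
      (tri_form g h k x * indicator {x. C1 * 2 powr \<kappa> \<le> m k x} x)) \<partial>count_space UNIV) \<partial>lborel)
    = (\<integral>\<^sup>+k. (\<integral>\<^sup>+x. ennreal (2 powr (real_of_int k * \<alpha>)) * (ennreal (m k x powr - (\<kappa> + \<tau> / q)) *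
      (tri_form g h k x * indicator {x. C1 * 2 powr \<kappa> \<le> m k x} x)) \<partial>lborel) \<partial>count_space UNIV)"
    by (rule nn_integral_count_space_nn_integral) auto
  also have "\<dots> \<le> (\<integral>\<^sup>+k. (\<integral>\<^sup>+x. ennreal (B powr (1 / q) * C1 * 2 powr (- real_of_int k * real CARD('d))) *
      (\<integral>\<^sup>+y. f y * w k y * indicator (tri k x) y \<partial>lborel) \<partial>lborel) \<partial>count_space UNIV)"
    by (intro nn_integral_mono pointwise)
  also have "\<dots> = (\<integral>\<^sup>+k. ennreal (B powr (1 / q) * C1 * 3 ^ CARD('d)) * (\<integral>\<^sup>+y. f y * w k y \<partial>lborel) \<partial>count_space UNIV)"
  proof (intro nn_integral_cong)
    fix k :: int
    have "(\<lambda>(x, y). f y * w k y * indicator (tri k x) y) \<in> borel_measurable (lborel \<Otimes>\<^sub>M lborel)"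
      by (simp add: indicator_def split_beta')
    then have "(\<lambda>x. \<integral>\<^sup>+y. f y * w k y * indicator (tri k x) y \<partial>lborel) \<in> borel_measurable lborel"
      by (rule lborel.borel_measurable_nn_integral)
    then have "(\<integral>\<^sup>+x. ennreal (B powr (1 / q) * C1 * 2 powr (- real_of_int k * real CARD('d))) *
        (\<integral>\<^sup>+y. f y * w k y * indicator (tri k x) y \<partial>lborel) \<partial>lborel)
      = ennreal (B powr (1 / q) * C1 * 2 powr (- real_of_int k * real CARD('d))) *
        (ennreal (3 ^ CARD('d) * volume TYPE('d) k) * (\<integral>\<^sup>+y. f y * w k y \<partial>lborel))"
      by (simp add: nn_integral_cmult nn_integral_tri_average del: emeasure_tri)
    also have "\<dots> = ennreal (B powr (1 / q) * C1 * 2 powr (- real_of_int k * real CARD('d)) *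
        (3 ^ CARD('d) * volume TYPE('d) k)) * (\<integral>\<^sup>+y. f y * w k y \<partial>lborel)"
      using C1 by (simp add: ennreal_mult mult.assoc)
    also have "B powr (1 / q) * C1 * 2 powr (- real_of_int k * real CARD('d)) * (3 ^ CARD('d) * volume TYPE('d) k)
        = B powr (1 / q) * C1 * 3 ^ CARD('d)"
      by (simp add: powr_minus)
    finally show "(\<integral>\<^sup>+x. ennreal (B powr (1 / q) * C1 * 2 powr (- real_of_int k * real CARD('d))) *
        (\<integral>\<^sup>+y. f y * w k y * indicator (tri k x) y \<partial>lborel) \<partial>lborel)
      = ennreal (B powr (1 / q) * C1 * 3 ^ CARD('d)) * (\<integral>\<^sup>+y. f y * w k y \<partial>lborel)" .
  qed
  also have "\<dots> = ennreal (B powr (1 / q) * C1 * 3 ^ CARD('d)) * (\<integral>\<^sup>+k. (\<integral>\<^sup>+y. f y * w k y \<partial>lborel) \<partial>count_space UNIV)"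
    by (rule nn_integral_cmult) simp
  also have "(\<integral>\<^sup>+k. (\<integral>\<^sup>+y. f y * w k y \<partial>lborel) \<partial>count_space UNIV) = (\<integral>\<^sup>+y. (\<integral>\<^sup>+k. f y * w k y \<partial>count_space UNIV) \<partial>lborel)"
    by (rule nn_integral_count_space_nn_integral[symmetric]) auto
  also have "\<dots> \<le> (\<integral>\<^sup>+y. geometric_const 1 * f y \<partial>lborel)"
  proof (intro nn_integral_mono)
    fix y
    have "(\<integral>\<^sup>+k. f y * w k y \<partial>count_space UNIV) = f y * (\<integral>\<^sup>+k. w k y \<partial>count_space UNIV)"
      by (rule nn_integral_cmult) simp
    also have "\<dots> \<le> f y * geometric_const 1"
      unfolding w_def m_def by (intro mult_left_mono large_scales_sum \<rho>) simp
    finally show "(\<integral>\<^sup>+k. f y * w k y \<partial>count_space UNIV) \<le> geometric_const 1 * f y"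
      by (simp add: mult.commute)
  qed
  also have "\<dots> = geometric_const 1 * (\<integral>\<^sup>+y. f y \<partial>lborel)"
    by (rule nn_integral_cmult) measurable
  also have "(\<integral>\<^sup>+y. f y \<partial>lborel) = (\<integral>\<^sup>+y. h y \<up> s \<partial>lborel) + (\<integral>\<^sup>+y. g y \<up> p \<partial>lborel)"
    unfolding f_def by (rule nn_integral_add) measurable
  also have "\<dots> \<le> 2"
    using add_mono[OF h g] by simp
  finally show ?thesis
    using C1 by (simp add: ennreal_mult mult_left_mono mult_right_mono mult_ac)
qed

end

section \<open>Critical radius functions and the kernel of the fractional integral\<close>

text \<open>A critical radius function need not be measurable; its upper envelope over the balls
  \<open>ball y (\<rho> y)\<close> is lower semicontinuous and comparable to it.\<close>
lemma critical_radius_function_measurable: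
  fixes \<rho> :: "real ^ 'd \<Rightarrow> real"
  assumes "critical_radius_function \<rho>"
  obtains \<rho>' C1 \<kappa> where "\<rho>' \<in> borel_measurable borel" "\<And>x. 0 < \<rho>' x" "1 \<le> C1" "1 \<le> \<kappa>"
    "\<And>x. \<rho> x \<le> \<rho>' x"
    "\<And>k x y. y \<in> tri k x \<Longrightarrow> 1 + 2 powr real_of_int k / \<rho> y \<le> C1 * (1 + 2 powr real_of_int k / \<rho>' x) powr \<kappa>"
proof -
  obtain C0 N0 where C0: "0 < C0" and N0: "0 < N0" and pos: "\<And>x. 0 < \<rho> x"
    and low: "\<And>x y. \<rho> x / C0 * (1 + norm (x - y) / \<rho> x) powr (- N0) \<le> \<rho> y"
    using assms unfolding critical_radius_function_def by blast
  have C0_1: "1 \<le> C0"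
  proof -
    have "\<rho> 0 / C0 \<le> \<rho> 0" using low[of 0 0] pos[of 0] by simp
    then show ?thesis using C0 pos[of 0] by (simp add: divide_le_eq)
  qed
  \<comment> \<open>If \<open>y\<close> is at distance less than \<open>\<rho> y\<close> from
    \<open>x\<close>, the bracket in the lower bound for \<open>\<rho> x\<close> is at most
    \<open>2\<close>; so all values competing in the supremum at \<open>x\<close> are at most
    \<open>D * \<rho> x\<close>.\<close>
  define D where "D = C0 * 2 powr N0"
  have D: "1 \<le> D"
    unfolding D_def using C0_1 N0 mult_mono[of 1 C0 1 "2 powr N0"] ge_one_powr_ge_zero[of 2 N0] by simp
  have near: "\<rho> y \<le> D * \<rho> x" if "norm (y - x) < \<rho> y" for x y
  proof -
    have "(2 :: real) powr - N0 \<le> (1 + norm (y - x) / \<rho> y) powr - N0"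
    proof (rule powr_mono2')
      show "0 < 1 + norm (y - x) / \<rho> y" using pos[of y] by (simp add: add_pos_nonneg)
      show "1 + norm (y - x) / \<rho> y \<le> 2" using that pos[of y] by (simp add: divide_le_eq)
    qed (use N0 in simp)
    then have "\<rho> y / C0 * 2 powr - N0 \<le> \<rho> y / C0 * (1 + norm (y - x) / \<rho> y) powr - N0"
      using pos[of y] C0 by (intro mult_left_mono) auto
    also have "\<dots> \<le> \<rho> x" by (rule low)
    finally show ?thesis
      using C0 by (simp add: D_def powr_minus divide_simps mult_ac)
  qed
  define \<rho>' where "\<rho>' x = (SUP y\<in>{y. norm (y - x) < \<rho> y}. \<rho> y)" for x
  have bdd: "bdd_above (\<rho> ` {y. norm (y - x) < \<rho> y})" for x
    using near by (intro bdd_aboveI[of _ "D * \<rho> x"]) auto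
  have ne: "{y. norm (y - x) < \<rho> y} \<noteq> {}" for x
    using pos[of x] by (auto intro!: exI[of _ x])
  have le: "\<rho> x \<le> \<rho>' x" for x
    unfolding \<rho>'_def using pos[of x] by (intro cSUP_upper bdd) auto
  have ge: "\<rho>' x \<le> D * \<rho> x" for x
    unfolding \<rho>'_def using near by (intro cSUP_least ne) auto
  have meas: "\<rho>' \<in> borel_measurable borel"
  proof (rule borel_measurableI_greater)
    fix a
    have "{x. a < \<rho>' x} = (\<Union>y\<in>{y. a < \<rho> y}. ball y (\<rho> y))"
    proof (intro set_eqI)
      fix x
      have "a < \<rho>' x \<longleftrightarrow> (\<exists>y\<in>{y. norm (y - x) < \<rho> y}. a < \<rho> y)"
        unfolding \<rho>'_def by (rule less_cSUP_iff[OF ne bdd])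
      then show "x \<in> {x. a < \<rho>' x} \<longleftrightarrow> x \<in> (\<Union>y\<in>{y. a < \<rho> y}. ball y (\<rho> y))"
        by (auto simp: dist_norm)
    qed
    then have "open {x. a < \<rho>' x}" by auto
    then show "{x \<in> space borel. a < \<rho>' x} \<in> sets borel" by simp
  qed
  define d where "d = 3 * real CARD('d)"
  have "1 \<le> real CARD('d)" by (simp add: Suc_leI)
  then have d: "1 \<le> d" unfolding d_def by linarith
  \<comment> \<open>The exponent \<open>N0 + 1\<close> arises from \<open>N0\<close> in the lower
    bound for \<open>\<rho> y\<close> and one more factor \<open>m\<close> from
    \<open>a / \<rho> x \<le> m\<close>. The power of \<open>D\<close> pays for the passage from
    \<rho> to its envelope, that of \<open>d\<close> for the diameter of
    \<open>tri k x\<close>.\<close>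
  define C1 where "C1 = (1 + C0 * d powr N0) * D powr (N0 + 1)"
  have "1 + 2 powr real_of_int k / \<rho> y \<le> C1 * (1 + 2 powr real_of_int k / \<rho>' x) powr (N0 + 1)"
    if "y \<in> tri k x" for k x y
  proof -
    define a where "a = 2 powr real_of_int k"
    define m where "m = 1 + a / \<rho> x"
    have a: "0 < a" by (simp add: a_def)
    have m: "1 \<le> m" using a pos[of x] by (simp add: m_def)
    have "norm (x - y) \<le> d * a" using tri_norm[OF that] by (simp add: d_def a_def)
    then have "norm (x - y) / \<rho> x \<le> d * a / \<rho> x" using pos[of x] by (simp add: divide_right_mono)
    then have "1 + norm (x - y) / \<rho> x \<le> d * m"
      using d unfolding m_def by (simp add: distrib_left)
    moreover have "0 < 1 + norm (x - y) / \<rho> x" using pos[of x] by (simp add: add_pos_nonneg)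
    ultimately have pw: "(d * m) powr - N0 \<le> (1 + norm (x - y) / \<rho> x) powr - N0"
      using N0 by (intro powr_mono2') auto
    have "\<rho> x / C0 * (d * m) powr - N0 \<le> \<rho> y"
      using mult_left_mono[OF pw, of "\<rho> x / C0"] low[of x y] pos[of x] C0 by simp
    then have "a / \<rho> y \<le> a / (\<rho> x / C0 * (d * m) powr - N0)"
      using a pos[of x] pos[of y] C0 d m by (intro divide_left_mono) auto
    also have "\<dots> = a / \<rho> x * (C0 * d powr N0 * m powr N0)"
      using d m C0 pos[of x] by (simp add: powr_minus powr_mult divide_simps)
    also have "\<dots> \<le> m * (C0 * d powr N0 * m powr N0)"
      using C0 by (intro mult_right_mono) (auto simp: m_def)
    also have "\<dots> = C0 * d powr N0 * m powr (N0 + 1)"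
      using m by (simp add: powr_add mult_ac)
    finally have "1 + a / \<rho> y \<le> 1 + C0 * d powr N0 * m powr (N0 + 1)" by simp
    also have "\<dots> \<le> (1 + C0 * d powr N0) * m powr (N0 + 1)"
      using m N0 ge_one_powr_ge_zero[of m "N0 + 1"] by (simp add: distrib_right)
    also have "m powr (N0 + 1) \<le> (D * (1 + a / \<rho>' x)) powr (N0 + 1)"
    proof (intro powr_mono2)
      have "a / \<rho> x \<le> D * (a / \<rho>' x)"
        using ge[of x] le[of x] pos[of x] a by (simp add: divide_simps mult_ac)
      then show "m \<le> D * (1 + a / \<rho>' x)" using D by (simp add: m_def distrib_left)
    qed (use N0 m in auto)
    also have "\<dots> = D powr (N0 + 1) * (1 + a / \<rho>' x) powr (N0 + 1)"
      using D a le[of x] pos[of x] by (simp add: powr_mult)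
    finally show ?thesis
      using C0 by (simp add: C1_def a_def mult.assoc mult_left_mono)
  qed
  moreover have "1 \<le> C1"
    unfolding C1_def using C0 D N0 ge_one_powr_ge_zero[of D "N0 + 1"]
      mult_mono[of 1 "1 + C0 * d powr N0" 1 "D powr (N0 + 1)"] by simp
  moreover have "0 < \<rho>' x" for x using le[of x] pos[of x] by simp
  ultimately show thesis
    using that[of \<rho>' C1 "N0 + 1"] meas le N0 by simp
qed

section \<open>Heat kernel bounds and their integration in time\<close>

lemma exp_minus_le_powr:
  fixes u M :: real
  assumes "0 < u" "0 < M"
  shows "exp (- u) \<le> (M / u) powr M"
proof -
  have "u / M \<le> exp (u / M)" using exp_ge_add_one_self[of "u / M"] by linarith
  then have "(u / M) powr M \<le> exp (u / M) powr M" using assms by (intro powr_mono2) auto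
  also have "\<dots> = exp u" using assms by (simp add: powr_def)
  finally have "1 / exp u \<le> 1 / (u / M) powr M" using assms by (intro divide_left_mono) auto
  then show ?thesis using assms by (simp add: exp_minus inverse_eq_divide powr_divide)
qed

lemma powr_square:
  fixes r e :: real
  assumes "0 < r"
  shows "(r\<^sup>2) powr e = r powr (2 * e)"
  using assms powr_powr[of r 2 e] powr_realpow[of r 2] by simp

text \<open>For \<open>t < r^2\<close> the Gaussian factor must pay both for
  \<open>t powr - (n / 2)\<close> and for replacing \<open>sqrt t\<close> by the larger
  \<open>r\<close> in the decay factor; a polynomial bound of order \<open>(N + n) / 2\<close> does
  exactly this. For larger \<open>t\<close> the decay factor only improves and the exponential is
  dropped.\<close>

lemma heat_kernel_pointwise:
  fixes r t c N n R :: real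
  assumes r: "0 < r" and t: "0 < t" and c: "0 < c" and N: "0 < N" and n: "0 < n" and R: "0 < R"
  shows "1 / t powr (n / 2) * exp (- r\<^sup>2 / (c * t)) * (1 + sqrt t / R) powr - N
    \<le> (1 + r / R) powr - N * (if t < r\<^sup>2 then (c * ((N + n) / 2)) powr ((N + n) / 2) * r powr - n else t powr - (n / 2))"
proof (cases "t < r\<^sup>2")
  case True
  define M where "M = (N + n) / 2"
  define z where "z = t / r\<^sup>2"
  have z: "0 < z" "z < 1" using r t True by (auto simp: z_def)
  have M: "0 < M" using N n by (simp add: M_def)
  have sq: "sqrt t = r * sqrt z"
    using r t by (simp add: z_def real_sqrt_divide)
  have "sqrt z * (1 + r / R) \<le> 1 + sqrt t / R"
    using z by (simp add: sq distrib_left mult.commute)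
  then have "(1 + sqrt t / R) powr - N \<le> (sqrt z * (1 + r / R)) powr - N"
    using z r R N by (intro powr_mono2') (auto intro!: mult_pos_pos add_pos_pos)
  also have "\<dots> = z powr - (N / 2) * (1 + r / R) powr - N"
    using z r R by (simp add: powr_mult powr_half_sqrt[symmetric] powr_powr)
  finally have 1: "(1 + sqrt t / R) powr - N \<le> z powr - (N / 2) * (1 + r / R) powr - N" .
  have "exp (- (r\<^sup>2 / (c * t))) \<le> (M / (r\<^sup>2 / (c * t))) powr M"
    using r t c M by (intro exp_minus_le_powr) auto
  also have "M / (r\<^sup>2 / (c * t)) = c * M * z" by (simp add: z_def)
  also have "(c * M * z) powr M = (c * M) powr M * z powr M"
    using c M z by (simp add: powr_mult)
  finally have 2: "exp (- r\<^sup>2 / (c * t)) \<le> (c * M) powr M * z powr M" by simp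
  have 3: "1 / t powr (n / 2) = r powr - n * z powr - (n / 2)"
  proof -
    have "t = r\<^sup>2 * z" using r by (simp add: z_def)
    then have "t powr (n / 2) = r powr n * z powr (n / 2)"
      using r z powr_square[OF r, of "n / 2"] by (simp add: powr_mult)
    then show ?thesis by (simp add: powr_minus divide_simps)
  qed
  have "1 / t powr (n / 2) * exp (- r\<^sup>2 / (c * t)) * (1 + sqrt t / R) powr - N
      \<le> (r powr - n * z powr - (n / 2)) * ((c * M) powr M * z powr M) * (z powr - (N / 2) * (1 + r / R) powr - N)"
    using 1 2 unfolding 3 by (intro mult_mono) auto
  also have "\<dots> = (1 + r / R) powr - N * ((c * M) powr M * r powr - n) * (z powr - (n / 2) * z powr M * z powr - (N / 2))"
    by simp
  \<comment> \<open>The order \<open>M\<close> was chosen so that these three powers of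
    \<open>z = t / r^2\<close> cancel.\<close>
  also have "z powr - (n / 2) * z powr M * z powr - (N / 2) = 1"
    using z unfolding powr_add[symmetric] by (simp add: M_def field_simps)
  finally show ?thesis using True by (simp add: M_def)
next
  case False
  have "r \<le> sqrt t" using False r by (simp add: real_le_rsqrt not_less)
  then have "r / R \<le> sqrt t / R" using R by (simp add: divide_right_mono)
  moreover have "0 < 1 + r / R" using r R by (simp add: add_pos_pos)
  ultimately have "(1 + sqrt t / R) powr - N \<le> (1 + r / R) powr - N"
    using N by (intro powr_mono2') auto
  moreover have "exp (- r\<^sup>2 / (c * t)) \<le> 1" using c t by simp
  ultimately have "1 / t powr (n / 2) * exp (- r\<^sup>2 / (c * t)) * (1 + sqrt t / R) powr - N
      \<le> 1 / t powr (n / 2) * 1 * (1 + r / R) powr - N"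
    by (intro mult_mono) auto
  then show ?thesis using False by (simp add: powr_minus inverse_eq_divide mult.commute)
qed

lemma nn_integral_powr_below:
  assumes "0 < a" "0 \<le> b"
  shows "(\<integral>\<^sup>+t. indicator {0..b} t * ennreal (t powr (a - 1)) \<partial>lborel) = ennreal (b powr a / a)"
proof -
  have "((\<lambda>t. t powr (a - 1)) has_integral b powr a / a) {0..b}"
    using has_integral_powr_from_0[of "a - 1" b] assms by simp
  then have "(\<integral>\<^sup>+t. ennreal (indicator {0..b} t * t powr (a - 1)) \<partial>lborel) = ennreal (b powr a / a)"
    by (intro nn_integral_has_integral_lebesgue) auto
  then show ?thesis by (simp add: ennreal_mult ennreal_indicator)
qed

lemma nn_integral_powr_above:
  assumes "0 < a" "0 < b"
  shows "(\<integral>\<^sup>+t. indicator {b..} t * ennreal (t powr (- a - 1)) \<partial>lborel) = ennreal (b powr - a / a)"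
proof -
  have "((\<lambda>t. t powr (- a - 1)) has_integral b powr - a / a) {b..}"
    using has_integral_powr_to_inf[of "- a - 1" b] assms by simp
  then have "(\<integral>\<^sup>+t. ennreal (indicator {b..} t * t powr (- a - 1)) \<partial>lborel) = ennreal (b powr - a / a)"
    by (intro nn_integral_has_integral_lebesgue) auto
  then show ?thesis by (simp add: ennreal_mult ennreal_indicator)
qed

text \<open>The integral over \<open>t\<close> is split at the square of the distance
  \<open>r\<close> of \<open>x\<close> and \<open>y\<close>. Both parts scale like
  \<open>r powr (\<alpha> - n)\<close>, times the decay factor at distance \<open>r\<close>; the
  first converges at \<open>0\<close> because \<open>\<alpha> > 0\<close>, the second at infinity
  because \<open>\<alpha> < n\<close>. A single summand of the dyadic sum dominates the
  result.\<close>

lemma frac_kernel_bound: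
  fixes k :: "real \<Rightarrow> real ^ 'd \<Rightarrow> real ^ 'd \<Rightarrow> complex" and \<rho> \<rho>' :: "real ^ 'd \<Rightarrow> real"
  assumes bound: "kernel_upper_bound \<rho> k" and \<rho>: "\<And>x. 0 < \<rho> x" "\<And>x. \<rho> x \<le> \<rho>' x"
    and \<alpha>: "0 < \<alpha>" "\<alpha> < real CARD('d)" and N: "0 < N"
  shows "\<exists>C>0. \<forall>x y. x \<noteq> y \<longrightarrow>
    (\<integral>\<^sup>+t. indicator {0<..} t * ennreal (norm (k t x y) * t powr (\<alpha> / 2 - 1)) \<partial>lborel)
    \<le> ennreal C * (\<integral>\<^sup>+i. ennreal (2 powr (real_of_int i * (\<alpha> - real CARD('d))) *
        (1 + 2 powr real_of_int i / \<rho>' x) powr - N) * indicator (tri i x) y \<partial>count_space UNIV)"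
proof -
  define n where "n = real CARD('d)"
  have n: "0 < n" "\<alpha> < n" using \<alpha> by (auto simp: n_def)
  obtain c C where c: "0 < c" and C: "0 < C" and kb: "\<And>x y t. 0 < t \<Longrightarrow> norm (k t x y) \<le>
      C / t powr (n / 2) * exp (- (norm (x - y))\<^sup>2 / (c * t)) * (1 + sqrt t / \<rho> x + sqrt t / \<rho> y) powr (- N)"
    using bound N unfolding kernel_upper_bound_def n_def by meson
  define K where "K = (c * ((N + n) / 2)) powr ((N + n) / 2)"
  have K: "0 < K" unfolding K_def using c N n by simp
  define C' where "C' = C * (K * (2 / \<alpha>) + 2 / (n - \<alpha>)) * 2 powr (n - \<alpha>) * 2 powr N"
  have Cpos: "0 < K * (2 / \<alpha>) + 2 / (n - \<alpha>)" using K \<alpha> n by (intro add_pos_pos mult_pos_pos) auto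
  have "0 < C'" unfolding C'_def using C Cpos by simp
  moreover have "(\<integral>\<^sup>+t. indicator {0<..} t * ennreal (norm (k t x y) * t powr (\<alpha> / 2 - 1)) \<partial>lborel)
    \<le> ennreal C' * (\<integral>\<^sup>+i. ennreal (2 powr (real_of_int i * (\<alpha> - n)) *
        (1 + 2 powr real_of_int i / \<rho>' x) powr - N) * indicator (tri i x) y \<partial>count_space UNIV)"
    if "x \<noteq> y" for x y
  proof -
    define r where "r = norm (x - y)"
    have r: "0 < r" using that by (simp add: r_def)
    define S where "S = C * (1 + r / \<rho> x) powr - N"
    have S: "0 \<le> S" using C by (simp add: S_def)
    have le: "indicator {0<..} t * ennreal (norm (k t x y) * t powr (\<alpha> / 2 - 1))
        \<le> ennreal (S * (K * r powr - n)) * (indicator {0..r\<^sup>2} t * ennreal (t powr (\<alpha> / 2 - 1)))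
          + ennreal S * (indicator {r\<^sup>2..} t * ennreal (t powr (- ((n - \<alpha>) / 2) - 1)))" for t
    proof (cases "0 < t")
      case t: True
      have "norm (k t x y) \<le> C / t powr (n / 2) * exp (- r\<^sup>2 / (c * t)) * (1 + sqrt t / \<rho> x) powr - N"
      proof -
        have "0 < 1 + sqrt t / \<rho> x" using t \<rho>(1)[of x] by (simp add: add_pos_nonneg)
        then have "(1 + sqrt t / \<rho> x + sqrt t / \<rho> y) powr - N \<le> (1 + sqrt t / \<rho> x) powr - N"
          using t \<rho>(1)[of y] N by (intro powr_mono2') (auto simp: less_imp_le)
        then have "C / t powr (n / 2) * exp (- r\<^sup>2 / (c * t)) * (1 + sqrt t / \<rho> x + sqrt t / \<rho> y) powr - N
            \<le> C / t powr (n / 2) * exp (- r\<^sup>2 / (c * t)) * (1 + sqrt t / \<rho> x) powr - N"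
          using C by (intro mult_left_mono) auto
        with kb[OF t, of x y] show ?thesis unfolding r_def[symmetric] by (rule order_trans)
      qed
      also have "\<dots> = C * (1 / t powr (n / 2) * exp (- r\<^sup>2 / (c * t)) * (1 + sqrt t / \<rho> x) powr - N)" by simp
      also have "\<dots> \<le> C * ((1 + r / \<rho> x) powr - N * (if t < r\<^sup>2 then K * r powr - n else t powr - (n / 2)))"
        unfolding K_def using C heat_kernel_pointwise[OF r t c N n(1) \<rho>(1)[of x]] by (intro mult_left_mono) auto
      also have "\<dots> = S * (if t < r\<^sup>2 then K * r powr - n else t powr - (n / 2))"
        by (simp add: S_def)
      finally have *: "norm (k t x y) * t powr (\<alpha> / 2 - 1)
          \<le> S * (if t < r\<^sup>2 then K * r powr - n else t powr - (n / 2)) * t powr (\<alpha> / 2 - 1)"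
        by (rule mult_right_mono) simp
      show ?thesis
      proof (cases "t < r\<^sup>2")
        case True
        then have "ennreal (norm (k t x y) * t powr (\<alpha> / 2 - 1)) \<le> ennreal (S * (K * r powr - n)) * ennreal (t powr (\<alpha> / 2 - 1))"
          using * S K by (simp add: ennreal_mult[symmetric] ennreal_leI)
        then show ?thesis using t True by (simp add: indicator_def)
      next
        case False
        have "t powr - (n / 2) * t powr (\<alpha> / 2 - 1) = t powr (- ((n - \<alpha>) / 2) - 1)"
          unfolding powr_add[symmetric] by (rule arg_cong[where f = "(powr) t"]) (simp add: field_simps)
        then have "ennreal (norm (k t x y) * t powr (\<alpha> / 2 - 1)) \<le> ennreal S * ennreal (t powr (- ((n - \<alpha>) / 2) - 1))"
          using * S False by (simp add: ennreal_mult[symmetric] ennreal_leI mult.assoc)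
        then show ?thesis using t False by (simp add: indicator_def add_increasing)
      qed
    qed simp
    have "(\<integral>\<^sup>+t. indicator {0<..} t * ennreal (norm (k t x y) * t powr (\<alpha> / 2 - 1)) \<partial>lborel)
      \<le> (\<integral>\<^sup>+t. ennreal (S * (K * r powr - n)) * (indicator {0..r\<^sup>2} t * ennreal (t powr (\<alpha> / 2 - 1)))
          + ennreal S * (indicator {r\<^sup>2..} t * ennreal (t powr (- ((n - \<alpha>) / 2) - 1))) \<partial>lborel)"
      by (intro nn_integral_mono le)
    also have "\<dots> = ennreal (S * (K * r powr - n)) * ennreal ((r\<^sup>2) powr (\<alpha> / 2) / (\<alpha> / 2))
        + ennreal S * ennreal ((r\<^sup>2) powr - ((n - \<alpha>) / 2) / ((n - \<alpha>) / 2))"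
      using \<alpha> n r nn_integral_powr_below[of "\<alpha> / 2" "r\<^sup>2"] nn_integral_powr_above[of "(n - \<alpha>) / 2" "r\<^sup>2"]
      by (simp add: nn_integral_add nn_integral_cmult)
    also have "(r\<^sup>2) powr (\<alpha> / 2) = r powr \<alpha>"
      unfolding powr_square[OF r] by simp
    also have "(r\<^sup>2) powr - ((n - \<alpha>) / 2) = r powr (\<alpha> - n)"
      unfolding powr_square[OF r] by (rule arg_cong[where f = "(powr) r"]) (simp add: field_simps)
    also have "ennreal (S * (K * r powr - n)) * ennreal (r powr \<alpha> / (\<alpha> / 2)) + ennreal S * ennreal (r powr (\<alpha> - n) / ((n - \<alpha>) / 2))
        = ennreal (S * (K * (2 / \<alpha>) + 2 / (n - \<alpha>)) * r powr (\<alpha> - n))"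
    proof -
      have "r powr - n * r powr \<alpha> = r powr (\<alpha> - n)"
        unfolding powr_add[symmetric] by simp
      then have "S * (K * r powr - n) * (r powr \<alpha> / (\<alpha> / 2)) + S * (r powr (\<alpha> - n) / ((n - \<alpha>) / 2))
          = S * (K * (2 / \<alpha>) + 2 / (n - \<alpha>)) * r powr (\<alpha> - n)"
        by (simp add: algebra_simps)
      then show ?thesis
        using S K \<alpha> n by (simp add: ennreal_mult[symmetric] ennreal_plus[symmetric] del: ennreal_plus)
    qed
    also have "\<dots> \<le> ennreal C' * (\<integral>\<^sup>+i. ennreal (2 powr (real_of_int i * (\<alpha> - n)) *
        (1 + 2 powr real_of_int i / \<rho>' x) powr - N) * indicator (tri i x) y \<partial>count_space UNIV)"
    proof -
      \<comment> \<open>The least level with \<open>r \<le> 2 powr i\<close>, which puts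
        \<open>y\<close> into \<open>tri i x\<close>. Since \<open>2 powr (i - 1) < r\<close>,
        replacing \<open>r\<close> by \<open>2 powr i\<close> costs only the factors
        \<open>2 powr (n - \<alpha>)\<close> and \<open>2 powr N\<close>; passing to the larger
        radius \<open>\<rho>' x\<close> only weakens the decay.\<close>
      define i where "i = \<lceil>log 2 r\<rceil>"
      have "log 2 r \<le> real_of_int i" "real_of_int i - 1 < log 2 r"
        unfolding i_def by linarith+
      then have "2 powr log 2 r \<le> 2 powr real_of_int i" "2 powr (real_of_int i - 1) < 2 powr log 2 r"
        by (auto intro!: powr_mono powr_less_mono)
      then have i: "r \<le> 2 powr real_of_int i" "2 powr (real_of_int i - 1) < r" using r by auto
      have y: "y \<in> tri i x" by (rule norm_tri) (use i in \<open>simp add: r_def\<close>)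
      have r_le: "r powr (\<alpha> - n) \<le> 2 powr (n - \<alpha>) * 2 powr (real_of_int i * (\<alpha> - n))"
      proof -
        have "r powr (\<alpha> - n) \<le> (2 powr (real_of_int i - 1)) powr (\<alpha> - n)"
          using i(2) n by (intro powr_mono2') auto
        also have "\<dots> = 2 powr (n - \<alpha>) * 2 powr (real_of_int i * (\<alpha> - n))"
          unfolding powr_powr powr_add[symmetric] by (simp add: algebra_simps)
        finally show ?thesis .
      qed
      have m_le: "(1 + r / \<rho> x) powr - N \<le> 2 powr N * (1 + 2 powr real_of_int i / \<rho>' x) powr - N"
      proof -
        have half: "2 powr (real_of_int i - 1) = 2 powr real_of_int i / 2" by (simp add: powr_diff)
        have rho': "0 < \<rho>' x" using \<rho>(1)[of x] \<rho>(2)[of x] by linarith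
        have "(1 + 2 powr real_of_int i / \<rho>' x) / 2 \<le> 1 + 2 powr (real_of_int i - 1) / \<rho>' x"
          unfolding half by simp
        also have "2 powr (real_of_int i - 1) / \<rho>' x \<le> r / \<rho> x"
          using i(2) \<rho>(1)[of x] \<rho>(2)[of x] r by (intro frac_le) auto
        finally have "(1 + 2 powr real_of_int i / \<rho>' x) / 2 \<le> 1 + r / \<rho> x" by simp
        moreover have pos: "0 < (1 + 2 powr real_of_int i / \<rho>' x)" using rho' by (simp add: add_pos_pos)
        ultimately have "(1 + r / \<rho> x) powr - N \<le> ((1 + 2 powr real_of_int i / \<rho>' x) / 2) powr - N"
          using N by (intro powr_mono2') auto
        also have "\<dots> = 2 powr N * (1 + 2 powr real_of_int i / \<rho>' x) powr - N"
          using pos by (simp add: powr_divide powr_minus divide_simps)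
        finally show ?thesis .
      qed
      have "S * (K * (2 / \<alpha>) + 2 / (n - \<alpha>)) * r powr (\<alpha> - n)
          \<le> C * (2 powr N * (1 + 2 powr real_of_int i / \<rho>' x) powr - N) * (K * (2 / \<alpha>) + 2 / (n - \<alpha>)) *
            (2 powr (n - \<alpha>) * 2 powr (real_of_int i * (\<alpha> - n)))"
        unfolding S_def using C Cpos m_le r_le by (intro mult_mono) auto
      also have "\<dots> = C' * (2 powr (real_of_int i * (\<alpha> - n)) * (1 + 2 powr real_of_int i / \<rho>' x) powr - N)"
        by (simp add: C'_def)
      finally have "ennreal (S * (K * (2 / \<alpha>) + 2 / (n - \<alpha>)) * r powr (\<alpha> - n))
          \<le> ennreal (C' * (2 powr (real_of_int i * (\<alpha> - n)) * (1 + 2 powr real_of_int i / \<rho>' x) powr - N))"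
        by (rule ennreal_leI)
      also have "\<dots> = ennreal C' * (ennreal (2 powr (real_of_int i * (\<alpha> - n)) *
          (1 + 2 powr real_of_int i / \<rho>' x) powr - N) * indicator (tri i x) y)"
        using \<open>0 < C'\<close> y by (simp add: ennreal_mult)
      also have "\<dots> \<le> ennreal C' * (\<integral>\<^sup>+i. ennreal (2 powr (real_of_int i * (\<alpha> - n)) *
          (1 + 2 powr real_of_int i / \<rho>' x) powr - N) * indicator (tri i x) y \<partial>count_space UNIV)"
        by (intro mult_left_mono nn_integral_ge_point) auto
      finally show ?thesis .
    qed
    finally show ?thesis .
  qed
  ultimately show ?thesis unfolding n_def by blast
qed

text \<open>The outer factor is lost when the weights are averaged over cells, the power of \<tau>
  is the ratio between the bound for the good cubes and \<open>B\<close>, and the last summand comes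
  from the large scales.\<close>

definition operator_const :: "nat \<Rightarrow> real \<Rightarrow> real \<Rightarrow> real \<Rightarrow> real \<Rightarrow> real \<Rightarrow> real \<Rightarrow> real \<Rightarrow> real \<Rightarrow> ennreal" where
  "operator_const d \<alpha> p P q s C1 \<kappa> \<tau> = ennreal (C1 powr (\<kappa> + \<tau> / q) * 9 ^ d) *
     (small_scales_const d \<alpha> p P q s * ennreal (((C1 * (C1 * 2 powr \<kappa>) powr \<kappa>) powr \<tau>) powr (1 + P / (q * q)))
      + ennreal (3 ^ d * C1) * (geometric_const 1 * 2))"

lemma operator_const_finite:
  assumes "0 < \<alpha>" "\<alpha> < real d / p"
  shows "operator_const d \<alpha> p P q s C1 \<kappa> \<tau> < top"
  using assms geometric_const_finite[of 1] geometric_const_finite[of "min \<alpha> (real d / p - \<alpha>)"]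
  unfolding operator_const_def small_scales_const_def
  by (simp add: ennreal_mult_less_top)

lemma borel_measurable_nn_integral_count_space:
  fixes f :: "int \<Rightarrow> 'a \<Rightarrow> ennreal"
  assumes "\<And>k. f k \<in> borel_measurable M"
  shows "(\<lambda>x. \<integral>\<^sup>+k. f k x \<partial>count_space UNIV) \<in> borel_measurable M"
proof -
  interpret sigma_finite_measure "count_space (UNIV :: int set)"
    by (rule sigma_finite_measure_count_space_countable) simp
  have "(\<lambda>(x, k). f k x) \<in> borel_measurable (M \<Otimes>\<^sub>M count_space UNIV)"
    using assms by (subst measurable_pair_swap_iff) (auto intro!: measurable_pair_measure_countable1)
  then show ?thesis by (rule borel_measurable_nn_integral)
qed

section \<open>From the localised forms to the operator\<close>

context submultiplicative_kernel
begin

text \<open>The integral over \<open>z\<close> is first averaged over the cell of \<open>z\<close>.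
  On a cell the neighbourhood \<open>tri k z\<close> does not depend on \<open>z\<close>, so the
  inner integral localises to one fixed set; then the weight is moved to \<open>x\<close> and the
  outer integral enlarged from the cell to that set. The factor \<open>9 ^ CARD('d)\<close> is the
  square of the ratio of the two volumes.\<close>

lemma nn_integral_scale_average:
  fixes g h :: "real ^ 'd \<Rightarrow> ennreal" and w w' :: "real ^ 'd \<Rightarrow> real" and C :: real
  assumes [measurable]: "g \<in> borel_measurable borel" "h \<in> borel_measurable borel" "w \<in> borel_measurable borel"
    and w: "\<And>x y. y \<in> cell k x \<Longrightarrow> w y \<le> C * w' x"
  shows "(\<integral>\<^sup>+z. h z * (ennreal (w z) * (\<integral>\<^sup>+y\<in>tri k z. F z y * g y \<partial>lborel)) \<partial>lborel)
    \<le> (\<integral>\<^sup>+x. ennreal (9 ^ CARD('d) * volume TYPE('d) k * (C * w' x)) * tri_form g h k x \<partial>lborel)"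
proof -
  define f where "f z = h z * (ennreal (w z) * (\<integral>\<^sup>+y\<in>tri k z. F z y * g y \<partial>lborel))" for z
  have "(\<lambda>(z, y). F z y * g y * indicator (tri k z) y) \<in> borel_measurable (lborel \<Otimes>\<^sub>M lborel)"
    by (simp add: indicator_def split_beta')
  then have [measurable]: "(\<lambda>z. \<integral>\<^sup>+y\<in>tri k z. F z y * g y \<partial>lborel) \<in> borel_measurable lborel"
    by (rule lborel.borel_measurable_nn_integral)
  have [measurable]: "f \<in> borel_measurable borel"
    unfolding f_def by measurable
  define v where "v = volume TYPE('d) k"
  have v: "0 < v" by (simp add: v_def)
  have "(\<integral>\<^sup>+z. f z \<partial>lborel) = ennreal (1 / v) * (ennreal v * (\<integral>\<^sup>+z. f z \<partial>lborel))"
    using v by (simp add: mult.assoc[symmetric] ennreal_mult[symmetric])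
  also have "\<dots> = ennreal (1 / v) * (\<integral>\<^sup>+x. (\<integral>\<^sup>+z\<in>cell k x. f z \<partial>lborel) \<partial>lborel)"
    unfolding v_def by (subst nn_integral_cell_average) auto
  also have "\<dots> = (\<integral>\<^sup>+x. ennreal (1 / v) * (\<integral>\<^sup>+z\<in>cell k x. f z \<partial>lborel) \<partial>lborel)"
  proof (rule nn_integral_cmult[symmetric])
    have "(\<lambda>(x, z). f z * indicator (cell k x) z) \<in> borel_measurable (lborel \<Otimes>\<^sub>M lborel)"
      by (simp add: indicator_def split_beta')
    then show "(\<lambda>x. \<integral>\<^sup>+z\<in>cell k x. f z \<partial>lborel) \<in> borel_measurable lborel"
      by (rule lborel.borel_measurable_nn_integral)
  qed
  also have "\<dots> \<le> (\<integral>\<^sup>+x. ennreal (9 ^ CARD('d) * v * (C * w' x)) * tri_form g h k x \<partial>lborel)"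
  proof (intro nn_integral_mono)
    fix x :: "real ^ 'd"
    define Q where "Q = tri k x"
    have [measurable]: "Q \<in> sets borel" by (simp add: Q_def)
    have "(\<integral>\<^sup>+z\<in>cell k x. f z \<partial>lborel) \<le> (\<integral>\<^sup>+z. ennreal (C * w' x) * (h z * (\<integral>\<^sup>+y\<in>Q. F z y * g y \<partial>lborel) * indicator Q z) \<partial>lborel)"
    proof (intro nn_integral_mono)
      fix z
      show "f z * indicator (cell k x) z
          \<le> ennreal (C * w' x) * (h z * (\<integral>\<^sup>+y\<in>Q. F z y * g y \<partial>lborel) * indicator Q z)"
      proof (cases "z \<in> cell k x")
        case True
        then have "tri k z = Q" "z \<in> Q"
          using tri_cong[OF True] subsetD[OF cell_subset_tri True] by (simp_all add: Q_def)
        moreover have "ennreal (w z) \<le> ennreal (C * w' x)" using w[OF True] by (rule ennreal_leI)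
        then have "ennreal (w z) * (h z * (\<integral>\<^sup>+y\<in>Q. F z y * g y \<partial>lborel))
            \<le> ennreal (C * w' x) * (h z * (\<integral>\<^sup>+y\<in>Q. F z y * g y \<partial>lborel))"
          by (rule mult_right_mono) simp
        ultimately show ?thesis using True by (simp add: f_def mult_ac)
      qed simp
    qed
    also have "\<dots> = ennreal (C * w' x) * (\<integral>\<^sup>+z. h z * (\<integral>\<^sup>+y\<in>Q. F z y * g y \<partial>lborel) * indicator Q z \<partial>lborel)"
    proof (rule nn_integral_cmult)
      have "(\<lambda>(z, y). F z y * g y * indicator Q y) \<in> borel_measurable (lborel \<Otimes>\<^sub>M lborel)"
        by measurable
      then have [measurable]: "(\<lambda>z. \<integral>\<^sup>+y\<in>Q. F z y * g y \<partial>lborel) \<in> borel_measurable lborel"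
        by (rule lborel.borel_measurable_nn_integral)
      show "(\<lambda>z. h z * (\<integral>\<^sup>+y\<in>Q. F z y * g y \<partial>lborel) * indicator Q z) \<in> borel_measurable lborel"
        by measurable
    qed
    also have "(\<integral>\<^sup>+z. h z * (\<integral>\<^sup>+y\<in>Q. F z y * g y \<partial>lborel) * indicator Q z \<partial>lborel)
        = (\<integral>\<^sup>+z. emeasure lborel Q * (h z * eavg Q (\<lambda>y. F z y * g y) * indicator Q z) \<partial>lborel)"
    proof -
      have inner: "(\<integral>\<^sup>+y\<in>Q. F z y * g y \<partial>lborel) = eavg Q (\<lambda>y. F z y * g y) * emeasure lborel Q" for z
        unfolding Q_def by (rule eavg_cube_simps)
      show ?thesis unfolding inner by (intro nn_integral_cong) (simp add: mult_ac)
    qed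
    also have "\<dots> = emeasure lborel Q * (\<integral>\<^sup>+z\<in>Q. h z * eavg Q (\<lambda>y. F z y * g y) \<partial>lborel)"
      by (rule nn_integral_cmult) measurable
    also have "(\<integral>\<^sup>+z\<in>Q. h z * eavg Q (\<lambda>y. F z y * g y) \<partial>lborel) = tri_form g h k x * emeasure lborel Q"
      unfolding Q_def tri_form_def by (rule eavg_cube_simps)
    finally have "ennreal (1 / v) * (\<integral>\<^sup>+z\<in>cell k x. f z \<partial>lborel)
        \<le> ennreal (1 / v) * (ennreal (C * w' x) * (emeasure lborel Q * (tri_form g h k x * emeasure lborel Q)))"
      by (rule mult_left_mono) simp
    also have "\<dots> = (ennreal (1 / v) * (emeasure lborel Q * emeasure lborel Q)) * ennreal (C * w' x) * tri_form g h k x"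
      by (simp only: mult_ac)
    also have "ennreal (1 / v) * (emeasure lborel Q * emeasure lborel Q) = ennreal (9 ^ CARD('d) * v)"
    proof -
      have "emeasure lborel Q = ennreal (3 ^ CARD('d) * v)" by (simp add: Q_def v_def)
      moreover have "1 / v * (3 ^ CARD('d) * v * (3 ^ CARD('d) * v)) = 9 ^ CARD('d) * v"
      proof -
        have "(3 :: real) ^ CARD('d) * 3 ^ CARD('d) = 9 ^ CARD('d)" by (simp flip: power_mult_distrib)
        moreover have "1 / v * (3 ^ CARD('d) * v * (3 ^ CARD('d) * v)) = (3 ^ CARD('d) * 3 ^ CARD('d)) * v"
          using v by simp
        ultimately show ?thesis by (simp only:)
      qed
      moreover have "ennreal (1 / v) * (ennreal (3 ^ CARD('d) * v) * ennreal (3 ^ CARD('d) * v))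
          = ennreal (1 / v * (3 ^ CARD('d) * v * (3 ^ CARD('d) * v)))"
      proof -
        have a: "ennreal (3 ^ CARD('d) * v) * ennreal (3 ^ CARD('d) * v) = ennreal (3 ^ CARD('d) * v * (3 ^ CARD('d) * v))"
          using v by (intro ennreal_mult[symmetric]) auto
        have b: "ennreal (1 / v) * ennreal (3 ^ CARD('d) * v * (3 ^ CARD('d) * v))
            = ennreal (1 / v * (3 ^ CARD('d) * v * (3 ^ CARD('d) * v)))"
          using v by (intro ennreal_mult[symmetric]) auto
        show ?thesis unfolding a b ..
      qed
      ultimately show ?thesis by (simp only:)
    qed
    also have "ennreal (9 ^ CARD('d) * v) * ennreal (C * w' x) = ennreal (9 ^ CARD('d) * v * (C * w' x))"
      using v by (simp add: ennreal_mult')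
    finally show "ennreal (1 / v) * (\<integral>\<^sup>+z\<in>cell k x. f z \<partial>lborel)
        \<le> ennreal (9 ^ CARD('d) * v * (C * w' x)) * tri_form g h k x" .
  qed
  finally show ?thesis unfolding f_def v_def .
qed

text \<open>By duality it suffices to test against \<open>h\<close> in the unit ball of
  \<open>L^s\<close>. Moving the decay factor within a cell costs the outer \<kappa> in its
  exponent. What is left is split at a threshold for \<open>m\<close>: below it the decay is
  discarded and \<open>small_scales\<close> applies with a constant multiple of \<open>B\<close>,
  above it \<open>large_scales\<close> uses all of the decay.\<close>

theorem operator_estimate:
  fixes g :: "real ^ 'd \<Rightarrow> ennreal" and \<rho> :: "real ^ 'd \<Rightarrow> real" and B p s \<alpha> C1 \<kappa> \<tau> :: real
  assumes [measurable]: "g \<in> borel_measurable borel" "\<rho> \<in> borel_measurable borel"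
    and p: "1 < p" "1 / p + 1 / P = 1" and s: "1 < s" "1 / q + 1 / s = 1"
    and \<alpha>: "0 < \<alpha>" "1 / q = 1 / p - \<alpha> / real CARD('d)"
    and g: "(\<integral>\<^sup>+x. g x \<up> p \<partial>lborel) \<le> 1"
    and \<rho>: "\<And>x. 0 < \<rho> x"
  defines "m \<equiv> \<lambda>k x. 1 + 2 powr real_of_int k / \<rho> x"
  assumes comparable: "\<And>k x y. y \<in> tri k x \<Longrightarrow> m k y \<le> C1 * m k x powr \<kappa>"
    and C1: "1 \<le> C1" and \<kappa>: "1 \<le> \<kappa>" and \<tau>: "0 \<le> \<tau>" and B: "1 \<le> B"
    and A_tri: "\<And>k x. A_const (tri k x) \<le> ennreal (B * m k x powr \<tau>)"
    and A_cell: "\<And>k x. A_const (cell k x) \<le> ennreal (B * m k x powr \<tau>)"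
  shows "(\<integral>\<^sup>+x. (\<integral>\<^sup>+y. (\<integral>\<^sup>+k. ennreal (2 powr (real_of_int k * (\<alpha> - real CARD('d))) *
        m k x powr - (\<kappa> * (\<kappa> + \<tau> / q))) * indicator (tri k x) y \<partial>count_space UNIV) * (F x y * g y) \<partial>lborel) \<up> q \<partial>lborel) \<up> (1 / q)
    \<le> operator_const CARD('d) \<alpha> p P q s C1 \<kappa> \<tau> * ennreal (B powr (1 + P / (q * q)))"
proof -
  \<comment> \<open>Of this exponent \<kappa> serves the summation over the large scales and
    \<open>\<tau> / q\<close> compensates the growth of \<open>A_const\<close> to the power
    \<open>1 / q\<close>.\<close>
  define N' where "N' = \<kappa> + \<tau> / q"
  define w where "w k x = 2 powr (real_of_int k * (\<alpha> - real CARD('d))) * m k x powr - (\<kappa> * N')" for k x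
  have [measurable]: "m k \<in> borel_measurable borel" for k unfolding m_def by measurable
  have [measurable]: "w k \<in> borel_measurable borel" for k unfolding w_def by measurable
  have m1: "1 \<le> m k x" for k x using \<rho>[of x] by (simp add: m_def)
  have N': "0 < N'" using \<kappa> \<tau> q by (simp add: N'_def add_pos_nonneg)
  define u where "u x = (\<integral>\<^sup>+y. (\<integral>\<^sup>+k. ennreal (w k x) * indicator (tri k x) y \<partial>count_space UNIV) * (F x y * g y) \<partial>lborel)" for x
  have swap: "u x = (\<integral>\<^sup>+k. ennreal (w k x) * (\<integral>\<^sup>+y\<in>tri k x. F x y * g y \<partial>lborel) \<partial>count_space UNIV)" for x
  proof -
    have "u x = (\<integral>\<^sup>+y. (\<integral>\<^sup>+k. ennreal (w k x) * (F x y * g y * indicator (tri k x) y) \<partial>count_space UNIV) \<partial>lborel)"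
      unfolding u_def by (subst nn_integral_multc[symmetric]) (auto simp: mult_ac)
    also have "\<dots> = (\<integral>\<^sup>+k. (\<integral>\<^sup>+y. ennreal (w k x) * (F x y * g y * indicator (tri k x) y) \<partial>lborel) \<partial>count_space UNIV)"
      by (rule nn_integral_count_space_nn_integral) auto
    finally show ?thesis by (simp add: nn_integral_cmult)
  qed
  have inner_meas [measurable]: "(\<lambda>z. \<integral>\<^sup>+y\<in>tri k z. F z y * g y \<partial>lborel) \<in> borel_measurable borel" for k
  proof -
    have "(\<lambda>(z, y). F z y * g y * indicator (tri k z) y) \<in> borel_measurable (lborel \<Otimes>\<^sub>M lborel)"
      by (simp add: indicator_def split_beta')
    then have "(\<lambda>z. \<integral>\<^sup>+y\<in>tri k z. F z y * g y \<partial>lborel) \<in> borel_measurable lborel"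
      by (rule lborel.borel_measurable_nn_integral)
    then show ?thesis by simp
  qed
  have [measurable]: "u \<in> borel_measurable lborel"
  proof -
    have "(\<lambda>x. \<integral>\<^sup>+k. ennreal (w k x) * (\<integral>\<^sup>+y\<in>tri k x. F x y * g y \<partial>lborel) \<partial>count_space (UNIV :: int set)) \<in> borel_measurable lborel"
      by (rule borel_measurable_nn_integral_count_space) auto
    then show ?thesis unfolding swap[abs_def] .
  qed
  \<comment> \<open>The largest value of the bound on the cells inside \<open>tri k x\<close> when
    \<open>m k x < \<Lambda>\<close>: comparability gives
    \<open>m \<le> C1 * \<Lambda> powr \<kappa>\<close> there, and finer cells have smaller
    \<open>m\<close>. Since this number is at least \<Lambda>, the same \<open>c\<close> serves for
    \<open>tri k x\<close>.\<close>
  define c where "c = B * (C1 * (C1 * 2 powr \<kappa>) powr \<kappa>) powr \<tau>"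
  define \<Lambda> where "\<Lambda> = C1 * 2 powr \<kappa>"
  have \<Lambda>: "1 \<le> \<Lambda>" unfolding \<Lambda>_def using C1 \<kappa> mult_mono[of 1 C1 1 "2 powr \<kappa>"] ge_one_powr_ge_zero[of 2 \<kappa>] by simp
  have L: "1 \<le> C1 * \<Lambda> powr \<kappa>" "\<Lambda> \<le> C1 * \<Lambda> powr \<kappa>"
  proof -
    have "\<Lambda> powr 1 \<le> \<Lambda> powr \<kappa>" using \<Lambda> \<kappa> by (intro powr_mono) auto
    then have "1 * \<Lambda> \<le> C1 * \<Lambda> powr \<kappa>" using \<Lambda> C1 by (intro mult_mono) auto
    then show "\<Lambda> \<le> C1 * \<Lambda> powr \<kappa>" by simp
    then show "1 \<le> C1 * \<Lambda> powr \<kappa>" using \<Lambda> by simp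
  qed
  have c1: "1 \<le> c"
    unfolding c_def \<Lambda>_def[symmetric] using B L \<tau> mult_mono[of 1 B 1 "(C1 * \<Lambda> powr \<kappa>) powr \<tau>"]
      ge_one_powr_ge_zero[of "C1 * \<Lambda> powr \<kappa>" \<tau>] by simp
  define good where "good k = {x. m k x < \<Lambda>}" for k
  have good_tri: "A_const (tri k x) \<le> ennreal c" if "x \<in> good k" for k x
  proof -
    have "m k x powr \<tau> \<le> (C1 * \<Lambda> powr \<kappa>) powr \<tau>"
      using that L m1[of k x] \<tau> by (intro powr_mono2) (auto simp: good_def)
    then have "B * m k x powr \<tau> \<le> c" using B by (simp add: c_def \<Lambda>_def)
    then show ?thesis using A_tri[of k x] ennreal_leI order_trans by blast
  qed
  have good_cell: "A_const (cell j y) \<le> ennreal c" if "x \<in> good k" "y \<in> tri k x" "j \<le> k" for k x y j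
  proof -
    have "2 powr real_of_int j \<le> 2 powr real_of_int k" using that by (intro powr_mono) auto
    then have "m j y \<le> m k y" using \<rho>[of y] by (simp add: m_def divide_right_mono)
    also have "\<dots> \<le> C1 * m k x powr \<kappa>" by (rule comparable) fact
    also have "\<dots> \<le> C1 * \<Lambda> powr \<kappa>"
      using that C1 \<kappa> m1[of k x] by (intro mult_left_mono powr_mono2) (auto simp: good_def)
    finally have "m j y powr \<tau> \<le> (C1 * \<Lambda> powr \<kappa>) powr \<tau>"
      using m1[of j y] \<tau> by (intro powr_mono2) auto
    then have "B * m j y powr \<tau> \<le> c" using B by (simp add: c_def \<Lambda>_def)
    then show ?thesis using A_cell[of j y] ennreal_leI order_trans by blast
  qed
  have "(\<integral>\<^sup>+x. u x \<up> q \<partial>lborel) \<up> (1 / q) \<le> operator_const CARD('d) \<alpha> p P q s C1 \<kappa> \<tau> * ennreal (B powr (1 + P / (q * q)))"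
  proof (rule nn_integral_dual_bound[OF _ lborel.sigma_finite_measure_axioms s(1) q])
    show "1 / s + 1 / q = 1" using s by simp
    fix h :: "real ^ 'd \<Rightarrow> ennreal"
    assume "h \<in> borel_measurable lborel" and h: "(\<integral>\<^sup>+x. h x \<up> s \<partial>lborel) \<le> 1"
    then have [measurable]: "h \<in> borel_measurable borel" by simp
    define E where "E k x = ennreal (2 powr (real_of_int k * \<alpha>)) * (ennreal (m k x powr - N') * tri_form g h k x)" for k x
    have [measurable]: "E k \<in> borel_measurable borel" for k unfolding E_def by measurable
    have "(\<integral>\<^sup>+x. h x * u x \<partial>lborel)
        = (\<integral>\<^sup>+x. (\<integral>\<^sup>+k. h x * (ennreal (w k x) * (\<integral>\<^sup>+y\<in>tri k x. F x y * g y \<partial>lborel)) \<partial>count_space UNIV) \<partial>lborel)"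
      unfolding swap by (simp add: nn_integral_cmult)
    also have "\<dots> = (\<integral>\<^sup>+k. (\<integral>\<^sup>+x. h x * (ennreal (w k x) * (\<integral>\<^sup>+y\<in>tri k x. F x y * g y \<partial>lborel)) \<partial>lborel) \<partial>count_space UNIV)"
      by (rule nn_integral_count_space_nn_integral) auto
    also have "\<dots> \<le> (\<integral>\<^sup>+k. (\<integral>\<^sup>+x. ennreal (C1 powr N' * 9 ^ CARD('d)) * E k x \<partial>lborel) \<partial>count_space UNIV)"
    proof (rule nn_integral_mono)
      fix k :: int
      have "(\<integral>\<^sup>+x. h x * (ennreal (w k x) * (\<integral>\<^sup>+y\<in>tri k x. F x y * g y \<partial>lborel)) \<partial>lborel)
        \<le> (\<integral>\<^sup>+x. ennreal (9 ^ CARD('d) * volume TYPE('d) k *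
            (C1 powr N' * (2 powr (real_of_int k * (\<alpha> - real CARD('d))) * m k x powr - N'))) * tri_form g h k x \<partial>lborel)"
      proof (rule nn_integral_scale_average[where w = "w k" and C = "C1 powr N'"
            and w' = "\<lambda>x. 2 powr (real_of_int k * (\<alpha> - real CARD('d))) * m k x powr - N'"])
        fix x y :: "real ^ 'd" assume "y \<in> cell k x"
        then have "x \<in> tri k y" using cell_sym cell_subset_tri by blast
        then have "m k x \<le> C1 * m k y powr \<kappa>" by (rule comparable)
        then have "(C1 * m k y powr \<kappa>) powr - N' \<le> m k x powr - N'"
          using m1[of k x] N' by (intro powr_mono2') auto
        moreover have "(C1 * m k y powr \<kappa>) powr - N' = C1 powr - N' * m k y powr - (\<kappa> * N')"
          using C1 m1[of k y] by (simp add: powr_mult powr_powr)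
        ultimately have "C1 powr N' * (C1 powr - N' * m k y powr - (\<kappa> * N')) \<le> C1 powr N' * m k x powr - N'"
          by (intro mult_left_mono) auto
        moreover have "C1 powr N' * (C1 powr - N' * m k y powr - (\<kappa> * N')) = m k y powr - (\<kappa> * N')"
        proof -
          have "C1 powr N' * C1 powr - N' = 1" using C1 by (simp flip: powr_add)
          then show ?thesis unfolding mult.assoc[symmetric] by simp
        qed
        ultimately have "m k y powr - (\<kappa> * N') \<le> C1 powr N' * m k x powr - N'"
          by (simp only:)
        from mult_left_mono[OF this, of "2 powr (real_of_int k * (\<alpha> - real CARD('d)))"]
        show "w k y \<le> C1 powr N' * (2 powr (real_of_int k * (\<alpha> - real CARD('d))) * m k x powr - N')"
          by (simp add: w_def mult_ac)
      qed measurable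
      also have "\<dots> = (\<integral>\<^sup>+x. ennreal (C1 powr N' * 9 ^ CARD('d)) * E k x \<partial>lborel)"
      proof (intro nn_integral_cong)
        fix x
        have "volume TYPE('d) k * 2 powr (real_of_int k * (\<alpha> - real CARD('d))) = 2 powr (real_of_int k * \<alpha>)"
          unfolding powr_add[symmetric] by (simp add: algebra_simps)
        then have eq: "9 ^ CARD('d) * volume TYPE('d) k * (C1 powr N' * (2 powr (real_of_int k * (\<alpha> - real CARD('d))) * m k x powr - N'))
            = (C1 powr N' * 9 ^ CARD('d)) * (2 powr (real_of_int k * \<alpha>) * m k x powr - N')"
        proof -
          have "9 ^ CARD('d) * volume TYPE('d) k * (C1 powr N' * (2 powr (real_of_int k * (\<alpha> - real CARD('d))) * m k x powr - N'))
            = (C1 powr N' * 9 ^ CARD('d)) * ((volume TYPE('d) k * 2 powr (real_of_int k * (\<alpha> - real CARD('d)))) * m k x powr - N')"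
            by (simp only: mult_ac)
          also note \<open>volume TYPE('d) k * 2 powr (real_of_int k * (\<alpha> - real CARD('d))) = 2 powr (real_of_int k * \<alpha>)\<close>
          finally show ?thesis .
        qed
        show "ennreal (9 ^ CARD('d) * volume TYPE('d) k *
            (C1 powr N' * (2 powr (real_of_int k * (\<alpha> - real CARD('d))) * m k x powr - N'))) * tri_form g h k x
          = ennreal (C1 powr N' * 9 ^ CARD('d)) * E k x"
          unfolding E_def eq by (simp add: ennreal_mult mult.assoc)
      qed
      finally show "(\<integral>\<^sup>+x. h x * (ennreal (w k x) * (\<integral>\<^sup>+y\<in>tri k x. F x y * g y \<partial>lborel)) \<partial>lborel)
        \<le> (\<integral>\<^sup>+x. ennreal (C1 powr N' * 9 ^ CARD('d)) * E k x \<partial>lborel)" .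
    qed
    also have "\<dots> = ennreal (C1 powr N' * 9 ^ CARD('d)) * (\<integral>\<^sup>+k. (\<integral>\<^sup>+x. E k x \<partial>lborel) \<partial>count_space UNIV)"
      by (simp add: nn_integral_cmult)
    also have "(\<integral>\<^sup>+k. (\<integral>\<^sup>+x. E k x \<partial>lborel) \<partial>count_space UNIV) = (\<integral>\<^sup>+x. (\<integral>\<^sup>+k. E k x \<partial>count_space UNIV) \<partial>lborel)"
      by (rule nn_integral_count_space_nn_integral[symmetric]) auto
    also have "\<dots> \<le> (\<integral>\<^sup>+x. (\<integral>\<^sup>+k. ennreal (2 powr (real_of_int k * \<alpha>)) * (tri_form g h k x * indicator (good k) x) \<partial>count_space UNIV)
        + (\<integral>\<^sup>+k. ennreal (2 powr (real_of_int k * \<alpha>)) * (ennreal (m k x powr - (\<kappa> + \<tau> / q)) *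
            (tri_form g h k x * indicator {x. C1 * 2 powr \<kappa> \<le> m k x} x)) \<partial>count_space UNIV) \<partial>lborel)"
    proof (intro nn_integral_mono)
      fix x
      have "E k x \<le> ennreal (2 powr (real_of_int k * \<alpha>)) * (tri_form g h k x * indicator (good k) x)
          + ennreal (2 powr (real_of_int k * \<alpha>)) * (ennreal (m k x powr - (\<kappa> + \<tau> / q)) *
            (tri_form g h k x * indicator {x. C1 * 2 powr \<kappa> \<le> m k x} x))" for k
      proof (cases "x \<in> good k")
        case True
        have "m k x powr - N' \<le> m k x powr 0" using m1[of k x] N' by (intro powr_mono) auto
        then have "ennreal (m k x powr - N') \<le> 1" using m1[of k x] by (simp add: ennreal_le_1)
        then have "ennreal (m k x powr - N') * tri_form g h k x \<le> 1 * tri_form g h k x"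
          by (rule mult_right_mono) simp
        then have "E k x \<le> ennreal (2 powr (real_of_int k * \<alpha>)) * tri_form g h k x"
          unfolding E_def by (intro mult_left_mono) auto
        then show ?thesis using True by (simp add: add_increasing2)
      next
        case False
        then show ?thesis by (simp add: E_def N'_def good_def \<Lambda>_def not_less)
      qed
      then show "(\<integral>\<^sup>+k. E k x \<partial>count_space UNIV)
        \<le> (\<integral>\<^sup>+k. ennreal (2 powr (real_of_int k * \<alpha>)) * (tri_form g h k x * indicator (good k) x) \<partial>count_space UNIV)
        + (\<integral>\<^sup>+k. ennreal (2 powr (real_of_int k * \<alpha>)) * (ennreal (m k x powr - (\<kappa> + \<tau> / q)) *
            (tri_form g h k x * indicator {x. C1 * 2 powr \<kappa> \<le> m k x} x)) \<partial>count_space UNIV)"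
        by (subst nn_integral_add[symmetric]) (auto intro!: nn_integral_mono)
    qed
    also have "\<dots> = (\<integral>\<^sup>+x. (\<integral>\<^sup>+k. ennreal (2 powr (real_of_int k * \<alpha>)) * (tri_form g h k x * indicator (good k) x) \<partial>count_space UNIV) \<partial>lborel)
        + (\<integral>\<^sup>+x. (\<integral>\<^sup>+k. ennreal (2 powr (real_of_int k * \<alpha>)) * (ennreal (m k x powr - (\<kappa> + \<tau> / q)) *
            (tri_form g h k x * indicator {x. C1 * 2 powr \<kappa> \<le> m k x} x)) \<partial>count_space UNIV) \<partial>lborel)"
    proof (rule nn_integral_add)
      have [measurable]: "good k \<in> sets borel" for k unfolding good_def by measurable
      show "(\<lambda>x. \<integral>\<^sup>+k. ennreal (2 powr (real_of_int k * \<alpha>)) * (tri_form g h k x * indicator (good k) x)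
          \<partial>count_space (UNIV :: int set)) \<in> borel_measurable lborel"
        by (rule borel_measurable_nn_integral_count_space) auto
      show "(\<lambda>x. \<integral>\<^sup>+k. ennreal (2 powr (real_of_int k * \<alpha>)) * (ennreal (m k x powr - (\<kappa> + \<tau> / q)) *
            (tri_form g h k x * indicator {x. C1 * 2 powr \<kappa> \<le> m k x} x)) \<partial>count_space (UNIV :: int set)) \<in> borel_measurable lborel"
        by (rule borel_measurable_nn_integral_count_space) auto
    qed
    also have "\<dots> \<le> small_scales_const CARD('d) \<alpha> p P q s * ennreal (c powr (1 + P / (q * q)))
        + ennreal (B powr (1 / q)) * (ennreal (3 ^ CARD('d) * C1) * (geometric_const 1 * 2))"
    proof (intro add_mono)
      show "(\<integral>\<^sup>+x. (\<integral>\<^sup>+k. ennreal (2 powr (real_of_int k * \<alpha>)) * (tri_form g h k x * indicator (good k) x) \<partial>count_space UNIV) \<partial>lborel)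
          \<le> small_scales_const CARD('d) \<alpha> p P q s * ennreal (c powr (1 + P / (q * q)))"
        using p s \<alpha> g h c1 good_tri good_cell by (intro small_scales) auto
      show "(\<integral>\<^sup>+x. (\<integral>\<^sup>+k. ennreal (2 powr (real_of_int k * \<alpha>)) * (ennreal (m k x powr - (\<kappa> + \<tau> / q)) *
            (tri_form g h k x * indicator {x. C1 * 2 powr \<kappa> \<le> m k x} x)) \<partial>count_space UNIV) \<partial>lborel)
          \<le> ennreal (B powr (1 / q)) * (ennreal (3 ^ CARD('d) * C1) * (geometric_const 1 * 2))"
        unfolding m_def using p s \<alpha> g h \<rho> comparable C1 \<kappa> B A_tri unfolding m_def
        by (intro large_scales) auto
    qed
    also have "\<dots> \<le> small_scales_const CARD('d) \<alpha> p P q s * (ennreal (((C1 * (C1 * 2 powr \<kappa>) powr \<kappa>) powr \<tau>) powr (1 + P / (q * q)))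
          * ennreal (B powr (1 + P / (q * q))))
        + ennreal (B powr (1 + P / (q * q))) * (ennreal (3 ^ CARD('d) * C1) * (geometric_const 1 * 2))"
    proof (intro add_mono mult_right_mono mult_left_mono)
      show "ennreal (c powr (1 + P / (q * q))) \<le> ennreal (((C1 * (C1 * 2 powr \<kappa>) powr \<kappa>) powr \<tau>) powr (1 + P / (q * q)))
          * ennreal (B powr (1 + P / (q * q)))"
        unfolding c_def using B by (simp add: powr_mult ennreal_mult mult.commute)
      have "1 / q \<le> 1" using q by simp
      also have "1 \<le> 1 + P / (q * q)" using P q by simp
      finally show "ennreal (B powr (1 / q)) \<le> ennreal (B powr (1 + P / (q * q)))"
        using B by (intro ennreal_leI powr_mono) auto
    qed auto
    finally have "(\<integral>\<^sup>+x. h x * u x \<partial>lborel) \<le> ennreal (C1 powr N' * 9 ^ CARD('d)) *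
      (small_scales_const CARD('d) \<alpha> p P q s * (ennreal (((C1 * (C1 * 2 powr \<kappa>) powr \<kappa>) powr \<tau>) powr (1 + P / (q * q)))
          * ennreal (B powr (1 + P / (q * q))))
        + ennreal (B powr (1 + P / (q * q))) * (ennreal (3 ^ CARD('d) * C1) * (geometric_const 1 * 2)))"
      by (simp add: mult_left_mono)
    also have "\<dots> = operator_const CARD('d) \<alpha> p P q s C1 \<kappa> \<tau> * ennreal (B powr (1 + P / (q * q)))"
      unfolding operator_const_def N'_def by (simp only: distrib_left distrib_right mult_ac)
    finally show "(\<integral>\<^sup>+x. h x * u x \<partial>lborel)
        \<le> operator_const CARD('d) \<alpha> p P q s C1 \<kappa> \<tau> * ennreal (B powr (1 + P / (q * q)))" .
  qed measurable
  then show ?thesis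
    unfolding u_def w_def N'_def .
qed

end

section \<open>Spectral calculus and measurability of matrix powers\<close>

lemma ctranspose_nth [simp]: "ctranspose A $ i $ j = cnj (A $ j $ i)"
  by (simp add: ctranspose_def)

lemma ctranspose_mult: "ctranspose (A ** B) = ctranspose B ** ctranspose A"
  by (simp add: vec_eq_iff matrix_matrix_mult_def mult.commute)

lemma ctranspose_ctranspose [simp]: "ctranspose (ctranspose A) = A"
  by (simp add: vec_eq_iff)

lemma ctranspose_mat_1 [simp]: "ctranspose (mat 1) = mat 1"
  by (simp add: vec_eq_iff mat_def)

lemma unitary_matrixI: "ctranspose U ** U = mat 1 \<Longrightarrow> unitary_matrix U"
  unfolding unitary_matrix_def using matrix_left_right_inverse by blast

lemma unitary_matrix_mult: "unitary_matrix U \<Longrightarrow> unitary_matrix V \<Longrightarrow> unitary_matrix (U ** V)"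
proof (rule unitary_matrixI)
  assume "unitary_matrix U" "unitary_matrix V"
  then have UV: "ctranspose U ** U = mat 1" "ctranspose V ** V = mat 1" by (auto simp: unitary_matrix_def)
  have "ctranspose (U ** V) ** (U ** V) = ctranspose V ** ((ctranspose U ** U) ** V)"
    by (simp add: ctranspose_mult matrix_mul_assoc)
  then show "ctranspose (U ** V) ** (U ** V) = mat 1" by (simp add: UV)
qed

lemma continuous_on_matrix_mult:
  fixes f g :: "'a :: topological_space \<Rightarrow> complex ^ 'n ^ 'n"
  assumes "continuous_on S f" "continuous_on S g"
  shows "continuous_on S (\<lambda>x. f x ** g x)"
  unfolding matrix_matrix_mult_def using assms by (intro continuous_intros)

lemma continuous_on_ctranspose:
  fixes f :: "'a :: topological_space \<Rightarrow> complex ^ 'n ^ 'n"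
  assumes "continuous_on S f"
  shows "continuous_on S (\<lambda>x. ctranspose (f x))"
  unfolding ctranspose_def using assms by (intro continuous_intros)

lemma norm_matrix_le_sum:
  fixes A :: "complex ^ 'n ^ 'm"
  shows "norm A \<le> (\<Sum>i\<in>UNIV. \<Sum>j\<in>UNIV. norm (A $ i $ j))"
proof -
  have "norm A \<le> (\<Sum>i\<in>UNIV. norm (A $ i))"
    unfolding norm_vec_def by (rule L2_set_le_sum) simp
  also have "\<dots> \<le> (\<Sum>i\<in>UNIV. \<Sum>j\<in>UNIV. norm (A $ i $ j))"
    by (rule sum_mono) (unfold norm_vec_def, rule L2_set_le_sum, simp)
  finally show ?thesis .
qed

lemma compact_unitary: "compact {U :: complex ^ 'n ^ 'n. unitary_matrix U}"
proof -
  have eq: "{U :: complex ^ 'n ^ 'n. unitary_matrix U} = {U. ctranspose U ** U = mat 1}"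
    using unitary_matrixI by (auto simp: unitary_matrix_def)
  have "closed {U :: complex ^ 'n ^ 'n. ctranspose U ** U = mat 1}"
    by (intro closed_Collect_eq continuous_on_matrix_mult continuous_on_ctranspose continuous_intros)
  moreover have "norm U \<le> (\<Sum>i\<in>(UNIV :: 'n set). \<Sum>j\<in>(UNIV :: 'n set). 1)"
    if "ctranspose U ** U = mat 1" for U :: "complex ^ 'n ^ 'n"
  proof -
    have "norm (U $ i $ j) \<le> 1" for i j
    proof -
      have "(\<Sum>k\<in>UNIV. cnj (U $ k $ j) * U $ k $ j) = 1"
        using arg_cong[OF that, of "\<lambda>M. M $ j $ j"] by (simp add: matrix_matrix_mult_def mat_def)
      moreover have "cnj (U $ k $ j) * U $ k $ j = complex_of_real ((norm (U $ k $ j))\<^sup>2)" for k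
        by (simp only: complex_norm_square mult.commute)
      ultimately have "complex_of_real (\<Sum>k\<in>UNIV. (norm (U $ k $ j))\<^sup>2) = complex_of_real 1"
        by simp
      then have "(\<Sum>k\<in>UNIV. (norm (U $ k $ j))\<^sup>2) = 1" by (simp only: of_real_eq_iff)
      moreover have "(norm (U $ i $ j))\<^sup>2 \<le> (\<Sum>k\<in>UNIV. (norm (U $ k $ j))\<^sup>2)"
        by (rule member_le_sum) auto
      ultimately show ?thesis by (simp add: power2_le_iff_abs_le power_le_one_iff)
    qed
    then show ?thesis
      by (intro order_trans[OF norm_matrix_le_sum] sum_mono) auto
  qed
  then have "bounded {U :: complex ^ 'n ^ 'n. ctranspose U ** U = mat 1}"
    unfolding bounded_iff by blast
  ultimately show ?thesis unfolding eq compact_eq_bounded_closed by blast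
qed

text \<open>A complex Jacobi rotation in the coordinates \<open>i\<close> and \<open>j\<close>. The
  phase \<omega> serves to make the off-diagonal entry of the rotated matrix act as a positive real
  number.\<close>

definition plane_rotation :: "'n \<Rightarrow> 'n \<Rightarrow> complex \<Rightarrow> real \<Rightarrow> complex ^ 'n ^ 'n" where
  "plane_rotation i j \<omega> t = (\<chi> a b.
     if b = i then (if a = i then of_real (cos t) else if a = j then \<omega> * of_real (sin t) else 0)
     else if b = j then (if a = i then - cnj \<omega> * of_real (sin t) else if a = j then of_real (cos t) else 0)
     else if a = b then 1 else 0)"

lemma mult_plane_rotation:
  fixes M :: "complex ^ 'n ^ 'n"
  assumes "i \<noteq> j"
  shows "(M ** plane_rotation i j \<omega> t) $ a $ b =
    (if b = i then M $ a $ i * of_real (cos t) + M $ a $ j * (\<omega> * of_real (sin t))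
     else if b = j then M $ a $ i * (- cnj \<omega> * of_real (sin t)) + M $ a $ j * of_real (cos t)
     else M $ a $ b)"
proof -
  have two: "(\<Sum>k\<in>UNIV. M $ a $ k * (if k = i then x else if k = j then y else 0)) = M $ a $ i * x + M $ a $ j * y" for x y
  proof -
    have "(\<Sum>k\<in>UNIV. M $ a $ k * (if k = i then x else if k = j then y else 0))
        = (\<Sum>k\<in>UNIV. (if k = i then M $ a $ k * x else 0) + (if k = j then M $ a $ k * y else 0))"
      using assms by (intro sum.cong) auto
    then show ?thesis by (simp add: sum.distrib)
  qed
  consider "b = i" | "b = j" "b \<noteq> i" | "b \<noteq> i" "b \<noteq> j" by blast
  then show ?thesis
  proof cases
    case 1
    then show ?thesis using two[of "of_real (cos t)" "\<omega> * of_real (sin t)"]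
      by (simp add: matrix_matrix_mult_def plane_rotation_def)
  next
    case 2
    then show ?thesis using two[of "- cnj \<omega> * of_real (sin t)" "of_real (cos t)"]
      by (simp add: matrix_matrix_mult_def plane_rotation_def)
  next
    case 3
    then show ?thesis
      by (simp add: matrix_matrix_mult_def plane_rotation_def if_distrib[of "\<lambda>z. _ * z"] cong: if_cong)
  qed
qed

lemma ctranspose_plane_rotation_mult:
  fixes M :: "complex ^ 'n ^ 'n"
  assumes "i \<noteq> j"
  shows "(ctranspose (plane_rotation i j \<omega> t) ** M) $ a $ b =
    (if a = i then of_real (cos t) * M $ i $ b + cnj \<omega> * of_real (sin t) * M $ j $ b
     else if a = j then - \<omega> * of_real (sin t) * M $ i $ b + of_real (cos t) * M $ j $ b
     else M $ a $ b)"
proof -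
  have "ctranspose (plane_rotation i j \<omega> t) ** M = ctranspose (ctranspose M ** plane_rotation i j \<omega> t)"
    by (simp add: ctranspose_mult)
  then show ?thesis by (simp add: mult_plane_rotation[OF assms] mult_ac)
qed

lemma unitary_plane_rotation:
  assumes ij: "i \<noteq> j" and \<omega>: "norm \<omega> = 1"
  shows "unitary_matrix (plane_rotation i j \<omega> t)"
proof (rule unitary_matrixI)
  have w: "\<omega> * cnj \<omega> = 1" using \<omega> complex_norm_square[of \<omega>] by simp
  have cs: "of_real (cos t) * of_real (cos t) + of_real (sin t) * of_real (sin t) = (1 :: complex)"
    using sin_cos_squared_add3[of t] by (simp flip: of_real_mult of_real_add)
  show "ctranspose (plane_rotation i j \<omega> t) ** plane_rotation i j \<omega> t = mat 1"
  proof (simp only: vec_eq_iff, intro allI)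
    fix a b
    let ?c = "complex_of_real (cos t)" and ?s = "complex_of_real (sin t)"
    have 1: "?c * ?c + cnj \<omega> * ?s * (\<omega> * ?s) = 1"
    proof -
      have e: "cnj \<omega> * ?s * (\<omega> * ?s) = (\<omega> * cnj \<omega>) * (?s * ?s)" by (simp only: mult_ac)
      show ?thesis unfolding e w using cs by simp
    qed
    have 2: "- \<omega> * ?s * (- cnj \<omega> * ?s) + ?c * ?c = 1"
    proof -
      have e: "- \<omega> * ?s * (- cnj \<omega> * ?s) = (\<omega> * cnj \<omega>) * (?s * ?s)"
        by (simp only: mult_minus_left mult_minus_right minus_minus mult_ac)
      show ?thesis unfolding e w using cs by (simp add: add.commute)
    qed
    show "(ctranspose (plane_rotation i j \<omega> t) ** plane_rotation i j \<omega> t) $ a $ b = mat 1 $ a $ b"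
      unfolding ctranspose_plane_rotation_mult[OF ij]
      using ij 1 2 by (auto simp: plane_rotation_def mat_def mult_ac)
  qed
qed

text \<open>Among all unitary \<open>U\<close>, one maximising \<open>Re (tr (C U\<^sup>* A U))\<close> for a diagonal \<open>C\<close> with distinct
  entries diagonalises \<open>A\<close>: otherwise a rotation in a coordinate plane increases the value.\<close>
theorem spectral_theorem:
  fixes A :: "complex ^ 'n ^ 'n"
  assumes A: "self_adjoint_matrix A"
  obtains U l where "unitary_matrix U" "A = U ** diag_matrix l ** ctranspose U"
proof -
  obtain c :: "'n \<Rightarrow> nat" where c: "inj c"
    using finite_imp_inj_to_nat_seg[of "UNIV :: 'n set"] by auto
  define \<Phi> where "\<Phi> U = (\<Sum>k\<in>UNIV. real (c k) * Re ((ctranspose U ** A ** U) $ k $ k))" for U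
  have "continuous_on {U. unitary_matrix U} \<Phi>"
    unfolding \<Phi>_def
    by (intro continuous_intros continuous_on_matrix_mult continuous_on_ctranspose)
  moreover have "unitary_matrix (mat 1 :: complex ^ 'n ^ 'n)" by (simp add: unitary_matrix_def)
  ultimately obtain U where U: "unitary_matrix U" and max: "\<And>V. unitary_matrix V \<Longrightarrow> \<Phi> V \<le> \<Phi> U"
    using continuous_attains_sup[OF compact_unitary, of \<Phi>] by blast
  define B where "B = ctranspose U ** A ** U"
  have B_adj: "B $ j $ i = cnj (B $ i $ j)" for i j
  proof -
    have "ctranspose B = B"
      using A by (simp add: B_def self_adjoint_matrix_def ctranspose_mult matrix_mul_assoc)
    then show ?thesis by (metis ctranspose_nth)
  qed
  have diag: "B $ i $ j = 0" if ij: "i \<noteq> j" for i j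
  proof (rule ccontr)
    assume nz: "B $ i $ j \<noteq> 0"
    define \<beta> where "\<beta> = norm (B $ i $ j)"
    \<comment> \<open>With this phase \<open>\<omega> * B $ i $ j = \<beta> > 0\<close>, so the
      first-order change of the diagonal under rotation by \<open>t\<close> is real and proportional
      to \<beta>.\<close>
    define \<omega> where "\<omega> = cnj (B $ i $ j) / of_real \<beta>"
    define \<Delta> where "\<Delta> = Re (B $ i $ i) - Re (B $ j $ j)"
    have \<beta>: "0 < \<beta>" using nz by (simp add: \<beta>_def)
    have \<omega>: "norm \<omega> = 1" using nz by (simp add: \<omega>_def \<beta>_def norm_divide)
    have \<omega>B: "\<omega> * B $ i $ j = of_real \<beta>"
    proof -
      have "cnj (B $ i $ j) * B $ i $ j = of_real \<beta> * of_real \<beta>"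
        using complex_norm_square[of "B $ i $ j"] by (simp add: \<beta>_def power2_eq_square mult.commute)
      then show ?thesis using \<beta> by (simp add: \<omega>_def)
    qed
    have \<omega>B': "cnj \<omega> * B $ j $ i = of_real \<beta>"
      using arg_cong[OF \<omega>B, of cnj] by (simp add: B_adj[of j i])
    define \<kappa> where "\<kappa> = real (c i) - real (c j)"
    have \<kappa>: "\<kappa> \<noteq> 0" using c ij by (auto simp: \<kappa>_def inj_def)
    have var: "\<kappa> * (2 * cos t * sin t * \<beta> - sin t * sin t * \<Delta>) \<le> 0" for t
    proof -
      define R where "R = plane_rotation i j \<omega> t"
      have R: "unitary_matrix R" unfolding R_def by (rule unitary_plane_rotation[OF ij \<omega>])
      define X where "X k = Re ((ctranspose R ** (B ** R)) $ k $ k)" for k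
      have Xk: "X k = Re (B $ k $ k)" if "k \<noteq> i" "k \<noteq> j" for k
        using that by (simp add: X_def R_def ctranspose_plane_rotation_mult[OF ij] mult_plane_rotation[OF ij])
      have Xi: "X i = Re (B $ i $ i) + (2 * cos t * sin t * \<beta> - sin t * sin t * \<Delta>)"
      proof -
        have "(ctranspose R ** (B ** R)) $ i $ i
            = of_real (cos t * cos t) * B $ i $ i + of_real (cos t * sin t) * (\<omega> * B $ i $ j)
              + of_real (cos t * sin t) * (cnj \<omega> * B $ j $ i) + of_real (sin t * sin t) * ((\<omega> * cnj \<omega>) * B $ j $ j)"
          by (simp add: R_def ctranspose_plane_rotation_mult[OF ij] mult_plane_rotation[OF ij] algebra_simps)
        also have "\<omega> * cnj \<omega> = 1" using \<omega> complex_norm_square[of \<omega>] by simp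
        finally have "X i = cos t * cos t * Re (B $ i $ i) + 2 * (cos t * sin t * \<beta>) + sin t * sin t * Re (B $ j $ j)"
          unfolding X_def \<omega>B \<omega>B' by simp
        moreover have "cos t * cos t = 1 - sin t * sin t" using sin_cos_squared_add3[of t] by linarith
        ultimately show ?thesis by (simp add: \<Delta>_def algebra_simps)
      qed
      have Xj: "X j = Re (B $ j $ j) - (2 * cos t * sin t * \<beta> - sin t * sin t * \<Delta>)"
      proof -
        have "(ctranspose R ** (B ** R)) $ j $ j
            = of_real (cos t * cos t) * B $ j $ j - of_real (cos t * sin t) * (\<omega> * B $ i $ j)
              - of_real (cos t * sin t) * (cnj \<omega> * B $ j $ i) + of_real (sin t * sin t) * ((\<omega> * cnj \<omega>) * B $ i $ i)"
          using ij by (simp add: R_def ctranspose_plane_rotation_mult[OF ij] mult_plane_rotation[OF ij] algebra_simps)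
        also have "\<omega> * cnj \<omega> = 1" using \<omega> complex_norm_square[of \<omega>] by simp
        finally have "X j = cos t * cos t * Re (B $ j $ j) - 2 * (cos t * sin t * \<beta>) + sin t * sin t * Re (B $ i $ i)"
          unfolding X_def \<omega>B \<omega>B' by simp
        moreover have "cos t * cos t = 1 - sin t * sin t" using sin_cos_squared_add3[of t] by linarith
        ultimately show ?thesis by (simp add: \<Delta>_def algebra_simps)
      qed
      define E where "E = 2 * cos t * sin t * \<beta> - sin t * sin t * \<Delta>"
      have "\<Phi> (U ** R) = (\<Sum>k\<in>UNIV. real (c k) * X k)"
        by (simp add: \<Phi>_def X_def B_def ctranspose_mult matrix_mul_assoc)
      also have "\<dots> = (\<Sum>k\<in>UNIV. real (c k) * Re (B $ k $ k) + ((if k = i then real (c i) * E else 0)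
          - (if k = j then real (c j) * E else 0)))"
      proof -
        have X': "X i = Re (B $ i $ i) + E" "X j = Re (B $ j $ j) - E" using Xi Xj by (simp_all add: E_def)
        show ?thesis using ij by (intro sum.cong) (auto simp: X' Xk algebra_simps)
      qed
      also have "\<dots> = \<Phi> U + \<kappa> * E"
        by (simp add: sum.distrib sum_subtractf \<Phi>_def B_def \<kappa>_def algebra_simps)
      finally show ?thesis
        using max[OF unitary_matrix_mult[OF U R]] by (simp add: E_def)
    qed
    \<comment> \<open>The change of the maximised quantity under rotation by \<open>t\<close> is
      \<open>sin t * f t\<close>, never positive by maximality. As \<open>sin t\<close> changes sign
      at \<open>0\<close> and \<open>f\<close> is continuous, \<open>f 0\<close> would have to
      vanish, but it equals \<open>2 * \<kappa> * \<beta>\<close>.\<close>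
    define f where "f t = \<kappa> * (2 * cos t * \<beta> - sin t * \<Delta>)" for t :: real
    have cont: "isCont f 0" unfolding f_def by (intro continuous_intros)
    have sgn: "sin t * f t \<le> 0" for t using var[of t] by (simp add: f_def algebra_simps)
    have f0: "f 0 \<noteq> 0" using \<kappa> \<beta> by (simp add: f_def)
    have "\<exists>d>0. \<forall>t. \<bar>t\<bar> < d \<longrightarrow> \<bar>f t - f 0\<bar> < \<bar>f 0\<bar>"
      using cont f0 unfolding continuous_at_eps_delta by (auto dest!: spec[of _ "\<bar>f 0\<bar>"] simp: dist_real_def)
    then obtain d where d: "0 < d" "\<And>t. \<bar>t\<bar> < d \<Longrightarrow> \<bar>f t - f 0\<bar> < \<bar>f 0\<bar>" by blast
    define t where "t = min (d / 2) 1"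
    have t: "0 < t" "t < d" "t < pi" using d pi_gt3 by (auto simp: t_def)
    have st: "0 < sin t" using t by (intro sin_gt_zero)
    have "f t \<le> 0" using sgn[of t] st by (simp add: mult_le_0_iff)
    moreover have "0 \<le> f (- t)" using sgn[of "- t"] st by (simp add: zero_le_mult_iff mult_le_0_iff)
    ultimately show False using d(2)[of t] d(2)[of "- t"] t by (auto simp: abs_if split: if_splits)
  qed
  define l where "l k = Re (B $ k $ k)" for k
  have "B = diag_matrix l"
  proof (simp only: vec_eq_iff, intro allI)
    fix i j
    have "B $ i $ i = of_real (l i)"
      using B_adj[of i i] by (simp add: l_def complex_eq_iff)
    then show "B $ i $ j = diag_matrix l $ i $ j"
      using diag[of i j] by (auto simp: diag_matrix_def)
  qed
  moreover have "A = U ** B ** ctranspose U"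
  proof -
    have "U ** B ** ctranspose U = (U ** ctranspose U) ** A ** (U ** ctranspose U)"
      by (simp add: B_def matrix_mul_assoc)
    then show ?thesis using U by (simp add: unitary_matrix_def)
  qed
  ultimately show thesis using that U by blast
qed

section \<open>Matrix powers through diagonalisation\<close>

lemma matrix_powr_eq:
  assumes "unitary_matrix U"
  shows "matrix_powr (U ** diag_matrix l ** ctranspose U) r = U ** diag_matrix (\<lambda>i. l i powr r) ** ctranspose U"
proof -
  have "spectral_calculus (\<lambda>s. s powr r) (U ** diag_matrix l ** ctranspose U)
      = U ** diag_matrix ((\<lambda>s. s powr r) \<circ> l) ** ctranspose U"
    unfolding spectral_calculus_def
  proof (rule the_equality)
    show "\<exists>V m. unitary_matrix V \<and> U ** diag_matrix l ** ctranspose U = V ** diag_matrix m ** ctranspose V \<and>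
        U ** diag_matrix ((\<lambda>s. s powr r) \<circ> l) ** ctranspose U = V ** diag_matrix ((\<lambda>s. s powr r) \<circ> m) ** ctranspose V"
      using assms by blast
    fix B assume "\<exists>V m. unitary_matrix V \<and> U ** diag_matrix l ** ctranspose U = V ** diag_matrix m ** ctranspose V \<and>
        B = V ** diag_matrix ((\<lambda>s. s powr r) \<circ> m) ** ctranspose V"
    then show "B = U ** diag_matrix ((\<lambda>s. s powr r) \<circ> l) ** ctranspose U"
      using spectral_calculus_unique[OF assms] by metis
  qed
  then show ?thesis unfolding matrix_powr_def o_def .
qed

lemma diag_matrix_mult: "diag_matrix l ** diag_matrix m = diag_matrix (\<lambda>i. l i * m i)"
  by (simp add: vec_eq_iff diag_matrix_mult_left) (simp add: diag_matrix_def)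

lemma diag_matrix_1: "diag_matrix (\<lambda>i. 1) = mat 1"
  by (simp add: vec_eq_iff diag_matrix_def mat_def)

lemma conj_diag_mult:
  assumes "unitary_matrix U"
  shows "(U ** diag_matrix l ** ctranspose U) ** (U ** diag_matrix m ** ctranspose U)
    = U ** diag_matrix (\<lambda>i. l i * m i) ** ctranspose U"
proof -
  have "(U ** diag_matrix l ** ctranspose U) ** (U ** diag_matrix m ** ctranspose U)
      = U ** diag_matrix l ** (ctranspose U ** U) ** diag_matrix m ** ctranspose U"
    by (simp add: matrix_mul_assoc)
  also have "\<dots> = U ** (diag_matrix l ** diag_matrix m) ** ctranspose U"
    using assms by (simp add: unitary_matrix_def matrix_mul_assoc)
  finally show ?thesis by (simp add: diag_matrix_mult)
qed

lemma pos_def_matrix_diagonalization: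
  assumes "pos_def_matrix A"
  obtains U l where "unitary_matrix U" "A = U ** diag_matrix l ** ctranspose U" "\<And>i. 0 < l i"
proof -
  have "self_adjoint_matrix A" using assms by (simp add: pos_def_matrix_def)
  then obtain U l where U: "unitary_matrix U" and A: "A = U ** diag_matrix l ** ctranspose U"
    by (rule spectral_theorem)
  have "0 < l i" for i
  proof -
    define v where "v = U *v axis i 1"
    have Uv: "ctranspose U *v v = axis i 1"
      using U by (simp add: v_def matrix_vector_mul_assoc unitary_matrix_def)
    have v0: "v \<noteq> 0"
    proof
      assume "v = 0"
      then have "axis i 1 = (0 :: complex ^ 'a)" using Uv by simp
      then show False by (simp add: axis_eq_0_iff)
    qed
    have "A *v v = of_real (l i) *s v"
    proof -
      have "A *v v = U *v (diag_matrix l *v (ctranspose U *v v))"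
        by (simp add: A matrix_vector_mul_assoc matrix_mul_assoc)
      also have "diag_matrix l *v (ctranspose U *v v) = of_real (l i) *s axis i 1"
        unfolding Uv by (simp add: vec_eq_iff matrix_vector_mult_def diag_matrix_def axis_def if_distrib[of "\<lambda>z. _ * z"]
              if_distrib[of "\<lambda>z. z * _"] cong: if_cong)
      also have "U *v (of_real (l i) *s axis i 1) = of_real (l i) *s v"
        by (simp add: v_def vector_scalar_commute)
      finally show ?thesis .
    qed
    then have "(\<Sum>k\<in>UNIV. (A *v v) $ k * cnj (v $ k)) = of_real (l i * (\<Sum>k\<in>UNIV. (norm (v $ k))\<^sup>2))"
      by (simp add: sum_distrib_left complex_norm_square mult.assoc del: of_real_power)
    moreover have "0 < Re (\<Sum>k\<in>UNIV. (A *v v) $ k * cnj (v $ k))"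
      using assms v0 unfolding pos_def_matrix_def by blast
    ultimately have "0 < l i * (\<Sum>k\<in>UNIV. (norm (v $ k))\<^sup>2)" by simp
    moreover have "0 \<le> (\<Sum>k\<in>UNIV. (norm (v $ k))\<^sup>2)" by (rule sum_nonneg) simp
    ultimately show ?thesis by (simp add: zero_less_mult_iff)
  qed
  then show thesis using that U A by blast
qed

lemma matrix_powr_mult_inverse:
  assumes "pos_def_matrix A"
  shows "matrix_powr A r ** matrix_powr A (- r) = mat 1"
proof -
  obtain U l where U: "unitary_matrix U" and A: "A = U ** diag_matrix l ** ctranspose U" and l: "\<And>i. 0 < l i"
    using pos_def_matrix_diagonalization[OF assms] by blast
  have "l i powr r * l i powr - r = 1" for i
    using l[of i] by (simp add: powr_add[symmetric])
  then show ?thesis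
    using U unfolding A matrix_powr_eq[OF U] conj_diag_mult[OF U] by (simp add: unitary_matrix_def diag_matrix_1)
qed

lemma matrix_powr_powr:
  assumes "pos_def_matrix A"
  shows "matrix_powr (matrix_powr A r) s = matrix_powr A (r * s)"
proof -
  obtain U l where U: "unitary_matrix U" and A: "A = U ** diag_matrix l ** ctranspose U" and l: "\<And>i. 0 < l i"
    using pos_def_matrix_diagonalization[OF assms] by blast
  show ?thesis unfolding A matrix_powr_eq[OF U] by (simp add: powr_powr)
qed

primrec matrix_power :: "complex ^ 'n ^ 'n \<Rightarrow> nat \<Rightarrow> complex ^ 'n ^ 'n" where
  "matrix_power A 0 = mat 1"
| "matrix_power A (Suc m) = A ** matrix_power A m"

lemma matrix_power_conj_diag:
  assumes "unitary_matrix U"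
  shows "matrix_power (U ** diag_matrix l ** ctranspose U) m = U ** diag_matrix (\<lambda>i. l i ^ m) ** ctranspose U"
proof (induction m)
  case 0
  show ?case using assms by (simp add: unitary_matrix_def diag_matrix_1)
next
  case (Suc m)
  then show ?case by (simp add: conj_diag_mult[OF assms])
qed

lemma conj_diag_nth:
  "(U ** diag_matrix l ** ctranspose U) $ a $ b = (\<Sum>k\<in>UNIV. of_real (l k) * (U $ a $ k * cnj (U $ b $ k)))"
  by (simp add: matrix_matrix_mult_def[of _ "ctranspose U"] diag_matrix_mult_right mult_ac)

lemma borel_measurable_matrix_mult [measurable]:
  fixes f g :: "'a \<Rightarrow> complex ^ 'n ^ 'n"
  assumes "f \<in> borel_measurable M" "g \<in> borel_measurable M"
  shows "(\<lambda>x. f x ** g x) \<in> borel_measurable M"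
  using assms by (rule borel_measurable_continuous_Pair)
    (intro continuous_on_matrix_mult continuous_intros)

lemma borel_measurable_matrix_power [measurable]:
  "f \<in> borel_measurable M \<Longrightarrow> (\<lambda>x. matrix_power (f x) m) \<in> borel_measurable M"
  by (induction m) auto

text \<open>Weierstrass approximation on the intervals from \<open>1 / Suc n\<close> to
  \<open>Suc n\<close>, which exhaust the positive half line. The polynomials do not depend on
  \<open>s\<close>, so one sequence serves all eigenvalues of all matrices at once.\<close>

lemma powr_polynomial_approximation:
  obtains P :: "nat \<Rightarrow> nat \<Rightarrow> real" and N :: "nat \<Rightarrow> nat"
  where "\<And>s. 0 < s \<Longrightarrow> (\<lambda>n. \<Sum>i\<le>N n. P n i * s ^ i) \<longlonglongrightarrow> s powr r"
proof -
  have "\<exists>a N. \<forall>s\<in>{1 / Suc n .. Suc n}. \<bar>s powr r - (\<Sum>i\<le>N. a i * s ^ i)\<bar> < 1 / Suc n" for n :: nat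
  proof -
    have "continuous_on {1 / real (Suc n) .. real (Suc n)} (\<lambda>s. s powr r)"
    proof (intro continuous_intros ballI)
      fix s assume "s \<in> {1 / real (Suc n) .. real (Suc n)}"
      then show "s \<noteq> 0" using divide_pos_pos[of 1 "real (Suc n)"] by auto
    qed
    then obtain g where g: "real_polynomial_function g"
        "\<And>s. s \<in> {1 / real (Suc n) .. real (Suc n)} \<Longrightarrow> \<bar>s powr r - g s\<bar> < 1 / Suc n"
      using Stone_Weierstrass_real_polynomial_function[of "{1 / real (Suc n) .. real (Suc n)}" "\<lambda>s. s powr r" "1 / Suc n"]
      by auto
    then show ?thesis
      unfolding real_polynomial_function_iff_sum by metis
  qed
  then obtain P N where PN: "\<And>n s. s \<in> {1 / real (Suc n) .. real (Suc n)} \<Longrightarrow>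
      \<bar>s powr r - (\<Sum>i\<le>N n. P n i * s ^ i)\<bar> < 1 / Suc n"
    by metis
  have "(\<lambda>n. \<Sum>i\<le>N n. P n i * s ^ i) \<longlonglongrightarrow> s powr r" if s: "0 < s" for s
  proof (rule LIM_zero_cancel, rule tendsto_rabs_zero_cancel, rule tendsto_sandwich)
    show "\<forall>\<^sub>F n in sequentially. 0 \<le> \<bar>(\<Sum>i\<le>N n. P n i * s ^ i) - s powr r\<bar>" by simp
    obtain n0 :: nat where n0: "max s (1 / s) \<le> real n0" using real_arch_simple by blast
    show "\<forall>\<^sub>F n in sequentially. \<bar>(\<Sum>i\<le>N n. P n i * s ^ i) - s powr r\<bar> \<le> 1 / Suc n"
      using eventually_ge_at_top[of n0]
    proof eventually_elim
      case (elim n)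
      then have "s \<le> real (Suc n)" "1 / s \<le> real (Suc n)" using n0 by auto
      then have "s \<in> {1 / real (Suc n) .. real (Suc n)}" using s by (simp add: field_simps)
      from PN[OF this] show ?case by (simp add: abs_minus_commute)
    qed
    show "(\<lambda>n. 1 / real (Suc n)) \<longlonglongrightarrow> 0" by (rule lim_inverse_n'[THEN LIMSEQ_Suc])
  qed simp
  then show thesis using that by blast
qed

text \<open>Diagonalisations are chosen separately at each point, without any regularity in
  \<open>x\<close>. The power is therefore written as a pointwise limit of fixed polynomials in
  \<open>W x\<close>, which are visibly measurable; the diagonalisation only proves
  convergence.\<close>

lemma borel_measurable_matrix_powr:
  fixes W :: "'a \<Rightarrow> complex ^ 'n ^ 'n"
  assumes [measurable]: "W \<in> borel_measurable M" and pd: "\<And>x. x \<in> space M \<Longrightarrow> pos_def_matrix (W x)"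
  shows "(\<lambda>x. matrix_powr (W x) r) \<in> borel_measurable M"
proof -
  obtain P :: "nat \<Rightarrow> nat \<Rightarrow> real" and N :: "nat \<Rightarrow> nat"
    where PN: "\<And>s. 0 < s \<Longrightarrow> (\<lambda>n. \<Sum>i\<le>N n. P n i * s ^ i) \<longlonglongrightarrow> s powr r"
    using powr_polynomial_approximation by blast
  show ?thesis
  proof (rule borel_measurable_LIMSEQ_metric)
    show "(\<lambda>x. \<Sum>i\<le>N n. P n i *\<^sub>R matrix_power (W x) i) \<in> borel_measurable M" for n
      by measurable
    fix x assume "x \<in> space M"
    then obtain U l where U: "unitary_matrix U" and W: "W x = U ** diag_matrix l ** ctranspose U" and l: "\<And>i. 0 < l i"
      using pd pos_def_matrix_diagonalization by metis
    have nth: "(\<Sum>i\<le>N n. P n i *\<^sub>R matrix_power (W x) i) $ a $ b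
        = (\<Sum>k\<in>UNIV. of_real (\<Sum>i\<le>N n. P n i * l k ^ i) * (U $ a $ k * cnj (U $ b $ k)))" for n a b
    proof -
      have "(\<Sum>i\<le>N n. P n i *\<^sub>R matrix_power (W x) i) $ a $ b
          = (\<Sum>i\<le>N n. \<Sum>k\<in>UNIV. of_real (P n i * l k ^ i) * (U $ a $ k * cnj (U $ b $ k)))"
        unfolding W matrix_power_conj_diag[OF U]
        by (simp add: conj_diag_nth scaleR_conv_of_real[where 'a = complex] sum_distrib_left mult.assoc)
      also have "\<dots> = (\<Sum>k\<in>UNIV. \<Sum>i\<le>N n. of_real (P n i * l k ^ i) * (U $ a $ k * cnj (U $ b $ k)))"
        by (rule sum.swap)
      finally show ?thesis by (simp add: sum_distrib_right)
    qed
    show "(\<lambda>n. \<Sum>i\<le>N n. P n i *\<^sub>R matrix_power (W x) i) \<longlonglongrightarrow> matrix_powr (W x) r"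
    proof (rule vec_tendstoI, rule vec_tendstoI)
      fix a b
      have "(\<lambda>n. \<Sum>k\<in>UNIV. of_real (\<Sum>i\<le>N n. P n i * l k ^ i) * (U $ a $ k * cnj (U $ b $ k)))
          \<longlonglongrightarrow> (\<Sum>k\<in>UNIV. of_real (l k powr r) * (U $ a $ k * cnj (U $ b $ k)))"
        by (intro tendsto_intros PN l)
      then show "(\<lambda>n. (\<Sum>i\<le>N n. P n i *\<^sub>R matrix_power (W x) i) $ a $ b) \<longlonglongrightarrow> matrix_powr (W x) r $ a $ b"
        unfolding nth unfolding W matrix_powr_eq[OF U] conj_diag_nth .
    qed
  qed
qed

section \<open>The kernel of a matrix weight\<close>

lemma lebesgue_complex_borel_version:
  fixes f :: "'a :: euclidean_space \<Rightarrow> complex"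
  assumes "f \<in> borel_measurable lebesgue"
  obtains g where "g \<in> borel_measurable borel" "AE x in lborel. f x = g x"
proof -
  have "(\<lambda>x. Re (f x)) \<in> borel_measurable (completion lborel)" "(\<lambda>x. Im (f x)) \<in> borel_measurable (completion lborel)"
    using assms by measurable
  from this[THEN completion_ex_borel_measurable_real]
  obtain a b where "a \<in> borel_measurable lborel" "b \<in> borel_measurable lborel"
      "AE x in lborel. Re (f x) = a x" "AE x in lborel. Im (f x) = b x" by blast
  moreover from this(3,4) have "AE x in lborel. f x = Complex (a x) (b x)"
    by eventually_elim (simp add: complex_eq_iff)
  moreover have "(\<lambda>x. Complex (a x) (b x)) \<in> borel_measurable borel"
    using calculation(1,2) by (simp add: Complex_eq)
  ultimately show thesis using that by blast
qed

lemma borel_measurable_vec_lambda: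
  fixes f :: "'n :: finite \<Rightarrow> 'a \<Rightarrow> 'b :: euclidean_space"
  assumes "\<And>i. f i \<in> borel_measurable M"
  shows "(\<lambda>x. \<chi> i. f i x) \<in> borel_measurable M"
  using assms by (subst borel_measurable_euclidean_space) (auto simp: Basis_vec_def inner_axis)

lemma lebesgue_vec_borel_version:
  fixes f :: "'a :: euclidean_space \<Rightarrow> complex ^ 'n"
  assumes "\<And>i. (\<lambda>x. f x $ i) \<in> borel_measurable lebesgue"
  obtains g where "g \<in> borel_measurable borel" "AE x in lborel. f x = g x"
proof -
  have "\<exists>g. g \<in> borel_measurable borel \<and> (AE x in lborel. f x $ i = g x)" for i
    using lebesgue_complex_borel_version[OF assms] by metis
  then obtain g where g: "\<And>i. g i \<in> borel_measurable borel" "\<And>i. AE x in lborel. f x $ i = g i x"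
    by metis
  have "AE x in lborel. \<forall>i. f x $ i = g i x" using g(2) by (simp add: AE_all_countable)
  then have "AE x in lborel. f x = (\<chi> i. g i x)" by eventually_elim (simp add: vec_eq_iff)
  moreover have "(\<lambda>x. \<chi> i. g i x) \<in> borel_measurable borel"
    using g(1) by (rule borel_measurable_vec_lambda)
  ultimately show thesis using that by blast
qed

text \<open>Local integrability yields measurability of the entries after cutting off to balls, and
  the cut-offs converge. On a Borel null set containing all bad points the weight is replaced by the
  identity, so that positive definiteness holds everywhere, as the locale for \<open>F\<close>
  requires.\<close>

lemma matrix_weight_borel_version:
  fixes W :: "real ^ 'd \<Rightarrow> complex ^ 'n ^ 'n"
  assumes W: "matrix_weight W"
  obtains V where "V \<in> borel_measurable borel" "\<And>x. pos_def_matrix (V x)" "AE x in lborel. W x = V x"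
proof -
  have meas: "(\<lambda>x. W x $ i $ j) \<in> borel_measurable lebesgue" for i j
  proof (rule borel_measurable_LIMSEQ_metric)
    fix n :: nat
    have "set_integrable lebesgue (cball 0 (real n)) (\<lambda>x. W x $ i $ j)"
      using W compact_cball unfolding matrix_weight_def by blast
    then show "(\<lambda>x. indicator (cball 0 (real n)) x *\<^sub>R W x $ i $ j) \<in> borel_measurable lebesgue"
      unfolding set_integrable_def by (rule borel_measurable_integrable)
  next
    fix x :: "real ^ 'd"
    obtain m :: nat where m: "norm x \<le> real m" using real_arch_simple by blast
    show "(\<lambda>n. indicator (cball 0 (real n)) x *\<^sub>R W x $ i $ j) \<longlonglongrightarrow> W x $ i $ j"
    proof (rule tendsto_eventually)
      show "\<forall>\<^sub>F n in sequentially. indicator (cball 0 (real n)) x *\<^sub>R W x $ i $ j = W x $ i $ j"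
        using eventually_ge_at_top[of m]
      proof eventually_elim
        case (elim n)
        then have "x \<in> cball 0 (real n)" using m by auto
        then show ?case by simp
      qed
    qed
  qed
  have "\<exists>g. g \<in> borel_measurable borel \<and> (AE x in lborel. W x $ i = g x)" for i
    using lebesgue_vec_borel_version[of "\<lambda>x. W x $ i"] meas by metis
  then obtain g where g: "\<And>i. g i \<in> borel_measurable borel" "\<And>i. AE x in lborel. W x $ i = g i x"
    by metis
  define V0 where "V0 x = (\<chi> i. g i x)" for x
  have V0: "V0 \<in> borel_measurable borel"
    unfolding V0_def using g(1) by (rule borel_measurable_vec_lambda)
  have "AE x in lborel. \<forall>i. W x $ i = g i x" using g(2) by (simp add: AE_all_countable)
  moreover have "AE x in lborel. pos_def_matrix (W x)"
    using W by (simp add: matrix_weight_def AE_completion_iff)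
  ultimately have "AE x in lborel. W x = V0 x \<and> pos_def_matrix (V0 x)"
  proof eventually_elim
    case (elim x)
    then have "W x = V0 x" by (simp add: V0_def vec_eq_iff)
    then show ?case using elim by simp
  qed
  then obtain N where N0: "\<And>x. x \<in> space lborel - N \<Longrightarrow> W x = V0 x \<and> pos_def_matrix (V0 x)" "N \<in> null_sets lborel"
    using AE_E3 by blast
  then have N: "N \<in> null_sets lborel" "{x. \<not> (W x = V0 x \<and> pos_def_matrix (V0 x))} \<subseteq> N"
    by auto
  define V where "V x = (if x \<in> N then mat 1 else V0 x)" for x
  have [measurable]: "N \<in> sets borel" using N by auto
  have "V \<in> borel_measurable borel"
    unfolding V_def using V0 by measurable
  moreover have "pos_def_matrix (V x)" for x
  proof (cases "x \<in> N")
    case True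
    have "0 < Re (\<Sum>i\<in>UNIV. v $ i * cnj (v $ i))" if "v \<noteq> 0" for v :: "complex ^ 'n"
    proof -
      have "\<exists>k. v $ k \<noteq> 0" using that by (auto simp: vec_eq_iff)
      then obtain k where "v $ k \<noteq> 0" ..
      then have "0 < (\<Sum>i\<in>UNIV. (norm (v $ i))\<^sup>2)" by (intro sum_pos2[of _ k]) auto
      also have "(\<Sum>i\<in>UNIV. (norm (v $ i))\<^sup>2) = Re (\<Sum>i\<in>UNIV. v $ i * cnj (v $ i))"
        by (simp flip: complex_norm_square)
      finally show ?thesis .
    qed
    then have "pos_def_matrix (mat 1 :: complex ^ 'n ^ 'n)"
      by (simp add: pos_def_matrix_def self_adjoint_matrix_def)
    then show ?thesis using True by (simp add: V_def)
  next
    case False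
    then show ?thesis using N(2) by (auto simp: V_def)
  qed
  moreover have "AE x in lborel. W x = V x"
    using AE_not_in[OF N(1)] by eventually_elim (use N(2) in \<open>auto simp: V_def\<close>)
  ultimately show thesis using that by blast
qed

section \<open>Operator norms of matrices\<close>

lemma linear_matrix_vector_mult: "linear ((*v) (A :: complex ^ 'n ^ 'm))"
  by (rule linearI)
    (simp add: matrix_vector_right_distrib, simp add: vec_eq_iff matrix_vector_mult_def scaleR_sum_right)

lemma bounded_linear_matrix_vector_mult: "bounded_linear ((*v) (A :: complex ^ 'n ^ 'm))"
  using linear_matrix_vector_mult by (rule linear_conv_bounded_linear[THEN iffD1])

lemma norm_matrix_vector_mult_le: "norm (A *v v) \<le> onorm ((*v) A) * norm (v :: complex ^ 'n)" for A :: "complex ^ 'n ^ 'm"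
  by (rule onorm[OF bounded_linear_matrix_vector_mult])

lemma onorm_matrix_mult_le: "onorm ((*v) (A ** B)) \<le> onorm ((*v) A) * onorm ((*v) (B :: complex ^ 'n ^ 'n))"
  using onorm_compose[OF bounded_linear_matrix_vector_mult[of A] bounded_linear_matrix_vector_mult[of B]]
  by (simp add: o_def matrix_vector_mul_assoc)

lemma onorm_matrix_le_sum:
  fixes A :: "complex ^ 'n ^ 'n"
  shows "onorm ((*v) A) \<le> (\<Sum>i\<in>UNIV. \<Sum>j\<in>UNIV. norm (A $ i $ j))"
proof (rule onorm_le)
  fix v :: "complex ^ 'n"
  have "norm (A *v v) \<le> (\<Sum>i\<in>UNIV. norm ((A *v v) $ i))"
    unfolding norm_vec_def by (rule L2_set_le_sum) simp
  also have "\<dots> \<le> (\<Sum>i\<in>UNIV. \<Sum>j\<in>UNIV. norm (A $ i $ j) * norm v)"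
  proof (rule sum_mono)
    fix i
    have "norm ((A *v v) $ i) \<le> (\<Sum>j\<in>UNIV. norm (A $ i $ j * v $ j))"
      unfolding matrix_vector_mult_def by (simp add: norm_sum)
    also have "\<dots> \<le> (\<Sum>j\<in>UNIV. norm (A $ i $ j) * norm v)"
      by (intro sum_mono) (simp add: norm_mult mult_left_mono Finite_Cartesian_Product.norm_nth_le)
    finally show "norm ((A *v v) $ i) \<le> (\<Sum>j\<in>UNIV. norm (A $ i $ j) * norm v)" .
  qed
  finally show "norm (A *v v) \<le> (\<Sum>i\<in>UNIV. \<Sum>j\<in>UNIV. norm (A $ i $ j)) * norm v"
    by (simp add: sum_distrib_right)
qed

text \<open>The operator norm is subadditive and dominated by the sum of the moduli of the entries,
  so it varies by at most the sum of the entrywise differences. It serves to make \<open>F\<close>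
  Borel.\<close>

lemma continuous_onorm_matrix: "continuous_on UNIV (\<lambda>A :: complex ^ 'n ^ 'n. onorm ((*v) A))"
proof -
  have diff: "onorm ((*v) A) \<le> onorm ((*v) B) + (\<Sum>i\<in>UNIV. \<Sum>j\<in>UNIV. norm (A $ i $ j - B $ i $ j))"
    for A B :: "complex ^ 'n ^ 'n"
  proof -
    have "onorm ((*v) A) = onorm (\<lambda>v. B *v v + (A - B) *v v)"
      by (intro arg_cong[where f = onorm]) (simp add: fun_eq_iff matrix_vector_mult_diff_rdistrib)
    also have "\<dots> \<le> onorm ((*v) B) + onorm ((*v) (A - B))"
      by (intro onorm_triangle bounded_linear_matrix_vector_mult)
    finally show ?thesis using onorm_matrix_le_sum[of "A - B"] by simp
  qed
  have "((\<lambda>B. onorm ((*v) B)) \<longlongrightarrow> onorm ((*v) A)) (at A)" for A :: "complex ^ 'n ^ 'n"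
  proof (rule LIM_zero_cancel, rule tendsto_rabs_zero_cancel, rule tendsto_sandwich)
    let ?s = "\<lambda>B. (\<Sum>i\<in>UNIV. \<Sum>j\<in>UNIV. norm (B $ i $ j - A $ i $ j))"
    show "\<forall>\<^sub>F B in at A. 0 \<le> \<bar>onorm ((*v) B) - onorm ((*v) A)\<bar>" by simp
    show "\<forall>\<^sub>F B in at A. \<bar>onorm ((*v) B) - onorm ((*v) A)\<bar> \<le> ?s B"
    proof (rule always_eventually, rule allI)
      fix B :: "complex ^ 'n ^ 'n"
      have "(\<Sum>i\<in>UNIV. \<Sum>j\<in>UNIV. norm (A $ i $ j - B $ i $ j)) = ?s B"
        by (simp add: norm_minus_commute)
      then show "\<bar>onorm ((*v) B) - onorm ((*v) A)\<bar> \<le> ?s B"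
        using diff[of A B] diff[of B A] by linarith
    qed
    have "(?s \<longlongrightarrow> (\<Sum>i\<in>UNIV. \<Sum>j\<in>UNIV. norm (A $ i $ j - A $ i $ j))) (at A)"
      by (intro tendsto_intros)
    then show "(?s \<longlongrightarrow> 0) (at A)" by simp
  qed auto
  then show ?thesis by (simp add: continuous_on_def)
qed

text \<open>The product telescopes: \<open>(R x ** S y) ** (R y ** S z) = R x ** S z\<close>. For
  \<open>z = x\<close> this also shows that \<open>R x ** S y\<close> is invertible, so its norm is
  not zero.\<close>

lemma submultiplicative_kernel_matrix:
  fixes R S :: "real ^ 'd \<Rightarrow> complex ^ 'n ^ 'n"
  assumes [measurable]: "R \<in> borel_measurable borel" "S \<in> borel_measurable borel"
    and RS: "\<And>x. R x ** S x = mat 1" and Pq: "1 < P" "1 < q"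
  shows "submultiplicative_kernel (\<lambda>x y. ennreal (onorm ((*v) (R x ** S y)))) P q"
proof
  have SR: "S x ** R x = mat 1" for x using RS matrix_left_right_inverse by blast
  have onorm_borel: "(\<lambda>A :: complex ^ 'n ^ 'n. onorm ((*v) A)) \<in> borel_measurable borel"
    using continuous_onorm_matrix by (rule borel_measurable_continuous_onI)
  have "(\<lambda>z. R (fst z) ** S (snd z)) \<in> borel_measurable (borel \<Otimes>\<^sub>M borel)"
    by measurable
  from measurable_compose[OF this onorm_borel]
  show "(\<lambda>(x, y). ennreal (onorm ((*v) (R x ** S y)))) \<in> borel_measurable (borel \<Otimes>\<^sub>M borel)"
    by (simp add: split_beta')
  have prod: "(R x ** S y) ** (R y ** S z) = R x ** S z" for x y z
  proof -
    have "(R x ** S y) ** (R y ** S z) = R x ** (S y ** R y) ** S z" by (simp add: matrix_mul_assoc)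
    then show ?thesis by (simp add: SR)
  qed
  have nonneg: "0 \<le> onorm ((*v) (R x ** S y))" for x y
    by (rule onorm_pos_le[OF bounded_linear_matrix_vector_mult])
  fix x y z
  show "ennreal (onorm ((*v) (R x ** S z))) \<le> ennreal (onorm ((*v) (R x ** S y))) * ennreal (onorm ((*v) (R y ** S z)))"
    using onorm_matrix_mult_le[of "R x ** S y" "R y ** S z"] nonneg
    by (simp add: prod ennreal_mult[symmetric] ennreal_leI)
  show "ennreal (onorm ((*v) (R x ** S y))) \<noteq> 0"
  proof
    assume "ennreal (onorm ((*v) (R x ** S y))) = 0"
    then have "onorm ((*v) (R x ** S y)) = 0" using nonneg[of x y] by (simp add: ennreal_eq_0_iff)
    then have zero: "(R x ** S y) *v v = 0" for v
      using norm_matrix_vector_mult_le[of "R x ** S y" v] by simp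
    define v :: "complex ^ 'n" where "v = axis undefined 1"
    have "v = (R y ** S x) *v ((R x ** S y) *v v)"
      unfolding matrix_vector_mul_assoc prod RS by simp
    then have "v = 0" unfolding zero by simp
    then show False by (simp add: v_def axis_eq_0_iff)
  qed
qed (use Pq in auto)

section \<open>Averages of a submultiplicative kernel over cubes\<close>

context submultiplicative_kernel
begin

text \<open>Here \<open>w\<close> stands for the factor \<open>psi\<close> in the normalisation of
  the characteristic. Removing it costs \<open>w\<close> in the outer average and
  \<open>w powr (q / P)\<close> in the inner one.\<close>

lemma A_const_le_cube:
  fixes S Q :: "(real ^ 'd) set" and v w :: real
  assumes [measurable]: "Q \<in> sets borel" "S \<in> sets borel" and S: "S \<subseteq> Q" "emeasure lborel S = ennreal v"
    and v: "0 < v" and w: "0 < w"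
  shows "A_const S \<le> ennreal (w powr (1 + q / P)) * (ennreal (1 / (w * v)) *
    (\<integral>\<^sup>+x\<in>Q. (ennreal (1 / (w * v)) * (\<integral>\<^sup>+y\<in>Q. F x y \<up> P \<partial>lborel)) \<up> (q / P) \<partial>lborel))"
proof -
  have qP: "0 < q / P" using P q by simp
  have avg: "eavg S f \<le> ennreal w * (ennreal (1 / (w * v)) * (\<integral>\<^sup>+x\<in>Q. f x \<partial>lborel))" for f
  proof -
    have "eavg S f = ennreal (1 / v) * (\<integral>\<^sup>+x\<in>S. f x \<partial>lborel)"
      unfolding eavg_def S(2) using v by (simp add: divide_ennreal_def inverse_ennreal inverse_eq_divide mult.commute)
    also have "\<dots> \<le> ennreal (1 / v) * (\<integral>\<^sup>+x\<in>Q. f x \<partial>lborel)"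
      using S(1) by (intro mult_left_mono nn_integral_mono) (auto split: split_indicator)
    also have "ennreal (1 / v) = ennreal w * ennreal (1 / (w * v))"
      using v w by (simp add: ennreal_mult[symmetric])
    finally show ?thesis by (simp add: mult.assoc)
  qed
  define J where "J x = (ennreal (1 / (w * v)) * (\<integral>\<^sup>+y\<in>Q. F x y \<up> P \<partial>lborel)) \<up> (q / P)" for x
  have "(\<lambda>(x, y). F x y \<up> P * indicator Q y) \<in> borel_measurable (lborel \<Otimes>\<^sub>M lborel)"
    by measurable
  then have [measurable]: "(\<lambda>x. \<integral>\<^sup>+y\<in>Q. F x y \<up> P \<partial>lborel) \<in> borel_measurable lborel"
    by (rule lborel.borel_measurable_nn_integral)
  have [measurable]: "J \<in> borel_measurable borel" unfolding J_def by measurable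
  have "A_const S \<le> eavg S (\<lambda>x. ennreal w \<up> (q / P) * J x)"
    unfolding A_const_def
  proof (rule eavg_mono)
    fix x
    have "eavg S (\<lambda>y. F x y \<up> P) \<up> (q / P) \<le> (ennreal w * (ennreal (1 / (w * v)) * (\<integral>\<^sup>+y\<in>Q. F x y \<up> P \<partial>lborel))) \<up> (q / P)"
      using qP by (intro epowr_mono avg) auto
    then show "eavg S (\<lambda>y. F x y \<up> P) \<up> (q / P) \<le> ennreal w \<up> (q / P) * J x"
      using qP by (simp add: J_def epowr_mult)
  qed
  also have "\<dots> = ennreal w \<up> (q / P) * eavg S J"
    by (rule eavg_cmult) measurable
  also have "\<dots> \<le> ennreal w \<up> (q / P) * (ennreal w * (ennreal (1 / (w * v)) * (\<integral>\<^sup>+x\<in>Q. J x \<partial>lborel)))"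
    by (intro mult_left_mono avg) simp
  also have "\<dots> = ennreal (w powr (1 + q / P)) * (ennreal (1 / (w * v)) * (\<integral>\<^sup>+x\<in>Q. J x \<partial>lborel))"
    using w by (simp add: epowr_ennreal powr_add ennreal_mult mult_ac)
  finally show ?thesis unfolding J_def .
qed

text \<open>Since \<open>F x y * F y x \<ge> F x x \<ge> 1\<close>, the set where \<open>F \<ge> 1\<close> occupies at least half of \<open>S \<times> S\<close>.\<close>
lemma A_const_lower_bound:
  fixes S :: "(real ^ 'd) set"
  assumes [measurable]: "S \<in> sets borel" and S: "emeasure lborel S = 1"
  shows "ennreal ((1 / 4) powr (1 + q / P)) \<le> A_const S"
proof -
  have qP: "0 < q / P" using P q by simp
  have S': "emeasure lborel S \<noteq> 0" "emeasure lborel S < top" using S by auto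
  have Fxx: "1 \<le> F x x" for x
  proof (rule ccontr)
    assume "\<not> 1 \<le> F x x"
    then have "F x x * F x x < F x x * 1"
      using F_pos[of x x] F_finite[of x x] by (intro ennreal_mult_strict_left_mono) (auto simp: less_top zero_less_iff_neq_zero)
    then show False using F_submult[of x x x] by simp
  qed
  define E where "E x y = (indicator {z. 1 \<le> F (fst z) (snd z)} (x, y) * (indicator S x * indicator S y) :: ennreal)" for x y
  have E_meas [measurable]: "(\<lambda>(x, y). E x y) \<in> borel_measurable (borel \<Otimes>\<^sub>M borel)"
    unfolding E_def by (simp add: split_beta' indicator_def)
  define e where "e x = (\<integral>\<^sup>+y. indicator {z. 1 \<le> F (fst z) (snd z)} (x, y) * indicator S y \<partial>lborel)" for x
  have "(\<lambda>(x, y). indicator {z. 1 \<le> F (fst z) (snd z)} (x, y) * indicator S y :: ennreal) \<in> borel_measurable (lborel \<Otimes>\<^sub>M lborel)"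
    by (simp add: split_beta' indicator_def)
  then have "e \<in> borel_measurable lborel"
    unfolding e_def by (rule lborel.borel_measurable_nn_integral)
  then have [measurable]: "e \<in> borel_measurable borel" by simp
  define I where "I = (\<integral>\<^sup>+x. \<integral>\<^sup>+y. E x y \<partial>lborel \<partial>lborel)"
  have I_e: "I = (\<integral>\<^sup>+x\<in>S. e x \<partial>lborel)"
    unfolding I_def E_def e_def by (intro nn_integral_cong) (auto simp: nn_integral_multc split: split_indicator)
  have I_swap: "I = (\<integral>\<^sup>+x. \<integral>\<^sup>+y. E y x \<partial>lborel \<partial>lborel)"
    unfolding I_def by (rule nn_integral_pair_swap) (rule E_meas)
  have "1 = (\<integral>\<^sup>+x. \<integral>\<^sup>+y. indicator S x * indicator S y \<partial>lborel \<partial>lborel)"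
    using S by (simp add: nn_integral_cmult)
  also have "\<dots> \<le> (\<integral>\<^sup>+x. \<integral>\<^sup>+y. E x y + E y x \<partial>lborel \<partial>lborel)"
  proof (intro nn_integral_mono)
    fix x y
    have "1 \<le> F x y \<or> 1 \<le> F y x"
    proof (rule ccontr)
      assume "\<not> ?thesis"
      then have F: "F x y < 1" "F y x \<le> 1" by auto
      have "F x y * F y x < 1 * F y x"
        using F(1) F_pos[of y x] F_finite[of y x]
        by (intro ennreal_mult_strict_right_mono) (simp_all add: less_top zero_less_iff_neq_zero)
      also have "\<dots> \<le> 1" using F(2) by simp
      also have "1 \<le> F x y * F y x" using F_submult[of x x y] Fxx[of x] by (rule order_trans[rotated])
      finally show False by simp
    qed
    then show "indicator S x * indicator S y \<le> E x y + E y x"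
      by (auto simp: E_def split: split_indicator)
  qed
  also have "\<dots> = I + I"
  proof -
    have [measurable]: "(\<lambda>y. E x y) \<in> borel_measurable lborel" "(\<lambda>y. E y x) \<in> borel_measurable lborel" for x
      unfolding E_def by (simp_all add: indicator_def)
    have "(\<lambda>(x, y). E x y) \<in> borel_measurable (lborel \<Otimes>\<^sub>M lborel)" "(\<lambda>(x, y). E y x) \<in> borel_measurable (lborel \<Otimes>\<^sub>M lborel)"
      unfolding E_def by (simp_all add: split_beta' indicator_def)
    then have [measurable]: "(\<lambda>x. \<integral>\<^sup>+y. E x y \<partial>lborel) \<in> borel_measurable lborel"
        "(\<lambda>x. \<integral>\<^sup>+y. E y x \<partial>lborel) \<in> borel_measurable lborel"
      by (auto intro: lborel.borel_measurable_nn_integral)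
    show ?thesis
      by (simp add: nn_integral_add) (simp add: I_def[symmetric] I_swap[symmetric])
  qed
  finally have half: "1 \<le> I + I" .
  define t where "t = q / P"
  \<comment> \<open>As \<open>e x \<le> 1\<close>, the term with \<open>e x \<up> t\<close> alone
    suffices where \<open>e x \<ge> 1 / 4\<close>, whatever the size of \<open>t\<close>. The other
    points contribute at most \<open>1 / 4\<close> in total, less than the half guaranteed for
    \<open>I\<close>.\<close>
  have e_le: "e x \<le> ennreal (4 powr t) * e x \<up> t + ennreal (1 / 4)" for x
  proof (cases "ennreal (1 / 4) \<le> e x")
    case True
    have "e x \<le> (\<integral>\<^sup>+y. indicator S y \<partial>lborel)"
      unfolding e_def by (intro nn_integral_mono) (auto split: split_indicator)
    then have "e x \<le> 1" using S by simp
    also have "1 = ennreal (4 powr t) * ennreal (1 / 4) \<up> t"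
    proof -
      have "ennreal (1 / 4) \<up> t = ennreal ((1 / 4) powr t)" by (rule epowr_ennreal) simp
      moreover have "4 powr t * (1 / 4) powr t = 1" by (simp add: powr_divide)
      ultimately show ?thesis by (simp add: ennreal_mult[symmetric])
    qed
    also have "\<dots> \<le> ennreal (4 powr t) * e x \<up> t"
      using True qP by (intro mult_left_mono epowr_mono) (auto simp: t_def)
    finally show ?thesis by (simp add: add_increasing2)
  qed (simp add: add_increasing)
  have "I \<le> (\<integral>\<^sup>+x. ennreal (4 powr t) * (e x \<up> t * indicator S x) + ennreal (1 / 4) * indicator S x \<partial>lborel)"
    unfolding I_e using e_le by (intro nn_integral_mono) (auto split: split_indicator)
  also have "\<dots> = ennreal (4 powr t) * (\<integral>\<^sup>+x\<in>S. e x \<up> t \<partial>lborel) + ennreal (1 / 4)"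
    using S by (subst nn_integral_add) (auto simp: nn_integral_cmult)
  also have "(\<integral>\<^sup>+x\<in>S. e x \<up> t \<partial>lborel) \<le> A_const S"
  proof -
    have "e x \<le> (\<integral>\<^sup>+y\<in>S. F x y \<up> P \<partial>lborel)" for x
      unfolding e_def
    proof (rule nn_integral_mono)
      fix y
      have "1 \<le> F x y \<Longrightarrow> 1 \<le> F x y \<up> P"
        using P epowr_mono[of P 1 "F x y"] epowr_ennreal[of 1 P] by simp
      then show "indicator {z. 1 \<le> F (fst z) (snd z)} (x, y) * indicator S y \<le> F x y \<up> P * indicator S y"
        by (auto split: split_indicator)
    qed
    then have "e x \<le> eavg S (\<lambda>y. F x y \<up> P)" for x
      by (simp add: nn_integral_eq_eavg[OF S'] S)
    then have "(\<integral>\<^sup>+x\<in>S. e x \<up> t \<partial>lborel) \<le> (\<integral>\<^sup>+x\<in>S. eavg S (\<lambda>y. F x y \<up> P) \<up> t \<partial>lborel)"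
      using qP by (intro nn_integral_mono mult_right_mono epowr_mono) (auto simp: t_def)
    also have "\<dots> = A_const S"
      by (simp add: A_const_def t_def nn_integral_eq_eavg[OF S'] S)
    finally show ?thesis .
  qed
  finally have I_le: "I \<le> ennreal (4 powr t) * A_const S + ennreal (1 / 4)"
    by (simp add: mult_left_mono add_right_mono)
  show ?thesis
  proof (cases "A_const S")
    case (real a)
    have "I \<le> ennreal (4 powr t * a + 1 / 4)"
      using I_le real ennreal_plus[of "4 powr t * a" "1 / 4"] by (simp add: ennreal_mult)
    then have "I + I \<le> ennreal (4 powr t * a + 1 / 4) + ennreal (4 powr t * a + 1 / 4)" by (intro add_mono)
    also have "\<dots> = ennreal (2 * (4 powr t * a + 1 / 4))"
      using real by (simp add: ennreal_plus[symmetric] del: ennreal_plus)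
    finally have "ennreal 1 \<le> ennreal (2 * (4 powr t * a + 1 / 4))"
      using half by (simp only: ennreal_1)
    then have "1 / 4 \<le> 4 powr t * a" using real by (subst (asm) ennreal_le_iff) auto
    then have "(1 / 4) powr t * (1 / 4) \<le> (1 / 4) powr t * (4 powr t * a)" by (intro mult_left_mono) auto
    also have "(1 / 4) powr t * (4 powr t * a) = a" by (simp add: powr_divide)
    finally have "(1 / 4) powr (1 + t) \<le> a" by (simp add: powr_add mult.commute)
    then show ?thesis using real by (simp add: t_def ennreal_leI)
  qed simp
qed

end

section \<open>Iterated integrals of vector-valued functions\<close>

text \<open>Because \<open>A\<close> is invertible, absolute convergence for
  \<open>A *v \<phi> y\<close> controls every component of \<phi>, which gives the first two claims.
  Then \<open>A\<close> may be taken under both integrals, and the norm of the result is estimated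
  component by component; this is where the dimension enters.\<close>

lemma iterated_integral_bound:
  fixes K :: "real \<Rightarrow> 'y :: euclidean_space \<Rightarrow> complex" and \<phi> :: "'y \<Rightarrow> complex ^ 'n" and A A' :: "complex ^ 'n ^ 'n"
  assumes K [measurable]: "(\<lambda>(t, y). K t y) \<in> borel_measurable (borel \<Otimes>\<^sub>M borel)"
    and [measurable]: "\<phi> \<in> borel_measurable borel" and A: "A' ** A = mat 1"
    and fin: "(\<integral>\<^sup>+t. \<integral>\<^sup>+y. ennreal (norm (K t y)) * ennreal (norm (A *v \<phi> y)) \<partial>lborel \<partial>lborel) < top" (is "?Z < top")
  shows "AE t in lborel. integrable lborel (\<lambda>y. K t y * \<phi> y $ i)"
    and "integrable lborel (\<lambda>t. \<integral>y. K t y * \<phi> y $ i \<partial>lborel)"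
    and "ennreal (norm (A *v (\<chi> i. \<integral>t. (\<integral>y. K t y * \<phi> y $ i \<partial>lborel) \<partial>lborel))) \<le> of_nat CARD('n) * ?Z"
proof -
  have K' [measurable (raw)]: "(\<lambda>x. K (f x) (g x)) \<in> borel_measurable M"
    if [measurable]: "f \<in> measurable M borel" "g \<in> measurable M borel" for f g and M :: "'m measure"
  proof -
    have "(\<lambda>x. (f x, g x)) \<in> measurable M (borel \<Otimes>\<^sub>M borel)" by measurable
    from measurable_compose[OF this K] show ?thesis by simp
  qed
  have Kpair: "(\<lambda>(t, y). K t y * \<psi> y) \<in> borel_measurable (lborel \<Otimes>\<^sub>M lborel)"
    if [measurable]: "\<psi> \<in> borel_measurable borel" for \<psi> :: "'y \<Rightarrow> complex"
  proof -
    have "(\<lambda>z. K (fst z) (snd z) * \<psi> (snd z)) \<in> borel_measurable (lborel \<Otimes>\<^sub>M lborel)"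
      by (intro borel_measurable_times K') measurable
    then show ?thesis by (simp add: split_beta')
  qed
  have Ky: "(\<lambda>y. K t y) \<in> borel_measurable borel" for t by (rule K') auto
  have A_borel [measurable]: "(\<lambda>y. A *v \<phi> y) \<in> borel_measurable borel"
    by (rule borel_measurable_continuous_on[OF linear_continuous_on[OF bounded_linear_matrix_vector_mult]]) auto
  define c where "c = onorm ((*v) A')"
  have c: "0 \<le> c" unfolding c_def by (rule onorm_pos_le[OF bounded_linear_matrix_vector_mult])
  have comp: "norm (\<phi> y $ i) \<le> c * norm (A *v \<phi> y)" for y i
  proof -
    have "norm (\<phi> y $ i) \<le> norm (\<phi> y)" by (rule Finite_Cartesian_Product.norm_nth_le)
    also have "norm (\<phi> y) = norm (A' *v (A *v \<phi> y))" by (simp add: matrix_vector_mul_assoc A)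
    also have "\<dots> \<le> c * norm (A *v \<phi> y)" unfolding c_def by (rule norm_matrix_vector_mult_le)
    finally show ?thesis .
  qed
  \<comment> \<open>Applied twice: to the components of \<phi>, where the norm of the inverse enters
    and only finiteness matters, and to the components of \<open>A *v \<phi> y\<close> with constant
    \<open>1\<close>, where the bound itself is used.\<close>
  have general: "(AE t in lborel. integrable lborel (\<lambda>y. K t y * \<psi> y)) \<and>
      integrable lborel (\<lambda>t. \<integral>y. K t y * \<psi> y \<partial>lborel) \<and>
      ennreal (norm (\<integral>t. (\<integral>y. K t y * \<psi> y \<partial>lborel) \<partial>lborel)) \<le> ennreal b * ?Z"
    if \<psi> [measurable]: "\<psi> \<in> borel_measurable borel" and b: "0 \<le> b" "\<And>y. norm (\<psi> y) \<le> b * norm (A *v \<phi> y)"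
    for \<psi> :: "'y \<Rightarrow> complex" and b
  proof -
    define Z where "Z t = (\<integral>\<^sup>+y. ennreal (norm (K t y * \<psi> y)) \<partial>lborel)" for t
    have [measurable]: "Z \<in> borel_measurable lborel"
    proof -
      have "(\<lambda>(t, y). ennreal (norm (K t y * \<psi> y))) \<in> borel_measurable (lborel \<Otimes>\<^sub>M lborel)"
        using Kpair[OF \<psi>] by (simp add: split_beta')
      then show ?thesis unfolding Z_def by (rule lborel.borel_measurable_nn_integral)
    qed
    have "(\<integral>\<^sup>+t. Z t \<partial>lborel) \<le> (\<integral>\<^sup>+t. ennreal b * (\<integral>\<^sup>+y. ennreal (norm (K t y)) * ennreal (norm (A *v \<phi> y)) \<partial>lborel) \<partial>lborel)"
    proof (rule nn_integral_mono)
      fix t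
      have "Z t \<le> (\<integral>\<^sup>+y. ennreal b * (ennreal (norm (K t y)) * ennreal (norm (A *v \<phi> y))) \<partial>lborel)"
        unfolding Z_def
      proof (rule nn_integral_mono)
        fix y
        have "norm (K t y * \<psi> y) \<le> b * (norm (K t y) * norm (A *v \<phi> y))"
          using mult_left_mono[OF b(2)[of y], of "norm (K t y)"] by (simp add: norm_mult mult_ac)
        then show "ennreal (norm (K t y * \<psi> y)) \<le> ennreal b * (ennreal (norm (K t y)) * ennreal (norm (A *v \<phi> y)))"
          using b by (simp add: ennreal_mult[symmetric] ennreal_leI)
      qed
      also have "\<dots> = ennreal b * (\<integral>\<^sup>+y. ennreal (norm (K t y)) * ennreal (norm (A *v \<phi> y)) \<partial>lborel)"
        using Ky by (intro nn_integral_cmult) auto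
      finally show "Z t \<le> ennreal b * (\<integral>\<^sup>+y. ennreal (norm (K t y)) * ennreal (norm (A *v \<phi> y)) \<partial>lborel)" .
    qed
    also have "\<dots> = ennreal b * ?Z"
    proof (rule nn_integral_cmult)
      have "(\<lambda>z. ennreal (norm (K (fst z) (snd z))) * ennreal (norm (A *v \<phi> (snd z)))) \<in> borel_measurable (lborel \<Otimes>\<^sub>M lborel)"
        using K'[of fst "lborel \<Otimes>\<^sub>M lborel" snd] by simp
      then have "(\<lambda>(t, y). ennreal (norm (K t y)) * ennreal (norm (A *v \<phi> y))) \<in> borel_measurable (lborel \<Otimes>\<^sub>M lborel)"
        by (simp add: split_beta')
      then show "(\<lambda>t. \<integral>\<^sup>+y. ennreal (norm (K t y)) * ennreal (norm (A *v \<phi> y)) \<partial>lborel) \<in> borel_measurable lborel"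
        by (rule lborel.borel_measurable_nn_integral)
    qed
    finally have Z_le: "(\<integral>\<^sup>+t. Z t \<partial>lborel) \<le> ennreal b * ?Z" .
    have "ennreal b * ?Z < top"
      using fin by (simp add: ennreal_mult_less_top)
    with Z_le have Z_fin: "(\<integral>\<^sup>+t. Z t \<partial>lborel) < top"
      by (rule order_le_less_trans)
    then have "AE t in lborel. Z t \<noteq> \<infinity>"
      by (intro nn_integral_PInf_AE) auto
    then have 1: "AE t in lborel. integrable lborel (\<lambda>y. K t y * \<psi> y)"
    proof eventually_elim
      case (elim t)
      then show ?case
        using Ky[of t] by (intro integrableI_bounded) (auto simp: Z_def less_top)
    qed
    have meas: "(\<lambda>t. \<integral>y. K t y * \<psi> y \<partial>lborel) \<in> borel_measurable lborel"
      using Kpair[OF \<psi>] by (rule lborel.borel_measurable_lebesgue_integral)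
    have inner: "ennreal (norm (\<integral>y. K t y * \<psi> y \<partial>lborel)) \<le> Z t" for t
    proof (cases "integrable lborel (\<lambda>y. K t y * \<psi> y)")
      case True
      then show ?thesis unfolding Z_def by (rule integral_norm_bound_ennreal)
    qed (simp add: not_integrable_integral_eq)
    have "(\<integral>\<^sup>+t. ennreal (norm (\<integral>y. K t y * \<psi> y \<partial>lborel)) \<partial>lborel) \<le> (\<integral>\<^sup>+t. Z t \<partial>lborel)"
      by (intro nn_integral_mono inner)
    note outer = this
    then have 2: "integrable lborel (\<lambda>t. \<integral>y. K t y * \<psi> y \<partial>lborel)"
      using meas Z_fin by (intro integrableI_bounded) (auto intro: order_le_less_trans)
    have "ennreal (norm (\<integral>t. (\<integral>y. K t y * \<psi> y \<partial>lborel) \<partial>lborel)) \<le> ennreal b * ?Z"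
      using integral_norm_bound_ennreal[OF 2] outer Z_le by (meson order_trans)
    then show ?thesis using 1 2 by blast
  qed
  have phi_i: "(\<lambda>y. \<phi> y $ i) \<in> borel_measurable borel" for i by measurable
  show "AE t in lborel. integrable lborel (\<lambda>y. K t y * \<phi> y $ i)"
    and "integrable lborel (\<lambda>t. \<integral>y. K t y * \<phi> y $ i \<partial>lborel)"
    using general[OF phi_i c comp] by blast+
  define \<Psi> where "\<Psi> = (\<chi> i. \<integral>t. (\<integral>y. K t y * \<phi> y $ i \<partial>lborel) \<partial>lborel)"
  have row: "ennreal (norm ((A *v \<Psi>) $ j)) \<le> ?Z" for j
  proof -
    have psi_j: "(\<lambda>y. (A *v \<phi> y) $ j) \<in> borel_measurable borel" by measurable
    have "(A *v \<Psi>) $ j = (\<Sum>i\<in>UNIV. A $ j $ i * (\<integral>t. (\<integral>y. K t y * \<phi> y $ i \<partial>lborel) \<partial>lborel))"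
      by (simp add: matrix_vector_mult_def \<Psi>_def)
    also have "\<dots> = (\<integral>t. (\<Sum>i\<in>UNIV. A $ j $ i * (\<integral>y. K t y * \<phi> y $ i \<partial>lborel)) \<partial>lborel)"
      using general[OF phi_i c comp] by (subst Bochner_Integration.integral_sum) auto
    also have "\<dots> = (\<integral>t. (\<integral>y. K t y * (A *v \<phi> y) $ j \<partial>lborel) \<partial>lborel)"
    proof (rule integral_cong_AE)
      have "\<forall>i. AE t in lborel. integrable lborel (\<lambda>y. K t y * \<phi> y $ i)"
        using general[OF phi_i c comp] by blast
      then have "AE t in lborel. \<forall>i. integrable lborel (\<lambda>y. K t y * \<phi> y $ i)"
        by (simp add: AE_all_countable)
      then show "AE t in lborel. (\<Sum>i\<in>UNIV. A $ j $ i * (\<integral>y. K t y * \<phi> y $ i \<partial>lborel)) = (\<integral>y. K t y * (A *v \<phi> y) $ j \<partial>lborel)"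
      proof eventually_elim
        case (elim t)
        have "(\<integral>y. K t y * (A *v \<phi> y) $ j \<partial>lborel) = (\<integral>y. (\<Sum>i\<in>UNIV. A $ j $ i * (K t y * \<phi> y $ i)) \<partial>lborel)"
          by (simp add: matrix_vector_mult_def sum_distrib_left mult_ac)
        also have "\<dots> = (\<Sum>i\<in>UNIV. A $ j $ i * (\<integral>y. K t y * \<phi> y $ i \<partial>lborel))"
          using elim by (subst Bochner_Integration.integral_sum) auto
        finally show ?case by simp
      qed
      have m: "(\<lambda>t. \<integral>y. K t y * \<psi> y \<partial>lborel) \<in> borel_measurable lborel"
        if "\<psi> \<in> borel_measurable borel" for \<psi> :: "'y \<Rightarrow> complex"
        using Kpair[OF that] by (rule lborel.borel_measurable_lebesgue_integral)
      show "(\<lambda>t. \<Sum>i\<in>UNIV. A $ j $ i * (\<integral>y. K t y * \<phi> y $ i \<partial>lborel)) \<in> borel_measurable lborel"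
        using m[OF phi_i] by (intro borel_measurable_sum borel_measurable_times) auto
      show "(\<lambda>t. \<integral>y. K t y * (A *v \<phi> y) $ j \<partial>lborel) \<in> borel_measurable lborel"
        by (rule m[OF psi_j])
    qed
    finally have eq: "(A *v \<Psi>) $ j = (\<integral>t. (\<integral>y. K t y * (A *v \<phi> y) $ j \<partial>lborel) \<partial>lborel)" .
    have "norm ((A *v \<phi> y) $ j) \<le> 1 * norm (A *v \<phi> y)" for y
      using Finite_Cartesian_Product.norm_nth_le[of "A *v \<phi> y" j] by simp
    then have "ennreal (norm (\<integral>t. (\<integral>y. K t y * (A *v \<phi> y) $ j \<partial>lborel) \<partial>lborel)) \<le> ennreal 1 * ?Z"
      using general[OF psi_j, of 1] by simp
    then show ?thesis unfolding eq by simp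
  qed
  have "norm (A *v \<Psi>) \<le> (\<Sum>j\<in>UNIV. norm ((A *v \<Psi>) $ j))"
    unfolding norm_vec_def by (rule L2_set_le_sum) simp
  then have "ennreal (norm (A *v \<Psi>)) \<le> (\<Sum>j\<in>UNIV. ennreal (norm ((A *v \<Psi>) $ j)))"
    by (simp add: ennreal_leI)
  also have "\<dots> \<le> (\<Sum>j\<in>(UNIV :: 'n set). ?Z)"
    by (intro sum_mono row)
  finally show "ennreal (norm (A *v (\<chi> i. \<integral>t. (\<integral>y. K t y * \<phi> y $ i \<partial>lborel) \<partial>lborel))) \<le> of_nat CARD('n) * ?Z"
    by (simp add: \<Psi>_def)
qed

section \<open>Cubes and the characteristic of the weight\<close>

lemma cube_eq_cbox: "cube c l = cbox (c - (\<chi> i. l / 2)) (c + (\<chi> i. l / 2))"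
  unfolding cube_def set_eq_iff mem_box_cart mem_Collect_eq abs_diff_le_iff by simp

lemma borel_cube [measurable]: "cube c l \<in> sets borel"
  by (simp add: cube_eq_cbox)

lemma measure_cube:
  assumes "0 \<le> l"
  shows "measure lborel (cube (c :: real ^ 'd) l) = l ^ CARD('d)"
proof -
  have "cube c l \<noteq> {}"
    using assms by (auto simp: cube_def intro!: exI[of _ c])
  then show ?thesis
    using content_cbox_cart[of "c - (\<chi> i. l / 2)" "c + (\<chi> i. l / 2)"] by (simp add: cube_eq_cbox)
qed

definition cell_center :: "int \<Rightarrow> real ^ 'd \<Rightarrow> real ^ 'd" where
  "cell_center k x = (\<chi> i. (of_int \<lfloor>x $ i / 2 powr k\<rfloor> + 1 / 2) * 2 powr k)"

lemma cell_center_in_cell: "cell_center k x \<in> cell k x"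
  by (simp add: cell_def cell_center_def floor_eq_iff)

lemma cell_subset_cube: "cell k x \<subseteq> cube (cell_center k x) (2 powr k)"
proof
  fix y assume "y \<in> cell k x"
  then have "of_int \<lfloor>x $ i / 2 powr k\<rfloor> * 2 powr k \<le> y $ i"
      "y $ i < of_int \<lfloor>x $ i / 2 powr k\<rfloor> * 2 powr k + 2 powr k" for i
    by (auto simp: cell_eq)
  then show "y \<in> cube (cell_center k x) (2 powr k)"
    by (simp add: cube_def cell_center_def abs_le_iff algebra_simps less_imp_le)
      (smt (verit, best) field_sum_of_halves)
qed

lemma tri_subset_cube: "tri k x \<subseteq> cube (cell_center k x) (3 * 2 powr k)"
proof
  fix y assume "y \<in> tri k x"
  then have "(of_int \<lfloor>x $ i / 2 powr k\<rfloor> - 1) * 2 powr k \<le> y $ i"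
      "y $ i < (of_int \<lfloor>x $ i / 2 powr k\<rfloor> - 1) * 2 powr k + 3 * 2 powr k" for i
    by (auto simp: tri_eq)
  then show "y \<in> cube (cell_center k x) (3 * 2 powr k)"
    by (simp add: cube_def cell_center_def abs_le_iff algebra_simps less_imp_le)
      (smt (verit, best) field_sum_of_halves)
qed

context submultiplicative_kernel
begin

lemma A_const_le_Apq_const:
  fixes W :: "real ^ 'd \<Rightarrow> complex ^ 'n ^ 'n" and \<rho> :: "real ^ 'd \<Rightarrow> real"
  assumes F: "AE x in lborel. AE y in lborel.
      F x y = ennreal (onorm (\<lambda>v. (matrix_powr (W x) (1 / q) ** matrix_powr (W y) (- 1 / q)) *v v))"
    and P_eq: "P = conj_exp p"
    and [measurable]: "S \<in> sets borel" and S: "S \<subseteq> cube c l" "emeasure lborel S = ennreal (l ^ CARD('d))"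
    and l: "0 < l" and \<rho>: "0 < \<rho> c"
  shows "A_const S \<le> ennreal (psi \<rho> \<theta> c l powr (1 + q / P)) * Apq_const \<rho> \<theta> p q W"
proof -
  define w where "w = psi \<rho> \<theta> c l"
  define r where "r = 1 / (w * l ^ CARD('d))"
  have "0 < 1 + l / \<rho> c" using l \<rho> by (intro add_pos_pos divide_pos_pos) auto
  then have w: "0 < w" by (simp add: w_def psi_def)
  have "A_const S \<le> ennreal (w powr (1 + q / P)) * (ennreal r *
    (\<integral>\<^sup>+x\<in>cube c l. (ennreal r * (\<integral>\<^sup>+y\<in>cube c l. F x y \<up> P \<partial>lborel)) \<up> (q / P) \<partial>lborel))"
    unfolding r_def using l w by (intro A_const_le_cube S) auto
  also have "ennreal r * (\<integral>\<^sup>+x\<in>cube c l. (ennreal r * (\<integral>\<^sup>+y\<in>cube c l. F x y \<up> P \<partial>lborel)) \<up> (q / P) \<partial>lborel)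
    = ennreal r * (\<integral>\<^sup>+x\<in>cube c l. (ennreal r * (\<integral>\<^sup>+y\<in>cube c l. ennreal (onorm (\<lambda>v. (matrix_powr (W x) (1 / q) ** matrix_powr (W y) (- 1 / q)) *v v)
         powr P) \<partial>lborel)) \<up> (q / P) \<partial>lborel)"
  proof (intro arg_cong[where f = "\<lambda>z. ennreal r * z"] nn_integral_cong_AE)
    show "AE x in lborel. (ennreal r * (\<integral>\<^sup>+y\<in>cube c l. F x y \<up> P \<partial>lborel)) \<up> (q / P) * indicator (cube c l) x
      = (ennreal r * (\<integral>\<^sup>+y\<in>cube c l. ennreal (onorm (\<lambda>v. (matrix_powr (W x) (1 / q) ** matrix_powr (W y) (- 1 / q)) *v v)
         powr P) \<partial>lborel)) \<up> (q / P) * indicator (cube c l) x"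
      using F
    proof eventually_elim
      case (elim x)
      have "(\<integral>\<^sup>+y\<in>cube c l. F x y \<up> P \<partial>lborel) = (\<integral>\<^sup>+y\<in>cube c l. ennreal (onorm (\<lambda>v. (matrix_powr (W x) (1 / q) ** matrix_powr (W y) (- 1 / q)) *v v)
         powr P) \<partial>lborel)"
        using elim by (intro nn_integral_cong_AE) (auto elim!: eventually_mono
          simp: epowr_ennreal onorm_pos_le[OF bounded_linear_matrix_vector_mult])
      then show ?case by simp
    qed
  qed
  also have "\<dots> \<le> Apq_const \<rho> \<theta> p q W"
    unfolding Apq_const_def
    by (rule SUP_upper2[of "(c, l)"]) (use l in \<open>simp_all add: measure_cube[OF less_imp_le] nn_integral_completion P_eq r_def w_def\<close>)
  finally show ?thesis unfolding w_def by (simp add: mult_left_mono)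
qed

text \<open>In the characteristic \<open>psi\<close> is evaluated at the centre of a cube containing
  the set. The centre lies in \<open>cell k x\<close>, so comparability moves it to \<open>x\<close>
  at the cost of the power \<kappa>; the factor \<open>3\<close> accounts for the side of
  \<open>tri k x\<close>.\<close>

lemma A_const_le_powr:
  fixes W :: "real ^ 'd \<Rightarrow> complex ^ 'n ^ 'n" and \<rho> \<rho>' :: "real ^ 'd \<Rightarrow> real"
  assumes F: "AE x in lborel. AE y in lborel.
      F x y = ennreal (onorm (\<lambda>v. (matrix_powr (W x) (1 / q) ** matrix_powr (W y) (- 1 / q)) *v v))"
    and P_eq: "P = conj_exp p" and \<rho>: "\<And>x. 0 < \<rho> x" and \<theta>: "0 \<le> \<theta>" and C1: "1 \<le> C1"
    and comparable: "\<And>k x y. y \<in> tri k x \<Longrightarrow> 1 + 2 powr real_of_int k / \<rho> y \<le> C1 * (1 + 2 powr real_of_int k / \<rho>' x) powr \<kappa>"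
  defines "m \<equiv> \<lambda>k x. 1 + 2 powr real_of_int k / \<rho>' x"
  assumes m: "\<And>k x. 1 \<le> m k x"
  shows "A_const (cell k x) \<le> ennreal ((3 * C1) powr (\<theta> * (1 + q / P)) * m k x powr (\<kappa> * (\<theta> * (1 + q / P)))) * Apq_const \<rho> \<theta> p q W"
    and "A_const (tri k x) \<le> ennreal ((3 * C1) powr (\<theta> * (1 + q / P)) * m k x powr (\<kappa> * (\<theta> * (1 + q / P)))) * Apq_const \<rho> \<theta> p q W"
proof -
  have qP: "0 < 1 + q / P" using P q by (simp add: add_pos_pos)
  define c where "c = cell_center k x"
  have cx: "1 + 2 powr real_of_int k / \<rho> c \<le> C1 * m k x powr \<kappa>"
    unfolding m_def using cell_center_in_cell[of k x] cell_subset_tri by (intro comparable) (auto simp: c_def)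
  have psi: "psi \<rho> \<theta> c l powr (1 + q / P) \<le> (3 * C1) powr (\<theta> * (1 + q / P)) * m k x powr (\<kappa> * (\<theta> * (1 + q / P)))"
    if l: "0 < l" "l \<le> 3 * 2 powr k" for l
  proof -
    have pos: "0 < 1 + l / \<rho> c" using l \<rho>[of c] by (intro add_pos_pos divide_pos_pos) auto
    have "l / \<rho> c \<le> 3 * 2 powr k / \<rho> c" using l \<rho>[of c] by (intro divide_right_mono) auto
    then have "1 + l / \<rho> c \<le> 3 * (1 + 2 powr k / \<rho> c)" by simp
    also have "\<dots> \<le> 3 * (C1 * m k x powr \<kappa>)" using cx by simp
    finally have "(1 + l / \<rho> c) powr (\<theta> * (1 + q / P)) \<le> (3 * C1 * m k x powr \<kappa>) powr (\<theta> * (1 + q / P))"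
      using pos \<theta> qP by (intro powr_mono2) (auto simp: mult.assoc)
    also have "\<dots> = (3 * C1) powr (\<theta> * (1 + q / P)) * m k x powr (\<kappa> * (\<theta> * (1 + q / P)))"
      using C1 by (simp add: powr_mult powr_powr)
    finally show ?thesis by (simp add: psi_def powr_powr)
  qed
  have bound: "A_const S \<le> ennreal ((3 * C1) powr (\<theta> * (1 + q / P)) * m k x powr (\<kappa> * (\<theta> * (1 + q / P)))) * Apq_const \<rho> \<theta> p q W"
    if "S \<in> sets borel" "S \<subseteq> cube c l" "emeasure lborel S = ennreal (l ^ CARD('d))" "0 < l" "l \<le> 3 * 2 powr k" for S l
    by (rule order_trans[OF A_const_le_Apq_const[where \<theta> = \<theta> and W = W and \<rho> = \<rho> and c = c and l = l, OF F P_eq that(1-4) \<rho>[of c]]]) (intro mult_right_mono ennreal_leI psi that, simp)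
  show "A_const (cell k x) \<le> ennreal ((3 * C1) powr (\<theta> * (1 + q / P)) * m k x powr (\<kappa> * (\<theta> * (1 + q / P)))) * Apq_const \<rho> \<theta> p q W"
    by (rule bound[of _ "2 powr k"]) (auto simp: c_def powr_powr[symmetric] powr_realpow intro: subsetD[OF cell_subset_cube])
  show "A_const (tri k x) \<le> ennreal ((3 * C1) powr (\<theta> * (1 + q / P)) * m k x powr (\<kappa> * (\<theta> * (1 + q / P)))) * Apq_const \<rho> \<theta> p q W"
    by (rule bound[of _ "3 * 2 powr k"]) (auto simp: c_def powr_powr[symmetric] powr_realpow power_mult_distrib intro: subsetD[OF tri_subset_cube])
qed

lemma borel_measurable_kernel_sum:
  fixes w :: "int \<Rightarrow> real ^ 'd \<Rightarrow> real"
  assumes [measurable]: "\<And>k. w k \<in> borel_measurable borel" and g: "g \<in> borel_measurable borel"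
  defines "\<Psi> \<equiv> \<lambda>x y. \<integral>\<^sup>+k. ennreal (w k x) * indicator (tri k x) y \<partial>count_space UNIV"
  shows "\<Psi> x \<in> borel_measurable borel"
    and "(\<lambda>x. \<integral>\<^sup>+y. \<Psi> x y * (F x y * g y) \<partial>lborel) \<in> borel_measurable borel"
proof -
  have "(\<lambda>(x, y). indicator (tri k x) y :: ennreal) \<in> borel_measurable (borel \<Otimes>\<^sub>M borel)" for k :: int
    by (simp add: split_beta' indicator_def)
  then have [measurable]: "(\<lambda>z. indicator (tri k (fst z)) (snd z) :: ennreal) \<in> borel_measurable (borel \<Otimes>\<^sub>M borel)" for k :: int
    by (simp add: split_beta')
  have \<Psi>_meas: "(\<lambda>z. \<Psi> (fst z) (snd z)) \<in> borel_measurable (borel \<Otimes>\<^sub>M borel)"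
    unfolding \<Psi>_def by (rule borel_measurable_nn_integral_count_space) measurable
  then show "\<Psi> x \<in> borel_measurable borel"
    using measurable_compose[OF measurable_Pair1'[of x borel borel] \<Psi>_meas] by simp
  have "(\<lambda>z. \<Psi> (fst z) (snd z) * (F (fst z) (snd z) * g (snd z))) \<in> borel_measurable (borel \<Otimes>\<^sub>M borel)"
    using \<Psi>_meas by (intro borel_measurable_times_ennreal F_measurable' measurable_compose[OF measurable_snd g]) auto
  also have "borel_measurable (borel \<Otimes>\<^sub>M borel) = borel_measurable (borel \<Otimes>\<^sub>M (lborel :: (real ^ 'd) measure))"
    by (intro measurable_cong_sets sets_pair_measure_cong) auto
  finally show "(\<lambda>x. \<integral>\<^sup>+y. \<Psi> x y * (F x y * g y) \<partial>lborel) \<in> borel_measurable borel"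
    by (intro lborel.borel_measurable_nn_integral) (simp add: split_beta')
qed

text \<open>Homogeneity: the estimate for the unit ball is applied to \<open>g / c\<close>, where
  \<open>c\<close> may be any positive bound for the norm of \<open>g\<close>, so that a vanishing
  norm needs no separate case.\<close>

lemma operator_estimate_scaled:
  fixes g :: "real ^ 'd \<Rightarrow> ennreal" and \<rho> :: "real ^ 'd \<Rightarrow> real" and B c p s \<alpha> C1 \<kappa> \<tau> :: real
  assumes [measurable]: "g \<in> borel_measurable borel" "\<rho> \<in> borel_measurable borel"
    and p: "1 < p" "1 / p + 1 / P = 1" and s: "1 < s" "1 / q + 1 / s = 1"
    and \<alpha>: "0 < \<alpha>" "1 / q = 1 / p - \<alpha> / real CARD('d)"
    and c: "0 < c" and g: "(\<integral>\<^sup>+x. g x \<up> p \<partial>lborel) \<le> ennreal (c powr p)"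
    and \<rho>: "\<And>x. 0 < \<rho> x"
  defines "m \<equiv> \<lambda>k x. 1 + 2 powr real_of_int k / \<rho> x"
  assumes comparable: "\<And>k x y. y \<in> tri k x \<Longrightarrow> m k y \<le> C1 * m k x powr \<kappa>"
    and C1: "1 \<le> C1" and \<kappa>: "1 \<le> \<kappa>" and \<tau>: "0 \<le> \<tau>" and B: "1 \<le> B"
    and A_tri: "\<And>k x. A_const (tri k x) \<le> ennreal (B * m k x powr \<tau>)"
    and A_cell: "\<And>k x. A_const (cell k x) \<le> ennreal (B * m k x powr \<tau>)"
  shows "(\<integral>\<^sup>+x. (\<integral>\<^sup>+y. (\<integral>\<^sup>+k. ennreal (2 powr (real_of_int k * (\<alpha> - real CARD('d))) *
        m k x powr - (\<kappa> * (\<kappa> + \<tau> / q))) * indicator (tri k x) y \<partial>count_space UNIV) * (F x y * g y) \<partial>lborel) \<up> q \<partial>lborel) \<up> (1 / q)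
    \<le> operator_const CARD('d) \<alpha> p P q s C1 \<kappa> \<tau> * ennreal (B powr (1 + P / (q * q))) * ennreal c"
proof -
  define \<Psi> where "\<Psi> x y = (\<integral>\<^sup>+k. ennreal (2 powr (real_of_int k * (\<alpha> - real CARD('d))) *
        m k x powr - (\<kappa> * (\<kappa> + \<tau> / q))) * indicator (tri k x) y \<partial>count_space UNIV)" for x y :: "real ^ 'd"
  define g' where "g' y = ennreal (1 / c) * g y" for y
  have g'_meas [measurable]: "g' \<in> borel_measurable borel" unfolding g'_def by measurable
  have g_eq: "g y = ennreal c * g' y" for y
    using c by (simp add: g'_def mult.assoc[symmetric] ennreal_mult[symmetric])
  have "(\<integral>\<^sup>+x. g' x \<up> p \<partial>lborel) = ennreal ((1 / c) powr p) * (\<integral>\<^sup>+x. g x \<up> p \<partial>lborel)"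
    using p c by (simp add: g'_def epowr_mult epowr_ennreal nn_integral_cmult)
  also have "\<dots> \<le> ennreal ((1 / c) powr p) * ennreal (c powr p)"
    by (intro mult_left_mono g) simp
  also have "\<dots> = 1" using c by (simp add: ennreal_mult[symmetric] powr_mult[symmetric])
  finally have g': "(\<integral>\<^sup>+x. g' x \<up> p \<partial>lborel) \<le> 1" .
  have est: "(\<integral>\<^sup>+x. (\<integral>\<^sup>+y. \<Psi> x y * (F x y * g' y) \<partial>lborel) \<up> q \<partial>lborel) \<up> (1 / q)
      \<le> operator_const CARD('d) \<alpha> p P q s C1 \<kappa> \<tau> * ennreal (B powr (1 + P / (q * q)))"
    unfolding \<Psi>_def m_def
    by (rule operator_estimate[OF g'_meas assms(2) p s \<alpha> g' \<rho> comparable[unfolded m_def] C1 \<kappa> \<tau> B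
      A_tri[unfolded m_def] A_cell[unfolded m_def]])
  have w_meas: "(\<lambda>x. 2 powr (real_of_int k * (\<alpha> - real CARD('d))) * m k x powr - (\<kappa> * (\<kappa> + \<tau> / q))) \<in> borel_measurable borel"
    for k unfolding m_def by measurable
  have [measurable]: "\<Psi> x \<in> borel_measurable borel" for x
    unfolding \<Psi>_def[abs_def] by (rule borel_measurable_kernel_sum(1)[OF w_meas g'_meas])
  have [measurable]: "(\<lambda>x. \<integral>\<^sup>+y. \<Psi> x y * (F x y * g' y) \<partial>lborel) \<in> borel_measurable borel"
    unfolding \<Psi>_def by (rule borel_measurable_kernel_sum(2)[OF w_meas g'_meas])
  have "(\<integral>\<^sup>+y. \<Psi> x y * (F x y * g y) \<partial>lborel) = ennreal c * (\<integral>\<^sup>+y. \<Psi> x y * (F x y * g' y) \<partial>lborel)" for x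
    unfolding g_eq by (subst nn_integral_cmult[symmetric]) (auto intro!: nn_integral_cong simp: mult_ac)
  then have "(\<integral>\<^sup>+x. (\<integral>\<^sup>+y. \<Psi> x y * (F x y * g y) \<partial>lborel) \<up> q \<partial>lborel) \<up> (1 / q)
      = (ennreal (c powr q) * (\<integral>\<^sup>+x. (\<integral>\<^sup>+y. \<Psi> x y * (F x y * g' y) \<partial>lborel) \<up> q \<partial>lborel)) \<up> (1 / q)"
    using c q by (simp add: epowr_mult epowr_ennreal nn_integral_cmult)
  also have "\<dots> = ennreal c * (\<integral>\<^sup>+x. (\<integral>\<^sup>+y. \<Psi> x y * (F x y * g' y) \<partial>lborel) \<up> q \<partial>lborel) \<up> (1 / q)"
    using c q by (simp add: epowr_mult epowr_ennreal powr_powr)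
  also have "\<dots> \<le> ennreal c * (operator_const CARD('d) \<alpha> p P q s C1 \<kappa> \<tau> * ennreal (B powr (1 + P / (q * q))))"
    by (intro mult_left_mono est) simp
  finally show ?thesis unfolding \<Psi>_def by (simp add: mult_ac)
qed

end

section \<open>Passing between Lebesgue and Borel measurable functions\<close>

lemma lebesgue_borel_version:
  fixes f g :: "'a :: euclidean_space \<Rightarrow> 'b :: {banach, second_countable_topology}"
  assumes g: "g \<in> borel_measurable borel" and eq: "AE x in lborel. f x = g x"
  shows "f \<in> borel_measurable lebesgue" "integrable lebesgue f \<longleftrightarrow> integrable lborel g"
    "(\<integral>x. f x \<partial>lebesgue) = (\<integral>x. g x \<partial>lborel)"
proof -
  have g': "g \<in> borel_measurable lborel" using g by simp
  have gl: "g \<in> borel_measurable lebesgue" by (rule measurable_completion[OF g'])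
  have eq': "AE x in lebesgue. f x = g x" using eq by (rule AE_completion)
  show f: "f \<in> borel_measurable lebesgue"
  proof (rule borel_measurableI)
    fix S :: "'b set" assume "open S"
    then have "g -` S \<inter> space lebesgue \<in> sets lebesgue"
      using gl by (intro measurable_sets[OF gl]) auto
    then show "f -` S \<inter> space lebesgue \<in> sets lebesgue"
      by (rule completion.in_sets_AE[rotated]) (use eq' in \<open>auto elim!: eventually_mono\<close>)
  qed
  show "integrable lebesgue f \<longleftrightarrow> integrable lborel g"
    using integrable_cong_AE[OF f gl eq'] integrable_completion[OF g'] by simp
  show "(\<integral>x. f x \<partial>lebesgue) = (\<integral>x. g x \<partial>lborel)"
    using integral_cong_AE[OF f gl eq'] integral_completion[OF g'] by simp
qed

text \<open>Both orders of the quantifiers are used later: for almost all \<open>t\<close> and then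
  \<open>y\<close> when the iterated integral defining the fractional integral is rewritten, for
  almost all \<open>y\<close> and then \<open>t\<close> when the kernel is integrated over
  \<open>t\<close> at fixed \<open>y\<close>. They follow from one null set in the product by
  disintegrating it in both orders.\<close>

lemma semigroup_kernel_borel_version:
  fixes k :: "real \<Rightarrow> real ^ 'd \<Rightarrow> real ^ 'd \<Rightarrow> complex"
  assumes "semigroup_kernel T k"
  obtains k' :: "real \<Rightarrow> real ^ 'd \<Rightarrow> real ^ 'd \<Rightarrow> complex"
    where "(\<lambda>(t, x, y). k' t x y) \<in> borel_measurable borel"
    "AE x in lborel. (AE t in lborel. AE y in lborel. 0 < t \<longrightarrow> k t x y = k' t x y) \<and>
      (AE y in lborel. AE t in lborel. 0 < t \<longrightarrow> k t x y = k' t x y)"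
proof -
  define X where "X = ({0<..} \<times> UNIV :: (real \<times> (real ^ 'd) \<times> (real ^ 'd)) set)"
  define f where "f z = (if z \<in> X then (\<lambda>(t, x, y). k t x y) z else 0)" for z
  have "X \<in> sets borel" unfolding X_def by (intro borel_open open_Times) auto
  then have "f \<in> borel_measurable lebesgue"
    using assms unfolding f_def semigroup_kernel_def X_def[symmetric] by (intro borel_measurable_if_I) auto
  then obtain h where h: "h \<in> borel_measurable borel" and eq: "AE z in lborel. f z = h z"
    using lebesgue_complex_borel_version by blast
  from eq obtain N where N: "{z \<in> space lborel. \<not> f z = h z} \<subseteq> N" "emeasure lborel N = 0" "N \<in> sets lborel"
    by (rule AE_E)
  have N_borel: "N \<in> sets borel" using N(3) by simp
  have "AE z in lborel. z \<notin> N"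
    using N by (intro AE_not_in) (auto simp: null_sets_def)
  then have "AE z in lborel \<Otimes>\<^sub>M lborel. z \<notin> N"
    by (subst lborel_prod[where 'a = real and 'b = "(real ^ 'd) \<times> (real ^ 'd)"])
  from lborel_pair.AE_pair[OF this] have *: "AE t in lborel. AE w in lborel. (t, w) \<notin> N" .
  have pred: "{z \<in> space (lborel \<Otimes>\<^sub>M lborel). (fst z, snd z) \<notin> N} \<in> sets (lborel \<Otimes>\<^sub>M lborel)"
  proof -
    have "{z \<in> space (lborel \<Otimes>\<^sub>M lborel). (fst z, snd z) \<notin> N} = - N" by (auto simp: space_pair_measure)
    then show ?thesis
      unfolding lborel_prod[where 'a = real and 'b = "(real ^ 'd) \<times> (real ^ 'd)"] using N_borel by (simp only: sets_lborel borel_comp)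
  qed
  have "AE w in lborel. AE t in lborel. (t, w) \<notin> N"
    using * lborel_pair.AE_commute[OF pred] by simp
  then have "AE w in lborel \<Otimes>\<^sub>M lborel. AE t in lborel. (t, w) \<notin> N"
    by (subst lborel_prod[where 'a = "real ^ 'd" and 'b = "real ^ 'd"])
  from lborel_pair.AE_pair[OF this] have *: "AE x in lborel. AE y in lborel. AE t in lborel. (t, x, y) \<notin> N" .
  have pred: "{z \<in> space (lborel \<Otimes>\<^sub>M lborel). (snd z, x, fst z) \<notin> N} \<in> sets (lborel \<Otimes>\<^sub>M lborel)" for x
  proof -
    have "(\<lambda>z. (snd z, x, fst z)) \<in> measurable borel borel"
      by (intro borel_measurable_continuous_onI continuous_intros)
    from measurable_sets[OF this borel_comp[OF N_borel]]
    have "{z. (snd z, x, fst z) \<notin> N} \<in> sets borel" by (simp add: vimage_def)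
    then show ?thesis
      unfolding lborel_prod[where 'a = "real ^ 'd" and 'b = real] by simp
  qed
  have fh: "f z = h z" if "z \<notin> N" for z using that N(1) by auto
  have kh: "k t x y = h (t, x, y)" if "(t, x, y) \<notin> N" "0 < t" for t x y
    using fh[OF that(1)] that(2) by (simp add: f_def X_def)
  have "AE x in lborel. (AE t in lborel. AE y in lborel. 0 < t \<longrightarrow> k t x y = h (t, x, y)) \<and>
      (AE y in lborel. AE t in lborel. 0 < t \<longrightarrow> k t x y = h (t, x, y))"
    using *
  proof eventually_elim
    case (elim x)
    have "AE t in lborel. AE y in lborel. (t, x, y) \<notin> N"
      using elim lborel_pair.AE_commute[OF pred] by simp
    then have "AE t in lborel. AE y in lborel. 0 < t \<longrightarrow> k t x y = h (t, x, y)"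
      by (rule eventually_mono) (auto elim!: eventually_mono intro: kh)
    moreover have "AE y in lborel. AE t in lborel. 0 < t \<longrightarrow> k t x y = h (t, x, y)"
      using elim by (rule eventually_mono) (auto elim!: eventually_mono intro: kh)
    ultimately show ?case ..
  qed
  then show thesis using h by (intro that[of "\<lambda>t x y. h (t, x, y)"]) (simp_all add: split_beta')
qed

section \<open>The weighted estimate for the fractional integral\<close>

text \<open>The power of \<open>t\<close> and the restriction to positive times are absorbed into
  the kernel \<open>K\<close>, so that a single Borel kernel on the whole line has to be integrated.
  For positive \<open>t\<close> the power can be divided out again, which recovers integrability of
  the original integrands.\<close>

lemma frac_integral_borel_version:
  fixes k k' :: "real \<Rightarrow> real ^ 'd \<Rightarrow> real ^ 'd \<Rightarrow> complex" and \<phi> \<phi>' :: "real ^ 'd \<Rightarrow> complex" and \<alpha> :: real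
  assumes [measurable]: "(\<lambda>(t, y). k' t x y) \<in> borel_measurable (borel \<Otimes>\<^sub>M borel)" "\<phi>' \<in> borel_measurable borel"
    and k: "AE t in lborel. AE y in lborel. 0 < t \<longrightarrow> k t x y = k' t x y"
    and \<phi>: "AE y in lborel. \<phi> y = \<phi>' y"
  defines "K \<equiv> \<lambda>t y. indicator {0<..} t * (complex_of_real (t powr (\<alpha> / 2 - 1)) * k' t x y)"
  shows "frac_integral k \<alpha> \<phi> x = (\<integral>t. (\<integral>y. K t y * \<phi>' y \<partial>lborel) \<partial>lborel)" (is ?eq)
    and "(AE t in lborel. integrable lborel (\<lambda>y. K t y * \<phi>' y)) \<Longrightarrow>
      integrable lborel (\<lambda>t. \<integral>y. K t y * \<phi>' y \<partial>lborel) \<Longrightarrow> frac_integral_defined k \<alpha> \<phi> x" (is "PROP ?def")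
proof -
  have k'_meas [measurable (raw)]: "(\<lambda>x'. k' (f x') x (g x')) \<in> borel_measurable M"
    if [measurable]: "f \<in> measurable M borel" "g \<in> measurable M borel" for f g and M :: "'m measure"
  proof -
    have "(\<lambda>x. (f x, g x)) \<in> measurable M (borel \<Otimes>\<^sub>M borel)" by measurable
    from measurable_compose[OF this assms(1)] show ?thesis by simp
  qed
  define J where "J t = (\<integral>y. K t y * \<phi>' y \<partial>lborel)" for t
  have J_borel: "J \<in> borel_measurable borel"
  proof -
    have "(\<lambda>z. K (fst z) (snd z) * \<phi>' (snd z)) \<in> borel_measurable (borel \<Otimes>\<^sub>M lborel)"
      unfolding K_def by measurable
    then show ?thesis
      unfolding J_def by (intro lborel.borel_measurable_lebesgue_integral) (simp add: split_beta')
  qed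
  have version: "AE y in lborel. k t x y * \<phi> y = k' t x y * \<phi>' y"
    if "0 < t" "AE y in lborel. 0 < t \<longrightarrow> k t x y = k' t x y" for t
    using that(2) \<phi> by eventually_elim (use that(1) in simp)
  have borel_y: "(\<lambda>y. k' t x y * \<phi>' y) \<in> borel_measurable borel" for t by measurable
  have eq: "AE t in lborel. indicator {0<..} t *\<^sub>R (kernel_apply k t \<phi> x * of_real (t powr (\<alpha> / 2 - 1))) = J t"
    using k
  proof eventually_elim
    case (elim t)
    show ?case
    proof (cases "0 < t")
      case True
      have "kernel_apply k t \<phi> x = (\<integral>y. k' t x y * \<phi>' y \<partial>lborel)"
        unfolding kernel_apply_def by (rule lebesgue_borel_version(3)[OF borel_y version[OF True elim]])
      moreover have "J t = (\<integral>y. of_real (t powr (\<alpha> / 2 - 1)) * (k' t x y * \<phi>' y) \<partial>lborel)"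
        using True by (simp add: J_def K_def mult.assoc)
      ultimately show ?thesis
        using True by (simp add: mult.commute[of "of_real _"])
    qed (simp add: J_def K_def)
  qed
  show ?eq
    unfolding frac_integral_def set_lebesgue_integral_def using lebesgue_borel_version(3)[OF J_borel eq] by (simp add: J_def)
  show "PROP ?def"
  proof -
    assume int: "AE t in lborel. integrable lborel (\<lambda>y. K t y * \<phi>' y)" "integrable lborel (\<lambda>t. \<integral>y. K t y * \<phi>' y \<partial>lborel)"
    have "AE t in lborel. 0 < t \<longrightarrow> integrable lebesgue (\<lambda>y. k t x y * \<phi> y)"
      using int(1) k
    proof eventually_elim
      case (elim t)
      show ?case
      proof
        assume t: "0 < t"
        then have "integrable lborel (\<lambda>y. inverse (complex_of_real (t powr (\<alpha> / 2 - 1))) * (K t y * \<phi>' y))"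
          using elim(1) by simp
        also have "(\<lambda>y. inverse (complex_of_real (t powr (\<alpha> / 2 - 1))) * (K t y * \<phi>' y)) = (\<lambda>y. k' t x y * \<phi>' y)"
          using t by (simp add: K_def fun_eq_iff)
        finally show "integrable lebesgue (\<lambda>y. k t x y * \<phi> y)"
          using lebesgue_borel_version(2)[OF borel_y version[OF t elim(2)]] by simp
      qed
    qed
    then have "AE t in lebesgue. 0 < t \<longrightarrow> integrable lebesgue (\<lambda>y. k t x y * \<phi> y)" by (rule AE_completion)
    moreover have "set_integrable lebesgue {0<..} (\<lambda>t. kernel_apply k t \<phi> x * of_real (t powr (\<alpha> / 2 - 1)))"
      unfolding set_integrable_def using lebesgue_borel_version(2)[OF J_borel eq] int(2) by (simp add: J_def)
    ultimately show "frac_integral_defined k \<alpha> \<phi> x" by (simp add: frac_integral_defined_def)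
  qed
qed

text \<open>Inserting \<open>S y ** R y = mat 1\<close> bounds \<open>R x *v f' y\<close> by
  \<open>F x y\<close> times the length of \<open>R y *v f' y\<close>, which no longer involves
  \<open>x\<close>. Tonelli then lets the time integral act on the kernel alone, where the dyadic
  bound applies off the diagonal, that is for almost every \<open>y\<close>.\<close>

lemma vec_frac_integral_pointwise_bound:
  fixes k k' :: "real \<Rightarrow> real ^ 'd \<Rightarrow> real ^ 'd \<Rightarrow> complex" and f f' :: "real ^ 'd \<Rightarrow> complex ^ 'n"
    and R S :: "real ^ 'd \<Rightarrow> complex ^ 'n ^ 'n" and \<Psi> :: "real ^ 'd \<Rightarrow> ennreal" and C \<alpha> :: real
  assumes k'_meas [measurable]: "(\<lambda>(t, y). k' t x y) \<in> borel_measurable (borel \<Otimes>\<^sub>M borel)"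
    and f'_meas [measurable]: "f' \<in> borel_measurable borel" and [measurable]: "\<Psi> \<in> borel_measurable borel"
    and R_meas [measurable]: "R \<in> borel_measurable borel" and S_meas [measurable]: "S \<in> borel_measurable borel"
    and k: "AE t in lborel. AE y in lborel. 0 < t \<longrightarrow> k t x y = k' t x y"
      "AE y in lborel. AE t in lborel. 0 < t \<longrightarrow> k t x y = k' t x y"
    and f: "AE y in lborel. f y = f' y"
    and SR: "\<And>x. S x ** R x = mat 1" and C: "0 \<le> C"
    and bound: "\<And>y. y \<noteq> x \<Longrightarrow> (\<integral>\<^sup>+t. indicator {0<..} t * ennreal (norm (k t x y) * t powr (\<alpha> / 2 - 1)) \<partial>lborel) \<le> ennreal C * \<Psi> y"
    and fin: "(\<integral>\<^sup>+y. \<Psi> y * (ennreal (onorm ((*v) (R x ** S y))) * ennreal (norm (R y *v f' y))) \<partial>lborel) < top" (is "?u < top")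
  shows "frac_integral_defined k \<alpha> (\<lambda>y. f y $ i) x"
    and "ennreal (norm (R x *v vec_frac_integral k \<alpha> f x)) \<le> of_nat CARD('n) * ennreal C * ?u"
proof -
  define K where "K t y = indicator {0<..} t * (complex_of_real (t powr (\<alpha> / 2 - 1)) * k' t x y)" for t y
  have k'_meas' [measurable (raw)]: "(\<lambda>x'. k' (f x') x (g x')) \<in> borel_measurable M"
    if [measurable]: "f \<in> measurable M borel" "g \<in> measurable M borel" for f g and M :: "'m measure"
  proof -
    have "(\<lambda>x. (f x, g x)) \<in> measurable M (borel \<Otimes>\<^sub>M borel)" by measurable
    from measurable_compose[OF this k'_meas] show ?thesis by simp
  qed
  have K': "(\<lambda>z. K (fst z) (snd z)) \<in> borel_measurable (borel \<Otimes>\<^sub>M borel)"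
    unfolding K_def by measurable
  have K_meas: "(\<lambda>(t, y). K t y) \<in> borel_measurable (borel \<Otimes>\<^sub>M borel)"
    using K' by (simp add: split_beta')
  have mat_borel: "(\<lambda>y. A *v f' y) \<in> borel_measurable borel" for A :: "complex ^ 'n ^ 'n"
    by (rule borel_measurable_continuous_on[OF linear_continuous_on[OF bounded_linear_matrix_vector_mult]]) auto
  have mat_vec: "(\<lambda>y. R y *v f' y) \<in> borel_measurable borel"
  proof -
    have "(\<lambda>y. \<chi> i. \<Sum>j\<in>UNIV. R y $ i $ j * f' y $ j) \<in> borel_measurable borel"
      by (intro borel_measurable_vec_lambda borel_measurable_sum borel_measurable_times) measurable
    then show ?thesis by (simp add: matrix_vector_mult_def)
  qed
  have onorm_borel: "(\<lambda>y. onorm ((*v) (R x ** S y))) \<in> borel_measurable borel"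
    by (rule borel_measurable_continuous_on[OF continuous_onorm_matrix]) measurable
  have u_meas [measurable]: "(\<lambda>y. \<Psi> y * (ennreal (onorm ((*v) (R x ** S y))) * ennreal (norm (R y *v f' y)))) \<in> borel_measurable borel"
    using mat_vec onorm_borel by measurable
  have K_int: "AE y in lborel. (\<integral>\<^sup>+t. ennreal (norm (K t y)) \<partial>lborel) \<le> ennreal C * \<Psi> y"
    using k(2) AE_lborel_singleton[of x]
  proof eventually_elim
    case (elim y)
    have "(\<integral>\<^sup>+t. ennreal (norm (K t y)) \<partial>lborel) = (\<integral>\<^sup>+t. indicator {0<..} t * ennreal (norm (k t x y) * t powr (\<alpha> / 2 - 1)) \<partial>lborel)"
      using elim(1) by (intro nn_integral_cong_AE) (auto elim!: eventually_mono simp: K_def norm_mult mult.commute split: split_indicator)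
    also have "\<dots> \<le> ennreal C * \<Psi> y" using elim(2) by (rule bound)
    finally show ?case .
  qed
  have A_le: "ennreal (norm (R x *v f' y)) \<le> ennreal (onorm ((*v) (R x ** S y))) * ennreal (norm (R y *v f' y))" for y
  proof -
    have "R x *v f' y = (R x ** S y) *v (R y *v f' y)"
      by (simp add: matrix_vector_mul_assoc matrix_mul_assoc[symmetric] SR)
    then have "norm (R x *v f' y) \<le> onorm ((*v) (R x ** S y)) * norm (R y *v f' y)"
      using norm_matrix_vector_mult_le[of "R x ** S y" "R y *v f' y"] by simp
    then show ?thesis
      by (simp add: ennreal_mult[symmetric] onorm_pos_le[OF bounded_linear_matrix_vector_mult])
  qed
  define Z where "Z = (\<integral>\<^sup>+t. \<integral>\<^sup>+y. ennreal (norm (K t y)) * ennreal (norm (R x *v f' y)) \<partial>lborel \<partial>lborel)"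
  have norm_Rf [measurable]: "(\<lambda>y. norm (R x *v f' y)) \<in> borel_measurable borel"
    using mat_borel by measurable
  have "Z = (\<integral>\<^sup>+y. \<integral>\<^sup>+t. ennreal (norm (K t y)) * ennreal (norm (R x *v f' y)) \<partial>lborel \<partial>lborel)"
    unfolding Z_def
  proof (rule lborel_pair.Fubini'[symmetric])
    have "(\<lambda>z. ennreal (norm (K (fst z) (snd z))) * ennreal (norm (R x *v f' (snd z)))) \<in> borel_measurable (borel \<Otimes>\<^sub>M borel)"
      using K' measurable_compose[OF measurable_snd norm_Rf] by measurable
    also have "borel_measurable (borel \<Otimes>\<^sub>M borel) = borel_measurable ((lborel :: real measure) \<Otimes>\<^sub>M (lborel :: (real ^ 'd) measure))"
      by (intro measurable_cong_sets sets_pair_measure_cong) auto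
    finally show "(\<lambda>(t, y). ennreal (norm (K t y)) * ennreal (norm (R x *v f' y))) \<in> borel_measurable (lborel \<Otimes>\<^sub>M lborel)"
      by (simp add: split_beta')
  qed
  also have "\<dots> \<le> (\<integral>\<^sup>+y. ennreal C * (\<Psi> y * (ennreal (onorm ((*v) (R x ** S y))) * ennreal (norm (R y *v f' y)))) \<partial>lborel)"
  proof (rule nn_integral_mono_AE)
    show "AE y in lborel. (\<integral>\<^sup>+t. ennreal (norm (K t y)) * ennreal (norm (R x *v f' y)) \<partial>lborel)
        \<le> ennreal C * (\<Psi> y * (ennreal (onorm ((*v) (R x ** S y))) * ennreal (norm (R y *v f' y))))"
      using K_int
    proof eventually_elim
      case (elim y)
      have "(\<lambda>t. K t y) \<in> borel_measurable borel" unfolding K_def by measurable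
      then have "(\<integral>\<^sup>+t. ennreal (norm (K t y)) * ennreal (norm (R x *v f' y)) \<partial>lborel)
          = (\<integral>\<^sup>+t. ennreal (norm (K t y)) \<partial>lborel) * ennreal (norm (R x *v f' y))"
        by (intro nn_integral_multc) simp
      also have "\<dots> \<le> (ennreal C * \<Psi> y) * (ennreal (onorm ((*v) (R x ** S y))) * ennreal (norm (R y *v f' y)))"
        by (rule mult_mono[OF elim A_le]) auto
      finally show ?case by (simp only: mult.assoc)
    qed
  qed
  also have "\<dots> = ennreal C * ?u"
    by (intro nn_integral_cmult) simp
  finally have Z_le: "Z \<le> ennreal C * ?u" .
  also have "\<dots> < top" using fin by (simp add: ennreal_mult_less_top)
  finally have Z: "(\<integral>\<^sup>+t. \<integral>\<^sup>+y. ennreal (norm (K t y)) * ennreal (norm (R x *v f' y)) \<partial>lborel \<partial>lborel) < top"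
    by (simp add: Z_def)
  note bound = iterated_integral_bound[OF K_meas f'_meas SR[of x] Z, folded Z_def]
  have fi: "AE y in lborel. f y $ i = f' y $ i" for i using f by eventually_elim simp
  have fi': "(\<lambda>y. f' y $ i) \<in> borel_measurable borel" for i by measurable
  note version = frac_integral_borel_version[where k = k and k' = k' and x = x and \<alpha> = \<alpha>
      and \<phi> = "\<lambda>y. f y $ i" and \<phi>' = "\<lambda>y. f' y $ i" for i, OF k'_meas fi' k(1) fi, folded K_def]
  show "frac_integral_defined k \<alpha> (\<lambda>y. f y $ i) x"
    using version(2) bound(1,2) by blast
  have "vec_frac_integral k \<alpha> f x = (\<chi> i. \<integral>t. (\<integral>y. K t y * f' y $ i \<partial>lborel) \<partial>lborel)"
    unfolding vec_frac_integral_def version(1) ..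
  then have "ennreal (norm (R x *v vec_frac_integral k \<alpha> f x)) \<le> of_nat CARD('n) * Z"
    using bound(3) by simp
  also have "\<dots> \<le> of_nat CARD('n) * (ennreal C * ?u)"
    by (intro mult_left_mono Z_le) simp
  finally show "ennreal (norm (R x *v vec_frac_integral k \<alpha> f x)) \<le> of_nat CARD('n) * ennreal C * ?u"
    by (simp only: mult.assoc)
qed

lemma vec_frac_integral_measurable:
  fixes k k' :: "real \<Rightarrow> real ^ 'd \<Rightarrow> real ^ 'd \<Rightarrow> complex" and f f' :: "real ^ 'd \<Rightarrow> complex ^ 'n"
  assumes k'_meas: "(\<lambda>(t, x, y). k' t x y) \<in> borel_measurable borel"
    and f'_meas [measurable]: "f' \<in> borel_measurable borel"
    and k: "AE x in lborel. AE t in lborel. AE y in lborel. 0 < t \<longrightarrow> k t x y = k' t x y"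
    and f: "AE y in lborel. f y = f' y"
  obtains h where "h \<in> borel_measurable borel" "AE x in lborel. vec_frac_integral k \<alpha> f x = h x"
proof -
  have k'_meas' [measurable (raw)]: "(\<lambda>x. k' (a x) (b x) (c x)) \<in> borel_measurable M"
    if [measurable]: "a \<in> measurable M borel" "b \<in> measurable M borel" "c \<in> measurable M borel" for a b c and M :: "'m measure"
  proof -
    have "(\<lambda>x. (a x, b x, c x)) \<in> measurable M borel" by (intro borel_measurable_Pair) measurable
    from measurable_compose[OF this k'_meas] show ?thesis by simp
  qed
  define K where "K x t y = indicator {0<..} t * (complex_of_real (t powr (\<alpha> / 2 - 1)) * k' t x y)" for x t y
  define h where "h x = (\<chi> i. \<integral>t. (\<integral>y. K x t y * f' y $ i \<partial>lborel) \<partial>lborel)" for x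
  have "(\<lambda>x. \<integral>t. (\<integral>y. K x t y * f' y $ i \<partial>lborel) \<partial>lborel) \<in> borel_measurable borel" for i
  proof -
    have "(\<lambda>z. K (fst (fst z)) (snd (fst z)) (snd z) * f' (snd z) $ i) \<in> borel_measurable ((borel \<Otimes>\<^sub>M lborel) \<Otimes>\<^sub>M lborel)"
      unfolding K_def by measurable
    then have "(\<lambda>w. \<integral>y. K (fst w) (snd w) y * f' y $ i \<partial>lborel) \<in> borel_measurable (borel \<Otimes>\<^sub>M lborel)"
      by (intro lborel.borel_measurable_lebesgue_integral) (simp add: split_beta')
    then show ?thesis
      by (intro lborel.borel_measurable_lebesgue_integral) (simp add: split_beta')
  qed
  then have "h \<in> borel_measurable borel"
    unfolding h_def by (rule borel_measurable_vec_lambda)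
  moreover have "AE x in lborel. vec_frac_integral k \<alpha> f x = h x"
    using k
  proof eventually_elim
    case (elim x)
    have "(\<lambda>z. k' (fst z) x (snd z)) \<in> borel_measurable (borel \<Otimes>\<^sub>M borel)" by measurable
    then have k'x: "(\<lambda>(t, y). k' t x y) \<in> borel_measurable (borel \<Otimes>\<^sub>M borel)" by (simp add: split_beta')
    have fi: "AE y in lborel. f y $ i = f' y $ i" for i using f by eventually_elim simp
    have fi': "(\<lambda>y. f' y $ i) \<in> borel_measurable borel" for i by measurable
    show ?case
      unfolding vec_frac_integral_def h_def K_def
      by (subst frac_integral_borel_version(1)[where k = k and k' = k' and x = x and \<alpha> = \<alpha>
            and \<phi> = "\<lambda>y. f y $ i" and \<phi>' = "\<lambda>y. f' y $ i" for i, OF k'x fi' elim fi]) (rule refl)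
  qed
  ultimately show thesis by (rule that)
qed

text \<open>The constant \<open>B0\<close> has two tasks: its first summand makes \<open>B0\<close>
  times the characteristic an upper bound for all localised constants, its second makes this product
  at least \<open>1\<close>. Neither involves the weight. The number \<open>c\<close> is any
  positive bound for the norm of \<open>f\<close>.\<close>

lemma vec_frac_integral_weighted_estimate:
  fixes \<rho> \<rho>' :: "real ^ 'd \<Rightarrow> real" and k :: "real \<Rightarrow> real ^ 'd \<Rightarrow> real ^ 'd \<Rightarrow> complex"
    and W :: "real ^ 'd \<Rightarrow> complex ^ 'n ^ 'n" and f :: "real ^ 'd \<Rightarrow> complex ^ 'n" and \<theta> \<alpha> p q c C C1 \<kappa> :: real
  assumes \<rho>: "\<And>x. 0 < \<rho> x" and \<rho>'_meas: "\<rho>' \<in> borel_measurable borel" and \<rho>': "\<And>x. 0 < \<rho>' x" "\<And>x. \<rho> x \<le> \<rho>' x"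
    and C1: "1 \<le> C1" and \<kappa>: "1 \<le> \<kappa>"
    and comparable: "\<forall>k x y. y \<in> tri k x \<longrightarrow> 1 + 2 powr real_of_int k / \<rho> y \<le> C1 * (1 + 2 powr real_of_int k / \<rho>' x) powr \<kappa>"
    and kernel: "semigroup_kernel T k"
    and \<theta>: "0 \<le> \<theta>" and \<alpha>: "0 < \<alpha>" "1 / q = 1 / p - \<alpha> / real CARD('d)" and p: "1 < p" and q: "1 < q"
  defines "P \<equiv> conj_exp p" and "s \<equiv> conj_exp q"
  defines "t \<equiv> 1 + q / P" and "e \<equiv> 1 + P / (q * q)"
  defines "\<tau> \<equiv> \<kappa> * (\<theta> * t)" and "D \<equiv> (3 * C1) powr (\<theta> * t)"
  defines "B0 \<equiv> D + D * (1 + 1 / \<rho>' 0) powr \<tau> * 4 powr t"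
  assumes fin: "operator_const CARD('d) \<alpha> p P q s C1 \<kappa> \<tau> < top" and C: "0 \<le> C"
    and bound: "\<forall>x y. x \<noteq> y \<longrightarrow>
      (\<integral>\<^sup>+t. indicator {0<..} t * ennreal (norm (k t x y) * t powr (\<alpha> / 2 - 1)) \<partial>lborel)
      \<le> ennreal C * (\<integral>\<^sup>+i. ennreal (2 powr (real_of_int i * (\<alpha> - real CARD('d))) *
          (1 + 2 powr real_of_int i / \<rho>' x) powr - (\<kappa> * (\<kappa> + \<tau> / q))) * indicator (tri i x) y \<partial>count_space UNIV)"
    and W: "W \<in> Apq_class \<rho> \<theta> p q" and f: "f \<in> borel_measurable lebesgue"
    and c: "0 < c" "weighted_norm p (\<lambda>x. matrix_powr (W x) (p / q)) f \<le> ennreal c"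
  shows "AE x in lebesgue. \<forall>i. frac_integral_defined k \<alpha> (\<lambda>y. f y $ i) x"
    and "vec_frac_integral k \<alpha> f \<in> borel_measurable lebesgue"
    and "weighted_norm q W (vec_frac_integral k \<alpha> f) \<le>
      of_nat CARD('n) * ennreal C * operator_const CARD('d) \<alpha> p P q s C1 \<kappa> \<tau> * ennreal (B0 powr e) *
      (epowr (Apq_const \<rho> \<theta> p q W) e * ennreal c)"
proof -
  have P1: "1 < P" and conj_P: "1 / p + 1 / P = 1" using p by (simp_all add: P_def conj_exp_def field_simps)
  have s: "1 < s" "1 / q + 1 / s = 1" using q by (simp_all add: s_def conj_exp_def field_simps)
  have qP: "0 < q / P" using P1 q by simp
  have t: "1 < t" and e: "1 \<le> e" using P1 q by (simp_all add: t_def e_def)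
  have \<tau>: "0 \<le> \<tau>" using \<theta> t \<kappa> by (simp add: \<tau>_def)
  have D: "0 < D" using C1 by (simp add: D_def)
  define m where "m k x = 1 + 2 powr real_of_int k / \<rho>' x" for k :: int and x
  have m1: "1 \<le> m k x" for k x using \<rho>'(1)[of x] by (simp add: m_def)
  have comparable': "m k y \<le> C1 * m k x powr \<kappa>" if "y \<in> tri k x" for k x y
  proof -
    have "m k y \<le> 1 + 2 powr real_of_int k / \<rho> y"
      using \<rho>[of y] \<rho>'(2)[of y] unfolding m_def by (intro add_left_mono divide_left_mono) auto
    also have "\<dots> \<le> C1 * m k x powr \<kappa>" unfolding m_def using comparable that by blast
    finally show ?thesis .
  qed
  have weight: "matrix_weight W" and Apq_fin: "Apq_const \<rho> \<theta> p q W < top"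
    using W by (auto simp: Apq_class_def)
  define a where "a = enn2real (Apq_const \<rho> \<theta> p q W)"
  have a: "0 \<le> a" "Apq_const \<rho> \<theta> p q W = ennreal a"
    using Apq_fin by (simp_all add: a_def)
  obtain V where V_meas [measurable]: "V \<in> borel_measurable borel" and V: "\<And>x. pos_def_matrix (V x)" and WV: "AE x in lborel. W x = V x"
    using matrix_weight_borel_version[OF weight] by blast
  define R where "R x = matrix_powr (V x) (1 / q)" for x
  define S where "S x = matrix_powr (V x) (- (1 / q))" for x
  have R_meas [measurable]: "R \<in> borel_measurable borel" and S_meas [measurable]: "S \<in> borel_measurable borel"
    unfolding R_def[abs_def] S_def[abs_def] using V by (auto intro!: borel_measurable_matrix_powr)
  have RS: "R x ** S x = mat 1" and SR: "S x ** R x = mat 1" for x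
    using matrix_powr_mult_inverse[OF V, of x "1 / q"] matrix_powr_mult_inverse[OF V, of x "- (1 / q)"]
    by (simp_all add: R_def S_def)
  define F where "F x y = ennreal (onorm ((*v) (R x ** S y)))" for x y
  interpret submultiplicative_kernel F P q
    unfolding F_def[abs_def] by (rule submultiplicative_kernel_matrix) (use RS P1 q in auto)
  have F_ae: "AE x in lborel. AE y in lborel.
      F x y = ennreal (onorm (\<lambda>v. (matrix_powr (W x) (1 / q) ** matrix_powr (W y) (- 1 / q)) *v v))"
    using WV
  proof eventually_elim
    case (elim x)
    show ?case using WV by eventually_elim (simp add: F_def R_def S_def elim)
  qed
  have A_le: "A_const (cell k x) \<le> ennreal (D * m k x powr \<tau>) * ennreal a"
    "A_const (tri k x) \<le> ennreal (D * m k x powr \<tau>) * ennreal a" for k x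
    unfolding D_def \<tau>_def t_def m_def a(2)[symmetric]
    using A_const_le_powr[where \<rho> = \<rho> and \<rho>' = \<rho>' and p = p and \<kappa> = \<kappa>, OF F_ae _ \<rho> \<theta> C1 _ m1[unfolded m_def]] comparable by (simp_all add: P_def)
  define B where "B = B0 * a"
  have D_B: "ennreal (D * m k x powr \<tau>) * ennreal a \<le> ennreal (B * m k x powr \<tau>)" for k x
  proof -
    have "D * m k x powr \<tau> * a \<le> B0 * a * m k x powr \<tau>"
      using a(1) D by (simp add: B0_def algebra_simps)
    then show ?thesis using a(1) D by (simp add: ennreal_mult[symmetric] B_def ennreal_leI)
  qed
  \<comment> \<open>The unit cell at the origin gives a lower bound for the characteristic in terms
    of \<open>\<rho>' 0\<close> only; this is the origin of the second summand of
    \<open>B0\<close>.\<close>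
  have "ennreal ((1 / 4) powr t) \<le> A_const (cell 0 0)"
    unfolding t_def by (rule A_const_lower_bound) simp_all
  also have "\<dots> \<le> ennreal (D * m 0 0 powr \<tau>) * ennreal a" by (rule A_le(1))
  also have "\<dots> = ennreal (D * m 0 0 powr \<tau> * a)" using a(1) D by (simp add: ennreal_mult)
  finally have "(1 / 4) powr t \<le> D * m 0 0 powr \<tau> * a" using a(1) D by (subst (asm) ennreal_le_iff) auto
  then have "4 powr t * (1 / 4) powr t \<le> 4 powr t * (D * m 0 0 powr \<tau> * a)" by (intro mult_left_mono) auto
  also have "\<dots> \<le> B" using a(1) D by (simp add: B_def B0_def m_def algebra_simps)
  finally have B: "1 \<le> B" by (simp add: powr_divide)
  obtain f' where f'_meas [measurable]: "f' \<in> borel_measurable borel" and ff': "AE x in lborel. f x = f' x"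
  proof (rule lebesgue_vec_borel_version)
    show "(\<lambda>x. f x $ i) \<in> borel_measurable lebesgue" for i using f by measurable
  qed
  define g where "g y = ennreal (norm (R y *v f' y))" for y
  have g_meas: "g \<in> borel_measurable borel"
  proof -
    have "(\<lambda>y. \<chi> i. \<Sum>j\<in>UNIV. R y $ i $ j * f' y $ j) \<in> borel_measurable borel"
      by (intro borel_measurable_vec_lambda borel_measurable_sum borel_measurable_times) measurable
    then show ?thesis unfolding g_def matrix_vector_mult_def by measurable
  qed
  \<comment> \<open>The weight in the norm of \<open>f\<close> is the power \<open>p / q\<close> of
    \<open>W\<close>; its power \<open>1 / p\<close> is \<open>W\<close> to the power
    \<open>1 / q\<close>, the same matrix that defines \<open>R\<close>.\<close>
  have g_le: "(\<integral>\<^sup>+x. g x \<up> p \<partial>lborel) \<le> ennreal (c powr p)"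
  proof -
    have "(\<integral>\<^sup>+x. g x \<up> p \<partial>lborel) = (\<integral>\<^sup>+x. ennreal (norm (matrix_powr (matrix_powr (W x) (p / q)) (1 / p) *v f x) powr p) \<partial>lborel)"
    proof (rule nn_integral_cong_AE)
      show "AE x in lborel. g x \<up> p = ennreal (norm (matrix_powr (matrix_powr (W x) (p / q)) (1 / p) *v f x) powr p)"
        using WV ff' by eventually_elim (use p in \<open>simp add: g_def R_def epowr_ennreal matrix_powr_powr[OF V]\<close>)
    qed
    moreover have "(\<integral>\<^sup>+x. ennreal (norm (matrix_powr (matrix_powr (W x) (p / q)) (1 / p) *v f x) powr p) \<partial>lborel) \<up> (1 / p) \<le> ennreal c"
      using c(2) by (simp add: weighted_norm_def nn_integral_completion)
    ultimately show ?thesis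
      using p c(1) by (simp add: epowr_le_iff epowr_ennreal)
  qed
  define \<Psi> where "\<Psi> x y = (\<integral>\<^sup>+i. ennreal (2 powr (real_of_int i * (\<alpha> - real CARD('d))) *
          m i x powr - (\<kappa> * (\<kappa> + \<tau> / q))) * indicator (tri i x) y \<partial>count_space UNIV)" for x y :: "real ^ 'd"
  define u where "u x = (\<integral>\<^sup>+y. \<Psi> x y * (F x y * g y) \<partial>lborel)" for x
  have w_meas: "(\<lambda>x. 2 powr (real_of_int i * (\<alpha> - real CARD('d))) * m i x powr - (\<kappa> * (\<kappa> + \<tau> / q))) \<in> borel_measurable borel"
    for i unfolding m_def using \<rho>'_meas by measurable
  have \<Psi>_meas: "\<Psi> x \<in> borel_measurable borel" for x
    unfolding \<Psi>_def[abs_def] by (rule borel_measurable_kernel_sum(1)[OF w_meas g_meas])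
  have u_meas [measurable]: "u \<in> borel_measurable borel"
    unfolding u_def \<Psi>_def by (rule borel_measurable_kernel_sum(2)[OF w_meas g_meas])
  define M where "M = operator_const CARD('d) \<alpha> p P q s C1 \<kappa> \<tau> * ennreal (B powr e) * ennreal c"
  have est: "(\<integral>\<^sup>+x. u x \<up> q \<partial>lborel) \<up> (1 / q) \<le> M"
    unfolding u_def \<Psi>_def M_def m_def e_def
  proof (rule operator_estimate_scaled[OF g_meas \<rho>'_meas p conj_P s \<alpha> c(1) g_le \<rho>'(1) _ C1 \<kappa> \<tau> B])
    show "1 + 2 powr real_of_int k / \<rho>' y \<le> C1 * (1 + 2 powr real_of_int k / \<rho>' x) powr \<kappa>" if "y \<in> tri k x" for k x y
      using comparable'[OF that] by (simp add: m_def)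
    show "A_const (tri k x) \<le> ennreal (B * (1 + 2 powr real_of_int k / \<rho>' x) powr \<tau>)" for k x
      using order_trans[OF A_le(2) D_B, of k x] by (simp only: m_def)
    show "A_const (cell k x) \<le> ennreal (B * (1 + 2 powr real_of_int k / \<rho>' x) powr \<tau>)" for k x
      using order_trans[OF A_le(1) D_B, of k x] by (simp only: m_def)
  qed
  \<comment> \<open>Finiteness of the bound makes \<open>u\<close> finite almost everywhere, and at
    such points all integrals in the fractional integral converge absolutely.\<close>
  have "M < top" using fin by (simp add: M_def ennreal_mult_less_top)
  then have "(\<integral>\<^sup>+x. u x \<up> q \<partial>lborel) \<up> (1 / q) < top" using est by (rule le_less_trans[rotated])
  then have "(\<integral>\<^sup>+x. u x \<up> q \<partial>lborel) \<noteq> \<infinity>" by auto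
  then have "AE x in lborel. u x \<up> q \<noteq> \<infinity>"
    by (intro nn_integral_PInf_AE) auto
  then have u_fin: "AE x in lborel. u x < top"
    by eventually_elim (simp add: less_top[symmetric])
  obtain k' :: "real \<Rightarrow> real ^ 'd \<Rightarrow> real ^ 'd \<Rightarrow> complex"
    where k'_meas: "(\<lambda>(t, x, y). k' t x y) \<in> borel_measurable borel"
    and kk': "AE x in lborel. (AE t in lborel. AE y in lborel. 0 < t \<longrightarrow> k t x y = k' t x y) \<and>
      (AE y in lborel. AE t in lborel. 0 < t \<longrightarrow> k t x y = k' t x y)"
    using semigroup_kernel_borel_version[OF kernel] by blast
  have k'x_meas: "(\<lambda>(t, y). k' t x y) \<in> borel_measurable (borel \<Otimes>\<^sub>M borel)" for x
  proof -
    have "(\<lambda>z :: real \<times> (real ^ 'd). (fst z, x, snd z)) \<in> measurable (borel \<Otimes>\<^sub>M borel) borel" by (intro borel_measurable_Pair) auto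
    from measurable_compose[OF this k'_meas] show ?thesis by (simp add: split_beta')
  qed
  have main: "AE x in lborel. (\<forall>i. frac_integral_defined k \<alpha> (\<lambda>y. f y $ i) x) \<and>
      ennreal (norm (R x *v vec_frac_integral k \<alpha> f x)) \<le> of_nat CARD('n) * ennreal C * u x"
    using kk' u_fin
  proof eventually_elim
    case (elim x)
    have bound_x: "(\<integral>\<^sup>+t. indicator {0<..} t * ennreal (norm (k t x y) * t powr (\<alpha> / 2 - 1)) \<partial>lborel) \<le> ennreal C * \<Psi> x y"
      if "y \<noteq> x" for y
      unfolding \<Psi>_def m_def using that by (intro bound[rule_format]) simp
    from elim(2) have "(\<integral>\<^sup>+y. \<Psi> x y * (ennreal (onorm ((*v) (R x ** S y))) * ennreal (norm (R y *v f' y))) \<partial>lborel) < top"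
      by (simp add: u_def F_def g_def)
    note vec_frac_integral_pointwise_bound[where k = k and k' = k' and x = x, OF k'x_meas f'_meas \<Psi>_meas R_meas S_meas
        elim(1)[THEN conjunct1] elim(1)[THEN conjunct2] ff' SR C bound_x this]
    then show ?case by (simp add: u_def F_def g_def)
  qed
  then have "AE x in lborel. \<forall>i. frac_integral_defined k \<alpha> (\<lambda>y. f y $ i) x"
    by (rule eventually_mono) blast
  then show "AE x in lebesgue. \<forall>i. frac_integral_defined k \<alpha> (\<lambda>y. f y $ i) x"
    by (rule AE_completion)
  have "AE x in lborel. AE t in lborel. AE y in lborel. 0 < t \<longrightarrow> k t x y = k' t x y"
    using kk' by (rule eventually_mono) blast
  then obtain h where "h \<in> borel_measurable borel" "AE x in lborel. vec_frac_integral k \<alpha> f x = h x"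
    using vec_frac_integral_measurable[OF k'_meas f'_meas _ ff', of k \<alpha>] by blast
  then show "vec_frac_integral k \<alpha> f \<in> borel_measurable lebesgue"
    by (rule lebesgue_borel_version(1))
  have "weighted_norm q W (vec_frac_integral k \<alpha> f)
      = (\<integral>\<^sup>+x. ennreal (norm (matrix_powr (W x) (1 / q) *v vec_frac_integral k \<alpha> f x) powr q) \<partial>lborel) \<up> (1 / q)"
    by (simp add: weighted_norm_def nn_integral_completion)
  also have "\<dots> \<le> (\<integral>\<^sup>+x. (of_nat CARD('n) * ennreal C * u x) \<up> q \<partial>lborel) \<up> (1 / q)"
  proof (rule epowr_mono)
    have "AE x in lborel. ennreal (norm (matrix_powr (W x) (1 / q) *v vec_frac_integral k \<alpha> f x) powr q)
        \<le> (of_nat CARD('n) * ennreal C * u x) \<up> q"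
      using WV main
    proof eventually_elim
      case (elim x)
      have "ennreal (norm (matrix_powr (W x) (1 / q) *v vec_frac_integral k \<alpha> f x) powr q)
          = ennreal (norm (R x *v vec_frac_integral k \<alpha> f x)) \<up> q"
        by (simp add: epowr_ennreal R_def elim(1))
      also have "\<dots> \<le> (of_nat CARD('n) * ennreal C * u x) \<up> q"
        using q elim(2) by (intro epowr_mono) auto
      finally show ?case .
    qed
    then show "(\<integral>\<^sup>+x. ennreal (norm (matrix_powr (W x) (1 / q) *v vec_frac_integral k \<alpha> f x) powr q) \<partial>lborel)
        \<le> (\<integral>\<^sup>+x. (of_nat CARD('n) * ennreal C * u x) \<up> q \<partial>lborel)"
      by (rule nn_integral_mono_AE)
  qed (use q in simp)
  also have "\<dots> = of_nat CARD('n) * ennreal C * (\<integral>\<^sup>+x. u x \<up> q \<partial>lborel) \<up> (1 / q)"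
    using q by (simp add: epowr_mult nn_integral_cmult epowr_epowr)
  also have "\<dots> \<le> of_nat CARD('n) * ennreal C * M"
    by (intro mult_left_mono est) simp
  also have "\<dots> = of_nat CARD('n) * ennreal C * operator_const CARD('d) \<alpha> p P q s C1 \<kappa> \<tau> * ennreal (B0 powr e) *
      (ennreal (a powr e) * ennreal c)"
    using a(1) D by (simp add: M_def B_def B0_def powr_mult ennreal_mult mult_ac)
  also have "ennreal (a powr e) = epowr (Apq_const \<rho> \<theta> p q W) e"
    using a by (simp add: epowr_ennreal)
  finally show "weighted_norm q W (vec_frac_integral k \<alpha> f) \<le>
      of_nat CARD('n) * ennreal C * operator_const CARD('d) \<alpha> p P q s C1 \<kappa> \<tau> * ennreal (B0 powr e) *
      (epowr (Apq_const \<rho> \<theta> p q W) e * ennreal c)" .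
qed

theorem theorem1p7:
  fixes \<rho> :: "real ^ 'd \<Rightarrow> real"
    and D :: "(real ^ 'd \<Rightarrow> complex) set"
    and L :: "(real ^ 'd \<Rightarrow> complex) \<Rightarrow> (real ^ 'd \<Rightarrow> complex)"
    and T :: "real \<Rightarrow> (real ^ 'd \<Rightarrow> complex) \<Rightarrow> (real ^ 'd \<Rightarrow> complex)"
    and k :: "real \<Rightarrow> real ^ 'd \<Rightarrow> real ^ 'd \<Rightarrow> complex"
    and \<theta> \<alpha> p q K :: real
  assumes "critical_radius_function \<rho>"
    and "nonneg_self_adjoint D L"
    and "semigroup_generated_by T D L"
    and "semigroup_kernel T k"
    and "kernel_upper_bound \<rho> k"
    and "0 \<le> \<theta>"
    and "0 < \<alpha>" and "\<alpha> < real CARD('d)"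
    and "1 < p" and "p < real CARD('d) / \<alpha>"
    and "1 / q = 1 / p - \<alpha> / real CARD('d)"
    and "(1 / K + q / (K * conj_exp p)) *
         ((1 - \<alpha> / real CARD('d)) * (conj_exp p / q) + 1 / conj_exp q) = 1 / 2"
  shows "\<exists>C>0. \<forall>W :: real ^ 'd \<Rightarrow> complex ^ 'n ^ 'n.
           W \<in> Apq_class \<rho> (\<theta> / (3 * K)) p q \<longrightarrow>
           (\<forall>f \<in> weighted_Lp p (\<lambda>x. matrix_powr (W x) (p / q)).
              (AE x in lebesgue. \<forall>i. frac_integral_defined k \<alpha> (\<lambda>y. f y $ i) x) \<and>
              vec_frac_integral k \<alpha> f \<in> weighted_Lp q W) \<and>
           weighted_op_norm p (\<lambda>x. matrix_powr (W x) (p / q)) q W (vec_frac_integral k \<alpha>)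
             \<le> ennreal C *
                epowr (Apq_const \<rho> (\<theta> / (3 * K)) p q W)
                      (conj_exp p / q * (1 - \<alpha> / real CARD('d)) + 1 / conj_exp q)"
proof -
  define d where "d = real CARD('d)"
  define P s where "P = conj_exp p" and "s = conj_exp q"
  define e where "e = 1 + P / (q * q)"
  have d: "0 < d" by (simp add: d_def)
  have p: "1 < p" and \<alpha>: "0 < \<alpha>" "\<alpha> < d" "\<alpha> < d / p" and pq: "1 / q = 1 / p - \<alpha> / d"
    using assms by (simp_all add: d_def field_simps)
  have "0 < 1 / q" using \<alpha> p d by (simp add: pq field_simps)
  moreover have "1 / q < 1" using \<alpha> p d by (simp add: pq field_simps add_strict_increasing2)
  ultimately have q: "1 < q" by (simp add: field_simps)
  have P: "1 < P" "1 / p + 1 / P = 1" using p by (simp_all add: P_def conj_exp_def field_simps)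
  have s: "1 < s" "1 / q + 1 / s = 1" using q by (simp_all add: s_def conj_exp_def field_simps)
  \<comment> \<open>The scaling relation gives \<open>1 - \<alpha> / d = 1 / P + 1 / q\<close>, so
    the first term of the exponent is \<open>1 / q + P / (q * q)\<close>, and
    \<open>1 / q + 1 / s = 1\<close>.\<close>
  have exponent: "P / q * (1 - \<alpha> / d) + 1 / s = e"
  proof -
    have "1 - \<alpha> / d = 1 / P + 1 / q" using P(2) pq by simp
    moreover have "P / q * (1 / P + 1 / q) = 1 / q + P / (q * q)" using P q by (simp add: field_simps)
    ultimately show ?thesis using s(2) by (simp add: e_def)
  qed
  have e: "0 < e" using P q by (simp add: e_def add_pos_pos)
  have "(1 - \<alpha> / d) * (P / q) + 1 / s = e" using exponent by (simp only: mult.commute)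
  then have "(1 / K + q / (K * P)) * e = 1 / 2" using assms(12)[folded P_def s_def d_def] by simp
  moreover have "1 / K + q / (K * P) = (1 / K) * (1 + q / P)" by (simp add: distrib_left)
  ultimately have "(1 / K) * ((1 + q / P) * e) = 1 / 2" by (simp only: mult.assoc)
  moreover have "0 < (1 + q / P) * e" using e P q by (intro mult_pos_pos add_pos_pos) auto
  \<comment> \<open>The condition on \<open>K\<close> writes \<open>1 / 2\<close> as
    \<open>1 / K\<close> times a positive number. Hence \<open>K\<close> is positive and the index
    \<open>\<theta> / (3 * K)\<close> of the class is not negative.\<close>
  ultimately have "0 < 1 / K" by (metis zero_less_mult_pos2 half_gt_zero zero_less_one)
  then have K: "0 < K" by simp
  define \<theta>' where "\<theta>' = \<theta> / (3 * K)"
  have \<theta>': "0 \<le> \<theta>'" using K assms(6) by (simp add: \<theta>'_def)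
  obtain \<rho>' C1 \<kappa> where \<rho>': "\<rho>' \<in> borel_measurable borel" "\<And>x. 0 < \<rho>' x" "\<And>x. \<rho> x \<le> \<rho>' x" and C1: "1 \<le> C1" and \<kappa>: "1 \<le> \<kappa>"
    and comparable: "\<forall>k x y. y \<in> tri k x \<longrightarrow> 1 + 2 powr real_of_int k / \<rho> y \<le> C1 * (1 + 2 powr real_of_int k / \<rho>' x) powr \<kappa>"
    using critical_radius_function_measurable[OF assms(1)] by metis
  have \<rho>: "0 < \<rho> x" for x using assms(1) by (simp add: critical_radius_function_def)
  define \<tau> where "\<tau> = \<kappa> * (\<theta>' * (1 + q / P))"
  have "0 \<le> \<tau>" using \<kappa> \<theta>' P q by (simp add: \<tau>_def)
  then have N: "0 < \<kappa> * (\<kappa> + \<tau> / q)" using \<kappa> q by (intro mult_pos_pos add_pos_nonneg) auto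
  obtain C where C: "0 < C" and bound: "\<forall>x y. x \<noteq> y \<longrightarrow>
      (\<integral>\<^sup>+t. indicator {0<..} t * ennreal (norm (k t x y) * t powr (\<alpha> / 2 - 1)) \<partial>lborel)
      \<le> ennreal C * (\<integral>\<^sup>+i. ennreal (2 powr (real_of_int i * (\<alpha> - real CARD('d))) *
          (1 + 2 powr real_of_int i / \<rho>' x) powr - (\<kappa> * (\<kappa> + \<tau> / q))) * indicator (tri i x) y \<partial>count_space UNIV)"
    using frac_kernel_bound[OF assms(5) \<rho> \<rho>'(3) assms(7,8) N] by blast
  define B0 where "B0 = (3 * C1) powr (\<theta>' * (1 + q / P)) + (3 * C1) powr (\<theta>' * (1 + q / P)) * (1 + 1 / \<rho>' 0) powr \<tau> * 4 powr (1 + q / P)"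
  define M where "M = of_nat CARD('n) * ennreal C * operator_const CARD('d) \<alpha> p P q s C1 \<kappa> \<tau> * ennreal (B0 powr e)"
  have op_fin: "operator_const CARD('d) \<alpha> p P q s C1 \<kappa> \<tau> < top"
    using \<alpha> by (intro operator_const_finite) (simp_all add: d_def)
  then have M: "M < top" by (simp add: M_def ennreal_mult_less_top of_nat_less_top)
  have M_le: "M \<le> ennreal (enn2real M + 1)"
    using M by (cases M) (simp_all add: ennreal_leI)
  note estimate = vec_frac_integral_weighted_estimate[where \<rho> = \<rho> and \<rho>' = \<rho>' and k = k and \<theta> = \<theta>' and p = p and q = q and C = C and W = W
      for W :: "real ^ 'd \<Rightarrow> complex ^ 'n ^ 'n",
      OF \<rho> \<rho>'(1-3) C1 \<kappa> comparable assms(4) \<theta>' \<alpha>(1) assms(11) p q,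
      folded P_def s_def, folded \<tau>_def e_def, OF op_fin less_imp_le[OF C] bound, folded B0_def, folded M_def]
  show ?thesis
  proof (intro exI[of _ "enn2real M + 1"] conjI allI impI ballI)
    show "0 < enn2real M + 1" by (simp add: add_nonneg_pos)
    fix W :: "real ^ 'd \<Rightarrow> complex ^ 'n ^ 'n"
    assume "W \<in> Apq_class \<rho> (\<theta> / (3 * K)) p q"
    then have W: "W \<in> Apq_class \<rho> \<theta>' p q" by (simp add: \<theta>'_def)
    then have A: "Apq_const \<rho> \<theta>' p q W < top" by (simp add: Apq_class_def)
    let ?V = "\<lambda>x. matrix_powr (W x) (p / q)"
    {
      fix f assume f: "f \<in> weighted_Lp p ?V"
      \<comment> \<open>The added \<open>1\<close> keeps the bound positive when \<open>f\<close>
        has norm zero; for membership in the target space any finite bound is good enough.\<close>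
      define c where "c = enn2real (weighted_norm p ?V f) + 1"
      have c: "0 < c" by (simp add: c_def add_nonneg_pos)
      have norm_le: "weighted_norm p ?V f \<le> ennreal c"
        using f by (cases "weighted_norm p ?V f") (simp_all add: weighted_Lp_def c_def ennreal_leI)
      have f_meas: "f \<in> borel_measurable lebesgue" using f by (simp add: weighted_Lp_def)
      note est = estimate[OF W f_meas c norm_le]
      show "AE x in lebesgue. \<forall>i. frac_integral_defined k \<alpha> (\<lambda>y. f y $ i) x" by (rule est(1))
      have "M * (Apq_const \<rho> \<theta>' p q W \<up> e * ennreal c) < top"
        using M A by (simp add: ennreal_mult_less_top)
      with est(3) have "weighted_norm q W (vec_frac_integral k \<alpha> f) < top" by (rule le_less_trans)
      with est(2) show "vec_frac_integral k \<alpha> f \<in> weighted_Lp q W" by (simp add: weighted_Lp_def)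
    }
    have "weighted_op_norm p ?V q W (vec_frac_integral k \<alpha>) \<le> M * Apq_const \<rho> \<theta>' p q W \<up> e"
      unfolding weighted_op_norm_def
    proof (rule SUP_least)
      fix f assume "f \<in> {f \<in> weighted_Lp p ?V. weighted_norm p ?V f \<le> 1}"
      then have f: "f \<in> borel_measurable lebesgue" "weighted_norm p ?V f \<le> ennreal 1"
        by (simp_all add: weighted_Lp_def)
      show "weighted_norm q W (vec_frac_integral k \<alpha> f) \<le> M * Apq_const \<rho> \<theta>' p q W \<up> e"
        using estimate(3)[OF W f(1) zero_less_one f(2)] by simp
    qed
    also have "\<dots> \<le> ennreal (enn2real M + 1) * Apq_const \<rho> \<theta>' p q W \<up> e"
      by (intro mult_right_mono M_le) simp
    finally show "weighted_op_norm p ?V q W (vec_frac_integral k \<alpha>)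
        \<le> ennreal (enn2real M + 1) * epowr (Apq_const \<rho> (\<theta> / (3 * K)) p q W)
            (conj_exp p / q * (1 - \<alpha> / real CARD('d)) + 1 / conj_exp q)"
      using exponent by (simp add: \<theta>'_def P_def s_def d_def)
  qed
qed

end
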